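(* Let $k$ be an algebraically closed field of characteristic $0$, let $n\ge 1$, $m \ge 1$, and let $f$ be an endomorphism of $\mathbb{P}^n_k$ of degree $d\ge 2$. Then the set \[ \{\Phi \in \mathcal{F}^n_m : V(\Phi) \text{ is dynamically improper under } f\} \] is Zariski dense in $\mathcal{F}^n_m$.
   Context: An endomorphism of $\mathbb{P}^n$ of degree $d$ is a morphism $f=(f_0:\dots:f_n)$ given by homogeneous forms of degree $d$ in $n+1$ variables with no common nontrivial zero; $f^i$ denotes the $i$-th iterate. $\mathcal{F}^n_m$ denotes the projective space of (nonzero, up to scaling) homogeneous forms of degree $m$ in $n+1$ variables over $k$, and $V(\Phi)\subset\mathbb{P}^n$ is the vanishing locus of $\Phi$. A hypersurface $H\subset \mathbb{P}^n$ is improper under $f$ if for every irreducible component $Z$ of $H$ there exist integers $0\le i_0<i_1<\dots<i_n$ with $f^{i_0}(Z)\cap\dots\cap f^{i_n}(Z)\neq\varnothing$. $H$ is dynamically improper under $f$ if $H$ is improper under $f^r$ for every $r>0$. *)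

theory Defs
  imports "HOL-Library.Poly_Mapping" "HOL-Computational_Algebra.Polynomial"
begin

type_synonym ('v, 'k) mpoly = "('v \<Rightarrow>\<^sub>0 nat) \<Rightarrow>\<^sub>0 'k"

definition mon_deg :: "('v \<Rightarrow>\<^sub>0 nat) \<Rightarrow> nat" where
  "mon_deg \<alpha> = (\<Sum>v\<in>Poly_Mapping.keys \<alpha>. Poly_Mapping.lookup \<alpha> v)"

definition mon_eval :: "('v \<Rightarrow>\<^sub>0 nat) \<Rightarrow> ('v \<Rightarrow> 'k::comm_ring_1) \<Rightarrow> 'k" where
  "mon_eval \<alpha> x = (\<Prod>v\<in>Poly_Mapping.keys \<alpha>. x v ^ Poly_Mapping.lookup \<alpha> v)"

definition mp_eval :: "('v, 'k::comm_ring_1) mpoly \<Rightarrow> ('v \<Rightarrow> 'k) \<Rightarrow> 'k" where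
  "mp_eval p x = (\<Sum>\<alpha>\<in>Poly_Mapping.keys p. Poly_Mapping.lookup p \<alpha> * mon_eval \<alpha> x)"

definition homog_in :: "'v set \<Rightarrow> nat \<Rightarrow> ('v, 'k::zero) mpoly \<Rightarrow> bool" where
  "homog_in V m p \<longleftrightarrow> (\<forall>\<alpha>\<in>Poly_Mapping.keys p. Poly_Mapping.keys \<alpha> \<subseteq> V \<and> mon_deg \<alpha> = m)"

(* Forms of degree m in the n+1 variables x_0..x_n (nonzero ones represent points of F^n_m). *)
definition form :: "nat \<Rightarrow> nat \<Rightarrow> (nat, 'k::zero) mpoly \<Rightarrow> bool" where
  "form n m p \<longleftrightarrow> homog_in {..n} m p"

(* Monomials of degree m in x_0..x_n: the coordinates of the space of forms. *)
definition mons :: "nat \<Rightarrow> nat \<Rightarrow> (nat \<Rightarrow>\<^sub>0 nat) set" where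
  "mons n m = {\<alpha>. Poly_Mapping.keys \<alpha> \<subseteq> {..n} \<and> mon_deg \<alpha> = m}"

(* Points of P^n, represented by their affine cone: nonzero vectors (x_0,..,x_n),
  all other coordinates zero. *)
definition Pts :: "nat \<Rightarrow> (nat \<Rightarrow> 'k::zero) set" where
  "Pts n = {x. (\<forall>i>n. x i = 0) \<and> (\<exists>i\<le>n. x i \<noteq> 0)}"

definition zclosed :: "nat \<Rightarrow> (nat \<Rightarrow> 'k::comm_ring_1) set \<Rightarrow> bool" where
  "zclosed n Z \<longleftrightarrow> (\<exists>S. (\<forall>G\<in>S. \<exists>e. homog_in {..n} e G) \<and>
                        Z = {x\<in>Pts n. \<forall>G\<in>S. mp_eval G x = 0})"

definition zirred :: "nat \<Rightarrow> (nat \<Rightarrow> 'k::comm_ring_1) set \<Rightarrow> bool" where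
  "zirred n Z \<longleftrightarrow> zclosed n Z \<and> Z \<noteq> {} \<and>
     (\<forall>A B. zclosed n A \<longrightarrow> zclosed n B \<longrightarrow> Z \<subseteq> A \<union> B \<longrightarrow> Z \<subseteq> A \<or> Z \<subseteq> B)"

definition irr_component :: "nat \<Rightarrow> (nat \<Rightarrow> 'k::comm_ring_1) set \<Rightarrow> (nat \<Rightarrow> 'k) set \<Rightarrow> bool" where
  "irr_component n H Z \<longleftrightarrow> zirred n Z \<and> Z \<subseteq> H \<and>
     (\<forall>W. zirred n W \<longrightarrow> Z \<subseteq> W \<longrightarrow> W \<subseteq> H \<longrightarrow> W = Z)"

definition hyp :: "nat \<Rightarrow> (nat, 'k::comm_ring_1) mpoly \<Rightarrow> (nat \<Rightarrow> 'k) set" where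
  "hyp n \<Phi> = {x\<in>Pts n. mp_eval \<Phi> x = 0}"

definition endomorphism :: "nat \<Rightarrow> nat \<Rightarrow> (nat \<Rightarrow> (nat, 'k::comm_ring_1) mpoly) \<Rightarrow> bool" where
  "endomorphism n d f \<longleftrightarrow> (\<forall>i\<le>n. form n d (f i)) \<and>
     (\<forall>x\<in>Pts n. \<exists>i\<le>n. mp_eval (f i) x \<noteq> 0)"

definition endo_map :: "nat \<Rightarrow> (nat \<Rightarrow> (nat, 'k::comm_ring_1) mpoly) \<Rightarrow> (nat \<Rightarrow> 'k) \<Rightarrow> (nat \<Rightarrow> 'k)" where
  "endo_map n f x = (\<lambda>i. if i \<le> n then mp_eval (f i) x else 0)"

(* H improper under the point map F: every irreducible component Z has indices
  i_0 < ... < i_n with F^{i_0}(Z) \<inter> ... \<inter> F^{i_n}(Z) nonempty (images of cones are cones,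
  so this is the projective intersection condition). *)
definition improper :: "nat \<Rightarrow> ((nat \<Rightarrow> 'k) \<Rightarrow> (nat \<Rightarrow> 'k)) \<Rightarrow> (nat \<Rightarrow> 'k::comm_ring_1) set \<Rightarrow> bool" where
  "improper n F H \<longleftrightarrow> (\<forall>Z. irr_component n H Z \<longrightarrow>
     (\<exists>idx::nat \<Rightarrow> nat. strict_mono_on {..n} idx \<and> (\<Inter>j\<in>{..n}. (F ^^ idx j) ` Z) \<noteq> {}))"

definition dyn_improper :: "nat \<Rightarrow> ((nat \<Rightarrow> 'k) \<Rightarrow> (nat \<Rightarrow> 'k)) \<Rightarrow> (nat \<Rightarrow> 'k::comm_ring_1) set \<Rightarrow> bool" where
  "dyn_improper n F H \<longleftrightarrow> (\<forall>r>0. improper n (F ^^ r) H)"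

(* Zariski density of a set S of forms in F^n_m = P(space of degree-m forms): no nonzero
  homogeneous polynomial in the coefficients vanishes on all of S. *)
definition zdense_forms :: "nat \<Rightarrow> nat \<Rightarrow> (nat, 'k::comm_ring_1) mpoly set \<Rightarrow> bool" where
  "zdense_forms n m S \<longleftrightarrow> (\<forall>(G :: (nat \<Rightarrow>\<^sub>0 nat, 'k) mpoly) e.
      homog_in (mons n m) e G \<longrightarrow> G \<noteq> 0 \<longrightarrow> (\<exists>\<Phi>\<in>S. mp_eval G (Poly_Mapping.lookup \<Phi>) \<noteq> 0))"

definition alg_closed_field :: "'k::field itself \<Rightarrow> bool" where
  "alg_closed_field _ \<longleftrightarrow> (\<forall>p :: 'k poly. degree p \<ge> 1 \<longrightarrow> (\<exists>x. poly p x = 0))"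

end

theory Submission
  imports Defs "Jordan_Normal_Form.Char_Poly"
begin

text \<open>
  If \<open>V(\<Phi>)\<close> is irreducible and contains a periodic point, then all iterates of a suitable iterate of \<open>f\<close> map
  \<open>V(\<Phi>)\<close> to hypersurfaces through that point, so \<open>V(\<Phi>)\<close> is dynamically improper. For \<open>n \<ge> 2\<close> a generic form
  is irreducible, and the forms vanishing at a given point form a hyperplane in the space of forms. A nonzero
  polynomial vanishes on finitely many hyperplanes only, so density follows once \<open>f\<close> has infinitely many
  periodic points. For \<open>n = 1\<close> one uses instead products of linear forms with periodic zeros.

  Suppose that the periodic points are finite in number. After replacing \<open>f\<close> by an iterate they are all fixed.
  Let \<open>F\<close> be the lift of \<open>f\<close> to the affine cone. For a large prime \<open>N\<close>, no eigenvalue other than \<open>1\<close> of the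
  derivative at a fixed point is an \<open>N\<close>-th root of unity, hence \<open>F\<^sup>N - id\<close> and \<open>F - id\<close> generate the same
  ideal locally at the fixed points (Shub-Sullivan). So a product \<open>G\<close> of linear forms which does not depend
  on \<open>N\<close> lies in the ideal generated by the components of \<open>F\<^sup>N - id\<close>. But nonzero elements of this ideal have
  degree at least \<open>d\<^sup>N\<close>: comparing the degree and the order of vanishing of the coefficients of \<open>G\<^sup>a\<close>
  over the subring generated by the components of \<open>F\<^sup>N - id\<close> shows that \<open>G\<close> vanishes.
\<close>

section \<open>Polynomial functions\<close>

text \<open>The obstacle is multiplicity: counted with multiplicity, the solutions of
  \<open>F^N = id\<close> become more and more numerous, but they might pile up on a few lines. The
  identity \<open>F^N - id = A_N (F - id)\<close> with a polynomial matrix \<open>A_N\<close>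
  controls this. At a fixed vector \<open>A_N\<close> equals \<open>1 + L + ... + L^(N-1)\<close>,
  where \<open>L\<close> is the derivative, and an eigenvalue 1 of \<open>L\<close> contributes the
  factor \<open>N\<close>, which is nonzero in characteristic 0; only nontrivial \<open>N\<close>-th
  roots of unity make \<open>A_N\<close> singular. Passing to the cone creates further zeros of
  \<open>F^N - id\<close>: the origin, where its derivative is \<open>-id\<close>, and multiples
  \<open>c * s\<close> of a fixed vector \<open>s\<close> with \<open>c^(D^N) = c\<close>, which
  scaling brings back to \<open>s\<close>. The degree bound is not obvious either, since the
  components of \<open>F^N - id\<close> are not homogeneous and leading terms may cancel in a
  combination of them. Expanding over the subring costs a bounded amount of degree, and a high power
  of \<open>G\<close> makes this loss negligible.\<close>

text \<open>
  Over an infinite field polynomials may be identified with polynomial functions. This avoids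
  substitution homomorphisms, and one type serves for every number of variables.
\<close>

inductive_set poly_fun :: "'v set \<Rightarrow> (('v \<Rightarrow> 'k::comm_ring_1) \<Rightarrow> 'k) set" for V where
  poly_fun_const: "(\<lambda>x. c) \<in> poly_fun V"
| poly_fun_add: "p \<in> poly_fun V \<Longrightarrow> q \<in> poly_fun V \<Longrightarrow> (\<lambda>x. p x + q x) \<in> poly_fun V"
| poly_fun_var_mult: "v \<in> V \<Longrightarrow> p \<in> poly_fun V \<Longrightarrow> (\<lambda>x. x v * p x) \<in> poly_fun V"

lemma poly_fun_var: "v \<in> V \<Longrightarrow> (\<lambda>x. x v) \<in> poly_fun V"
  using poly_fun_var_mult[OF _ poly_fun_const[of 1]] by simp

lemma poly_fun_cmult: "p \<in> poly_fun V \<Longrightarrow> (\<lambda>x. c * p x) \<in> poly_fun V"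
proof (induction rule: poly_fun.induct)
  case (poly_fun_const d) show ?case by (rule poly_fun.poly_fun_const)
next
  case (poly_fun_add p q) then show ?case using poly_fun.poly_fun_add by (simp add: distrib_left)
next
  case (poly_fun_var_mult v p) then show ?case using poly_fun.poly_fun_var_mult[OF poly_fun_var_mult(1,3)]
    by (simp add: mult.left_commute)
qed

lemma poly_fun_mult: "p \<in> poly_fun V \<Longrightarrow> q \<in> poly_fun V \<Longrightarrow> (\<lambda>x. p x * q x) \<in> poly_fun V"
proof (induction rule: poly_fun.induct)
  case (poly_fun_const c) then show ?case by (rule poly_fun_cmult)
next
  case (poly_fun_add p r) then show ?case using poly_fun.poly_fun_add by (simp add: distrib_right)
next
  case (poly_fun_var_mult v p) then show ?case using poly_fun.poly_fun_var_mult[OF poly_fun_var_mult(1)] by (simp add: mult.assoc)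
qed

lemma poly_fun_uminus: "p \<in> poly_fun V \<Longrightarrow> (\<lambda>x. - p x) \<in> poly_fun V"
  using poly_fun_cmult[of p V "-1"] by simp

lemma poly_fun_diff: "p \<in> poly_fun V \<Longrightarrow> q \<in> poly_fun V \<Longrightarrow> (\<lambda>x. p x - q x) \<in> poly_fun V"
  using poly_fun_add[OF _ poly_fun_uminus] by fastforce

lemma poly_fun_sum: "(\<And>i. i \<in> I \<Longrightarrow> p i \<in> poly_fun V) \<Longrightarrow> (\<lambda>x. \<Sum>i\<in>I. p i x) \<in> poly_fun V"
  by (induction I rule: infinite_finite_induct) (auto intro: poly_fun_const poly_fun_add)

lemma poly_fun_prod: "(\<And>i. i \<in> I \<Longrightarrow> p i \<in> poly_fun V) \<Longrightarrow> (\<lambda>x. \<Prod>i\<in>I. p i x) \<in> poly_fun V"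
  by (induction I rule: infinite_finite_induct) (auto intro: poly_fun_const poly_fun_mult)

lemma poly_fun_power: "p \<in> poly_fun V \<Longrightarrow> (\<lambda>x. p x ^ n) \<in> poly_fun V"
  by (induction n) (auto intro: poly_fun_const poly_fun_mult)

lemmas poly_fun_intros = poly_fun_const poly_fun_add poly_fun_var poly_fun_mult poly_fun_uminus poly_fun_diff poly_fun_sum poly_fun_prod poly_fun_power

lemma poly_fun_mono: "p \<in> poly_fun V \<Longrightarrow> V \<subseteq> W \<Longrightarrow> p \<in> poly_fun W"
  by (induction rule: poly_fun.induct) (auto intro: poly_fun.intros)

lemma poly_fun_compose: "p \<in> poly_fun V \<Longrightarrow> (\<And>v. v \<in> V \<Longrightarrow> u v \<in> poly_fun W) \<Longrightarrow> (\<lambda>x. p (\<lambda>v. u v x)) \<in> poly_fun W"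
  by (induction rule: poly_fun.induct) (auto intro: poly_fun_intros)

lemma poly_fun_cong: "p \<in> poly_fun V \<Longrightarrow> (\<And>v. v \<in> V \<Longrightarrow> x v = y v) \<Longrightarrow> p x = p y"
  by (induction rule: poly_fun.induct) auto

text \<open>Restriction to a polynomial curve, mostly a line, turns questions about several
  variables into questions about the roots of one univariate polynomial.\<close>

lemma poly_fun_curve:
  fixes p :: "('v \<Rightarrow> 'k::comm_ring_1) \<Rightarrow> 'k" and c :: "'v \<Rightarrow> 'k poly"
  assumes "p \<in> poly_fun V"
  shows "\<exists>Q. \<forall>t. p (\<lambda>v. poly (c v) t) = poly Q t"
  using assms
proof (induction rule: poly_fun.induct)
  case (poly_fun_const d) show ?case by (rule exI[of _ "[:d:]"]) simp
next
  case (poly_fun_add p q)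
  then obtain P Q where "\<forall>t. p (\<lambda>v. poly (c v) t) = poly P t" "\<forall>t. q (\<lambda>v. poly (c v) t) = poly Q t" by blast
  then show ?case by (intro exI[of _ "P + Q"]) simp
next
  case (poly_fun_var_mult v p)
  then obtain P where "\<forall>t. p (\<lambda>v. poly (c v) t) = poly P t" by blast
  then show ?case by (intro exI[of _ "c v * P"]) simp
qed

text \<open>The bound \<open>E\<close> does not depend on the line. Hence one can first fix more
  than \<open>E\<close> points and only then choose a line suited to them.\<close>

lemma poly_fun_line_degree:
  fixes p :: "('v \<Rightarrow> 'k::comm_ring_1) \<Rightarrow> 'k"
  assumes "p \<in> poly_fun V"
  shows "\<exists>E. \<forall>a b. \<exists>Q. degree Q \<le> E \<and> (\<forall>t. p (\<lambda>v. a v + t * b v) = poly Q t)"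
  using assms
proof (induction rule: poly_fun.induct)
  case (poly_fun_const d) show ?case by (intro exI[of _ 0] allI exI[of _ "[:d:]"]) simp
next
  case (poly_fun_add p q)
  then obtain E1 E2 where E1: "\<And>a b. \<exists>Q. degree Q \<le> E1 \<and> (\<forall>t. p (\<lambda>v. a v + t * b v) = poly Q t)"
    and E2: "\<And>a b. \<exists>Q. degree Q \<le> E2 \<and> (\<forall>t. q (\<lambda>v. a v + t * b v) = poly Q t)" by blast
  show ?case
  proof (intro exI[of _ "max E1 E2"] allI)
    fix a b
    obtain P where P: "degree P \<le> E1" "\<forall>t. p (\<lambda>v. a v + t * b v) = poly P t" using E1 by blast
    obtain Q where Q: "degree Q \<le> E2" "\<forall>t. q (\<lambda>v. a v + t * b v) = poly Q t" using E2 by blast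
    show "\<exists>Q. degree Q \<le> max E1 E2 \<and> (\<forall>t. p (\<lambda>v. a v + t * b v) + q (\<lambda>v. a v + t * b v) = poly Q t)"
      using P Q by (intro exI[of _ "P + Q"]) (auto intro!: degree_add_le)
  qed
next
  case (poly_fun_var_mult v p)
  then obtain E where E: "\<And>a b. \<exists>Q. degree Q \<le> E \<and> (\<forall>t. p (\<lambda>v. a v + t * b v) = poly Q t)" by blast
  show ?case
  proof (intro exI[of _ "Suc E"] allI)
    fix a b
    obtain P where P: "degree P \<le> E" "\<forall>t. p (\<lambda>v. a v + t * b v) = poly P t" using E by blast
    have "degree ([:a v, b v:] * P) \<le> degree [:a v, b v:] + degree P" by (rule degree_mult_le)
    also have "\<dots> \<le> Suc E" using P(1) by simp
    finally show "\<exists>Q. degree Q \<le> Suc E \<and> (\<forall>t. (a v + t * b v) * p (\<lambda>v. a v + t * b v) = poly Q t)"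
      using P by (intro exI[of _ "[:a v, b v:] * P"]) (simp add: algebra_simps)
  qed
qed

lemma poly_zero_if_zero_on_infinite:
  fixes P :: "'k::idom poly"
  assumes "infinite T" "\<And>t. t \<in> T \<Longrightarrow> poly P t = 0"
  shows "P = 0"
proof (rule ccontr)
  assume "P \<noteq> 0"
  then have "finite {t. poly P t = 0}" by (rule poly_roots_finite)
  moreover have "T \<subseteq> {t. poly P t = 0}" using assms(2) by blast
  ultimately show False using assms(1) finite_subset by blast
qed

lemma infinite_UNIV_field_char_0 [simp]: "infinite (UNIV :: 'k::field_char_0 set)"
  by (rule infinite_UNIV_char_0)

lemma poly_eq_0_if_everywhere_0:
  fixes P :: "'k::field_char_0 poly"
  assumes "\<And>t. poly P t = 0"
  shows "P = 0"
  by (rule poly_zero_if_zero_on_infinite[OF infinite_UNIV_field_char_0]) (rule assms)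

text \<open>On the line through \<open>a\<close> and \<open>b\<close> both restrictions are nonzero
  polynomials, the first one at \<open>t = 0\<close> and the second at \<open>t = 1\<close>, so
  their product has a non-root. Geometrically: two nonempty Zariski open sets meet. All generic
  choices rest on this.\<close>

lemma poly_fun_domain:
  fixes p q :: "('v \<Rightarrow> 'k::field_char_0) \<Rightarrow> 'k"
  assumes "p \<in> poly_fun V" "q \<in> poly_fun V" "p a \<noteq> 0" "q b \<noteq> 0"
  shows "\<exists>x. p x \<noteq> 0 \<and> q x \<noteq> 0"
proof -
  obtain P where P: "\<And>t. p (\<lambda>v. poly [:a v, b v - a v:] t) = poly P t" using poly_fun_curve[OF assms(1), of "\<lambda>v. [:a v, b v - a v:]"] by blast
  obtain Q where Q: "\<And>t. q (\<lambda>v. poly [:a v, b v - a v:] t) = poly Q t" using poly_fun_curve[OF assms(2), of "\<lambda>v. [:a v, b v - a v:]"] by blast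
  have "P \<noteq> 0" using P[of 0] assms by auto
  moreover have "Q \<noteq> 0" using Q[of 1] assms by auto
  ultimately have "P * Q \<noteq> 0" by simp
  then obtain t where "poly (P * Q) t \<noteq> 0" using poly_eq_0_if_everywhere_0[of "P * Q"] by blast
  then have "poly P t \<noteq> 0" "poly Q t \<noteq> 0" by auto
  then show ?thesis unfolding P[symmetric] Q[symmetric] by blast
qed

lemma poly_fun_domain_eq:
  fixes p q :: "('v \<Rightarrow> 'k::field_char_0) \<Rightarrow> 'k"
  assumes "p \<in> poly_fun V" "q \<in> poly_fun V" "\<And>x. p x * q x = 0" "p a \<noteq> 0"
  shows "q x = 0"
proof (rule ccontr)
  assume "q x \<noteq> 0"
  note poly_fun_domain[of p V q a x, OF assms(1,2,4) this]
  then obtain z where "p z \<noteq> 0 \<and> q z \<noteq> 0" ..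
  then show False using assms(3)[of z] by simp
qed

lemma poly_fun_prod_nonzero:
  fixes p :: "'i \<Rightarrow> ('v \<Rightarrow> 'k::field_char_0) \<Rightarrow> 'k"
  assumes "finite I" "\<And>i. i \<in> I \<Longrightarrow> p i \<in> poly_fun V" "\<And>i. i \<in> I \<Longrightarrow> \<exists>x. p i x \<noteq> 0"
  shows "\<exists>x. \<forall>i\<in>I. p i x \<noteq> 0"
  using assms
proof (induction I rule: finite_induct)
  case empty show ?case by simp
next
  case (insert i I)
  have "\<exists>x. \<forall>i\<in>I. p i x \<noteq> 0"
    by (rule insert.IH; rule insert.prems; erule insertI2)
  then obtain x where x: "\<forall>i\<in>I. p i x \<noteq> 0" ..
  obtain y where y: "p i y \<noteq> 0" using insert.prems(2)[OF insertI1] ..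
  have 1: "p i \<in> poly_fun V" by (rule insert.prems(1)[OF insertI1])
  have 2: "(\<lambda>z. \<Prod>j\<in>I. p j z) \<in> poly_fun V" by (rule poly_fun_prod, rule insert.prems(1), erule insertI2)
  have 3: "(\<Prod>j\<in>I. p j x) \<noteq> 0" unfolding prod_zero_iff[OF insert.hyps(1)] using x by blast
  have "\<exists>z. p i z \<noteq> 0 \<and> (\<Prod>j\<in>I. p j z) \<noteq> 0" 
    by (rule poly_fun_domain[of "p i" V "\<lambda>z. \<Prod>j\<in>I. p j z" y x, OF 1 2 y 3])
  then obtain z where z: "p i z \<noteq> 0" "(\<Prod>j\<in>I. p j z) \<noteq> 0" by (elim exE conjE)
  have "\<forall>j\<in>insert i I. p j z \<noteq> 0" using z unfolding prod_zero_iff[OF insert.hyps(1)] by blast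
  then show ?case by (rule exI[where x=z])
qed

section \<open>Homogeneous polynomial functions and total degree\<close>

inductive hom_fun :: "'v set \<Rightarrow> nat \<Rightarrow> (('v \<Rightarrow> 'k::comm_ring_1) \<Rightarrow> 'k) \<Rightarrow> bool" for V where
  hom_fun_zero: "hom_fun V m (\<lambda>x. 0)"
| hom_fun_const: "hom_fun V 0 (\<lambda>x. c)"
| hom_fun_add: "hom_fun V m p \<Longrightarrow> hom_fun V m q \<Longrightarrow> hom_fun V m (\<lambda>x. p x + q x)"
| hom_fun_var_mult: "v \<in> V \<Longrightarrow> hom_fun V m p \<Longrightarrow> hom_fun V (Suc m) (\<lambda>x. x v * p x)"

lemma hom_fun_poly_fun: "hom_fun V m p \<Longrightarrow> p \<in> poly_fun V"
  by (induction rule: hom_fun.induct) (auto intro: poly_fun.intros)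

lemma hom_fun_var: "v \<in> V \<Longrightarrow> hom_fun V 1 (\<lambda>x. x v)"
  using hom_fun_var_mult[OF _ hom_fun_const[of V 1]] by simp

lemma hom_fun_cmult: "hom_fun V m p \<Longrightarrow> hom_fun V m (\<lambda>x. c * p x)"
proof (induction rule: hom_fun.induct)
  case (hom_fun_zero m) show ?case using hom_fun.hom_fun_zero by simp
next
  case (hom_fun_const d) show ?case by (rule hom_fun.hom_fun_const)
next
  case (hom_fun_add m p q) then show ?case using hom_fun.hom_fun_add by (simp add: distrib_left)
next
  case (hom_fun_var_mult v m p) then show ?case using hom_fun.hom_fun_var_mult[OF hom_fun_var_mult(1,3)]
    by (simp add: mult.left_commute)
qed

lemma hom_fun_mult: "hom_fun V m p \<Longrightarrow> hom_fun V l q \<Longrightarrow> hom_fun V (m + l) (\<lambda>x. p x * q x)"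
proof (induction rule: hom_fun.induct)
  case (hom_fun_zero m) show ?case using hom_fun.hom_fun_zero by simp
next
  case (hom_fun_const c) then show ?case using hom_fun_cmult by simp
next
  case (hom_fun_add m p r) then show ?case using hom_fun.hom_fun_add by (simp add: distrib_right)
next
  case (hom_fun_var_mult v m p) then show ?case using hom_fun.hom_fun_var_mult[OF hom_fun_var_mult(1)] by (simp add: mult.assoc)
qed

lemma hom_fun_uminus: "hom_fun V m p \<Longrightarrow> hom_fun V m (\<lambda>x. - p x)"
  using hom_fun_cmult[of V m p "-1"] by simp

lemma hom_fun_diff: "hom_fun V m p \<Longrightarrow> hom_fun V m q \<Longrightarrow> hom_fun V m (\<lambda>x. p x - q x)"
  using hom_fun_add[OF _ hom_fun_uminus] by fastforce

lemma hom_fun_sum: "(\<And>i. i \<in> I \<Longrightarrow> hom_fun V m (p i)) \<Longrightarrow> hom_fun V m (\<lambda>x. \<Sum>i\<in>I. p i x)"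
  by (induction I rule: infinite_finite_induct) (auto intro: hom_fun_zero hom_fun_add)

lemma hom_fun_prod: "(\<And>i. i \<in> I \<Longrightarrow> hom_fun V (m i) (p i)) \<Longrightarrow> hom_fun V (\<Sum>i\<in>I. m i) (\<lambda>x. \<Prod>i\<in>I. p i x)"
  by (induction I rule: infinite_finite_induct) (auto intro: hom_fun_const hom_fun_mult)

lemma hom_fun_power: "hom_fun V m p \<Longrightarrow> hom_fun V (n * m) (\<lambda>x. p x ^ n)"
  by (induction n) (auto intro: hom_fun_const hom_fun_mult)

lemma hom_fun_compose: "hom_fun V m p \<Longrightarrow> (\<And>v. v \<in> V \<Longrightarrow> hom_fun W d (u v)) \<Longrightarrow> hom_fun W (m * d) (\<lambda>x. p (\<lambda>v. u v x))"
  by (induction rule: hom_fun.induct) (auto intro: hom_fun_zero hom_fun_const hom_fun_add hom_fun_mult)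

lemma hom_fun_scale: "hom_fun V m p \<Longrightarrow> p (\<lambda>v. c * x v) = c ^ m * p x"
  by (induction rule: hom_fun.induct) (auto simp: algebra_simps)

text \<open>The bound is witnessed by a decomposition into homogeneous components, from which
  products and restrictions to lines through the origin can be read off.\<close>

definition deg_le_fun :: "'v set \<Rightarrow> nat \<Rightarrow> (('v \<Rightarrow> 'k::comm_ring_1) \<Rightarrow> 'k) \<Rightarrow> bool" where
  "deg_le_fun V N p \<longleftrightarrow> (\<exists>q. (\<forall>j. hom_fun V j (q j)) \<and> p = (\<lambda>x. \<Sum>j\<le>N. q j x))"

lemma deg_le_fun_poly_fun: "deg_le_fun V N p \<Longrightarrow> p \<in> poly_fun V"
  unfolding deg_le_fun_def by (auto intro: poly_fun_sum hom_fun_poly_fun)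

lemma deg_le_fun_mono: assumes "deg_le_fun V N p" "N \<le> M" shows "deg_le_fun V M p"
proof -
  obtain q where q: "\<forall>j. hom_fun V j (q j)" "p = (\<lambda>x. \<Sum>j\<le>N. q j x)" using assms(1) deg_le_fun_def by blast
  let ?r = "\<lambda>j x. if j \<le> N then q j x else 0"
  have "hom_fun V j (?r j)" for j using q(1) by (cases "j \<le> N") (auto intro: hom_fun_zero)
  moreover have "(\<Sum>j\<le>N. q j x) = (\<Sum>j\<le>M. ?r j x)" for x
    by (rule sum.mono_neutral_cong_left) (use assms(2) in auto)
  ultimately show ?thesis unfolding deg_le_fun_def q(2) by (intro exI[of _ ?r]) simp
qed

lemma hom_fun_deg_le_fun: assumes "hom_fun V m p" shows "deg_le_fun V m p"
  unfolding deg_le_fun_def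
proof (intro exI conjI allI)
  fix j show "hom_fun V j (if j = m then p else (\<lambda>x. 0))" using assms by (auto intro: hom_fun_zero)
next
  show "p = (\<lambda>x. \<Sum>j\<le>m. (if j = m then p else (\<lambda>x. 0)) x)"
    by (rule ext, subst sum.remove[of _ m]) (auto intro!: sum.neutral)
qed

lemma deg_le_fun_add: assumes "deg_le_fun V N p" "deg_le_fun V N q" shows "deg_le_fun V N (\<lambda>x. p x + q x)"
proof -
  obtain a where a: "\<forall>j. hom_fun V j (a j)" "p = (\<lambda>x. \<Sum>j\<le>N. a j x)" using assms(1) deg_le_fun_def by blast
  obtain b where b: "\<forall>j. hom_fun V j (b j)" "q = (\<lambda>x. \<Sum>j\<le>N. b j x)" using assms(2) deg_le_fun_def by blast
  show ?thesis unfolding deg_le_fun_def a(2) b(2)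
    by (intro exI[of _ "\<lambda>j x. a j x + b j x"]) (use a b in \<open>auto simp: sum.distrib intro: hom_fun_add\<close>)
qed

lemma deg_le_fun_sum: "(\<And>i. i \<in> I \<Longrightarrow> deg_le_fun V N (p i)) \<Longrightarrow> deg_le_fun V N (\<lambda>x. \<Sum>i\<in>I. p i x)"
  by (induction I rule: infinite_finite_induct) (auto intro: hom_fun_deg_le_fun[OF hom_fun_zero] deg_le_fun_add)

lemma deg_le_fun_mult: assumes "deg_le_fun V N p" "deg_le_fun V M q" shows "deg_le_fun V (N + M) (\<lambda>x. p x * q x)"
proof -
  obtain a where a: "\<forall>j. hom_fun V j (a j)" "p = (\<lambda>x. \<Sum>j\<le>N. a j x)" using assms(1) deg_le_fun_def by blast
  obtain b where b: "\<forall>j. hom_fun V j (b j)" "q = (\<lambda>x. \<Sum>j\<le>M. b j x)" using assms(2) deg_le_fun_def by blast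
  have "deg_le_fun V (N + M) (\<lambda>x. \<Sum>i\<le>N. \<Sum>j\<le>M. a i x * b j x)"
  proof (rule deg_le_fun_sum, rule deg_le_fun_sum)
    fix i j assume "i \<in> {..N}" "j \<in> {..M}"
    then have "i + j \<le> N + M" by simp
    with hom_fun_deg_le_fun[OF hom_fun_mult[OF a(1)[rule_format] b(1)[rule_format]]]
    show "deg_le_fun V (N + M) (\<lambda>x. a i x * b j x)" by (rule deg_le_fun_mono)
  qed
  then show ?thesis unfolding a b by (simp add: sum_product)
qed

lemma deg_le_fun_power: "deg_le_fun V N p \<Longrightarrow> deg_le_fun V (n * N) (\<lambda>x. p x ^ n)"
proof (induction n)
  case 0 show ?case using hom_fun_deg_le_fun[OF hom_fun_const[of V 1]] by simp
next
  case (Suc n) from deg_le_fun_mult[OF Suc.prems Suc.IH[OF Suc.prems]] show ?case by simp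
qed

lemma poly_fun_deg_le_fun: "p \<in> poly_fun V \<Longrightarrow> \<exists>N. deg_le_fun V N p"
proof (induction rule: poly_fun.induct)
  case (poly_fun_const c) show ?case by (rule exI, rule hom_fun_deg_le_fun, rule hom_fun_const)
next
  case (poly_fun_add p q)
  then obtain N M where "deg_le_fun V N p" "deg_le_fun V M q" by blast
  then have "deg_le_fun V (max N M) p" "deg_le_fun V (max N M) q"
    using deg_le_fun_mono[of V N p "max N M"] deg_le_fun_mono[of V M q "max N M"] by simp_all
  then have *: "deg_le_fun V (max N M) (\<lambda>x. p x + q x)" by (rule deg_le_fun_add)
  show ?case by (rule exI, rule *)
next
  case (poly_fun_var_mult v p)
  from poly_fun_var_mult(3) obtain N where N: "deg_le_fun V N p" ..
  have "hom_fun V 1 (\<lambda>x. x v)" by (rule hom_fun_var) (rule poly_fun_var_mult(1))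
  then have "deg_le_fun V 1 (\<lambda>x. x v)" by (rule hom_fun_deg_le_fun)
  from deg_le_fun_mult[OF this N] have *: "deg_le_fun V (1 + N) (\<lambda>x. x v * p x)" .
  show ?case by (rule exI, rule *)
qed

text \<open>By scaling, the univariate polynomial with coefficients \<open>a j x\<close> takes at
  \<open>t\<close> the value of the whole sum at \<open>t * x\<close>. It is zero everywhere, so its
  coefficients are zero.\<close>

lemma hom_fun_components_unique:
  fixes a :: "nat \<Rightarrow> ('v \<Rightarrow> 'k::field_char_0) \<Rightarrow> 'k"
  assumes "\<And>j. hom_fun V j (a j)" "\<And>x. (\<Sum>j\<le>N. a j x) = 0" "j \<le> N"
  shows "a j x = 0"
proof -
  let ?P = "\<Sum>j\<le>N. monom (a j x) j"
  have "poly ?P t = 0" for t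
  proof -
    have "poly ?P t = (\<Sum>j\<le>N. a j x * t ^ j)" by (simp add: poly_sum poly_monom)
    also have "\<dots> = (\<Sum>j\<le>N. a j (\<lambda>v. t * x v))"
      by (rule sum.cong[OF refl]) (subst hom_fun_scale[OF assms(1)], rule mult.commute)
    also have "\<dots> = 0" by (rule assms(2))
    finally show ?thesis .
  qed
  then have "?P = 0" by (rule poly_eq_0_if_everywhere_0)
  then have "0 = coeff ?P j" by simp
  also have "\<dots> = (\<Sum>k\<le>N. if k = j then a k x else 0)"
    unfolding coeff_sum by (rule sum.cong[OF refl]) simp
  also have "\<dots> = a j x" using assms(3) by (subst sum.delta) simp_all
  finally show ?thesis by (rule sym)
qed

section \<open>The Nullstellensatz\<close>

lemma poly_fun_det:
  fixes A :: "nat \<Rightarrow> nat \<Rightarrow> ('v \<Rightarrow> 'k::comm_ring_1) \<Rightarrow> 'k"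
  assumes "\<And>i j. i < N \<Longrightarrow> j < N \<Longrightarrow> A i j \<in> poly_fun V"
  shows "(\<lambda>x. det (mat N N (\<lambda>(i, j). A i j x))) \<in> poly_fun V"
proof -
  have eq: "det (mat N N (\<lambda>(i, j). A i j x)) =
    (\<Sum>p\<in>{p. p permutes {0..<N}}. signof p * (\<Prod>i\<in>{0..<N}. A i (p i) x))" for x
    by (subst det_def'[of _ N]) (auto intro!: sum.cong prod.cong dest: permutes_in_image)
  show ?thesis unfolding eq
  proof (rule poly_fun_sum, rule poly_fun_mult, rule poly_fun_const, rule poly_fun_prod)
    fix p i assume "p \<in> {p. p permutes {0..<N}}" "i \<in> {0..<N}"
    then show "A i (p i) \<in> poly_fun V" using assms[of i "p i"] permutes_in_image[of p "{0..<N}" i] by auto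
  qed
qed

text \<open>The matrix \<open>C\<close> is the adjugate; its entries are signed minors, hence
  polynomial. As \<open>w\<close> consists of scalars, the identity can be used pointwise with
  powers of a variable or with generators of an ideal in place of \<open>w\<close>.\<close>

lemma poly_fun_cramer:
  fixes A :: "nat \<Rightarrow> nat \<Rightarrow> ('v \<Rightarrow> 'k::comm_ring_1) \<Rightarrow> 'k"
  assumes A: "\<And>i j. i < N \<Longrightarrow> j < N \<Longrightarrow> A i j \<in> poly_fun V"
  obtains C where "\<And>i j. i < N \<Longrightarrow> j < N \<Longrightarrow> C i j \<in> poly_fun V"
    "\<And>x w i. i < N \<Longrightarrow> det (mat N N (\<lambda>(i, j). A i j x)) * w i
        = (\<Sum>j<N. C i j x * (\<Sum>l<N. A j l x * w l))"
proof -
  define M where "M x = mat N N (\<lambda>(i, j). A i j x)" for x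
  have M: "M x \<in> carrier_mat N N" for x by (simp add: M_def)
  define C where "C i j x = adj_mat (M x) $$ (i, j)" for i j x
  have C: "C i j \<in> poly_fun V" if ij: "i < N" "j < N" for i j
  proof -
    have "C i j x = (-1)^(j+i) * det (mat (N-1) (N-1) (\<lambda>(a, b).
        A (if a < j then a else Suc a) (if b < i then b else Suc b) x))" for x
    proof -
      have "C i j x = (-1)^(j+i) * det (mat_delete (M x) j i)"
        using ij by (simp add: C_def adj_mat_def M_def cofactor_def)
      also have "mat_delete (M x) j i = mat (N-1) (N-1) (\<lambda>(a, b).
        A (if a < j then a else Suc a) (if b < i then b else Suc b) x)"
        by (rule eq_matI) (auto simp: mat_delete_def M_def)
      finally show ?thesis .
    qed
    then have "C i j = (\<lambda>x. (-1)^(j+i) * det (mat (N-1) (N-1) (\<lambda>(a, b).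
        A (if a < j then a else Suc a) (if b < i then b else Suc b) x)))" by (rule ext)
    also have "\<dots> \<in> poly_fun V"
      by (rule poly_fun_mult[OF poly_fun_const poly_fun_det], rule A) (use ij in auto)
    finally show ?thesis .
  qed
  have eq: "det (M x) * w i = (\<Sum>j<N. C i j x * (\<Sum>l<N. A j l x * w l))" if i: "i < N" for x w i
  proof -
    have adj: "adj_mat (M x) \<in> carrier_mat N N" "adj_mat (M x) * M x = det (M x) \<cdot>\<^sub>m 1\<^sub>m N"
      using adj_mat[OF M] by auto
    have ent: "(\<Sum>j<N. C i j x * A j l x) = (if i = l then det (M x) else 0)" if l: "l < N" for l
    proof -
      have "(adj_mat (M x) * M x) $$ (i, l) = (\<Sum>j<N. C i j x * A j l x)"
        using i l adj(1) by (simp add: scalar_prod_def C_def M_def atLeast0LessThan)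
      then show ?thesis unfolding adj(2) using i l by (cases "i = l") simp_all
    qed
    have "(\<Sum>j<N. C i j x * (\<Sum>l<N. A j l x * w l)) = (\<Sum>l<N. (\<Sum>j<N. C i j x * A j l x) * w l)"
      by (simp add: sum_distrib_left sum_distrib_right mult.assoc) (rule sum.swap)
    also have "\<dots> = (\<Sum>l<N. (if i = l then det (M x) else 0) * w l)"
      by (rule sum.cong) (use ent in auto)
    also have "\<dots> = (\<Sum>l<N. if i = l then det (M x) * w l else 0)"
      by (rule sum.cong) auto
    also have "\<dots> = det (M x) * w i" using i by simp
    finally show ?thesis by simp
  qed
  show ?thesis using that[of C] C eq unfolding M_def by blast
qed

section \<open>Ideals, and division with remainder in one variable\<close>

definition poly_fun_ideal :: "'v set \<Rightarrow> (('v \<Rightarrow> 'k::comm_ring_1) \<Rightarrow> 'k) set \<Rightarrow> bool" where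
  "poly_fun_ideal V I \<longleftrightarrow> I \<subseteq> poly_fun V \<and> (\<lambda>x. 0) \<in> I \<and> (\<forall>p\<in>I. \<forall>q\<in>I. (\<lambda>x. p x + q x) \<in> I)
     \<and> (\<forall>p\<in>I. \<forall>q\<in>poly_fun V. (\<lambda>x. q x * p x) \<in> I)"

lemma poly_fun_idealD:
  assumes "poly_fun_ideal V I"
  shows "I \<subseteq> poly_fun V" "(\<lambda>x. 0) \<in> I" "\<And>p q. p \<in> I \<Longrightarrow> q \<in> I \<Longrightarrow> (\<lambda>x. p x + q x) \<in> I"
    "\<And>p q. p \<in> I \<Longrightarrow> q \<in> poly_fun V \<Longrightarrow> (\<lambda>x. q x * p x) \<in> I"
  using assms unfolding poly_fun_ideal_def by blast+

lemma poly_fun_ideal_sum: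
  assumes "poly_fun_ideal V I" "\<And>i. i \<in> S \<Longrightarrow> p i \<in> I"
  shows "(\<lambda>x. \<Sum>i\<in>S. p i x) \<in> I"
  using assms(2)
proof (induction S rule: infinite_finite_induct)
  case (insert i S)
  have "(\<lambda>x. \<Sum>j\<in>S. p j x) \<in> I" by (rule insert.IH) (rule insert.prems, erule insertI2)
  from poly_fun_idealD(3)[OF assms(1) insert.prems[OF insertI1] this]
  show ?case using insert.hyps by simp
qed (use poly_fun_idealD(2)[OF assms(1)] in simp_all)

lemma poly_fun_ideal_diff:
  assumes "poly_fun_ideal V I" "p \<in> I" "q \<in> I"
  shows "(\<lambda>x. p x - q x) \<in> I"
proof -
  have "(\<lambda>x. -1 * q x) \<in> I" by (rule poly_fun_idealD(4)[OF assms(1,3)]) (rule poly_fun_const)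
  from poly_fun_idealD(3)[OF assms(1,2) this] show ?thesis by simp
qed

text \<open>With a strict bound, \<open>N = 0\<close> means the zero function, and \<open>D\<close>
  is the bound for remainders modulo a monic polynomial of degree \<open>D\<close>.\<close>

definition deg_less_in :: "'v \<Rightarrow> 'v set \<Rightarrow> nat \<Rightarrow> (('v \<Rightarrow> 'k::comm_ring_1) \<Rightarrow> 'k) \<Rightarrow> bool" where
  "deg_less_in y V N p \<longleftrightarrow> (\<exists>c. (\<forall>i. c i \<in> poly_fun V) \<and> p = (\<lambda>x. \<Sum>i<N. c i x * x y ^ i))"

lemma deg_less_in_mono: assumes "deg_less_in y V N p" "N \<le> M" shows "deg_less_in y V M p"
proof -
  obtain c where c: "\<And>i. c i \<in> poly_fun V" "p = (\<lambda>x. \<Sum>i<N. c i x * x y ^ i)" using assms(1) unfolding deg_less_in_def by blast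
  let ?c = "\<lambda>i x. if i < N then c i x else 0"
  have "?c i \<in> poly_fun V" for i using c(1) by (cases "i < N") (auto intro: poly_fun_const)
  moreover have "p = (\<lambda>x. \<Sum>i<M. ?c i x * x y ^ i)"
    unfolding c(2) by (rule ext, rule sum.mono_neutral_cong_left) (use assms(2) in auto)
  ultimately show ?thesis unfolding deg_less_in_def by (intro exI[of _ ?c]) simp
qed

lemma deg_less_in_zero: "deg_less_in y V N (\<lambda>x. 0)"
  unfolding deg_less_in_def by (rule exI[of _ "\<lambda>i x. 0"]) (simp add: poly_fun_const)

lemma deg_less_in_add: assumes "deg_less_in y V N p" "deg_less_in y V N q" shows "deg_less_in y V N (\<lambda>x. p x + q x)"
proof -
  obtain c where c: "\<And>i. c i \<in> poly_fun V" "p = (\<lambda>x. \<Sum>i<N. c i x * x y ^ i)" using assms(1) unfolding deg_less_in_def by blast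
  obtain d where d: "\<And>i. d i \<in> poly_fun V" "q = (\<lambda>x. \<Sum>i<N. d i x * x y ^ i)" using assms(2) unfolding deg_less_in_def by blast
  show ?thesis unfolding deg_less_in_def c d
    by (rule exI[of _ "\<lambda>i x. c i x + d i x"]) (simp add: poly_fun_add c d sum.distrib distrib_right)
qed

lemma deg_less_in_mult: assumes "deg_less_in y V N p" "r \<in> poly_fun V" shows "deg_less_in y V N (\<lambda>x. r x * p x)"
proof -
  obtain c where c: "\<And>i. c i \<in> poly_fun V" "p = (\<lambda>x. \<Sum>i<N. c i x * x y ^ i)" using assms(1) unfolding deg_less_in_def by blast
  show ?thesis unfolding deg_less_in_def c
    by (rule exI[of _ "\<lambda>i x. r x * c i x"]) (simp add: poly_fun_mult c assms(2) sum_distrib_left mult.assoc)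
qed

lemma deg_less_in_diff: assumes "deg_less_in y V N p" "deg_less_in y V N q" shows "deg_less_in y V N (\<lambda>x. p x - q x)"
  using deg_less_in_add[OF assms(1) deg_less_in_mult[OF assms(2) poly_fun_const[of "-1"]]] by simp

lemma deg_less_in_mult_y: assumes "deg_less_in y V N p" shows "deg_less_in y V (Suc N) (\<lambda>x. x y * p x)"
proof -
  obtain c where c: "\<And>i. c i \<in> poly_fun V" "p = (\<lambda>x. \<Sum>i<N. c i x * x y ^ i)" using assms(1) unfolding deg_less_in_def by blast
  have "case_nat (\<lambda>x. 0) c i \<in> poly_fun V" for i using c(1) by (cases i) (auto intro: poly_fun_const)
  moreover have "x y * (\<Sum>i<N. c i x * x y ^ i) = (\<Sum>i<Suc N. case_nat (\<lambda>x. 0) c i x * x y ^ i)" for x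
    unfolding sum.lessThan_Suc_shift by (simp add: sum_distrib_left mult.left_commute)
  ultimately show ?thesis unfolding deg_less_in_def c by (intro exI[of _ "case_nat (\<lambda>x. 0) c"]) auto
qed

lemma deg_less_in_single: assumes "r \<in> poly_fun V" "i < N" shows "deg_less_in y V N (\<lambda>x. r x * x y ^ i)"
proof -
  let ?c = "\<lambda>j x. if j = i then r x else 0"
  have "?c j \<in> poly_fun V" for j using assms(1) by (cases "j = i") (auto intro: poly_fun_const)
  moreover have "(\<Sum>j<N. ?c j x * x y ^ j) = r x * x y ^ i" for x
  proof -
    have "(\<Sum>j<N. ?c j x * x y ^ j) = (\<Sum>j<N. if j = i then r x * x y ^ j else 0)" by (rule sum.cong) auto
    also have "\<dots> = r x * x y ^ i" using assms(2) by simp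
    finally show ?thesis .
  qed
  ultimately show ?thesis unfolding deg_less_in_def by (intro exI[of _ ?c]) simp
qed

lemma deg_less_in_top: assumes "deg_less_in y V (Suc N) p"
  obtains c where "c \<in> poly_fun V" "deg_less_in y V N (\<lambda>x. p x - c x * x y ^ N)"
proof -
  obtain c where c: "\<And>i. c i \<in> poly_fun V" "p = (\<lambda>x. \<Sum>i<Suc N. c i x * x y ^ i)" using assms(1) unfolding deg_less_in_def by blast
  have "deg_less_in y V N (\<lambda>x. p x - c N x * x y ^ N)" unfolding deg_less_in_def c(2)
    by (rule exI[of _ c]) (simp add: c(1))
  then show ?thesis using that c(1) by blast
qed

text \<open>Long division along the inductive construction of \<open>p\<close>. Only multiplication
  by \<open>y\<close> can push the remainder up to degree \<open>D\<close>; its top coefficient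
  \<open>c\<close> is then moved into the quotient.\<close>

lemma deg_less_in_division:
  assumes g: "deg_less_in y V D (\<lambda>x. g x - x y ^ D)" and "D \<ge> 1" and p: "p \<in> poly_fun (insert y V)"
  shows "\<exists>q\<in>poly_fun (insert y V). deg_less_in y V D (\<lambda>x. p x - q x * g x)"
  using p
proof (induction rule: poly_fun.induct)
  case (poly_fun_const c)
  have "deg_less_in y V D (\<lambda>x. c)" using deg_less_in_single[where r="\<lambda>x. c" and V=V and i=0 and N=D and y=y] assms(2) by (simp add: poly_fun.poly_fun_const)
  then show ?case by (intro bexI[where x="\<lambda>x. 0"]) (auto intro: poly_fun.poly_fun_const)
next
  case (poly_fun_add p p')
  then obtain q q' where q: "q \<in> poly_fun (insert y V)" "deg_less_in y V D (\<lambda>x. p x - q x * g x)"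
    "q' \<in> poly_fun (insert y V)" "deg_less_in y V D (\<lambda>x. p' x - q' x * g x)" by blast
  have "deg_less_in y V D (\<lambda>x. p x + p' x - (q x + q' x) * g x)"
    using deg_less_in_add[OF q(2,4)] by (simp add: algebra_simps)
  then show ?case using poly_fun.poly_fun_add[OF q(1,3)] by (intro bexI[where x="\<lambda>x. q x + q' x"])
next
  case (poly_fun_var_mult v p)
  then obtain q where q: "q \<in> poly_fun (insert y V)" "deg_less_in y V D (\<lambda>x. p x - q x * g x)" by blast
  show ?case
  proof (cases "v = y")
    case False
    then have "v \<in> V" using poly_fun_var_mult(1) by simp
    then have "deg_less_in y V D (\<lambda>x. x v * (p x - q x * g x))" by (intro deg_less_in_mult[OF q(2)] poly_fun_var)
    then have "deg_less_in y V D (\<lambda>x. x v * p x - (x v * q x) * g x)" by (simp add: algebra_simps)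
    then show ?thesis using poly_fun.poly_fun_var_mult[OF poly_fun_var_mult(1) q(1)] by (intro bexI[where x="\<lambda>x. x v * q x"])
  next
    case True
    obtain c where c: "c \<in> poly_fun V" "deg_less_in y V D (\<lambda>x. x y * (p x - q x * g x) - c x * x y ^ D)"
      using deg_less_in_top[OF deg_less_in_mult_y[OF q(2)]] by blast
    have "deg_less_in y V D (\<lambda>x. (x y * (p x - q x * g x) - c x * x y ^ D) - c x * (g x - x y ^ D))"
      by (rule deg_less_in_diff[OF c(2)], rule deg_less_in_mult[OF g c(1)])
    then have "deg_less_in y V D (\<lambda>x. x y * p x - (x y * q x + c x) * g x)" by (simp add: algebra_simps)
    moreover have "(\<lambda>x. x y * q x + c x) \<in> poly_fun (insert y V)"
      by (rule poly_fun.poly_fun_add, rule poly_fun.poly_fun_var_mult, simp, rule q(1), rule poly_fun_mono[OF c(1)], blast)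
    ultimately show ?thesis unfolding True by (intro bexI[where x="\<lambda>x. x y * q x + c x"])
  qed
qed

text \<open>After a shear in direction \<open>a\<close>, the coefficient of \<open>y^N\<close> is
  the value of the form at the point with coordinates \<open>a\<close> and
  \<open>y\<close>-coordinate 1. To make a polynomial monic it is thus enough to find a direction
  where its leading form does not vanish.\<close>

lemma hom_fun_shear_monic:
  assumes "hom_fun (insert y V) N h"
  shows "deg_less_in y V N (\<lambda>x. h (\<lambda>v. if v = y then x y else x v + a v * x y)
           - h (\<lambda>v. if v = y then 1 else a v) * x y ^ N)"
  using assms
proof (induction rule: hom_fun.induct)
  case (hom_fun_zero m) then show ?case using deg_less_in_zero by simp
next
  case (hom_fun_const c) then show ?case using deg_less_in_zero by simp
next
  case (hom_fun_add m p q) from deg_less_in_add[OF hom_fun_add(3,4)] show ?case by (simp add: algebra_simps)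
next
  case (hom_fun_var_mult v N h)
  let ?s = "\<lambda>x v. if v = y then x y else x v + a v * x y"
  let ?h = "h (\<lambda>v. if v = y then 1 else a v)"
  let ?r = "\<lambda>x. h (?s x) - ?h * x y ^ N"
  let ?a = "if v = y then 1 else a v"
  have 1: "deg_less_in y V (Suc N) (\<lambda>x. ?a * (x y * ?r x))"
    by (rule deg_less_in_mult[OF deg_less_in_mult_y[OF hom_fun_var_mult(3)] poly_fun_const])
  show ?case
  proof (cases "v = y")
    case True then show ?thesis using 1 by (simp add: algebra_simps)
  next
    case False
    then have v: "(\<lambda>x. x v) \<in> poly_fun V" using hom_fun_var_mult(1) by (auto intro: poly_fun_var)
    have 2: "deg_less_in y V (Suc N) (\<lambda>x. x v * ?r x)" by (rule deg_less_in_mono[OF deg_less_in_mult[OF hom_fun_var_mult(3) v]]) simp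
    have 3: "deg_less_in y V (Suc N) (\<lambda>x. (?h * x v) * x y ^ N)" by (rule deg_less_in_single[OF poly_fun_cmult[OF v]]) simp
    from deg_less_in_add[OF deg_less_in_add[OF 1 2] 3] False show ?thesis by (simp add: algebra_simps)
  qed
qed

text \<open>A nonzero member of least degree divides all the others. It is not constant because 1 is
  excluded, and its root is the common one.\<close>

lemma poly_ideal_common_root:
  fixes L :: "'k::field poly set"
  assumes ac: "alg_closed_field TYPE('k)"
    and add: "\<And>P Q. P \<in> L \<Longrightarrow> Q \<in> L \<Longrightarrow> P + Q \<in> L"
    and mult: "\<And>P Q. P \<in> L \<Longrightarrow> Q * P \<in> L"
    and no1: "1 \<notin> L"
  shows "\<exists>t. \<forall>P\<in>L. poly P t = 0"
proof (cases "\<exists>P\<in>L. P \<noteq> 0")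
  case False then show ?thesis by (metis poly_0)
next
  case True
  define N where "N = (LEAST N. \<exists>P\<in>L. P \<noteq> 0 \<and> degree P = N)"
  have "\<exists>P\<in>L. P \<noteq> 0 \<and> degree P = N" unfolding N_def by (rule LeastI_ex) (use True in blast)
  then obtain P where P: "P \<in> L" "P \<noteq> 0" "degree P = N" by blast
  have min: "N \<le> degree Q" if "Q \<in> L" "Q \<noteq> 0" for Q
    unfolding N_def by (rule Least_le) (use that in blast)
  have dv: "P dvd Q" if "Q \<in> L" for Q
  proof -
    have "Q mod P = Q + (- (Q div P)) * P" by (simp add: minus_div_mult_eq_mod[symmetric])
    then have "Q mod P \<in> L" using add[OF that mult[OF P(1), of "- (Q div P)"]] by simp
    then have "Q mod P = 0" using min[of "Q mod P"] degree_mod_less[of P Q] P by fastforce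
    then show ?thesis by (simp add: mod_eq_0_iff_dvd)
  qed
  have "degree P \<ge> 1"
  proof (rule ccontr)
    assume "\<not> degree P \<ge> 1"
    then have "degree P = 0" by simp
    then obtain c where c: "P = [:c:]" by (rule degree_eq_zeroE)
    then have "[:1 / c:] * P = 1" using P(2) by (simp add: one_pCons)
    then show False using mult[OF P(1), of "[:1/c:]"] no1 by simp
  qed
  then obtain t where "poly P t = 0" using ac unfolding alg_closed_field_def by blast
  then have "poly Q t = 0" if "Q \<in> L" for Q using dv[OF that] by (metis dvd_trans poly_eq_0_iff_dvd)
  then show ?thesis by blast
qed

lemma poly_mult_small_degree:
  fixes P Q G :: "'k::idom poly"
  assumes "P = Q * G" "degree P < degree G"
  shows "P = 0"
proof (rule ccontr)
  assume "P \<noteq> 0"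
  then have "Q \<noteq> 0" "G \<noteq> 0" using assms(1) by auto
  then have "degree P = degree Q + degree G" using assms(1) by (simp add: degree_mult_eq)
  then show False using assms(2) by simp
qed

lemma poly_fun_fiber:
  assumes "p \<in> poly_fun V"
  shows "\<exists>P. \<forall>t. p (a(y := t)) = poly P (t::'k::comm_ring_1)"
proof -
  have eq: "a(y := t) = (\<lambda>v. poly (if v = y then [:0, 1:] else [:a v:]) t)" for t by auto
  show ?thesis unfolding eq using poly_fun_curve[OF assms, of "\<lambda>v. if v = y then [:0, 1:] else [:a v:]"] .
qed

text \<open>A zero \<open>a\<close> of the elimination ideal lifts to the fibre above
  \<open>a\<close>. Otherwise some \<open>f\<close> in \<open>J\<close> equals 1 on the whole fibre;
  then the determinant \<open>s\<close> of multiplication by \<open>f\<close> on remainders modulo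
  \<open>g\<close>, a resultant, lies in \<open>J\<close> and does not involve \<open>y\<close>, but
  its value at \<open>a\<close> is 1.\<close>

lemma monic_ideal_zero:
  fixes J :: "(('v \<Rightarrow> 'k::field_char_0) \<Rightarrow> 'k) set"
  assumes ac: "alg_closed_field TYPE('k)"
    and J: "poly_fun_ideal (insert y V) J" and y: "y \<notin> V"
    and g: "g \<in> J" "deg_less_in y V D (\<lambda>x. g x - x y ^ D)"
    and no1: "(\<lambda>x. 1) \<notin> J"
    and a: "\<And>p. p \<in> J \<Longrightarrow> p \<in> poly_fun V \<Longrightarrow> p a = 0"
  shows "\<exists>x. \<forall>p\<in>J. p x = 0"
proof -
  note Jd = poly_fun_idealD[OF J]
  have D: "D \<ge> 1"
  proof (rule ccontr)
    assume "\<not> D \<ge> 1"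
    then have D0: "D = 0" by simp
    have "(\<lambda>x. g x - x y ^ D) = (\<lambda>x. 0)" using g(2) unfolding deg_less_in_def D0 by auto
    then have "g x - 1 = 0" for x unfolding D0 by (auto dest: fun_cong[of _ _ x])
    then have "g = (\<lambda>x. 1)" by auto
    then show False using g(1) no1 by simp
  qed
  define L where "L = {P. \<exists>f\<in>J. \<forall>t. f (a(y := t)) = poly P t}"
  have "\<exists>t. \<forall>P\<in>L. poly P t = 0"
  proof (rule poly_ideal_common_root[OF ac])
    fix P Q assume "P \<in> L" "Q \<in> L"
    then obtain f h where "f \<in> J" "\<forall>t. f (a(y := t)) = poly P t" "h \<in> J" "\<forall>t. h (a(y := t)) = poly Q t"
      unfolding L_def by blast
    then show "P + Q \<in> L" unfolding L_def using Jd(3)[of f h] by (intro CollectI bexI[where x="\<lambda>x. f x + h x"]) simp_all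
  next
    fix P Q assume "P \<in> L"
    then obtain f where f: "f \<in> J" "\<forall>t. f (a(y := t)) = poly P t" unfolding L_def by blast
    have eq: "poly Q (x y) = (\<Sum>i\<le>degree Q. coeff Q i * x y ^ i)" for x :: "'v \<Rightarrow> 'k" by (rule poly_altdef)
    have "(\<lambda>x. poly Q (x y)) \<in> poly_fun (insert y V)" unfolding eq
      by (rule poly_fun_sum, rule poly_fun_mult, rule poly_fun_const, rule poly_fun_power, rule poly_fun_var, simp)
    from Jd(4)[OF f(1) this] show "Q * P \<in> L" unfolding L_def using f(2)
      by (intro CollectI bexI[where x="\<lambda>x. poly Q (x y) * f x"]) simp_all
  next
    show "1 \<notin> L"
    proof
      assume "1 \<in> L"
      then obtain f where f: "f \<in> J" "\<And>t. f (a(y := t)) = 1" unfolding L_def by auto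
      have fPF: "f \<in> poly_fun (insert y V)" using f(1) Jd(1) by blast
      have yi: "(\<lambda>x. f x * x y ^ i) \<in> poly_fun (insert y V)" for i
        by (rule poly_fun_mult[OF fPF], rule poly_fun_power, rule poly_fun_var, simp)
      \<comment> \<open>The coefficients of the remainder of \<open>f * y^i\<close> modulo
        \<open>g\<close> will form row \<open>i\<close> of the matrix \<open>c\<close>.\<close>
      have "\<forall>i. \<exists>q. q \<in> poly_fun (insert y V) \<and> deg_less_in y V D (\<lambda>x. f x * x y ^ i - q x * g x)"
      proof
        fix i
        from deg_less_in_division[OF g(2) D yi[of i]]
        show "\<exists>q. q \<in> poly_fun (insert y V) \<and> deg_less_in y V D (\<lambda>x. f x * x y ^ i - q x * g x)" unfolding Bex_def .
      qed
      from choice[OF this] obtain q where q': "\<forall>i. q i \<in> poly_fun (insert y V) \<and> deg_less_in y V D (\<lambda>x. f x * x y ^ i - q i x * g x)" ..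
      have q: "q i \<in> poly_fun (insert y V)" for i using q'[rule_format, of i] by (rule conjunct1)
      have "\<forall>i. \<exists>c. (\<forall>j. c j \<in> poly_fun V) \<and> (\<lambda>x. f x * x y ^ i - q i x * g x) = (\<lambda>x. \<Sum>j<D. c j x * x y ^ j)"
        using q' unfolding deg_less_in_def by simp
      from choice[OF this] obtain c where c': "\<forall>i. (\<forall>j. c i j \<in> poly_fun V) \<and> (\<lambda>x. f x * x y ^ i - q i x * g x) = (\<lambda>x. \<Sum>j<D. c i j x * x y ^ j)" ..
      have c: "c i j \<in> poly_fun V" for i j using c' by simp
      have eq: "f x * x y ^ i - q i x * g x = (\<Sum>j<D. c i j x * x y ^ j)" for i x
        using c'[rule_format, of i] by (auto dest: fun_cong[of _ _ x])
      \<comment> \<open>On the fibre \<open>f\<close> is 1, so the remainder of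
        \<open>f * y^i\<close> restricts to the remainder of \<open>y^i\<close>, which is
        \<open>y^i\<close> itself because \<open>i < D\<close>.\<close>
      have ca: "c i j a = (if i = j then 1 else 0)" if i: "i < D" and j: "j < D" for i j
      proof -
        obtain e where e: "\<And>j. e j \<in> poly_fun V" "(\<lambda>x. g x - x y ^ D) = (\<lambda>x. \<Sum>i<D. e i x * x y ^ i)"
          using g(2) unfolding deg_less_in_def by blast
        have up: "p (a(y := t)) = p a" if "p \<in> poly_fun V" for p t
          by (rule poly_fun_cong[OF that]) (use y in auto)
        define G where "G = monom 1 D + (\<Sum>i<D. monom (e i a) i)"
        have dl: "degree (\<Sum>i<D. monom (e i a) i) < D"
          by (rule degree_sum_less) (use D in \<open>auto intro: le_less_trans[OF degree_monom_le]\<close>)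
        then have dG: "degree G = D" unfolding G_def
          by (subst degree_add_eq_left) (auto simp: degree_monom_eq)
        have pG: "g (a(y := t)) = poly G t" for t
          using fun_cong[OF e(2), of "a(y := t)"] by (simp add: G_def poly_sum poly_monom up[OF e(1)] algebra_simps)
        obtain Q where Q: "\<And>t. q i (a(y := t)) = poly Q t" using poly_fun_fiber[OF q[of i]] by blast
        define P where "P = monom 1 i - (\<Sum>j<D. monom (c i j a) j)"
        have "degree (\<Sum>j<D. monom (c i j a) j) < D"
          by (rule degree_sum_less) (use D in \<open>auto intro: le_less_trans[OF degree_monom_le]\<close>)
        then have dP: "degree P < D" unfolding P_def
          using degree_diff_le_max[of "monom 1 i" "\<Sum>j<D. monom (c i j a) j"] i
          by (auto intro: le_less_trans[OF degree_monom_le] simp: degree_monom_eq intro!: le_less_trans[OF degree_diff_le_max])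
        have "poly (P - Q * G) t = 0" for t
          using eq[of "a(y := t)" i] by (simp add: P_def poly_sum poly_monom f(2) pG Q up[OF c] algebra_simps)
        then have "P - Q * G = 0" by (rule poly_eq_0_if_everywhere_0)
        then have "P = 0" using poly_mult_small_degree[of P Q G] dP dG by simp
        then have "coeff P j = 0" by simp
        moreover have "coeff (\<Sum>j<D. monom (c i j a) j) j = c i j a"
        proof -
          have "coeff (\<Sum>j<D. monom (c i j a) j) j = (\<Sum>k<D. if k = j then c i k a else 0)"
            unfolding coeff_sum by (rule sum.cong[OF refl]) simp
          also have "\<dots> = c i j a" using j by (subst sum.delta) simp_all
          finally show ?thesis .
        qed
        ultimately show ?thesis unfolding P_def by (simp add: if_split)
      qed
      obtain C where C: "\<And>i j. i < D \<Longrightarrow> j < D \<Longrightarrow> C i j \<in> poly_fun V"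
        "\<And>x w i. i < D \<Longrightarrow> det (mat D D (\<lambda>(i, j). c i j x)) * w i
        = (\<Sum>j<D. C i j x * (\<Sum>l<D. c j l x * w l))"
        using poly_fun_cramer[of D c V] c by blast
      define s where "s x = det (mat D D (\<lambda>(i, j). c i j x))" for x
      have sV: "s \<in> poly_fun V" unfolding s_def by (rule poly_fun_det) (rule c)
      have V: "V \<subseteq> insert y V" by blast
      \<comment> \<open>Cramer's rule for the vector of powers of \<open>y\<close>, whose entry 0 is
        1, expresses the determinant itself through the \<open>f * y^j - q j * g\<close>.\<close>
      have "s = (\<lambda>x. \<Sum>j<D. C 0 j x * (x y ^ j * f x - q j x * g x))"
      proof
        fix x
        have "s x = (\<Sum>j<D. C 0 j x * (\<Sum>l<D. c j l x * x y ^ l))"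
          using C(2)[of 0 x "\<lambda>l. x y ^ l"] D by (simp add: s_def)
        also have "\<dots> = (\<Sum>j<D. C 0 j x * (x y ^ j * f x - q j x * g x))"
          by (rule sum.cong[OF refl]) (simp only: eq[symmetric] mult.commute[of "f x"])
        finally show "s x = \<dots>" .
      qed
      moreover have "(\<lambda>x. \<Sum>j<D. C 0 j x * (x y ^ j * f x - q j x * g x)) \<in> J"
      proof (rule poly_fun_ideal_sum[OF J], rule Jd(4))
        fix j assume "j \<in> {..<D}"
        then show "C 0 j \<in> poly_fun (insert y V)" using poly_fun_mono[OF C(1) V, of 0 j] D by simp
        have "(\<lambda>x. x y ^ j * f x) \<in> J" by (rule Jd(4)[OF f(1)], rule poly_fun_power, rule poly_fun_var, simp)
        from poly_fun_ideal_diff[OF J this Jd(4)[OF g(1) q]]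
        show "(\<lambda>x. x y ^ j * f x - q j x * g x) \<in> J" .
      qed
      ultimately have "s a = 0" using a[of s] sV by simp
      moreover have "mat D D (\<lambda>(i, j). c i j a) = 1\<^sub>m D" by (rule eq_matI) (auto simp: ca)
      then have "s a = 1" by (simp add: s_def)
      ultimately show False by simp
    qed
  qed
  then obtain t where t: "\<And>P. P \<in> L \<Longrightarrow> poly P t = 0" by blast
  have "p (a(y := t)) = 0" if "p \<in> J" for p
  proof -
    have "p \<in> poly_fun (insert y V)" using that Jd(1) by blast
    from poly_fun_fiber[OF this, of a y] obtain P where P: "\<forall>t. p (a(y := t)) = poly P t" ..
    then have "P \<in> L" unfolding L_def using that by blast
    then show ?thesis using t P by simp
  qed
  then have *: "\<forall>p\<in>J. p (a(y := t)) = 0" ..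
  show ?thesis by (rule exI, rule *)
qed


lemma hom_fun_shear_deg_less_in:
  assumes "hom_fun (insert y V) N h"
  shows "deg_less_in y V (Suc N) (\<lambda>x. h (\<lambda>v. if v = y then x y else x v + a v * x y))"
proof -
  let ?c = "h (\<lambda>v. if v = y then 1 else a v)"
  have "deg_less_in y V (Suc N) (\<lambda>x. ?c * x y ^ N)" by (rule deg_less_in_single[OF poly_fun_const]) simp
  from deg_less_in_add[OF deg_less_in_mono[OF hom_fun_shear_monic[OF assms], of "Suc N" a] this] show ?thesis by simp
qed

lemma deg_less_in_sum: "(\<And>i. i \<in> S \<Longrightarrow> deg_less_in y V N (p i)) \<Longrightarrow> deg_less_in y V N (\<lambda>x. \<Sum>i\<in>S. p i x)"
  by (induction S rule: infinite_finite_induct) (auto intro: deg_less_in_zero deg_less_in_add)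

lemma poly_fun_top_component:
  fixes p :: "('v \<Rightarrow> 'k::comm_ring_1) \<Rightarrow> 'k"
  assumes "p \<in> poly_fun V" "p x0 \<noteq> 0"
  obtains q N where "\<And>j. hom_fun V j (q j)" "\<And>x. p x = (\<Sum>j\<le>N. q j x)" "\<exists>x. q N x \<noteq> 0"
proof -
  obtain M where "deg_le_fun V M p" using poly_fun_deg_le_fun[OF assms(1)] by blast
  then obtain q where q: "\<And>j. hom_fun V j (q j)" "p = (\<lambda>x. \<Sum>j\<le>M. q j x)" unfolding deg_le_fun_def by blast
  define S where "S = {j. j \<le> M \<and> (\<exists>x. q j x \<noteq> 0)}"
  have "finite S" unfolding S_def by simp
  have "S \<noteq> {}"
  proof
    assume "S = {}"
    then have "\<forall>j\<le>M. \<forall>x. q j x = 0" unfolding S_def by blast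
    then show False using assms(2) q(2) by simp
  qed
  define N where "N = Max S"
  have N: "N \<in> S" "\<And>j. j \<in> S \<Longrightarrow> j \<le> N" unfolding N_def using \<open>finite S\<close> \<open>S \<noteq> {}\<close> by auto
  have "p x = (\<Sum>j\<le>N. q j x)" for x
    unfolding q(2)
  proof (rule sum.mono_neutral_right)
    show "\<forall>i\<in>{..M} - {..N}. q i x = 0" using N(2) unfolding S_def by fastforce
  qed (use N(1) in \<open>auto simp: S_def\<close>)
  then show ?thesis using that[of q N] q(1) N(1) unfolding S_def by blast
qed

text \<open>
  Arrondo's proof: after a linear change of coordinates the ideal contains a polynomial that is monic in
  one variable \<open>y\<close>, and a zero of the elimination ideal extends to a zero of the ideal.
\<close>

lemma nullstellensatz_zero:
  fixes I :: "(('v \<Rightarrow> 'k::field_char_0) \<Rightarrow> 'k) set"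
  assumes ac: "alg_closed_field TYPE('k)"
    and "finite V" "poly_fun_ideal V I" "(\<lambda>x. 1) \<notin> I"
  shows "\<exists>x. \<forall>p\<in>I. p x = 0"
  using assms(2-)
proof (induction V arbitrary: I rule: finite_induct)
  case empty
  have "p x = 0" if p: "p \<in> I" for p x
  proof (rule ccontr)
    assume nz: "p x \<noteq> 0"
    have "p \<in> poly_fun {}" using poly_fun_idealD(1)[OF empty(1)] p by blast
    then have "p z = p x" for z by (rule poly_fun_cong) simp
    then have "(\<lambda>z. (1 / p x) * p z) = (\<lambda>z. 1)" using nz by (intro ext) simp
    moreover have "(\<lambda>z. (1 / p x) * p z) \<in> I" by (rule poly_fun_idealD(4)[OF empty(1) p poly_fun_const])
    ultimately show False using empty(2) by simp
  qed
  then have *: "\<forall>p\<in>I. p (\<lambda>v. 0) = 0" by simp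
  show ?case by (rule exI, rule *)
next
  case (insert y V)
  note I = insert.prems(1)
  show ?case
  proof (cases "\<exists>p\<in>I. \<exists>x. p x \<noteq> 0")
    case False
    then have *: "\<forall>p\<in>I. p (\<lambda>v. 0) = 0" by simp
    show ?thesis by (rule exI, rule *)
  next
    case True
    then obtain p x0 where p: "p \<in> I" "p x0 \<noteq> 0" by blast
    have pPF: "p \<in> poly_fun (insert y V)" using p(1) poly_fun_idealD(1)[OF I] by (rule subsetD[rotated])
    obtain q N where q: "\<And>j. hom_fun (insert y V) j (q j)" "\<And>x. p x = (\<Sum>j\<le>N. q j x)" "\<exists>x. q N x \<noteq> 0"
    proof (rule poly_fun_top_component[of p "insert y V" x0, OF pPF p(2)])
      fix q N assume "\<And>j. hom_fun (insert y V) j (q j)" "\<And>x. p x = (\<Sum>j\<le>N. q j x)" "\<exists>x. q N x \<noteq> 0"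
      then show thesis by (rule that)
    qed
    obtain a1 where a1: "q N a1 \<noteq> 0" using q(3) ..
    \<comment> \<open>A direction in which the leading form is nonzero and which can be scaled to
      \<open>y\<close>-coordinate 1.\<close>
    have "\<exists>x. q N x \<noteq> 0 \<and> x y \<noteq> 0"
      using poly_fun_domain[of "q N" "insert y V" "\<lambda>x. x y" a1 "\<lambda>v. 1", OF hom_fun_poly_fun[OF q(1)] _ a1]
      by (simp add: poly_fun_var)
    then obtain a0 where a0: "q N a0 \<noteq> 0" "a0 y \<noteq> 0" by auto
    define a where "a v = a0 v / a0 y" for v
    define c where "c = q N (\<lambda>v. if v = y then 1 else a v)"
    have "(\<lambda>v. if v = y then 1 else a v) = (\<lambda>v. (1 / a0 y) * a0 v)" using a0 by (auto simp: a_def)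
    then have "c = (1 / a0 y) ^ N * q N a0" unfolding c_def by (simp only: hom_fun_scale[OF q(1)])
    then have c: "c \<noteq> 0" using a0 by simp
    define s where "s x v = (if v = y then x y else x v + a v * x y)" for x v
    define s' where "s' x v = (if v = y then x y else x v - a v * x y)" for x v
    have s's: "s' (s x) = x" and ss': "s (s' x) = x" for x by (auto simp: s_def s'_def)
    have sPF: "(\<lambda>x. r (s x)) \<in> poly_fun (insert y V)" "(\<lambda>x. r (s' x)) \<in> poly_fun (insert y V)"
      if "r \<in> poly_fun (insert y V)" for r
    proof -
      have 1: "(\<lambda>x. s x v) \<in> poly_fun (insert y V)" if "v \<in> insert y V" for v
        using that by (cases "v = y") (auto simp: s_def intro!: poly_fun_var poly_fun_add poly_fun_cmult)
      from poly_fun_compose[OF that 1] show "(\<lambda>x. r (s x)) \<in> poly_fun (insert y V)" .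
      have 2: "(\<lambda>x. s' x v) \<in> poly_fun (insert y V)" if "v \<in> insert y V" for v
        using that by (cases "v = y") (auto simp: s'_def intro!: poly_fun_var poly_fun_diff poly_fun_cmult)
      from poly_fun_compose[OF that 2] show "(\<lambda>x. r (s' x)) \<in> poly_fun (insert y V)" .
    qed
    \<comment> \<open>The ideal in the sheared coordinates; \<open>s'\<close> undoes the shear
      \<open>s\<close>.\<close>
    define J where "J = (\<lambda>r x. r (s x)) ` I"
    have JI: "(\<lambda>x. r (s' x)) \<in> I" if "r \<in> J" for r using that unfolding J_def by (auto simp: ss')
    have J: "poly_fun_ideal (insert y V) J" unfolding poly_fun_ideal_def
    proof (intro conjI ballI)
      show "J \<subseteq> poly_fun (insert y V)" unfolding J_def using poly_fun_idealD(1)[OF I] sPF(1) by blast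
      show "(\<lambda>x. 0) \<in> J" unfolding J_def using poly_fun_idealD(2)[OF I] by (intro image_eqI[where x="\<lambda>x. 0"]) auto
      show "(\<lambda>x. r x + t x) \<in> J" if "r \<in> J" "t \<in> J" for r t
        unfolding J_def using poly_fun_idealD(3)[OF I JI[OF that(1)] JI[OF that(2)]]
        by (intro image_eqI[where x="\<lambda>x. r (s' x) + t (s' x)"]) (auto simp: s's)
      show "(\<lambda>x. t x * r x) \<in> J" if "r \<in> J" "t \<in> poly_fun (insert y V)" for r t
        unfolding J_def using poly_fun_idealD(4)[OF I JI[OF that(1)] sPF(2)[OF that(2)]]
        by (intro image_eqI[where x="\<lambda>x. t (s' x) * r (s' x)"]) (auto simp: s's)
    qed
    have no1: "(\<lambda>x. 1) \<notin> J" using JI[of "\<lambda>x. 1"] insert.prems(2) by blast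
    define g where "g x = (1 / c) * p (s x)" for x
    have gJ: "g \<in> J" unfolding g_def
      by (rule poly_fun_idealD(4)[OF J _ poly_fun_const]) (use p(1) in \<open>auto simp: J_def\<close>)
    have "deg_less_in y V N (\<lambda>x. (1 / c) * ((\<Sum>j<N. q j (s x)) + (q N (s x) - c * x y ^ N)))"
    proof (rule deg_less_in_mult[OF deg_less_in_add poly_fun_const])
      show "deg_less_in y V N (\<lambda>x. \<Sum>j<N. q j (s x))"
      proof (rule deg_less_in_sum)
        fix j assume "j \<in> {..<N}"
        then show "deg_less_in y V N (\<lambda>x. q j (s x))"
          unfolding s_def by (intro deg_less_in_mono[OF hom_fun_shear_deg_less_in[OF q(1)], of j N a]) simp
      qed
      show "deg_less_in y V N (\<lambda>x. q N (s x) - c * x y ^ N)" unfolding s_def c_def by (rule hom_fun_shear_monic[OF q(1)])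
    qed
    moreover have "(\<Sum>j<N. q j (s x)) + (q N (s x) - c * x y ^ N) = p (s x) - c * x y ^ N" for x
      unfolding q(2) by (simp add: lessThan_Suc_atMost[symmetric])
    ultimately have gLD: "deg_less_in y V N (\<lambda>x. g x - x y ^ N)"
      using c by (simp add: g_def right_diff_distrib)
    have V: "poly_fun V \<subseteq> poly_fun (insert y V)" by (auto intro: poly_fun_mono)
    have "poly_fun_ideal V (J \<inter> poly_fun V)" unfolding poly_fun_ideal_def
      using poly_fun_idealD[OF J] V by (auto intro: poly_fun_const poly_fun_add poly_fun_mult)
    moreover have "(\<lambda>x. 1) \<notin> J \<inter> poly_fun V" using no1 by blast
    ultimately obtain b where b: "\<forall>p\<in>J \<inter> poly_fun V. p b = 0" using insert.IH by blast
    obtain x where x: "\<forall>p\<in>J. p x = 0"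
      using monic_ideal_zero[OF ac J insert.hyps(2) gJ gLD no1, of b] b by blast
    have *: "\<forall>r\<in>I. r (s x) = 0" using x unfolding J_def by simp
    show ?thesis by (rule exI, rule *)
  qed
qed

text \<open>Substituting \<open>1 / G\<close> for \<open>y\<close> creates denominators which a
  power of \<open>G\<close> clears. Since every large \<open>T\<close> works, sums and finite
  families can share one exponent.\<close>

lemma poly_fun_clear_denominator:
  fixes G :: "('v \<Rightarrow> 'k::field) \<Rightarrow> 'k"
  assumes G: "G \<in> poly_fun V" and q: "q \<in> poly_fun (insert y V)"
  shows "\<exists>T0. \<forall>T\<ge>T0. \<exists>h\<in>poly_fun V. \<forall>x. G x \<noteq> 0 \<longrightarrow> h x = G x ^ T * q (x(y := 1 / G x))"
  using q
proof (induction rule: poly_fun.induct)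
  case (poly_fun_const c)
  show ?case
  proof (rule exI[of _ 0], intro allI impI)
    fix T :: nat
    show "\<exists>h\<in>poly_fun V. \<forall>x. G x \<noteq> 0 \<longrightarrow> h x = G x ^ T * c"
      by (rule bexI[where x="\<lambda>x. G x ^ T * c"], simp, rule poly_fun_mult[OF poly_fun_power[OF G] poly_fun.poly_fun_const])
  qed
next
  case (poly_fun_add p q)
  then obtain T1 T2 where
    T1: "\<forall>T\<ge>T1. \<exists>h\<in>poly_fun V. \<forall>x. G x \<noteq> 0 \<longrightarrow> h x = G x ^ T * p (x(y := 1 / G x))" and
    T2: "\<forall>T\<ge>T2. \<exists>h\<in>poly_fun V. \<forall>x. G x \<noteq> 0 \<longrightarrow> h x = G x ^ T * q (x(y := 1 / G x))" by blast
  show ?case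
  proof (rule exI[of _ "max T1 T2"], intro allI impI)
    fix T assume "max T1 T2 \<le> T"
    then have "T1 \<le> T" "T2 \<le> T" by auto
    from T1[rule_format, OF this(1)] obtain h1 where
      h1: "h1 \<in> poly_fun V" "\<forall>x. G x \<noteq> 0 \<longrightarrow> h1 x = G x ^ T * p (x(y := 1 / G x))" ..
    from T2[rule_format, OF \<open>T2 \<le> T\<close>] obtain h2 where
      h2: "h2 \<in> poly_fun V" "\<forall>x. G x \<noteq> 0 \<longrightarrow> h2 x = G x ^ T * q (x(y := 1 / G x))" ..
    show "\<exists>h\<in>poly_fun V. \<forall>x. G x \<noteq> 0 \<longrightarrow> h x = G x ^ T * (p (x(y := 1 / G x)) + q (x(y := 1 / G x)))"
      by (rule bexI[where x="\<lambda>x. h1 x + h2 x"]) (use h1 h2 in \<open>auto intro: poly_fun.poly_fun_add simp: distrib_left\<close>)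
  qed
next
  case (poly_fun_var_mult v p)
  then obtain T1 where
    T1: "\<forall>T\<ge>T1. \<exists>h\<in>poly_fun V. \<forall>x. G x \<noteq> 0 \<longrightarrow> h x = G x ^ T * p (x(y := 1 / G x))" by blast
  show ?case
  proof (rule exI[of _ "Suc T1"], intro allI impI)
    fix T assume "Suc T1 \<le> T"
    then obtain T' where T': "T = Suc T'" "T1 \<le> T'" by (cases T) auto
    from T1[rule_format, OF T'(2)] obtain h where
      h: "h \<in> poly_fun V" "\<forall>x. G x \<noteq> 0 \<longrightarrow> h x = G x ^ T' * p (x(y := 1 / G x))" ..
    show "\<exists>h\<in>poly_fun V. \<forall>x. G x \<noteq> 0 \<longrightarrow> h x = G x ^ T * ((x(y := 1 / G x)) v * p (x(y := 1 / G x)))"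
    proof (cases "v = y")
      case True
      show ?thesis by (rule bexI[where x=h]) (use h True T' in auto)
    next
      case False
      then have v: "v \<in> V" using poly_fun_var_mult(1) by simp
      show ?thesis
        by (rule bexI[where x="\<lambda>x. x v * (G x * h x)"])
          (use h False T' in \<open>auto intro!: poly_fun.poly_fun_var_mult[OF v] poly_fun_mult G\<close>)
    qed
  qed
qed

lemma poly_fun_ideal_generated:
  fixes f :: "'i \<Rightarrow> ('v \<Rightarrow> 'k::comm_ring_1) \<Rightarrow> 'k"
  assumes "\<And>i. i \<in> I \<Longrightarrow> f i \<in> poly_fun V"
  shows "poly_fun_ideal V {p. \<exists>g. (\<forall>i\<in>I. g i \<in> poly_fun V) \<and> p = (\<lambda>x. \<Sum>i\<in>I. g i x * f i x)}" (is "poly_fun_ideal V ?J")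
  unfolding poly_fun_ideal_def
proof (intro conjI ballI)
  show "?J \<subseteq> poly_fun V" using assms by (auto intro!: poly_fun_sum poly_fun_mult)
  show "(\<lambda>x. 0) \<in> ?J" by (intro CollectI exI[of _ "\<lambda>i x. 0"]) (auto intro: poly_fun_const)
next
  fix p q assume "p \<in> ?J" "q \<in> ?J"
  then obtain g h where g: "\<forall>i\<in>I. g i \<in> poly_fun V" "p = (\<lambda>x. \<Sum>i\<in>I. g i x * f i x)"
    and h: "\<forall>i\<in>I. h i \<in> poly_fun V" "q = (\<lambda>x. \<Sum>i\<in>I. h i x * f i x)" by blast
  show "(\<lambda>x. p x + q x) \<in> ?J" unfolding g h
    by (intro CollectI exI[of _ "\<lambda>i x. g i x + h i x"]) (use g h in \<open>auto intro: poly_fun_add simp: sum.distrib distrib_right\<close>)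
next
  fix p q :: "('v \<Rightarrow> 'k) \<Rightarrow> 'k" assume "p \<in> ?J" and q: "q \<in> poly_fun V"
  then obtain g where g: "\<forall>i\<in>I. g i \<in> poly_fun V" "p = (\<lambda>x. \<Sum>i\<in>I. g i x * f i x)" by blast
  show "(\<lambda>x. q x * p x) \<in> ?J" unfolding g
    by (intro CollectI exI[of _ "\<lambda>i x. q x * g i x"]) (use g q in \<open>auto intro: poly_fun_mult simp: sum_distrib_left mult.assoc\<close>)
qed

lemma poly_fun_ideal_generator:
  fixes f :: "'i \<Rightarrow> ('v \<Rightarrow> 'k::comm_ring_1) \<Rightarrow> 'k"
  assumes "finite I" "j \<in> I"
  shows "f j \<in> {p. \<exists>g. (\<forall>i\<in>I. g i \<in> poly_fun V) \<and> p = (\<lambda>x. \<Sum>i\<in>I. g i x * f i x)}"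
proof -
  have "f j x = (\<Sum>i\<in>I. (if i = j then 1 else 0) * f i x)" for x
  proof -
    have "(\<Sum>i\<in>I. (if i = j then 1 else 0) * f i x) = (\<Sum>i\<in>I. if i = j then f i x else 0)" by (rule sum.cong) auto
    then show ?thesis using assms by simp
  qed
  then show ?thesis
    by (intro CollectI exI[of _ "\<lambda>i x. if i = j then 1 else 0"] conjI ballI ext) (simp_all add: poly_fun_const)
qed

text \<open>Rabinowitsch's trick.\<close>

theorem strong_nullstellensatz:
  fixes f :: "'i \<Rightarrow> (nat \<Rightarrow> 'k::field_char_0) \<Rightarrow> 'k"
  assumes ac: "alg_closed_field TYPE('k)" and V: "finite V" and I: "finite I"
    and f: "\<And>i. i \<in> I \<Longrightarrow> f i \<in> poly_fun V" and G: "G \<in> poly_fun V"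
    and van: "\<And>x. (\<And>i. i \<in> I \<Longrightarrow> f i x = 0) \<Longrightarrow> G x = 0"
  shows "\<exists>T g. (\<forall>i\<in>I. g i \<in> poly_fun V) \<and> (\<forall>x. G x ^ T = (\<Sum>i\<in>I. g i x * f i x))"
proof -
  obtain y where y: "y \<notin> V" using ex_new_if_finite[OF infinite_UNIV_nat V] by blast
  \<comment> \<open>The additional generator, indexed by \<open>None\<close>, forces
    \<open>y * G = 1\<close> at a common zero, whereas \<open>van\<close> gives \<open>G = 0\<close>
    there.\<close>
  define f' where "f' = case_option (\<lambda>x. 1 - x y * G x) f"
  define I' where "I' = insert None (Some ` I)"
  define J where "J = {p. \<exists>g. (\<forall>i\<in>I'. g i \<in> poly_fun (insert y V)) \<and> p = (\<lambda>x. \<Sum>i\<in>I'. g i x * f' i x)}"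
  have sub: "poly_fun V \<subseteq> poly_fun (insert y V)" by (auto intro: poly_fun_mono)
  have f': "f' i \<in> poly_fun (insert y V)" if "i \<in> I'" for i
  proof (cases i)
    case None
    have "(\<lambda>x. 1 - x y * G x) \<in> poly_fun (insert y V)"
      by (rule poly_fun_diff[OF poly_fun_const poly_fun_var_mult]) (use G sub in auto)
    then show ?thesis using None by (simp add: f'_def)
  next
    case (Some j)
    then have "f j \<in> poly_fun V" using that f by (auto simp: I'_def)
    then show ?thesis using Some sub by (auto simp: f'_def)
  qed
  have J: "poly_fun_ideal (insert y V) J" unfolding J_def by (rule poly_fun_ideal_generated[OF f'])
  have "(\<lambda>x. 1) \<in> J"
  proof (rule ccontr)
    assume no1: "(\<lambda>x. 1) \<notin> J"
    have "finite (insert y V)" using V by simp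
    from nullstellensatz_zero[OF ac this J no1] obtain x where x: "\<forall>p\<in>J. p x = 0" ..
    have fJ: "f' i \<in> J" if "i \<in> I'" for i
      unfolding J_def by (rule poly_fun_ideal_generator) (use that I in \<open>auto simp: I'_def\<close>)
    have "f i x = 0" if "i \<in> I" for i
      using bspec[OF x fJ[of "Some i"]] that by (simp add: I'_def f'_def)
    then have "G x = 0" by (rule van)
    then show False using bspec[OF x fJ[of None]] by (simp add: I'_def f'_def)
  qed
  then obtain g where g: "\<forall>i\<in>I'. g i \<in> poly_fun (insert y V)" "(\<lambda>x. 1) = (\<lambda>x. \<Sum>i\<in>I'. g i x * f' i x)"
    unfolding J_def by blast
  have one: "1 = (\<Sum>i\<in>I. g (Some i) (x(y := 1 / G x)) * f i x)" if nz: "G x \<noteq> 0" for x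
  proof -
    let ?x = "x(y := 1 / G x)"
    have up: "p ?x = p x" if "p \<in> poly_fun V" for p by (rule poly_fun_cong[OF that]) (use y in auto)
    have "1 = (\<Sum>i\<in>I'. g i ?x * f' i ?x)" using g(2) by (rule fun_cong)
    also have "\<dots> = g None ?x * f' None ?x + (\<Sum>i\<in>I. g (Some i) ?x * f' (Some i) ?x)"
      unfolding I'_def using I by (simp add: sum.reindex)
    also have "f' None ?x = 0" using nz by (simp add: f'_def up[OF G])
    also have "(\<Sum>i\<in>I. g (Some i) ?x * f' (Some i) ?x) = (\<Sum>i\<in>I. g (Some i) ?x * f i x)"
      by (rule sum.cong[OF refl]) (simp add: f'_def up[OF f])
    finally show ?thesis by simp
  qed
  have "\<forall>i. \<exists>T0. i \<in> I \<longrightarrow> (\<forall>T\<ge>T0. \<exists>h\<in>poly_fun V. \<forall>x. G x \<noteq> 0 \<longrightarrow> h x = G x ^ T * g (Some i) (x(y := 1 / G x)))"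
  proof
    fix i
    show "\<exists>T0. i \<in> I \<longrightarrow> (\<forall>T\<ge>T0. \<exists>h\<in>poly_fun V. \<forall>x. G x \<noteq> 0 \<longrightarrow> h x = G x ^ T * g (Some i) (x(y := 1 / G x)))"
    proof (cases "i \<in> I")
      case True
      then have "g (Some i) \<in> poly_fun (insert y V)" using g(1) by (simp add: I'_def)
      from poly_fun_clear_denominator[OF G this] True show ?thesis by simp
    qed simp
  qed
  from choice[OF this] obtain T0 where T0: "\<forall>i. i \<in> I \<longrightarrow> (\<forall>T\<ge>T0 i. \<exists>h\<in>poly_fun V. \<forall>x. G x \<noteq> 0 \<longrightarrow> h x = G x ^ T * g (Some i) (x(y := 1 / G x)))" ..
  define T where "T = (\<Sum>i\<in>I. T0 i)"
  have T: "T0 i \<le> T" if "i \<in> I" for i unfolding T_def by (rule member_le_sum[OF that]) (use I in auto)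
  have "\<forall>i. \<exists>h. i \<in> I \<longrightarrow> h \<in> poly_fun V \<and> (\<forall>x. G x \<noteq> 0 \<longrightarrow> h x = G x ^ T * g (Some i) (x(y := 1 / G x)))"
  proof
    fix i
    show "\<exists>h. i \<in> I \<longrightarrow> h \<in> poly_fun V \<and> (\<forall>x. G x \<noteq> 0 \<longrightarrow> h x = G x ^ T * g (Some i) (x(y := 1 / G x)))"
    proof (cases "i \<in> I")
      case True
      from T0[rule_format, OF True T[OF True]] True show ?thesis unfolding Bex_def by simp
    qed simp
  qed
  from choice[OF this] obtain h where h: "\<forall>i. i \<in> I \<longrightarrow> h i \<in> poly_fun V \<and> (\<forall>x. G x \<noteq> 0 \<longrightarrow> h i x = G x ^ T * g (Some i) (x(y := 1 / G x)))" ..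
  \<comment> \<open>The substitution says nothing where \<open>G\<close> vanishes; one more factor
    \<open>G\<close> makes the identity trivial at these points.\<close>
  have "G x ^ Suc T = (\<Sum>i\<in>I. (G x * h i x) * f i x)" for x
  proof (cases "G x = 0")
    case False
    have "G x ^ Suc T = G x ^ Suc T * (\<Sum>i\<in>I. g (Some i) (x(y := 1 / G x)) * f i x)"
      using one[OF False] by simp
    also have "\<dots> = (\<Sum>i\<in>I. (G x * h i x) * f i x)"
      unfolding sum_distrib_left by (rule sum.cong[OF refl]) (use h False in \<open>simp add: algebra_simps\<close>)
    finally show ?thesis .
  qed simp
  moreover have "\<forall>i\<in>I. (\<lambda>x. G x * h i x) \<in> poly_fun V" using h by (auto intro: poly_fun_mult G)
  ultimately show ?thesis by (intro exI[of _ "Suc T"] exI[of _ "\<lambda>i x. G x * h i x"]) simp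
qed

section \<open>Expansion into monomials\<close>

inductive monomial_sum :: "'v set \<Rightarrow> nat \<Rightarrow> (('v \<Rightarrow> 'k::comm_ring_1) \<Rightarrow> 'k) \<Rightarrow> bool" for V t where
  monomial_sum_zero: "monomial_sum V t (\<lambda>x. 0)"
| monomial_sum_add: "monomial_sum V t p \<Longrightarrow> sum e V = t \<Longrightarrow> monomial_sum V t (\<lambda>x. c * (\<Prod>v\<in>V. x v ^ e v) + p x)"

lemma monomial_sum_plus: "monomial_sum V t p \<Longrightarrow> monomial_sum V t q \<Longrightarrow> monomial_sum V t (\<lambda>x. p x + q x)"
proof (induction rule: monomial_sum.induct)
  case monomial_sum_zero then show ?case by simp
next
  case (monomial_sum_add p e c) from monomial_sum.monomial_sum_add[OF monomial_sum_add(3)[OF monomial_sum_add(4)] monomial_sum_add(2), of c] show ?case by (simp add: add.assoc)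
qed

lemma monomial_sum_var: 
  assumes "finite V" "v \<in> V"
  shows "monomial_sum V t p \<Longrightarrow> monomial_sum V (Suc t) (\<lambda>x. x v * p x)"
proof (induction rule: monomial_sum.induct)
  case monomial_sum_zero show ?case using monomial_sum.monomial_sum_zero by simp
next
  case (monomial_sum_add p e c)
  let ?e = "e(v := Suc (e v))"
  have s: "sum ?e V = Suc t"
  proof -
    have "sum ?e V = Suc (e v) + sum e (V - {v})" using assms by (simp add: sum.remove)
    also have "\<dots> = Suc (sum e V)" using assms by (simp add: sum.remove)
    finally show ?thesis using monomial_sum_add(2) by simp
  qed
  have "(\<Prod>u\<in>V. x u ^ ?e u) = x v * (\<Prod>u\<in>V. x u ^ e u)" for x :: "'a \<Rightarrow> 'b"
  proof -
    have "(\<Prod>u\<in>V. x u ^ ?e u) = x v ^ Suc (e v) * (\<Prod>u\<in>V - {v}. x u ^ e u)"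
      using assms by (simp add: prod.remove)
    also have "\<dots> = x v * (\<Prod>u\<in>V. x u ^ e u)" using assms by (simp add: prod.remove mult.assoc)
    finally show ?thesis .
  qed
  then show ?case using monomial_sum.monomial_sum_add[OF monomial_sum_add(3) s, of c] by (simp add: algebra_simps)
qed

lemma hom_fun_monomial_sum:
  assumes "finite V" "hom_fun V t p"
  shows "monomial_sum V t p"
  using assms(2)
proof (induction rule: hom_fun.induct)
  case (hom_fun_zero m) show ?case by (rule monomial_sum_zero)
next
  case (hom_fun_const c)
  show ?case using monomial_sum_add[OF monomial_sum_zero[of V 0], of "\<lambda>_. 0" c] by simp
next
  case (hom_fun_add m p q) show ?case by (rule monomial_sum_plus[OF hom_fun_add(3,4)])
next
  case (hom_fun_var_mult v m p) show ?case by (rule monomial_sum_var[OF assms(1) hom_fun_var_mult(1,3)])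
qed

text \<open>A box of exponents rather than a simplex, so that its size is a power of
  \<open>T + 1\<close>. Exponents are 0 outside \<open>V\<close> to make the set finite.\<close>

definition exps :: "'v set \<Rightarrow> nat \<Rightarrow> ('v \<Rightarrow> nat) set" where
  "exps V T = {e. (\<forall>v\<in>V. e v \<le> T) \<and> (\<forall>v. v \<notin> V \<longrightarrow> e v = 0)}"

lemma finite_exps: "finite V \<Longrightarrow> finite (exps V T)"
  using finite_set_of_finite_funs[of V "{..T}" 0] unfolding exps_def
  by (rule rev_finite_subset) auto

lemma monomial_sum_span:
  assumes V: "finite V" and "monomial_sum V t p" and "t \<le> T"
  shows "\<exists>c. p = (\<lambda>x. \<Sum>e\<in>exps V T. c e * (\<Prod>v\<in>V. x v ^ e v))"
  using assms(2)
proof (induction rule: monomial_sum.induct)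
  case monomial_sum_zero show ?case by (rule exI[of _ "\<lambda>e. 0"]) simp
next
  case (monomial_sum_add p e d)
  then obtain c where c: "p = (\<lambda>x. \<Sum>e\<in>exps V T. c e * (\<Prod>v\<in>V. x v ^ e v))" by blast
  define e' where "e' = (\<lambda>v. if v \<in> V then e v else 0)"
  have "e v \<le> T" if "v \<in> V" for v using member_le_sum[OF that, of e] V monomial_sum_add(2) assms(3) by simp
  then have e': "e' \<in> exps V T" unfolding exps_def e'_def by simp
  have pe: "(\<Prod>v\<in>V. x v ^ e v) = (\<Prod>v\<in>V. x v ^ e' v)" for x :: "'a \<Rightarrow> 'b"
    by (rule prod.cong) (auto simp: e'_def)
  have "d * (\<Prod>v\<in>V. x v ^ e v) + p x = (\<Sum>e\<in>exps V T. (c e + (if e = e' then d else 0)) * (\<Prod>v\<in>V. x v ^ e v))" for x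
  proof -
    have "(\<Sum>e\<in>exps V T. (if e = e' then d else 0) * (\<Prod>v\<in>V. x v ^ e v))
       = (\<Sum>e\<in>exps V T. if e = e' then d * (\<Prod>v\<in>V. x v ^ e v) else 0)" by (rule sum.cong) auto
    also have "\<dots> = d * (\<Prod>v\<in>V. x v ^ e v)" using e' finite_exps[OF V] pe by simp
    finally show ?thesis unfolding c by (simp add: distrib_right sum.distrib)
  qed
  then show ?case by (intro exI[of _ "\<lambda>e. c e + (if e = e' then d else 0)"]) (rule ext)
qed

lemma deg_le_fun_span:
  assumes V: "finite V" and "deg_le_fun V t p" and "t \<le> T"
  shows "\<exists>c. p = (\<lambda>x. \<Sum>e\<in>exps V T. c e * (\<Prod>v\<in>V. x v ^ e v))"
proof -
  obtain q where q: "\<forall>j. hom_fun V j (q j)" "p = (\<lambda>x. \<Sum>j\<le>t. q j x)" using assms(2) unfolding deg_le_fun_def by blast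
  have "\<forall>j. \<exists>c. j \<le> t \<longrightarrow> q j = (\<lambda>x. \<Sum>e\<in>exps V T. c e * (\<Prod>v\<in>V. x v ^ e v))"
    using monomial_sum_span[OF V hom_fun_monomial_sum[OF V q(1)[rule_format]]] assms(3) by (meson le_trans)
  from choice[OF this] obtain c where c: "\<forall>j. j \<le> t \<longrightarrow> q j = (\<lambda>x. \<Sum>e\<in>exps V T. c j e * (\<Prod>v\<in>V. x v ^ e v))" ..
  have "p x = (\<Sum>e\<in>exps V T. (\<Sum>j\<le>t. c j e) * (\<Prod>v\<in>V. x v ^ e v))" for x
  proof -
    have "p x = (\<Sum>j\<le>t. \<Sum>e\<in>exps V T. c j e * (\<Prod>v\<in>V. x v ^ e v))" unfolding q(2)
      by (rule sum.cong[OF refl]) (use c in auto)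
    also have "\<dots> = (\<Sum>e\<in>exps V T. (\<Sum>j\<le>t. c j e) * (\<Prod>v\<in>V. x v ^ e v))"
      by (subst sum.swap) (simp add: sum_distrib_right)
    finally show ?thesis .
  qed
  then show ?thesis by (intro exI[of _ "\<lambda>e. \<Sum>j\<le>t. c j e"]) (rule ext)
qed

section \<open>The ideal of fixed points\<close>

lemma poly_fun_homogeneous_components:
  assumes "p \<in> poly_fun V"
  shows "\<exists>q. (\<forall>j. hom_fun V j (q j)) \<and> (\<exists>N. (\<forall>x. p x = (\<Sum>j\<le>N. q j x)) \<and> (\<forall>j x. N < j \<longrightarrow> q j x = 0))"
proof -
  obtain N where "deg_le_fun V N p" using poly_fun_deg_le_fun[OF assms] ..
  then obtain q where q: "\<forall>j. hom_fun V j (q j)" "p = (\<lambda>x. \<Sum>j\<le>N. q j x)" unfolding deg_le_fun_def by blast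
  let ?q = "\<lambda>j. if j \<le> N then q j else (\<lambda>x. 0)"
  have "\<forall>j. hom_fun V j (?q j)" using q(1) by (simp add: hom_fun_zero)
  moreover have "\<forall>x. p x = (\<Sum>j\<le>N. ?q j x)" unfolding q(2) by (intro allI sum.cong) auto
  moreover have "\<forall>j x. N < j \<longrightarrow> ?q j x = 0" by simp
  ultimately show ?thesis by (intro exI[of _ ?q] conjI exI[of _ N])
qed

text \<open>\<open>V\<close> indexes both the variables and the forms, so there are as many
  equations as unknowns. Points are functions on all naturals, hence \<open>nz\<close> speaks of the
  coordinates in \<open>V\<close> only.\<close>

locale form_system =
  fixes V :: "nat set" and D :: nat and F :: "nat \<Rightarrow> (nat \<Rightarrow> 'k::field_char_0) \<Rightarrow> 'k"
  assumes ac: "alg_closed_field TYPE('k)" and finV: "finite V" and D: "D \<ge> 2"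
    and F: "\<And>i. i \<in> V \<Longrightarrow> hom_fun V D (F i)"
    and nz: "\<And>x i. (\<And>i. i \<in> V \<Longrightarrow> F i x = 0) \<Longrightarrow> i \<in> V \<Longrightarrow> x i = 0"
begin

text \<open>Each variable vanishes wherever all \<open>F i\<close> do, so the Nullstellensatz
  applies to it; the sum of the exponents serves all variables at once.\<close>

lemma var_power_in_ideal:
  "\<exists>T. \<forall>v\<in>V. \<exists>g. (\<forall>i\<in>V. g i \<in> poly_fun V) \<and> (\<forall>x. x v ^ T = (\<Sum>i\<in>V. g i x * F i x))"
proof -
  have "\<forall>v. \<exists>T. v \<in> V \<longrightarrow> (\<exists>g. (\<forall>i\<in>V. g i \<in> poly_fun V) \<and> (\<forall>x. x v ^ T = (\<Sum>i\<in>V. g i x * F i x)))"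
  proof
    fix v
    show "\<exists>T. v \<in> V \<longrightarrow> (\<exists>g. (\<forall>i\<in>V. g i \<in> poly_fun V) \<and> (\<forall>x. x v ^ T = (\<Sum>i\<in>V. g i x * F i x)))"
    proof (cases "v \<in> V")
      case True
      have "\<exists>T g. (\<forall>i\<in>V. g i \<in> poly_fun V) \<and> (\<forall>x. x v ^ T = (\<Sum>i\<in>V. g i x * F i x))"
        by (rule strong_nullstellensatz[OF ac finV finV]) (auto intro: hom_fun_poly_fun[OF F] poly_fun_var True nz)
      then show ?thesis by simp
    qed simp
  qed
  from choice[OF this] obtain T where T: "\<forall>v. v \<in> V \<longrightarrow> (\<exists>g. (\<forall>i\<in>V. g i \<in> poly_fun V) \<and> (\<forall>x. x v ^ T v = (\<Sum>i\<in>V. g i x * F i x)))" ..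
  show ?thesis
  proof (rule exI[of _ "sum T V"], rule ballI)
    fix v assume v: "v \<in> V"
    have le: "T v \<le> sum T V" by (rule member_le_sum[OF v]) (use finV in auto)
    from T v obtain g where g: "\<forall>i\<in>V. g i \<in> poly_fun V" "\<forall>x. x v ^ T v = (\<Sum>i\<in>V. g i x * F i x)" by blast
    have "x v ^ sum T V = (\<Sum>i\<in>V. (x v ^ (sum T V - T v) * g i x) * F i x)" for x
    proof -
      have "x v ^ sum T V = x v ^ (sum T V - T v) * x v ^ T v" using le by (simp flip: power_add)
      also have "\<dots> = (\<Sum>i\<in>V. (x v ^ (sum T V - T v) * g i x) * F i x)"
        unfolding g(2)[rule_format] by (simp add: sum_distrib_left mult.assoc)
      finally show ?thesis .
    qed
    moreover have "\<forall>i\<in>V. (\<lambda>x. x v ^ (sum T V - T v) * g i x) \<in> poly_fun V"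
      using g(1) by (auto intro!: poly_fun_mult poly_fun_power poly_fun_var v)
    ultimately show "\<exists>g. (\<forall>i\<in>V. g i \<in> poly_fun V) \<and> (\<forall>x. x v ^ sum T V = (\<Sum>i\<in>V. g i x * F i x))"
      by (intro exI[of _ "\<lambda>i x. x v ^ (sum T V - T v) * g i x"]) simp
  qed
qed

text \<open>Pigeonhole: in a monomial of degree above \<open>card V * T\<close> some variable has
  exponent at least \<open>T\<close>.\<close>

lemma high_degree_in_ideal:
  "\<exists>T. \<forall>t\<ge>T. \<forall>h. hom_fun V t h \<longrightarrow> (\<exists>g. (\<forall>i\<in>V. g i \<in> poly_fun V) \<and> h = (\<lambda>x. \<Sum>i\<in>V. g i x * F i x))"
proof -
  obtain T where T: "\<forall>v\<in>V. \<exists>g. (\<forall>i\<in>V. g i \<in> poly_fun V) \<and> (\<forall>x. x v ^ T = (\<Sum>i\<in>V. g i x * F i x))"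
    using var_power_in_ideal ..
  define J where "J = {p. \<exists>g. (\<forall>i\<in>V. g i \<in> poly_fun V) \<and> p = (\<lambda>x. \<Sum>i\<in>V. g i x * F i x)}"
  have J: "poly_fun_ideal V J" unfolding J_def by (rule poly_fun_ideal_generated) (rule hom_fun_poly_fun[OF F])
  have "p \<in> J" if "monomial_sum V t p" and t: "card V * T + 1 \<le> t" for p t
    using that(1)
  proof (induction rule: monomial_sum.induct)
    case monomial_sum_zero show ?case by (rule poly_fun_idealD(2)[OF J])
  next
    case (monomial_sum_add p e c)
    have "\<exists>v\<in>V. T \<le> e v"
    proof (rule ccontr)
      assume "\<not> ?thesis"
      then have "\<And>v. v \<in> V \<Longrightarrow> e v \<le> T" by force
      then have "sum e V \<le> of_nat (card V) * T" by (rule sum_bounded_above)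
      then show False using monomial_sum_add(2) t by simp
    qed
    then obtain v where v: "v \<in> V" "T \<le> e v" by blast
    from T v(1) obtain g where g: "\<forall>i\<in>V. g i \<in> poly_fun V" "\<forall>x. x v ^ T = (\<Sum>i\<in>V. g i x * F i x)" by blast
    have xv: "(\<lambda>x. x v ^ T) \<in> J" unfolding J_def using g by (intro CollectI exI[of _ g]) auto
    let ?q = "\<lambda>x. c * x v ^ (e v - T) * (\<Prod>u\<in>V - {v}. x u ^ e u)"
    have "?q \<in> poly_fun V" by (intro poly_fun_mult poly_fun_const poly_fun_power poly_fun_prod poly_fun_var) (use v in auto)
    from poly_fun_idealD(4)[OF J xv this] have q: "(\<lambda>x. ?q x * x v ^ T) \<in> J" .
    have "?q x * x v ^ T = c * (\<Prod>u\<in>V. x u ^ e u)" for x :: "nat \<Rightarrow> 'k"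
    proof -
      have "?q x * x v ^ T = c * (x v ^ (e v - T) * x v ^ T) * (\<Prod>u\<in>V - {v}. x u ^ e u)" by simp
      also have "x v ^ (e v - T) * x v ^ T = x v ^ e v" using v(2) by (simp flip: power_add)
      finally show ?thesis using v finV by (simp add: prod.remove mult.assoc)
    qed
    with q have "(\<lambda>x. c * (\<Prod>u\<in>V. x u ^ e u)) \<in> J" by (simp only:)
    from poly_fun_idealD(3)[OF J this monomial_sum_add(3)] show ?case .
  qed
  then have "h \<in> J" if "hom_fun V t h" "card V * T + 1 \<le> t" for t h using hom_fun_monomial_sum[OF finV that(1)] that(2) by blast
  then show ?thesis unfolding J_def by (intro exI[of _ "card V * T + 1"]) blast
qed

text \<open>In a representation of \<open>h\<close> by the \<open>F i\<close>, the parts of degree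
  \<open>t\<close> already agree, so each cofactor may be replaced by its component of degree
  \<open>t - D\<close>. The degree control of the module generators depends on this.\<close>

lemma high_degree_homogeneous:
  "\<exists>T\<ge>D. \<forall>t\<ge>T. \<forall>h. hom_fun V t h \<longrightarrow> (\<exists>g. (\<forall>i\<in>V. hom_fun V (t - D) (g i)) \<and> h = (\<lambda>x. \<Sum>i\<in>V. g i x * F i x))"
proof -
  obtain T where T: "\<forall>t\<ge>T. \<forall>h. hom_fun V t h \<longrightarrow> (\<exists>g. (\<forall>i\<in>V. g i \<in> poly_fun V) \<and> h = (\<lambda>x. \<Sum>i\<in>V. g i x * F i x))"
    using high_degree_in_ideal ..
  have "\<exists>g. (\<forall>i\<in>V. hom_fun V (t - D) (g i)) \<and> h = (\<lambda>x. \<Sum>i\<in>V. g i x * F i x)"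
    if t: "t \<ge> max D T" and h: "hom_fun V t h" for t h
  proof -
    obtain g where g: "\<forall>i\<in>V. g i \<in> poly_fun V" "h = (\<lambda>x. \<Sum>i\<in>V. g i x * F i x)" using T t h by force
    have "\<forall>i. \<exists>q. i \<in> V \<longrightarrow> (\<forall>j. hom_fun V j (q j)) \<and> (\<exists>N. (\<forall>x. g i x = (\<Sum>j\<le>N. q j x)) \<and> (\<forall>j x. N < j \<longrightarrow> q j x = 0))"
    proof
      fix i
      show "\<exists>q. i \<in> V \<longrightarrow> (\<forall>j. hom_fun V j (q j)) \<and> (\<exists>N. (\<forall>x. g i x = (\<Sum>j\<le>N. q j x)) \<and> (\<forall>j x. N < j \<longrightarrow> q j x = 0))"
      proof (cases "i \<in> V")
        case True
        then have "g i \<in> poly_fun V" using g(1) by blast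
        from poly_fun_homogeneous_components[OF this] True show ?thesis by simp
      qed simp
    qed
    from choice[OF this] obtain q where q: "\<forall>i. i \<in> V \<longrightarrow> (\<forall>j. hom_fun V j (q i j)) \<and> (\<exists>N. (\<forall>x. g i x = (\<Sum>j\<le>N. q i j x)) \<and> (\<forall>j x. N < j \<longrightarrow> q i j x = 0))" ..
    then have "\<forall>i. \<exists>N. i \<in> V \<longrightarrow> (\<forall>x. g i x = (\<Sum>j\<le>N. q i j x)) \<and> (\<forall>j x. N < j \<longrightarrow> q i j x = 0)" by blast
    from choice[OF this] obtain N where N: "\<forall>i. i \<in> V \<longrightarrow> (\<forall>x. g i x = (\<Sum>j\<le>N i. q i j x)) \<and> (\<forall>j x. N i < j \<longrightarrow> q i j x = 0)" ..
    define M where "M = sum N V + t"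
    have gM: "g i x = (\<Sum>j\<le>M. q i j x)" if i: "i \<in> V" for i x
    proof -
      have "N i \<le> M" unfolding M_def using member_le_sum[OF i, of N] finV by simp
      moreover have "g i x = (\<Sum>j\<le>N i. q i j x)" using N i by blast
      moreover have "(\<Sum>j\<le>N i. q i j x) = (\<Sum>j\<le>M. q i j x)"
        by (rule sum.mono_neutral_left) (use N i \<open>N i \<le> M\<close> in auto)
      ultimately show ?thesis by simp
    qed
    \<comment> \<open>\<open>b j\<close> is the component of degree \<open>j\<close> of the
      combination of the \<open>F i\<close>; there is none below \<open>D\<close>.\<close>
    define b where "b j x = (if j < D then 0 else \<Sum>i\<in>V. q i (j - D) x * F i x)" for j x
    have b: "hom_fun V j (b j)" for j
    proof (cases "j < D")
      case True then show ?thesis by (simp add: b_def[abs_def] hom_fun_zero)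
    next
      case False
      have "hom_fun V (j - D + D) (\<lambda>x. \<Sum>i\<in>V. q i (j - D) x * F i x)"
        by (rule hom_fun_sum, rule hom_fun_mult) (use q F in auto)
      then show ?thesis using False by (simp add: b_def[abs_def])
    qed
    define a where "a j x = (if j = t then h x else 0) - b j x" for j x
    have aHF: "hom_fun V j (a j)" for j
      using hom_fun_diff[OF h b[of t]] hom_fun_uminus[OF b[of j]] by (cases "j = t") (simp_all add: a_def[abs_def])
    have hb: "h x = (\<Sum>j\<le>M + D. b j x)" for x
    proof -
      have "h x = (\<Sum>i\<in>V. (\<Sum>j\<le>M. q i j x) * F i x)" unfolding g(2)
        by (rule sum.cong[OF refl]) (simp add: gM)
      also have "\<dots> = (\<Sum>j\<le>M. \<Sum>i\<in>V. q i j x * F i x)"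
        by (simp add: sum_distrib_right) (rule sum.swap)
      also have "\<dots> = (\<Sum>j\<in>{D..M + D}. \<Sum>i\<in>V. q i (j - D) x * F i x)"
        by (rule sum.reindex_bij_witness[of _ "\<lambda>j. j - D" "\<lambda>j. j + D"]) auto
      also have "\<dots> = (\<Sum>j\<in>{D..M + D}. b j x)" by (rule sum.cong) (auto simp: b_def)
      also have "\<dots> = (\<Sum>j\<le>M + D. b j x)"
        by (rule sum.mono_neutral_left) (auto simp: b_def)
      finally show ?thesis .
    qed
    have "a t x = 0" for x
    proof (rule hom_fun_components_unique[of V a "M + D" t x, OF aHF])
      show "(\<Sum>j\<le>M + D. a j x) = 0" for x
        unfolding a_def sum_subtractf hb[symmetric] by (simp add: M_def)
      show "t \<le> M + D" by (simp add: M_def)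
    qed
    then have "h = (\<lambda>x. \<Sum>i\<in>V. q i (t - D) x * F i x)"
      using t by (intro ext) (simp add: a_def b_def)
    then show ?thesis using q by (intro exI[of _ "\<lambda>i. q i (t - D)"]) blast
  qed
  then show ?thesis by (intro exI[of _ "max D T"]) simp
qed

definition Phi :: "(nat \<Rightarrow> 'k) \<Rightarrow> nat \<Rightarrow> 'k" where
  "Phi x i = F i x - x i"

lemma Phi_poly_fun: "i \<in> V \<Longrightarrow> (\<lambda>x. Phi x i) \<in> poly_fun V"
  unfolding Phi_def by (intro poly_fun_diff poly_fun_var hom_fun_poly_fun[OF F])

text \<open>Polynomials form a finite module over the subring generated by the components of
  \<open>Phi\<close>, with a gain in degree: a form of large degree is
  \<open>\<Sum> g i * F i = \<Sum> g i * Phi i + \<Sum> g i * x i\<close>. A factor from the subring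
  thus replaces \<open>D\<close> degrees, and the rest has smaller degree.\<close>

lemma degree_controlled_generation:
  "\<exists>(E :: (nat \<Rightarrow> nat) set) w. finite E \<and> (\<forall>e\<in>E. w e \<in> poly_fun V) \<and>
    (\<forall>t p. deg_le_fun V t p \<longrightarrow> (\<exists>\<beta>. (\<forall>e\<in>E. deg_le_fun V (t div D) (\<beta> e)) \<and> p = (\<lambda>x. \<Sum>e\<in>E. \<beta> e (Phi x) * w e x)))"
proof -
  obtain T where TD: "T \<ge> D" and T: "\<And>t h. t \<ge> T \<Longrightarrow> hom_fun V t h \<Longrightarrow> (\<exists>g. (\<forall>i\<in>V. hom_fun V (t - D) (g i)) \<and> h = (\<lambda>x. \<Sum>i\<in>V. g i x * F i x))"
    using high_degree_homogeneous by blast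
  define E where "E = exps V T"
  define w where "w e x = (\<Prod>v\<in>V. x v ^ e v)" for e :: "nat \<Rightarrow> nat" and x :: "nat \<Rightarrow> 'k"
  have E: "finite E" unfolding E_def by (rule finite_exps[OF finV])
  have w: "w e \<in> poly_fun V" for e unfolding w_def by (intro poly_fun_prod poly_fun_power poly_fun_var)
  have gen: "\<exists>\<beta>. (\<forall>e\<in>E. deg_le_fun V (t div D) (\<beta> e)) \<and> p = (\<lambda>x. \<Sum>e\<in>E. \<beta> e (Phi x) * w e x)" if "deg_le_fun V t p" for t p
    using that
  proof (induction t arbitrary: p rule: less_induct)
    case (less t)
    show ?case
    proof (cases "t \<le> T - 1")
      case True
      then have "t \<le> T" by simp
      from deg_le_fun_span[OF finV less.prems this] obtain c where c: "p = (\<lambda>x. \<Sum>e\<in>E. c e * w e x)" unfolding E_def w_def ..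
      have "deg_le_fun V (t div D) (\<lambda>x. c e)" for e by (rule deg_le_fun_mono[OF hom_fun_deg_le_fun[OF hom_fun_const]]) simp
      then show ?thesis using c by (intro exI[of _ "\<lambda>e x. c e"]) simp
    next
      case False
      then have t: "T \<le> t" "D \<le> t" "t \<ge> 2" using TD D by auto
      obtain q where q: "\<forall>j. hom_fun V j (q j)" "p = (\<lambda>x. \<Sum>j\<le>t. q j x)" using less.prems unfolding deg_le_fun_def by blast
      obtain g where g: "\<forall>i\<in>V. hom_fun V (t - D) (g i)" "q t = (\<lambda>x. \<Sum>i\<in>V. g i x * F i x)"
        using T[OF t(1) q(1)[rule_format]] by (elim exE conjE)
      \<comment> \<open>What remains after \<open>F i\<close> has been traded for
        \<open>Phi i\<close>. The second sum has degree at most \<open>t - D + 1\<close>, which is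
        below \<open>t\<close> because \<open>D \<ge> 2\<close>.\<close>
      define r where "r x = (\<Sum>j\<le>t - 1. q j x) + (\<Sum>i\<in>V. g i x * x i)" for x
      have "deg_le_fun V (t - 1) (\<lambda>x. \<Sum>j\<le>t - 1. q j x)" unfolding deg_le_fun_def using q(1) by blast
      moreover have "deg_le_fun V (t - 1) (\<lambda>x. \<Sum>i\<in>V. g i x * x i)"
      proof (rule deg_le_fun_sum)
        fix i assume i: "i \<in> V"
        have "hom_fun V (t - D + 1) (\<lambda>x. g i x * x i)" by (rule hom_fun_mult[OF _ hom_fun_var[OF i]]) (use g i in blast)
        then show "deg_le_fun V (t - 1) (\<lambda>x. g i x * x i)" by (rule deg_le_fun_mono[OF hom_fun_deg_le_fun]) (use D t in auto)
      qed
      ultimately have r: "deg_le_fun V (t - 1) r" unfolding r_def by (rule deg_le_fun_add)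
      obtain \<beta>0 where b0: "\<forall>e\<in>E. deg_le_fun V ((t - 1) div D) (\<beta>0 e)" "r = (\<lambda>x. \<Sum>e\<in>E. \<beta>0 e (Phi x) * w e x)"
        using less.IH[of "t - 1" r, OF _ r] t by auto
      have "\<forall>i. \<exists>\<beta>. i \<in> V \<longrightarrow> (\<forall>e\<in>E. deg_le_fun V ((t - D) div D) (\<beta> e)) \<and> g i = (\<lambda>x. \<Sum>e\<in>E. \<beta> e (Phi x) * w e x)"
      proof
        fix i
        show "\<exists>\<beta>. i \<in> V \<longrightarrow> (\<forall>e\<in>E. deg_le_fun V ((t - D) div D) (\<beta> e)) \<and> g i = (\<lambda>x. \<Sum>e\<in>E. \<beta> e (Phi x) * w e x)"
        proof (cases "i \<in> V")
          case True
          then have "deg_le_fun V (t - D) (g i)" using hom_fun_deg_le_fun g(1) by blast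
          moreover have "t - D < t" using D t by simp
          ultimately show ?thesis using less.IH[of "t - D" "g i"] by simp
        qed simp
      qed
      from choice[OF this] obtain \<beta> where b: "\<forall>i. i \<in> V \<longrightarrow> (\<forall>e\<in>E. deg_le_fun V ((t - D) div D) (\<beta> i e)) \<and> g i = (\<lambda>x. \<Sum>e\<in>E. \<beta> i e (Phi x) * w e x)" ..
      define \<gamma> where "\<gamma> e y = \<beta>0 e y + (\<Sum>i\<in>V. y i * \<beta> i e y)" for e y
      have "deg_le_fun V (t div D) (\<gamma> e)" if e: "e \<in> E" for e
        unfolding \<gamma>_def
      proof (rule deg_le_fun_add, rule deg_le_fun_mono)
        show "deg_le_fun V ((t - 1) div D) (\<beta>0 e)" using b0 e by blast
        show "(t - 1) div D \<le> t div D" by (rule div_le_mono) simp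
        show "deg_le_fun V (t div D) (\<lambda>y. \<Sum>i\<in>V. y i * \<beta> i e y)"
        proof (rule deg_le_fun_sum, rule deg_le_fun_mono)
          fix i assume i: "i \<in> V"
          show "deg_le_fun V (1 + (t - D) div D) (\<lambda>y. y i * \<beta> i e y)"
            by (rule deg_le_fun_mult[OF hom_fun_deg_le_fun[OF hom_fun_var[OF i]]]) (use b e i in blast)
          show "1 + (t - D) div D \<le> t div D" using t(2) D by (simp add: le_div_geq)
        qed
      qed
      moreover have "p x = (\<Sum>e\<in>E. \<gamma> e (Phi x) * w e x)" for x
      proof -
        have "{..t} = insert t {..t - 1}" using t by auto
        then have "p x = (\<Sum>i\<in>V. g i x * F i x) + (\<Sum>j\<le>t - 1. q j x)" unfolding q(2) using g(2) t by simp
        also have "\<dots> = (\<Sum>i\<in>V. Phi x i * g i x) + r x"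
          by (simp add: r_def Phi_def algebra_simps sum_subtractf flip: sum.distrib)
        also have "(\<Sum>i\<in>V. Phi x i * g i x) = (\<Sum>i\<in>V. \<Sum>e\<in>E. Phi x i * \<beta> i e (Phi x) * w e x)"
        proof (rule sum.cong[OF refl])
          fix i assume "i \<in> V"
          then have "g i x = (\<Sum>e\<in>E. \<beta> i e (Phi x) * w e x)" using b by (auto dest: fun_cong)
          then show "Phi x i * g i x = (\<Sum>e\<in>E. Phi x i * \<beta> i e (Phi x) * w e x)"
            by (simp add: sum_distrib_left mult.assoc)
        qed
        also have "\<dots> = (\<Sum>e\<in>E. (\<Sum>i\<in>V. Phi x i * \<beta> i e (Phi x)) * w e x)"
          by (subst sum.swap) (simp add: sum_distrib_right)
        finally show ?thesis unfolding b0(2) \<gamma>_def by (simp add: distrib_right sum.distrib)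
      qed
      ultimately show ?thesis by (intro exI[of _ \<gamma>]) auto
    qed
  qed
  show ?thesis by (intro exI[of _ E] exI[of _ w] conjI ballI allI impI E w gen)
qed

end

text \<open>Order at least \<open>a\<close> at the origin, tested on each line through it
  separately; no uniformity of \<open>P\<close> in \<open>x\<close> is asked for, which keeps the
  closure properties immediate.\<close>

definition vanish_order :: "'v set \<Rightarrow> nat \<Rightarrow> (('v \<Rightarrow> 'k::comm_ring_1) \<Rightarrow> 'k) \<Rightarrow> bool" where
  "vanish_order V a p \<longleftrightarrow> p \<in> poly_fun V \<and> (\<forall>x. \<exists>P. \<forall>t. p (\<lambda>v. t * x v) = t ^ a * poly P t)"

lemma vanish_order_0:
  fixes p :: "('v \<Rightarrow> 'k::comm_ring_1) \<Rightarrow> 'k"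
  assumes "p \<in> poly_fun V" shows "vanish_order V 0 p"
  unfolding vanish_order_def
proof (intro conjI allI assms)
  fix x :: "'v \<Rightarrow> 'k"
  have eq: "(\<lambda>v. t * x v) = (\<lambda>v. poly [:0, x v:] t)" for t by simp
  show "\<exists>P. \<forall>t. p (\<lambda>v. t * x v) = t ^ 0 * poly P t"
    unfolding eq using poly_fun_curve[OF assms, of "\<lambda>v. [:0, x v:]"] by simp
qed

lemma vanish_order_mult:
  fixes p :: "('v \<Rightarrow> 'k::comm_ring_1) \<Rightarrow> 'k"
  assumes "vanish_order V a p" "vanish_order V b q" shows "vanish_order V (a + b) (\<lambda>x. p x * q x)"
  unfolding vanish_order_def
proof (intro conjI allI)
  show "(\<lambda>x. p x * q x) \<in> poly_fun V" using assms unfolding vanish_order_def by (intro poly_fun_mult) auto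
  fix x :: "'v \<Rightarrow> 'k"
  obtain P Q where P: "\<forall>t. p (\<lambda>v. t * x v) = t ^ a * poly P t" and Q: "\<forall>t. q (\<lambda>v. t * x v) = t ^ b * poly Q t"
    using assms unfolding vanish_order_def by blast
  show "\<exists>R. \<forall>t. p (\<lambda>v. t * x v) * q (\<lambda>v. t * x v) = t ^ (a + b) * poly R t"
    using P Q by (intro exI[of _ "P * Q"]) (simp add: power_add algebra_simps)
qed

lemma vanish_order_zero: "vanish_order V a (\<lambda>x. 0)"
  unfolding vanish_order_def by (auto intro: poly_fun_const exI[of _ 0])

lemma vanish_order_add:
  fixes p :: "('v \<Rightarrow> 'k::comm_ring_1) \<Rightarrow> 'k"
  assumes "vanish_order V a p" "vanish_order V a q" shows "vanish_order V a (\<lambda>x. p x + q x)"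
  unfolding vanish_order_def
proof (intro conjI allI)
  show "(\<lambda>x. p x + q x) \<in> poly_fun V" using assms unfolding vanish_order_def by (intro poly_fun_add) auto
  fix x :: "'v \<Rightarrow> 'k"
  obtain P Q where P: "\<forall>t. p (\<lambda>v. t * x v) = t ^ a * poly P t" and Q: "\<forall>t. q (\<lambda>v. t * x v) = t ^ a * poly Q t"
    using assms unfolding vanish_order_def by blast
  show "\<exists>R. \<forall>t. p (\<lambda>v. t * x v) + q (\<lambda>v. t * x v) = t ^ a * poly R t"
    using P Q by (intro exI[of _ "P + Q"]) (simp add: algebra_simps)
qed

lemma vanish_order_sum: "(\<And>i. i \<in> I \<Longrightarrow> vanish_order V a (p i)) \<Longrightarrow> vanish_order V a (\<lambda>x. \<Sum>i\<in>I. p i x)"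
  by (induction I rule: infinite_finite_induct) (auto intro: vanish_order_zero vanish_order_add)

lemma vanish_order_var: "v \<in> V \<Longrightarrow> vanish_order V 1 (\<lambda>x. x v)"
  unfolding vanish_order_def by (auto intro!: poly_fun_var exI[of _ "[:x v:]" for x])

text \<open>On each line through the origin a polynomial of degree at most \<open>N\<close> is
  divisible by \<open>t^a\<close> with \<open>a > N\<close>, hence zero.\<close>

lemma vanish_order_deg_le_fun_zero:
  fixes p :: "('v \<Rightarrow> 'k::field_char_0) \<Rightarrow> 'k"
  assumes "vanish_order V a p" "deg_le_fun V N p" "N < a"
  shows "p x = 0"
proof -
  obtain q where q: "\<forall>j. hom_fun V j (q j)" "p = (\<lambda>x. \<Sum>j\<le>N. q j x)" using assms(2) unfolding deg_le_fun_def by blast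
  obtain P where P: "\<forall>t. p (\<lambda>v. t * x v) = t ^ a * poly P t" using assms(1) unfolding vanish_order_def by blast
  define R where "R = (\<Sum>j\<le>N. monom (q j x) j)"
  have pR: "p (\<lambda>v. t * x v) = poly R t" for t
    unfolding q(2) R_def poly_sum poly_monom by (rule sum.cong[OF refl]) (simp add: hom_fun_scale[OF q(1)[rule_format]])
  have "R - P * monom 1 a = 0"
    by (rule poly_eq_0_if_everywhere_0) (use P pR in \<open>simp add: poly_monom mult.commute\<close>)
  then have "R = P * monom 1 a" by simp
  moreover have "degree R < degree (monom (1::'k) a)"
  proof -
    have "degree R \<le> N" unfolding R_def
      by (rule degree_sum_le) (auto intro: order.trans[OF degree_monom_le])
    then show ?thesis using assms(3) by (simp add: degree_monom_eq)
  qed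
  ultimately have "R = 0" by (rule poly_mult_small_degree)
  then show ?thesis using pR[of 1] by simp
qed

section \<open>The subring generated by \<open>Phi\<close> and the degree bound\<close>

context form_system
begin

text \<open>The linear part of \<open>Phi\<close> at the origin is \<open>-id\<close>. Along
  \<open>t * u\<close> with \<open>u = -z\<close>, the map \<open>Phi\<close> is \<open>t\<close>
  times a curve that starts at \<open>z\<close>. So the coefficient of the lowest power of
  \<open>t\<close> in \<open>b (Phi (t * u))\<close> is the lowest form of \<open>b\<close> at
  \<open>z\<close>, which is nonzero.\<close>

lemma Phi_algebraically_independent:
  assumes b: "b \<in> poly_fun V" and zero: "\<And>x. b (Phi x) = 0"
  shows "b x = 0"
proof (rule ccontr)
  assume bx: "b x \<noteq> 0"
  obtain q where q0: "(\<forall>j. hom_fun V j (q j)) \<and> (\<exists>N. (\<forall>x. b x = (\<Sum>j\<le>N. q j x)) \<and> (\<forall>j x. N < j \<longrightarrow> q j x = 0))"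
    using poly_fun_homogeneous_components[OF b] ..
  then obtain N where q: "\<And>j. hom_fun V j (q j)" and N: "\<And>x. b x = (\<Sum>j\<le>N. q j x)" by blast
  have ex: "\<exists>j. j \<le> N \<and> (\<exists>x. q j x \<noteq> 0)"
  proof (rule ccontr)
    assume "\<not> ?thesis"
    then have "\<forall>j\<le>N. q j x = 0" by simp
    then show False using bx N[of x] by simp
  qed
  define m where "m = (LEAST j. j \<le> N \<and> (\<exists>x. q j x \<noteq> 0))"
  have "m \<le> N \<and> (\<exists>x. q m x \<noteq> 0)" unfolding m_def by (rule LeastI_ex[OF ex])
  then obtain z where m: "m \<le> N" and z: "q m z \<noteq> 0" by auto
  have lo: "q j x = 0" if "j < m" for j x
    using not_less_Least[of j "\<lambda>j. j \<le> N \<and> (\<exists>x. q j x \<noteq> 0)"] that m unfolding m_def by auto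
  define u where "u v = - z v" for v
  define c where "c v = [: - u v :] + monom (F v u) (D - 1)" for v
  have Ph: "Phi (\<lambda>v. t * u v) i = t * poly (c i) t" if "i \<in> V" for t i
  proof -
    have "t ^ D = t * t ^ (D - 1)" using D by (simp flip: power_Suc)
    then show ?thesis using hom_fun_scale[OF F[OF that], of t u]
      by (simp add: Phi_def c_def poly_monom algebra_simps)
  qed
  have "\<forall>j. \<exists>Q. \<forall>t. q j (\<lambda>v. poly (c v) t) = poly Q t" using poly_fun_curve[OF hom_fun_poly_fun[OF q]] by blast
  from choice[OF this] obtain Q where Q: "\<forall>j t. q j (\<lambda>v. poly (c v) t) = poly (Q j) t" ..
  define R where "R = (\<Sum>j\<in>{m..N}. monom 1 (j - m) * Q j)"
  have "poly (monom 1 m * R) t = 0" for t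
  proof -
    have Q0: "poly (Q j) t = 0" if "j < m" for j using lo[OF that, of "\<lambda>v. poly (c v) t"] Q by simp
    have "0 = b (Phi (\<lambda>v. t * u v))" using zero by simp
    also have "\<dots> = b (\<lambda>v. t * poly (c v) t)" by (rule poly_fun_cong[OF b]) (rule Ph)
    also have "\<dots> = (\<Sum>j\<le>N. t ^ j * poly (Q j) t)"
      unfolding N by (rule sum.cong[OF refl]) (simp add: hom_fun_scale[OF q] Q)
    also have "\<dots> = (\<Sum>j\<in>{m..N}. t ^ j * poly (Q j) t)"
    proof (rule sum.mono_neutral_right)
      show "\<forall>j\<in>{..N} - {m..N}. t ^ j * poly (Q j) t = 0" using Q0 by auto
    qed auto
    also have "\<dots> = poly (monom 1 m * R) t"
      unfolding R_def sum_distrib_left poly_sum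
      by (rule sum.cong[OF refl]) (simp add: poly_monom mult.assoc[symmetric] flip: power_add)
    finally show ?thesis by simp
  qed
  then have "monom 1 m * R = 0" by (rule poly_eq_0_if_everywhere_0)
  then have "R = 0" by simp
  moreover have "poly R 0 = q m z"
  proof -
    have "poly R 0 = (\<Sum>j\<in>{m..N}. if j = m then poly (Q m) 0 else 0)"
      unfolding R_def poly_sum by (rule sum.cong[OF refl]) (auto simp: poly_monom)
    also have "\<dots> = poly (Q m) 0" using m by simp
    also have "\<dots> = q m (\<lambda>v. poly (c v) 0)" using Q by simp
    also have "\<dots> = q m z"
      by (rule poly_fun_cong[OF hom_fun_poly_fun[OF q]]) (use D in \<open>simp add: c_def u_def poly_monom\<close>)
    finally show ?thesis .
  qed
  ultimately show False using z by simp
qed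

lemma poly_fun_Phi_compose: "b \<in> poly_fun V \<Longrightarrow> (\<lambda>x. b (Phi x)) \<in> poly_fun V"
  using poly_fun_compose[of b V "\<lambda>v x. Phi x v" V] Phi_poly_fun by simp

text \<open>
  The generators \<open>w\<close> need not be independent over the subring generated by the components of \<open>Phi\<close>, but after
  multiplication by a nonzero element \<open>b\<close> of the subring they are combinations of independent ones. This makes
  coefficients unique.
\<close>

lemma independent_generators:
  fixes E :: "'e set" and w :: "'e \<Rightarrow> (nat \<Rightarrow> 'k) \<Rightarrow> 'k"
  assumes E: "finite E" and w: "\<And>e. e \<in> E \<Longrightarrow> w e \<in> poly_fun V"
  obtains U b c where "U \<subseteq> E" "b \<in> poly_fun V" "\<exists>x. b x \<noteq> 0" "\<forall>e u. c e u \<in> poly_fun V"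
    "\<forall>e\<in>E. \<forall>x. b (Phi x) * w e x = (\<Sum>u\<in>U. c e u (Phi x) * w u x)"
    "\<forall>d. (\<forall>u\<in>U. d u \<in> poly_fun V) \<longrightarrow> (\<forall>x. (\<Sum>u\<in>U. d u (Phi x) * w u x) = 0) \<longrightarrow> (\<forall>u\<in>U. \<forall>x. d u x = 0)"
proof -
  define indep where "indep U \<longleftrightarrow> U \<subseteq> E \<and> (\<forall>d. (\<forall>u\<in>U. d u \<in> poly_fun V) \<longrightarrow>
    (\<forall>x. (\<Sum>u\<in>U. d u (Phi x) * w u x) = 0) \<longrightarrow> (\<forall>u\<in>U. \<forall>x. d u x = 0))" for U
  have finI: "finite {U. indep U}" by (rule finite_subset[of _ "Pow E"]) (auto simp: indep_def E)
  have "{} \<in> {U. indep U}" by (simp add: indep_def)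
  then have "{U. indep U} \<noteq> {}" by blast
  with finI obtain U where U': "U \<in> {U. indep U}" "Max (card ` {U. indep U}) = card U"
    by (rule obtains_MAX[where f=card])
  have U: "indep U" using U'(1) by simp
  have max: "card W \<le> card U" if "indep W" for W
    unfolding U'(2)[symmetric] by (rule Max_ge) (use finI that in auto)
  have UE: "U \<subseteq> E" and finU: "finite U" using U E finite_subset unfolding indep_def by auto
  have "\<forall>e. \<exists>bc. e \<in> E \<longrightarrow> fst bc \<in> poly_fun V \<and> (\<exists>x. fst bc x \<noteq> 0) \<and> (\<forall>u. snd bc u \<in> poly_fun V) \<and>
      (\<forall>x. fst bc (Phi x) * w e x = (\<Sum>u\<in>U. snd bc u (Phi x) * w u x))"
  proof
    fix e
    show "\<exists>bc. e \<in> E \<longrightarrow> fst bc \<in> poly_fun V \<and> (\<exists>x. fst bc x \<noteq> 0) \<and> (\<forall>u. snd bc u \<in> poly_fun V) \<and>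
      (\<forall>x. fst bc (Phi x) * w e x = (\<Sum>u\<in>U. snd bc u (Phi x) * w u x))"
    proof (cases "e \<in> U")
      case True
      let ?c = "\<lambda>u x. if u = e then 1 else 0"
      have "(\<Sum>u\<in>U. ?c u (Phi x) * w u x) = w e x" for x
      proof -
        have "(\<Sum>u\<in>U. ?c u (Phi x) * w u x) = (\<Sum>u\<in>U. if u = e then w u x else 0)" by (rule sum.cong) auto
        then show ?thesis using True finU by simp
      qed
      then show ?thesis by (intro exI[of _ "(\<lambda>x. 1, ?c)"]) (simp add: poly_fun_const)
    next
      case False
      show ?thesis
      proof (cases "e \<in> E")
        case True
        have "\<not> indep (insert e U)" using max[of "insert e U"] False finU by auto
        then obtain d where d: "\<forall>u\<in>insert e U. d u \<in> poly_fun V"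
          "\<forall>x. (\<Sum>u\<in>insert e U. d u (Phi x) * w u x) = 0" "\<not> (\<forall>u\<in>insert e U. \<forall>x. d u x = 0)"
          unfolding indep_def using True UE by auto
        have "\<exists>x. d e x \<noteq> 0"
        proof (rule ccontr)
          assume "\<not> ?thesis"
          then have de: "d e x = 0" for x by simp
          then have "\<forall>x. (\<Sum>u\<in>U. d u (Phi x) * w u x) = 0" using d(2) False finU by simp
          then have "\<forall>u\<in>U. \<forall>x. d u x = 0" using U d(1) unfolding indep_def by auto
          then show False using d(3) de by auto
        qed
        moreover have "d e (Phi x) * w e x = (\<Sum>u\<in>U. (if u \<in> U then - d u (Phi x) else 0) * w u x)" for x
        proof -
          have "d e (Phi x) * w e x = - (\<Sum>u\<in>U. d u (Phi x) * w u x)"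
            using d(2)[rule_format, of x] False finU by (simp add: add_eq_0_iff2)
          also have "\<dots> = (\<Sum>u\<in>U. (if u \<in> U then - d u (Phi x) else 0) * w u x)"
            unfolding sum_negf[symmetric] by (rule sum.cong) auto
          finally show ?thesis .
        qed
        moreover have "(\<lambda>x. if u \<in> U then - d u x else 0) \<in> poly_fun V" for u
          using d(1) by (cases "u \<in> U") (auto intro: poly_fun_uminus poly_fun_const)
        ultimately show ?thesis using d(1)
          by (intro exI[of _ "(d e, \<lambda>u x. if u \<in> U then - d u x else 0)"]) simp
      qed simp
    qed
  qed
  from choice[OF this] obtain bc where bc: "\<forall>e. e \<in> E \<longrightarrow> fst (bc e) \<in> poly_fun V \<and> (\<exists>x. fst (bc e) x \<noteq> 0) \<and> (\<forall>u. snd (bc e) u \<in> poly_fun V) \<and>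
      (\<forall>x. fst (bc e) (Phi x) * w e x = (\<Sum>u\<in>U. snd (bc e) u (Phi x) * w u x))" ..
  \<comment> \<open>The product of the individual denominators; each \<open>c e u\<close> receives
    the complementary product.\<close>
  define b where "b y = (\<Prod>e\<in>E. fst (bc e) y)" for y
  define c where "c e u y = (if e \<in> E then (\<Prod>e'\<in>E - {e}. fst (bc e') y) * snd (bc e) u y else 0)" for e u y
  have bPF: "b \<in> poly_fun V" unfolding b_def by (rule poly_fun_prod) (use bc in blast)
  have "\<exists>x. \<forall>e\<in>E. fst (bc e) x \<noteq> 0" by (rule poly_fun_prod_nonzero[OF E, of _ V]) (use bc in blast)+
  then have bnz: "\<exists>x. b x \<noteq> 0" unfolding b_def using E by (auto simp: prod_zero_iff)
  have cPF: "\<forall>e u. c e u \<in> poly_fun V"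
  proof (intro allI)
    fix e u
    show "c e u \<in> poly_fun V"
    proof (cases "e \<in> E")
      case True
      have "(\<lambda>y. (\<Prod>e'\<in>E - {e}. fst (bc e') y) * snd (bc e) u y) \<in> poly_fun V"
        by (rule poly_fun_mult, rule poly_fun_prod) (use bc True in blast)+
      then show ?thesis using True by (simp add: c_def[abs_def])
    qed (simp add: c_def[abs_def] poly_fun_const)
  qed
  have eq: "\<forall>e\<in>E. \<forall>x. b (Phi x) * w e x = (\<Sum>u\<in>U. c e u (Phi x) * w u x)"
  proof (intro ballI allI)
    fix e x assume e: "e \<in> E"
    have "b (Phi x) * w e x = (\<Prod>e'\<in>E - {e}. fst (bc e') (Phi x)) * (fst (bc e) (Phi x) * w e x)"
      unfolding b_def by (subst prod.remove[OF E e]) simp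
    also have "fst (bc e) (Phi x) * w e x = (\<Sum>u\<in>U. snd (bc e) u (Phi x) * w u x)" using bc e by blast
    finally show "b (Phi x) * w e x = (\<Sum>u\<in>U. c e u (Phi x) * w u x)"
      using e by (simp add: c_def sum_distrib_left mult.assoc)
  qed
  show ?thesis by (rule that[OF UE bPF bnz cPF eq]) (use U in \<open>simp add: indep_def\<close>)
qed

text \<open>Two estimates for \<open>G^a\<close> collide. Lying in the \<open>a\<close>-th power of
  the ideal, it has coefficients that vanish to order \<open>a\<close> at the origin; having degree
  at most \<open>a * g\<close>, it also has coefficients of degree at most
  \<open>a * g div D\<close>. After multiplication by \<open>b (Phi x)\<close> the expansion in the
  independent generators is unique, so one family of coefficients obeys both estimates, up to a
  constant \<open>K\<close>, and must be zero.\<close>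

lemma low_degree_not_in_ideal:
  assumes G: "deg_le_fun V g G" and g: "g < D" and r: "\<And>i. i \<in> V \<Longrightarrow> r i \<in> poly_fun V"
    and Gr: "\<And>x. G x = (\<Sum>i\<in>V. r i x * Phi x i)"
  shows "G x = 0"
proof (rule ccontr)
  assume Gx: "G x \<noteq> 0"
  obtain E :: "(nat \<Rightarrow> nat) set" and w where E: "finite E" and w: "\<forall>e\<in>E. w e \<in> poly_fun V" and
    gen: "\<forall>t p. deg_le_fun V t p \<longrightarrow> (\<exists>\<beta>. (\<forall>e\<in>E. deg_le_fun V (t div D) (\<beta> e)) \<and> p = (\<lambda>x. \<Sum>e\<in>E. \<beta> e (Phi x) * w e x))"
    using degree_controlled_generation by (elim exE conjE)
  obtain U b c where U: "U \<subseteq> E" and b: "b \<in> poly_fun V" "\<exists>x. b x \<noteq> 0" and c: "\<forall>e u. c e u \<in> poly_fun V"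
    and bw: "\<forall>e\<in>E. \<forall>x. b (Phi x) * w e x = (\<Sum>u\<in>U. c e u (Phi x) * w u x)"
    and ind: "\<forall>d. (\<forall>u\<in>U. d u \<in> poly_fun V) \<longrightarrow> (\<forall>x. (\<Sum>u\<in>U. d u (Phi x) * w u x) = 0) \<longrightarrow> (\<forall>u\<in>U. \<forall>x. d u x = 0)"
    by (rule independent_generators[of E w]) (use E w in auto)
  have "\<forall>e. \<exists>C. \<forall>u\<in>U. deg_le_fun V C (c e u)"
  proof
    fix e
    have "\<forall>u. \<exists>C. deg_le_fun V C (c e u)" using poly_fun_deg_le_fun c by blast
    from choice[OF this] obtain C where C: "\<forall>u. deg_le_fun V (C u) (c e u)" ..
    have "C u \<le> sum C U" if "u \<in> U" for u
      by (rule member_le_sum[OF that]) (use finite_subset[OF U E] in auto)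
    then have "\<forall>u\<in>U. deg_le_fun V (sum C U) (c e u)" using C deg_le_fun_mono by blast
    then show "\<exists>C. \<forall>u\<in>U. deg_le_fun V C (c e u)" ..
  qed
  from choice[OF this] obtain C where C: "\<forall>e. \<forall>u\<in>U. deg_le_fun V (C e) (c e u)" ..
  \<comment> \<open>Passing to independent generators raises degrees by at most \<open>K\<close>,
    which does not depend on the exponent \<open>a\<close> chosen later.\<close>
  define K where "K = sum C E"
  have K: "deg_le_fun V K (c e u)" if "e \<in> E" "u \<in> U" for e u
    by (rule deg_le_fun_mono[of V "C e"]) (use C that E in \<open>auto simp: K_def intro: member_le_sum\<close>)
  \<comment> \<open>The \<open>a\<close>-th power of the ideal, seen through coefficients. Only the
    existence of one expansion with the required order is asked for, since expansions in the
    \<open>w e\<close> are not unique.\<close>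
  define S where "S a = {p. \<exists>\<beta>. (\<forall>e\<in>E. vanish_order V a (\<beta> e)) \<and> p = (\<lambda>x. \<Sum>e\<in>E. \<beta> e (Phi x) * w e x)}" for a
  have S0: "p \<in> S 0" if p: "p \<in> poly_fun V" for p
  proof -
    obtain t where "deg_le_fun V t p" using poly_fun_deg_le_fun[OF p] ..
    with gen obtain \<beta> where "(\<forall>e\<in>E. deg_le_fun V (t div D) (\<beta> e)) \<and> p = (\<lambda>x. \<Sum>e\<in>E. \<beta> e (Phi x) * w e x)" by blast
    then show ?thesis unfolding S_def using vanish_order_0 deg_le_fun_poly_fun by blast
  qed
  have Smult: "(\<lambda>x. s x * p x) \<in> S a" if p: "p \<in> S a" and s: "s \<in> poly_fun V" for s p a
  proof -
    obtain \<beta> where \<beta>: "\<forall>e\<in>E. vanish_order V a (\<beta> e)" "p = (\<lambda>x. \<Sum>e\<in>E. \<beta> e (Phi x) * w e x)"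
      using p unfolding S_def by blast
    have "\<forall>e. \<exists>\<gamma>. e \<in> E \<longrightarrow> (\<forall>e'\<in>E. vanish_order V 0 (\<gamma> e')) \<and> (\<lambda>x. s x * w e x) = (\<lambda>x. \<Sum>e'\<in>E. \<gamma> e' (Phi x) * w e' x)"
    proof
      fix e
      show "\<exists>\<gamma>. e \<in> E \<longrightarrow> (\<forall>e'\<in>E. vanish_order V 0 (\<gamma> e')) \<and> (\<lambda>x. s x * w e x) = (\<lambda>x. \<Sum>e'\<in>E. \<gamma> e' (Phi x) * w e' x)"
      proof (cases "e \<in> E")
        case True
        then have "w e \<in> poly_fun V" using w by blast
        from S0[OF poly_fun_mult[OF s this]] True show ?thesis unfolding S_def by simp
      qed simp
    qed
    from choice[OF this] obtain \<gamma> where \<gamma>: "\<forall>e. e \<in> E \<longrightarrow> (\<forall>e'\<in>E. vanish_order V 0 (\<gamma> e e')) \<and> (\<lambda>x. s x * w e x) = (\<lambda>x. \<Sum>e'\<in>E. \<gamma> e e' (Phi x) * w e' x)" ..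
    define \<delta> where "\<delta> e' y = (\<Sum>e\<in>E. \<beta> e y * \<gamma> e e' y)" for e' y
    have "vanish_order V a (\<delta> e')" if "e' \<in> E" for e'
      unfolding \<delta>_def
    proof (rule vanish_order_sum)
      fix e assume "e \<in> E"
      then have "vanish_order V (a + 0) (\<lambda>y. \<beta> e y * \<gamma> e e' y)" by (intro vanish_order_mult) (use \<beta> \<gamma> that in blast)+
      then show "vanish_order V a (\<lambda>y. \<beta> e y * \<gamma> e e' y)" by simp
    qed
    moreover have "s x * p x = (\<Sum>e'\<in>E. \<delta> e' (Phi x) * w e' x)" for x
    proof -
      have "s x * p x = (\<Sum>e\<in>E. \<beta> e (Phi x) * (s x * w e x))"
        unfolding \<beta>(2) by (simp add: sum_distrib_left mult.left_commute)
      also have "\<dots> = (\<Sum>e\<in>E. \<Sum>e'\<in>E. \<beta> e (Phi x) * \<gamma> e e' (Phi x) * w e' x)"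
      proof (rule sum.cong[OF refl])
        fix e assume "e \<in> E"
        then have "s x * w e x = (\<Sum>e'\<in>E. \<gamma> e e' (Phi x) * w e' x)" using \<gamma> by (auto dest: fun_cong)
        then show "\<beta> e (Phi x) * (s x * w e x) = (\<Sum>e'\<in>E. \<beta> e (Phi x) * \<gamma> e e' (Phi x) * w e' x)"
          by (simp add: sum_distrib_left mult.assoc)
      qed
      also have "\<dots> = (\<Sum>e'\<in>E. \<delta> e' (Phi x) * w e' x)"
        by (subst sum.swap) (simp add: \<delta>_def sum_distrib_right)
      finally show ?thesis .
    qed
    ultimately show ?thesis unfolding S_def by (intro CollectI exI[of _ \<delta>]) auto
  qed
  have SPhi: "(\<lambda>x. \<Sum>i\<in>V. Phi x i * p i x) \<in> S (Suc a)" if p: "\<And>i. i \<in> V \<Longrightarrow> p i \<in> S a" for p a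
  proof -
    have "\<forall>i. \<exists>\<beta>. i \<in> V \<longrightarrow> (\<forall>e\<in>E. vanish_order V a (\<beta> e)) \<and> p i = (\<lambda>x. \<Sum>e\<in>E. \<beta> e (Phi x) * w e x)"
    proof
      fix i
      show "\<exists>\<beta>. i \<in> V \<longrightarrow> (\<forall>e\<in>E. vanish_order V a (\<beta> e)) \<and> p i = (\<lambda>x. \<Sum>e\<in>E. \<beta> e (Phi x) * w e x)"
        using p[of i] unfolding S_def by (cases "i \<in> V") simp_all
    qed
    from choice[OF this] obtain \<beta> where \<beta>: "\<forall>i. i \<in> V \<longrightarrow> (\<forall>e\<in>E. vanish_order V a (\<beta> i e)) \<and> p i = (\<lambda>x. \<Sum>e\<in>E. \<beta> i e (Phi x) * w e x)" ..
    define \<delta> where "\<delta> e y = (\<Sum>i\<in>V. y i * \<beta> i e y)" for e y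
    have "vanish_order V (Suc a) (\<delta> e)" if "e \<in> E" for e
      unfolding \<delta>_def
    proof (rule vanish_order_sum)
      fix i assume i: "i \<in> V"
      have "vanish_order V (1 + a) (\<lambda>y. y i * \<beta> i e y)" by (rule vanish_order_mult[OF vanish_order_var[OF i]]) (use \<beta> i that in blast)
      then show "vanish_order V (Suc a) (\<lambda>y. y i * \<beta> i e y)" by simp
    qed
    moreover have "(\<Sum>i\<in>V. Phi x i * p i x) = (\<Sum>e\<in>E. \<delta> e (Phi x) * w e x)" for x
    proof -
      have "(\<Sum>i\<in>V. Phi x i * p i x) = (\<Sum>i\<in>V. \<Sum>e\<in>E. Phi x i * \<beta> i e (Phi x) * w e x)"
      proof (rule sum.cong[OF refl])
        fix i assume "i \<in> V"
        then have "p i x = (\<Sum>e\<in>E. \<beta> i e (Phi x) * w e x)" using \<beta> by (auto dest: fun_cong)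
        then show "Phi x i * p i x = (\<Sum>e\<in>E. Phi x i * \<beta> i e (Phi x) * w e x)"
          by (simp add: sum_distrib_left mult.assoc)
      qed
      also have "\<dots> = (\<Sum>e\<in>E. \<delta> e (Phi x) * w e x)"
        by (subst sum.swap) (simp add: \<delta>_def sum_distrib_right)
      finally show ?thesis .
    qed
    ultimately show ?thesis unfolding S_def by (intro CollectI exI[of _ \<delta>]) auto
  qed
  have Gpow: "(\<lambda>x. G x ^ a) \<in> S a" for a
  proof (induction a)
    case 0 show ?case using S0[OF poly_fun_const[of 1]] by simp
  next
    case (Suc a)
    have "(\<lambda>x. \<Sum>i\<in>V. Phi x i * (r i x * G x ^ a)) \<in> S (Suc a)"
      by (rule SPhi, rule Smult[OF Suc.IH]) (rule r)
    moreover have "(\<lambda>x. \<Sum>i\<in>V. Phi x i * (r i x * G x ^ a)) = (\<lambda>x. G x ^ Suc a)"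
      by (rule ext) (simp add: Gr sum_distrib_left sum_distrib_right mult_ac)
    ultimately show ?case by simp
  qed
  \<comment> \<open>Chosen so that \<open>a * g div D + K < a\<close>: since
    \<open>g \<le> D - 1\<close>, the left side is at most \<open>(K + 1) * (D - 1) + K\<close>,
    which is \<open>a - 1\<close>.\<close>
  define a where "a = D * (K + 1)"
  obtain \<beta> where \<beta>: "\<forall>e\<in>E. vanish_order V a (\<beta> e)" "(\<lambda>x. G x ^ a) = (\<lambda>x. \<Sum>e\<in>E. \<beta> e (Phi x) * w e x)"
    using Gpow[of a] unfolding S_def by blast
  from gen deg_le_fun_power[OF G, of a] obtain \<gamma> where \<gamma>: "\<forall>e\<in>E. deg_le_fun V (a * g div D) (\<gamma> e)" "(\<lambda>x. G x ^ a) = (\<lambda>x. \<Sum>e\<in>E. \<gamma> e (Phi x) * w e x)"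
    by blast
  have bG: "b (Phi x) * G x ^ a = (\<Sum>u\<in>U. (\<Sum>e\<in>E. \<epsilon> e (Phi x) * c e u (Phi x)) * w u x)"
    if "(\<lambda>x. G x ^ a) = (\<lambda>x. \<Sum>e\<in>E. \<epsilon> e (Phi x) * w e x)" for \<epsilon> x
  proof -
    have "G x ^ a = (\<Sum>e\<in>E. \<epsilon> e (Phi x) * w e x)" using that by (rule fun_cong)
    then have "b (Phi x) * G x ^ a = (\<Sum>e\<in>E. \<epsilon> e (Phi x) * (b (Phi x) * w e x))"
      by (simp add: sum_distrib_left mult.left_commute)
    also have "\<dots> = (\<Sum>e\<in>E. \<Sum>u\<in>U. \<epsilon> e (Phi x) * c e u (Phi x) * w u x)"
      by (rule sum.cong[OF refl]) (simp add: bw sum_distrib_left mult.assoc)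
    also have "\<dots> = (\<Sum>u\<in>U. (\<Sum>e\<in>E. \<epsilon> e (Phi x) * c e u (Phi x)) * w u x)"
      by (subst sum.swap) (simp add: sum_distrib_right)
    finally show ?thesis .
  qed
  have DFu: "deg_le_fun V (a * g div D + K) (\<lambda>y. \<Sum>e\<in>E. \<gamma> e y * c e u y)" if "u \<in> U" for u
    by (rule deg_le_fun_sum, rule deg_le_fun_mult) (use \<gamma> K that in auto)
  have VOu: "vanish_order V a (\<lambda>y. \<Sum>e\<in>E. \<beta> e y * c e u y)" for u
  proof (rule vanish_order_sum)
    fix e assume "e \<in> E"
    then have "vanish_order V (a + 0) (\<lambda>y. \<beta> e y * c e u y)" by (intro vanish_order_mult vanish_order_0) (use \<beta> c in auto)
    then show "vanish_order V a (\<lambda>y. \<beta> e y * c e u y)" by simp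
  qed
  have lt: "a * g div D + K < a"
  proof -
    have "a * g = ((K + 1) * g) * D" by (simp only: a_def mult_ac)
    then have "a * g div D = (K + 1) * g" using D by simp
    moreover have "(K + 1) * g + (K + 1) \<le> (K + 1) * D" using mult_le_mono2[of "Suc g" D "K + 1"] g by simp
    ultimately show ?thesis by (simp add: a_def mult.commute)
  qed
  define d where "d u x = (\<Sum>e\<in>E. \<gamma> e x * c e u x) - (\<Sum>e\<in>E. \<beta> e x * c e u x)" for u x
  have "\<forall>u\<in>U. d u \<in> poly_fun V"
  proof
    fix u assume u: "u \<in> U"
    have "(\<lambda>y. \<Sum>e\<in>E. \<beta> e y * c e u y) \<in> poly_fun V" using VOu[of u] unfolding vanish_order_def by (rule conjunct1)
    from poly_fun_diff[OF deg_le_fun_poly_fun[OF DFu[OF u]] this] show "d u \<in> poly_fun V" unfolding d_def .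
  qed
  moreover have "\<forall>x. (\<Sum>u\<in>U. d u (Phi x) * w u x) = 0"
  proof
    fix x
    have "(\<Sum>u\<in>U. d u (Phi x) * w u x) = b (Phi x) * G x ^ a - b (Phi x) * G x ^ a"
      unfolding d_def left_diff_distrib sum_subtractf bG[OF \<gamma>(2), symmetric] bG[OF \<beta>(2), symmetric] ..
    then show "(\<Sum>u\<in>U. d u (Phi x) * w u x) = 0" by simp
  qed
  ultimately have "\<forall>u\<in>U. \<forall>x. d u x = 0" using spec[OF ind, of d] by iprover
  then have eq: "(\<lambda>y. \<Sum>e\<in>E. \<gamma> e y * c e u y) = (\<lambda>y. \<Sum>e\<in>E. \<beta> e y * c e u y)" if "u \<in> U" for u
    using that by (intro ext) (simp add: d_def)
  have "(\<Sum>e\<in>E. \<beta> e y * c e u y) = 0" if "u \<in> U" for u y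
    by (rule vanish_order_deg_le_fun_zero[OF VOu[of u] _ lt]) (use DFu[OF that] in \<open>simp only: eq[OF that]\<close>)
  then have "b (Phi x) * G x ^ a = 0" for x using bG[OF \<beta>(2)] by simp
  then have prod0: "G x ^ a * b (Phi x) = 0" for x by (simp add: mult.commute)
  have "b (Phi z) = 0" for z
    by (rule poly_fun_domain_eq[of "\<lambda>x. G x ^ a" V "\<lambda>x. b (Phi x)" x z, OF poly_fun_power[OF deg_le_fun_poly_fun[OF G]] poly_fun_Phi_compose[OF b(1)] prod0])
      (use Gx in simp)
  then show False using Phi_algebraically_independent[OF b(1)] b(2) by blast
qed

end

section \<open>Infinitely many periodic points\<close>

text \<open>The functions \<open>dp\<close> are the partial derivatives of \<open>p\<close>.\<close>

lemma poly_fun_hadamard: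
  fixes p :: "('v \<Rightarrow> 'k::comm_ring_1) \<Rightarrow> 'k"
  assumes V: "finite V" and p: "p \<in> poly_fun V"
  shows "\<exists>dp. \<forall>u w. (\<forall>i\<in>V. u i \<in> poly_fun V) \<longrightarrow> (\<forall>i\<in>V. w i \<in> poly_fun V) \<longrightarrow> (\<exists>a. (\<forall>i. a i \<in> poly_fun V) \<and>
     (\<forall>x. p (\<lambda>i. u i x) - p (\<lambda>i. w i x) = (\<Sum>i\<in>V. a i x * (u i x - w i x))) \<and>
     (\<forall>x z. (\<forall>i\<in>V. u i x = z i \<and> w i x = z i) \<longrightarrow> (\<forall>i\<in>V. a i x = dp i z)))"
  using p
proof (induction rule: poly_fun.induct)
  case (poly_fun_const c)
  show ?case by (rule exI[of _ "\<lambda>i z. 0"], intro allI impI, rule exI[of _ "\<lambda>i x. 0"]) (simp add: poly_fun.poly_fun_const)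
next
  case (poly_fun_add p q)
  obtain dp where dp: "\<forall>u w. (\<forall>i\<in>V. u i \<in> poly_fun V) \<longrightarrow> (\<forall>i\<in>V. w i \<in> poly_fun V) \<longrightarrow> (\<exists>a. (\<forall>i. a i \<in> poly_fun V) \<and>
     (\<forall>x. p (\<lambda>i. u i x) - p (\<lambda>i. w i x) = (\<Sum>i\<in>V. a i x * (u i x - w i x))) \<and>
     (\<forall>x z. (\<forall>i\<in>V. u i x = z i \<and> w i x = z i) \<longrightarrow> (\<forall>i\<in>V. a i x = dp i z)))" using poly_fun_add(3) ..
  obtain dq where dq: "\<forall>u w. (\<forall>i\<in>V. u i \<in> poly_fun V) \<longrightarrow> (\<forall>i\<in>V. w i \<in> poly_fun V) \<longrightarrow> (\<exists>a. (\<forall>i. a i \<in> poly_fun V) \<and>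
     (\<forall>x. q (\<lambda>i. u i x) - q (\<lambda>i. w i x) = (\<Sum>i\<in>V. a i x * (u i x - w i x))) \<and>
     (\<forall>x z. (\<forall>i\<in>V. u i x = z i \<and> w i x = z i) \<longrightarrow> (\<forall>i\<in>V. a i x = dq i z)))" using poly_fun_add(4) ..
  show ?case
  proof (rule exI[of _ "\<lambda>i z. dp i z + dq i z"], intro allI impI)
    fix u w :: "'v \<Rightarrow> ('v \<Rightarrow> 'k) \<Rightarrow> 'k" assume u: "\<forall>i\<in>V. u i \<in> poly_fun V" and w: "\<forall>i\<in>V. w i \<in> poly_fun V"
    from dp[rule_format, of u w, OF bspec[OF u] bspec[OF w]] obtain a where a: "(\<forall>i. a i \<in> poly_fun V) \<and>
     (\<forall>x. p (\<lambda>i. u i x) - p (\<lambda>i. w i x) = (\<Sum>i\<in>V. a i x * (u i x - w i x))) \<and>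
     (\<forall>x z. (\<forall>i\<in>V. u i x = z i \<and> w i x = z i) \<longrightarrow> (\<forall>i\<in>V. a i x = dp i z))" ..
    from dq[rule_format, of u w, OF bspec[OF u] bspec[OF w]] obtain b where b: "(\<forall>i. b i \<in> poly_fun V) \<and>
     (\<forall>x. q (\<lambda>i. u i x) - q (\<lambda>i. w i x) = (\<Sum>i\<in>V. b i x * (u i x - w i x))) \<and>
     (\<forall>x z. (\<forall>i\<in>V. u i x = z i \<and> w i x = z i) \<longrightarrow> (\<forall>i\<in>V. b i x = dq i z))" ..
    show "\<exists>a. (\<forall>i. a i \<in> poly_fun V) \<and>
     (\<forall>x. p (\<lambda>i. u i x) + q (\<lambda>i. u i x) - (p (\<lambda>i. w i x) + q (\<lambda>i. w i x)) = (\<Sum>i\<in>V. a i x * (u i x - w i x))) \<and>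
     (\<forall>x z. (\<forall>i\<in>V. u i x = z i \<and> w i x = z i) \<longrightarrow> (\<forall>i\<in>V. a i x = dp i z + dq i z))"
    proof (rule exI[of _ "\<lambda>i x. a i x + b i x"], intro conjI allI)
      fix i show "(\<lambda>x. a i x + b i x) \<in> poly_fun V" using a b by (intro poly_fun.poly_fun_add) auto
    next
      fix x
      have "p (\<lambda>i. u i x) - p (\<lambda>i. w i x) = (\<Sum>i\<in>V. a i x * (u i x - w i x))"
        "q (\<lambda>i. u i x) - q (\<lambda>i. w i x) = (\<Sum>i\<in>V. b i x * (u i x - w i x))" using a b by auto
      then show "p (\<lambda>i. u i x) + q (\<lambda>i. u i x) - (p (\<lambda>i. w i x) + q (\<lambda>i. w i x)) = (\<Sum>i\<in>V. (a i x + b i x) * (u i x - w i x))"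
        by (simp only: distrib_right sum.distrib add_diff_add)
    next
      fix x z
      show "(\<forall>i\<in>V. u i x = z i \<and> w i x = z i) \<longrightarrow> (\<forall>i\<in>V. a i x + b i x = dp i z + dq i z)"
      proof (intro impI ballI)
        fix i assume eq: "\<forall>i\<in>V. u i x = z i \<and> w i x = z i" and i: "i \<in> V"
        have "\<forall>i\<in>V. a i x = dp i z" "\<forall>i\<in>V. b i x = dq i z"
          using conjunct2[OF conjunct2[OF a]] conjunct2[OF conjunct2[OF b]] eq by blast+
        then show "a i x + b i x = dp i z + dq i z" using i by simp
      qed
    qed
  qed
next
  case (poly_fun_var_mult j p)
  obtain dp where dp: "\<forall>u w. (\<forall>i\<in>V. u i \<in> poly_fun V) \<longrightarrow> (\<forall>i\<in>V. w i \<in> poly_fun V) \<longrightarrow> (\<exists>a. (\<forall>i. a i \<in> poly_fun V) \<and>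
     (\<forall>x. p (\<lambda>i. u i x) - p (\<lambda>i. w i x) = (\<Sum>i\<in>V. a i x * (u i x - w i x))) \<and>
     (\<forall>x z. (\<forall>i\<in>V. u i x = z i \<and> w i x = z i) \<longrightarrow> (\<forall>i\<in>V. a i x = dp i z)))" using poly_fun_var_mult(3) ..
  show ?case
  \<comment> \<open>Product rule for \<open>x j * p\<close>: the term \<open>p\<close> is added in
    direction \<open>j\<close>.\<close>
  proof (rule exI[of _ "\<lambda>i z. z j * dp i z + (if i = j then p z else 0)"], intro allI impI)
    fix u w :: "'v \<Rightarrow> ('v \<Rightarrow> 'k) \<Rightarrow> 'k" assume u: "\<forall>i\<in>V. u i \<in> poly_fun V" and w: "\<forall>i\<in>V. w i \<in> poly_fun V"
    from dp[rule_format, of u w, OF bspec[OF u] bspec[OF w]] obtain a where a: "(\<forall>i. a i \<in> poly_fun V) \<and>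
     (\<forall>x. p (\<lambda>i. u i x) - p (\<lambda>i. w i x) = (\<Sum>i\<in>V. a i x * (u i x - w i x))) \<and>
     (\<forall>x z. (\<forall>i\<in>V. u i x = z i \<and> w i x = z i) \<longrightarrow> (\<forall>i\<in>V. a i x = dp i z))" ..
    let ?b = "\<lambda>i x. u j x * a i x + (if i = j then p (\<lambda>i. w i x) else 0)"
    show "\<exists>a. (\<forall>i. a i \<in> poly_fun V) \<and>
     (\<forall>x. u j x * p (\<lambda>i. u i x) - w j x * p (\<lambda>i. w i x) = (\<Sum>i\<in>V. a i x * (u i x - w i x))) \<and>
     (\<forall>x z. (\<forall>i\<in>V. u i x = z i \<and> w i x = z i) \<longrightarrow> (\<forall>i\<in>V. a i x = z j * dp i z + (if i = j then p z else 0)))"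
    proof (rule exI[of _ ?b], intro conjI allI)
      fix i
      have pw: "(\<lambda>x. p (\<lambda>i. w i x)) \<in> poly_fun V" by (rule poly_fun_compose[OF poly_fun_var_mult(2)]) (use w in blast)
      have "(\<lambda>x. u j x * a i x) \<in> poly_fun V" using u a poly_fun_var_mult(1) by (intro poly_fun_mult) auto
      from this poly_fun.poly_fun_add[OF this pw] show "?b i \<in> poly_fun V" by (cases "i = j") simp_all
    next
      fix x
      have "u j x * p (\<lambda>i. u i x) - w j x * p (\<lambda>i. w i x) =
        u j x * (p (\<lambda>i. u i x) - p (\<lambda>i. w i x)) + p (\<lambda>i. w i x) * (u j x - w j x)" by (simp add: algebra_simps)
      also have "p (\<lambda>i. u i x) - p (\<lambda>i. w i x) = (\<Sum>i\<in>V. a i x * (u i x - w i x))" using a by blast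
      also have "p (\<lambda>i. w i x) * (u j x - w j x) = (\<Sum>i\<in>V. if i = j then p (\<lambda>i. w i x) * (u i x - w i x) else 0)"
        using V poly_fun_var_mult(1) by simp
      also have "\<dots> = (\<Sum>i\<in>V. (if i = j then p (\<lambda>i. w i x) else 0) * (u i x - w i x))" by (rule sum.cong) auto
      finally show "u j x * p (\<lambda>i. u i x) - w j x * p (\<lambda>i. w i x) = (\<Sum>i\<in>V. ?b i x * (u i x - w i x))"
        by (simp add: sum_distrib_left distrib_right sum.distrib mult.assoc)
    next
      fix x z
      show "(\<forall>i\<in>V. u i x = z i \<and> w i x = z i) \<longrightarrow> (\<forall>i\<in>V. ?b i x = z j * dp i z + (if i = j then p z else 0))"
      proof (intro impI ballI)
        fix i assume eq: "\<forall>i\<in>V. u i x = z i \<and> w i x = z i" and i: "i \<in> V"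
        have "p (\<lambda>i. w i x) = p z" by (rule poly_fun_cong[OF poly_fun_var_mult(2)]) (use eq in auto)
        moreover have "\<forall>i\<in>V. a i x = dp i z" using conjunct2[OF conjunct2[OF a]] eq by blast
        ultimately show "?b i x = z j * dp i z + (if i = j then p z else 0)" using eq i poly_fun_var_mult(1) by simp
      qed
    qed
  qed
qed

section \<open>Eigenvalues and roots of unity\<close>

definition poly_act :: "(('a \<Rightarrow> 'k) \<Rightarrow> ('a \<Rightarrow> 'k)) \<Rightarrow> 'k::field poly \<Rightarrow> ('a \<Rightarrow> 'k) \<Rightarrow> 'a \<Rightarrow> 'k" where
  "poly_act L p v i = (\<Sum>l\<le>degree p. coeff p l * (L ^^ l) v i)"

lemma poly_act_bound:
  assumes "degree p \<le> B"
  shows "poly_act L p v i = (\<Sum>l\<le>B. coeff p l * (L ^^ l) v i)"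
  unfolding poly_act_def by (rule sum.mono_neutral_left) (use assms in \<open>auto simp: coeff_eq_0\<close>)

locale linear_op =
  fixes L :: "('a \<Rightarrow> 'k::field) \<Rightarrow> ('a \<Rightarrow> 'k)"
  assumes L_add: "L (\<lambda>i. u i + v i) = (\<lambda>i. L u i + L v i)" and L_scale: "L (\<lambda>i. c * v i) = (\<lambda>i. c * L v i)"
begin

lemma L_zero: "L (\<lambda>i. 0) = (\<lambda>i. 0)" using L_scale[of 0 "\<lambda>i. 0"] by simp

lemma L_sum: "L (\<lambda>i. \<Sum>l\<in>S. c l * u l i) = (\<lambda>i. \<Sum>l\<in>S. c l * L (u l) i)"
  by (induction S rule: infinite_finite_induct) (simp_all add: L_zero L_add L_scale)

lemma poly_act_linear_factor:
  "poly_act L ([:- z, 1:] * p) v i = L (poly_act L p v) i - z * poly_act L p v i"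
proof -
  let ?B = "Suc (degree p)"
  have deg: "degree ([:- z, 1:] * p) \<le> ?B"
    by (rule order.trans[OF degree_mult_le]) simp
  have c: "coeff ([:- z, 1:] * p) l = (case l of 0 \<Rightarrow> 0 | Suc k \<Rightarrow> coeff p k) - z * coeff p l" for l
    by (cases l) simp_all
  have "poly_act L ([:- z, 1:] * p) v i =
     (\<Sum>l\<le>?B. (case l of 0 \<Rightarrow> 0 | Suc k \<Rightarrow> coeff p k) * (L ^^ l) v i) - z * (\<Sum>l\<le>?B. coeff p l * (L ^^ l) v i)"
    unfolding poly_act_bound[OF deg] c by (simp add: left_diff_distrib sum_subtractf sum_distrib_left mult.assoc del: sum.atMost_Suc)
  also have "(\<Sum>l\<le>?B. coeff p l * (L ^^ l) v i) = poly_act L p v i" by (rule poly_act_bound[symmetric]) simp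
  also have "(\<Sum>l\<le>?B. (case l of 0 \<Rightarrow> 0 | Suc k \<Rightarrow> coeff p k) * (L ^^ l) v i) = (\<Sum>l\<le>degree p. coeff p l * L ((L ^^ l) v) i)"
    unfolding sum.atMost_Suc_shift by simp
  also have "\<dots> = L (poly_act L p v) i" unfolding poly_act_def[abs_def] L_sum by simp
  finally show ?thesis .
qed

text \<open>Linear factors are stripped from \<open>p\<close> until the remaining factor
  \<open>q\<close> no longer kills \<open>v\<close>. Then \<open>q(L) v\<close> is an eigenvector
  for the root removed last.\<close>

lemma eigenvalue_of_annihilating_poly:
  assumes ac: "alg_closed_field TYPE('k)"
    and "p \<noteq> 0" "v \<noteq> (\<lambda>i. 0)" "poly_act L p v = (\<lambda>i. 0)"
  shows "\<exists>z w. poly p z = 0 \<and> w \<noteq> (\<lambda>i. 0) \<and> L w = (\<lambda>i. z * w i)"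
  using assms(2-)
proof (induction "degree p" arbitrary: p)
  case 0
  then obtain c where c: "p = [:c:]" "c \<noteq> 0" by (metis degree_eq_zeroE pCons_eq_0_iff)
  have "c * v i = 0" for i using fun_cong[OF 0(4), of i] by (simp add: poly_act_def c)
  then have "v = (\<lambda>i. 0)" using c(2) by auto
  then show ?case using 0 by simp
next
  case (Suc d)
  then obtain z where z: "poly p z = 0" using ac unfolding alg_closed_field_def by (metis le_add1 plus_1_eq_Suc)
  then obtain q where q: "p = [:- z, 1:] * q" by (metis poly_eq_0_iff_dvd dvdE)
  have q0: "q \<noteq> 0" using q Suc.prems(1) by auto
  then have dq: "d = degree q" using Suc.hyps(2) unfolding q by (subst (asm) degree_mult_eq) auto
  show ?case
  proof (cases "poly_act L q v = (\<lambda>i. 0)")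
    case True
    then obtain z' w where "poly q z' = 0" "w \<noteq> (\<lambda>i. 0)" "L w = (\<lambda>i. z' * w i)"
      using Suc.hyps(1)[OF dq q0 Suc.prems(2)] by blast
    then show ?thesis unfolding q by (intro exI[of _ z'] exI[of _ w]) simp
  next
    case False
    have "L (poly_act L q v) i - z * poly_act L q v i = 0" for i
      using fun_cong[OF Suc.prems(3), of i] unfolding q poly_act_linear_factor .
    then have "L (poly_act L q v) = (\<lambda>i. z * poly_act L q v i)" by (intro ext) simp
    then show ?thesis using z False by blast
  qed
qed

end

lemma geometric_root_eq_1:
  fixes z :: "'k::field_char_0"
  assumes "prime p" "prime q" "p \<noteq> q" "z ^ p = 1" "z ^ q = 1"
  shows "z = 1"
proof -
  have "\<not> q dvd p" using assms(1-3) primes_dvd_imp_eq by blast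
  then obtain a b where ab: "p * a = Suc (q * b)" using bezout_prime[OF assms(2)] by blast
  have "z ^ (p * a) = 1" using assms(4) by (simp add: power_mult)
  moreover have "z ^ (q * b) = 1" using assms(5) by (simp add: power_mult)
  ultimately show ?thesis using ab by simp
qed

text \<open>If the geometric sum vanishes then \<open>z\<close> is a \<open>p\<close>-th root of
  unity, and \<open>z \<noteq> 1\<close> because the sum would be \<open>p\<close>, nonzero in
  characteristic 0. Such a \<open>z\<close> belongs to one prime only.\<close>

lemma finite_primes_geometric_zero:
  fixes z :: "'k::field_char_0"
  shows "finite {p. prime p \<and> (\<Sum>l<p. z ^ l) = 0}"
proof -
  have p1: "z ^ p = 1 \<and> z \<noteq> 1" if "prime p" "(\<Sum>l<p. z ^ l) = 0" for p
  proof
    show "z ^ p = 1" using power_diff_1_eq[of z p] that by simp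
    show "z \<noteq> 1" using that by (auto simp: prime_gt_0_nat)
  qed
  show ?thesis
  proof (cases "\<exists>p. prime p \<and> (\<Sum>l<p. z ^ l) = 0")
    case True
    then obtain p where p: "prime p" "(\<Sum>l<p. z ^ l) = 0" by blast
    have "{p. prime p \<and> (\<Sum>l<p. z ^ l) = 0} \<subseteq> {p}"
      using p1[OF p] geometric_root_eq_1[of p] p(1) p1 by blast
    then show ?thesis by (rule finite_subset) simp
  next
    case False
    then have "{p. prime p \<and> (\<Sum>l<p. z ^ l) = 0} = {}" by blast
    then show ?thesis by (metis finite.emptyI)
  qed
qed

section \<open>The lift to the cone and its iterates\<close>

locale proj_endo = form_system "{..<r}" D F
  for r D :: nat and F :: "nat \<Rightarrow> (nat \<Rightarrow> 'k::field_char_0) \<Rightarrow> 'k" +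
  assumes r: "r \<ge> 2"
begin

abbreviation "V \<equiv> {..<r}"

text \<open>The lift to the cone. Coordinates from \<open>r\<close> on are set to 0, so that fixed
  vectors are genuine equalities of functions.\<close>

definition fm :: "(nat \<Rightarrow> 'k) \<Rightarrow> nat \<Rightarrow> 'k" where
  "fm x i = (if i < r then F i x else 0)"

lemma fm_in: "i < r \<Longrightarrow> fm y i = F i y"
  by (simp add: fm_def)

lemma fm_out: "\<not> i < r \<Longrightarrow> fm y i = 0"
  by (simp add: fm_def)

lemma fm_iter_Suc: "i < r \<Longrightarrow> (fm ^^ Suc N) x i = F i ((fm ^^ N) x)"
  using fm_in[of i "(fm ^^ N) x"] by simp

lemma fm_iter_hom_fun: "i < r \<Longrightarrow> hom_fun V (D ^ N) (\<lambda>x. (fm ^^ N) x i)"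
proof (induction N arbitrary: i)
  case 0 then show ?case using hom_fun_var[of i V] by simp
next
  case (Suc N)
  have "hom_fun V (D * D ^ N) (\<lambda>x. F i (\<lambda>v. (fm ^^ N) x v))"
    by (rule hom_fun_compose[OF F]) (use Suc in auto)
  moreover have "(\<lambda>x. F i (\<lambda>v. (fm ^^ N) x v)) = (\<lambda>x. (fm ^^ Suc N) x i)" using fm_iter_Suc[OF Suc.prems] by simp
  ultimately show ?case by simp
qed

lemma fm_iter_poly_fun: "i < r \<Longrightarrow> (\<lambda>x. (fm ^^ N) x i) \<in> poly_fun V"
  by (rule hom_fun_poly_fun[OF fm_iter_hom_fun])

lemma fm_iter_scale: "i < r \<Longrightarrow> (fm ^^ N) (\<lambda>v. c * x v) i = c ^ (D ^ N) * (fm ^^ N) x i"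
  by (rule hom_fun_scale[OF fm_iter_hom_fun])

lemma fm_iter_cong: "(\<And>v. v < r \<Longrightarrow> x v = y v) \<Longrightarrow> i < r \<Longrightarrow> (fm ^^ N) x i = (fm ^^ N) y i"
  by (rule poly_fun_cong[OF fm_iter_poly_fun]) auto

lemma fm_iter_outside: "(\<And>i. i \<ge> r \<Longrightarrow> x i = 0) \<Longrightarrow> i \<ge> r \<Longrightarrow> (fm ^^ N) x i = 0"
  by (cases N) (simp_all add: fm_def)

lemma fm_iter_nz: "(\<And>i. i < r \<Longrightarrow> (fm ^^ N) x i = 0) \<Longrightarrow> i < r \<Longrightarrow> x i = 0"
proof (induction N arbitrary: i)
  case 0 then show ?case by simp
next
  case (Suc N)
  have "F i ((fm ^^ N) x) = 0" if "i < r" for i using Suc.prems(1)[OF that] fm_iter_Suc[OF that] by simp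
  then have "(fm ^^ N) x i = 0" if "i < r" for i using nz[of "(fm ^^ N) x" i] that by simp
  then show ?case using Suc.IH Suc.prems(2) by blast
qed

lemma iter_form_system: assumes "N \<ge> 1" shows "form_system V (D ^ N) (\<lambda>i x. (fm ^^ N) x i)"
proof
  show "alg_closed_field TYPE('k)" by (rule ac)
  have "2 ^ 1 \<le> (2::nat) ^ N" by (rule power_increasing) (use assms in auto)
  also have "\<dots> \<le> D ^ N" by (rule power_mono[OF D]) simp
  finally show "D ^ N \<ge> 2" by simp
next
  fix i assume "i \<in> V" then show "hom_fun V (D ^ N) (\<lambda>x. (fm ^^ N) x i)" by (intro fm_iter_hom_fun) simp
next
  fix x i assume "\<And>i. i \<in> V \<Longrightarrow> (fm ^^ N) x i = 0" "i \<in> V"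
  then show "x i = 0" using fm_iter_nz[of N x i] by simp
qed simp

text \<open>The derivative of the lift at \<open>s\<close> when \<open>dF i k\<close> are the
  partial derivatives of \<open>F i\<close>.\<close>

definition lin :: "(nat \<Rightarrow> nat \<Rightarrow> (nat \<Rightarrow> 'k) \<Rightarrow> 'k) \<Rightarrow> (nat \<Rightarrow> 'k) \<Rightarrow> (nat \<Rightarrow> 'k) \<Rightarrow> nat \<Rightarrow> 'k" where
  "lin dF s v i = (if i < r then \<Sum>k<r. dF i k s * v k else 0)"

text \<open>A chain rule for differences: applying the difference formula for \<open>F\<close> to
  consecutive iterates writes \<open>F^(l+1) - F^l\<close> as a polynomial matrix times
  \<open>F - id\<close>. At a fixed point all iterates coincide, and the matrix is the
  \<open>l\<close>-th power of the derivative.\<close>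

lemma telescope_step:
  "\<exists>dF. \<forall>l. \<exists>E. (\<forall>i<r. \<forall>j<r. E i j \<in> poly_fun V) \<and>
    (\<forall>x. \<forall>i<r. (fm ^^ Suc l) x i - (fm ^^ l) x i = (\<Sum>j<r. E i j x * (F j x - x j))) \<and>
    (\<forall>s. fm s = s \<longrightarrow> (\<forall>v. \<forall>i<r. (\<Sum>j<r. E i j s * v j) = (lin dF s ^^ l) v i))"
proof -
  define had where "had p dp \<longleftrightarrow> (\<forall>u w. (\<forall>i\<in>V. u i \<in> poly_fun V) \<longrightarrow> (\<forall>i\<in>V. w i \<in> poly_fun V) \<longrightarrow> (\<exists>a. (\<forall>i. a i \<in> poly_fun V) \<and>
     (\<forall>x. p (\<lambda>i. u i x) - p (\<lambda>i. w i x) = (\<Sum>i\<in>V. a i x * (u i x - w i x))) \<and>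
     (\<forall>x z. (\<forall>i\<in>V. u i x = z i \<and> w i x = z i) \<longrightarrow> (\<forall>i\<in>V. a i x = dp i z))))" for p :: "(nat \<Rightarrow> 'k) \<Rightarrow> 'k" and dp
  have "\<forall>i. \<exists>dp. i < r \<longrightarrow> had (F i) dp"
  proof
    fix i show "\<exists>dp. i < r \<longrightarrow> had (F i) dp"
    proof (cases "i < r")
      case True
      then have "F i \<in> poly_fun V" by (intro hom_fun_poly_fun[OF F]) simp
      from poly_fun_hadamard[OF finV this] True show ?thesis unfolding had_def by simp
    qed simp
  qed
  from choice[OF this] obtain dF where dF: "\<forall>i. i < r \<longrightarrow> had (F i) (dF i)" ..
  have "\<exists>E. (\<forall>i<r. \<forall>j<r. E i j \<in> poly_fun V) \<and>
    (\<forall>x. \<forall>i<r. (fm ^^ Suc l) x i - (fm ^^ l) x i = (\<Sum>j<r. E i j x * (F j x - x j))) \<and>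
    (\<forall>s. fm s = s \<longrightarrow> (\<forall>v. \<forall>i<r. (\<Sum>j<r. E i j s * v j) = (lin dF s ^^ l) v i))" for l
  proof (induction l)
    case 0
    let ?E = "\<lambda>i j x. if j = i then 1 else 0"
    have del: "(\<Sum>j<r. (if j = i then 1 else 0) * f j) = f i" if "i < r" for i and f :: "nat \<Rightarrow> 'k"
    proof -
      have "(\<Sum>j<r. (if j = i then 1 else 0) * f j) = (\<Sum>j<r. if j = i then f j else 0)" by (rule sum.cong) auto
      then show ?thesis using that by simp
    qed
    show ?case by (rule exI[of _ ?E]) (simp add: del poly_fun_const fm_in)
  next
    case (Suc l)
    then obtain E where E: "\<forall>i<r. \<forall>j<r. E i j \<in> poly_fun V"
      and Et: "\<forall>x. \<forall>i<r. (fm ^^ Suc l) x i - (fm ^^ l) x i = (\<Sum>j<r. E i j x * (F j x - x j))"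
      and Es: "\<forall>s. fm s = s \<longrightarrow> (\<forall>v. \<forall>i<r. (\<Sum>j<r. E i j s * v j) = (lin dF s ^^ l) v i)" by blast
    have "\<forall>i. \<exists>a. i < r \<longrightarrow> (\<forall>k. a k \<in> poly_fun V) \<and>
     (\<forall>x. F i (\<lambda>k. (fm ^^ Suc l) x k) - F i (\<lambda>k. (fm ^^ l) x k) = (\<Sum>k\<in>V. a k x * ((fm ^^ Suc l) x k - (fm ^^ l) x k))) \<and>
     (\<forall>x z. (\<forall>k\<in>V. (fm ^^ Suc l) x k = z k \<and> (fm ^^ l) x k = z k) \<longrightarrow> (\<forall>k\<in>V. a k x = dF i k z))" (is "\<forall>i. \<exists>a. ?P i a")
    proof
      fix i show "\<exists>a. ?P i a"
      proof (cases "i < r")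
        case True
        have 1: "\<forall>k\<in>V. (\<lambda>x. (fm ^^ N) x k) \<in> poly_fun V" for N using fm_iter_poly_fun by simp
        have "had (F i) (dF i)" using dF True by blast
        note this[unfolded had_def, rule_format, of "\<lambda>k x. (fm ^^ Suc l) x k" "\<lambda>k x. (fm ^^ l) x k", OF bspec[OF 1] bspec[OF 1]]
        then show ?thesis using True by simp
      qed simp
    qed
    from choice[OF this] obtain a where a: "\<forall>i. ?P i (a i)" ..
    have aPF: "a i k \<in> poly_fun V" if "i < r" for i k using a that by blast
    have aF: "F i ((fm ^^ Suc l) x) - F i ((fm ^^ l) x) = (\<Sum>k<r. a i k x * ((fm ^^ Suc l) x k - (fm ^^ l) x k))" if "i < r" for i x
      using a[rule_format, OF that, THEN conjunct2, THEN conjunct1, rule_format, of x] by simp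
    have as: "a i k s = dF i k s" if "i < r" "k < r" "fm s = s" for i k s
    proof -
      have "(fm ^^ N) s = s" for N by (induction N) (simp_all add: that)
      then have "\<forall>k\<in>V. (fm ^^ Suc l) s k = s k \<and> (fm ^^ l) s k = s k" by metis
      with a[rule_format, OF that(1), THEN conjunct2, THEN conjunct2, THEN spec[of _ s], THEN spec[of _ s]]
      show ?thesis using that(2) by blast
    qed
    \<comment> \<open>Matrix product of the difference quotients at the two latest iterates with the
      previous matrix.\<close>
    let ?E = "\<lambda>i j x. \<Sum>k<r. a i k x * E k j x"
    have "\<forall>i<r. \<forall>j<r. ?E i j \<in> poly_fun V" by (intro allI impI poly_fun_sum poly_fun_mult aPF) (use E in auto)
    moreover have "(fm ^^ Suc (Suc l)) x i - (fm ^^ Suc l) x i = (\<Sum>j<r. ?E i j x * (F j x - x j))" if i: "i < r" for x i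
    proof -
      have "(fm ^^ Suc (Suc l)) x i - (fm ^^ Suc l) x i = F i ((fm ^^ Suc l) x) - F i ((fm ^^ l) x)"
        by (simp only: fm_iter_Suc[OF i])
      also have "\<dots> = (\<Sum>k<r. a i k x * (\<Sum>j<r. E k j x * (F j x - x j)))"
        unfolding aF[OF i] by (rule sum.cong[OF refl]) (use Et in auto)
      also have "\<dots> = (\<Sum>j<r. ?E i j x * (F j x - x j))"
        by (simp only: sum_distrib_left sum_distrib_right mult.assoc) (rule sum.swap)
      finally show ?thesis .
    qed
    moreover have "(\<Sum>j<r. ?E i j s * v j) = (lin dF s ^^ Suc l) v i" if i: "i < r" and s: "fm s = s" for i s v
    proof -
      have "(\<Sum>j<r. ?E i j s * v j) = (\<Sum>k<r. a i k s * (\<Sum>j<r. E k j s * v j))"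
        by (simp only: sum_distrib_left sum_distrib_right mult.assoc) (rule sum.swap)
      also have "\<dots> = (\<Sum>k<r. dF i k s * (lin dF s ^^ l) v k)"
        by (rule sum.cong[OF refl]) (use Es s as[OF i _ s] in simp)
      also have "\<dots> = (lin dF s ^^ Suc l) v i" using i by (simp add: lin_def)
      finally show ?thesis .
    qed
    ultimately show ?case by (intro exI[of _ ?E]) simp
  qed
  then show ?thesis by (intro exI[of _ dF]) simp
qed

text \<open>Summing the differences gives \<open>F^N - id = A N (F - id)\<close>, and at a fixed
  point \<open>A N\<close> is \<open>1 + L + ... + L^(N-1)\<close> for the derivative
  \<open>L\<close>.\<close>

lemma telescope:
  "\<exists>dF A. \<forall>N. (\<forall>i<r. \<forall>j<r. A N i j \<in> poly_fun V) \<and>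
    (\<forall>x. \<forall>i<r. (fm ^^ N) x i - x i = (\<Sum>j<r. A N i j x * (F j x - x j))) \<and>
    (\<forall>s. fm s = s \<longrightarrow> (\<forall>v. \<forall>i<r. (\<Sum>j<r. A N i j s * v j) = (\<Sum>l<N. (lin dF s ^^ l) v i)))"
proof -
  obtain dF where dF: "\<forall>l. \<exists>E. (\<forall>i<r. \<forall>j<r. E i j \<in> poly_fun V) \<and>
    (\<forall>x. \<forall>i<r. (fm ^^ Suc l) x i - (fm ^^ l) x i = (\<Sum>j<r. E i j x * (F j x - x j))) \<and>
    (\<forall>s. fm s = s \<longrightarrow> (\<forall>v. \<forall>i<r. (\<Sum>j<r. E i j s * v j) = (lin dF s ^^ l) v i))"
    using telescope_step ..
  from choice[OF dF] obtain E where E: "\<forall>l. (\<forall>i<r. \<forall>j<r. E l i j \<in> poly_fun V) \<and>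
    (\<forall>x. \<forall>i<r. (fm ^^ Suc l) x i - (fm ^^ l) x i = (\<Sum>j<r. E l i j x * (F j x - x j))) \<and>
    (\<forall>s. fm s = s \<longrightarrow> (\<forall>v. \<forall>i<r. (\<Sum>j<r. E l i j s * v j) = (lin dF s ^^ l) v i))" ..
  define A where "A N i j x = (\<Sum>l<N. E l i j x)" for N i j x
  show ?thesis
  proof (rule exI[of _ dF], rule exI[of _ A], intro allI conjI impI)
    fix N i j assume "i < r" "j < r"
    then show "A N i j \<in> poly_fun V" unfolding A_def by (intro poly_fun_sum) (use E in blast)
  next
    fix N x i assume i: "i < r"
    have "(fm ^^ N) x i - x i = (\<Sum>l<N. (fm ^^ Suc l) x i - (fm ^^ l) x i)"
      using sum_lessThan_telescope[of "\<lambda>l. (fm ^^ l) x i" N] by simp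
    also have "\<dots> = (\<Sum>l<N. \<Sum>j<r. E l i j x * (F j x - x j))"
      by (rule sum.cong[OF refl]) (use E i in blast)
    also have "\<dots> = (\<Sum>j<r. A N i j x * (F j x - x j))"
      unfolding A_def by (subst sum.swap) (simp only: sum_distrib_right)
    finally show "(fm ^^ N) x i - x i = (\<Sum>j<r. A N i j x * (F j x - x j))" .
  next
    fix N s v i assume s: "fm s = s" and i: "i < r"
    have "(\<Sum>j<r. A N i j s * v j) = (\<Sum>l<N. \<Sum>j<r. E l i j s * v j)"
      unfolding A_def by (subst sum.swap) (simp only: sum_distrib_right)
    also have "\<dots> = (\<Sum>l<N. (lin dF s ^^ l) v i)"
      by (rule sum.cong[OF refl]) (use E i s in blast)
    finally show "(\<Sum>j<r. A N i j s * v j) = (\<Sum>l<N. (lin dF s ^^ l) v i)" .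
  qed
qed

lemma lin_linear_op: "linear_op (lin dF s)"
  by unfold_locales (auto simp: lin_def fun_eq_iff distrib_left sum.distrib sum_distrib_left mult.left_commute)

text \<open>For \<open>z \<noteq> 0\<close> an eigenvector is supported on the first
  \<open>r\<close> coordinates, so it is an eigenvector of the Jacobian matrix and \<open>z\<close>
  is a root of its characteristic polynomial.\<close>

lemma finite_nonzero_eigenvalues:
  "finite {z. z \<noteq> 0 \<and> (\<exists>w. w \<noteq> (\<lambda>i. 0) \<and> lin dF s w = (\<lambda>i. z * w i))}"
proof -
  define M where "M = mat r r (\<lambda>(i, j). dF i j s)"
  have M: "M \<in> carrier_mat r r" by (simp add: M_def)
  have "{z. z \<noteq> 0 \<and> (\<exists>w. w \<noteq> (\<lambda>i. 0) \<and> lin dF s w = (\<lambda>i. z * w i))} \<subseteq> {z. poly (char_poly M) z = 0}"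
  proof safe
    fix z w assume z: "z \<noteq> 0" and w: "w \<noteq> (\<lambda>i. 0)" and eq: "lin dF s w = (\<lambda>i. z * w i)"
    obtain i where i: "w i \<noteq> 0" using w by auto
    have ir: "i < r" using fun_cong[OF eq, of i] z i by (auto simp: lin_def split: if_splits)
    have "eigenvector M (vec r w) z" unfolding eigenvector_def
    proof (intro conjI)
      show "vec r w \<in> carrier_vec (dim_row M)" by (simp add: M_def)
      show "vec r w \<noteq> 0\<^sub>v (dim_row M)" using i ir by (auto simp: M_def vec_eq_iff)
      show "M *\<^sub>v vec r w = z \<cdot>\<^sub>v vec r w"
      proof (rule eq_vecI)
        fix j assume "j < dim_vec (z \<cdot>\<^sub>v vec r w)"
        then have j: "j < r" by simp
        have "(M *\<^sub>v vec r w) $ j = (\<Sum>k<r. dF j k s * w k)"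
          using j by (simp add: M_def scalar_prod_def atLeast0LessThan)
        then show "(M *\<^sub>v vec r w) $ j = (z \<cdot>\<^sub>v vec r w) $ j"
          using fun_cong[OF eq, of j] j by (simp add: lin_def)
      qed (simp add: M_def)
    qed
    then have "eigenvalue M z" unfolding eigenvalue_def by blast
    then show "poly (char_poly M) z = 0" using eigenvalue_root_char_poly[OF M] by blast
  qed
  moreover have "char_poly M \<noteq> 0" using degree_monic_char_poly[OF M] by auto
  then have "finite {z. poly (char_poly M) z = 0}" by (rule poly_roots_finite)
  ultimately show ?thesis by (rule finite_subset)
qed

text \<open>A kernel vector of \<open>1 + L + ... + L^(N-1)\<close> yields an eigenvalue
  \<open>z\<close> of \<open>L\<close> with \<open>1 + z + ... + z^(N-1) = 0\<close>. There are
  finitely many nonzero eigenvalues, and each admits finitely many such primes.\<close>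

lemma finite_singular_primes:
  assumes A: "\<And>N v i. i < r \<Longrightarrow> (\<Sum>j<r. A N i j * v j) = (\<Sum>l<N. (lin dF s ^^ l) v i)"
  shows "finite {N. prime N \<and> det (mat r r (\<lambda>(i, j). A N i j)) = 0}"
proof -
  let ?L = "lin dF s"
  interpret linear_op ?L by (rule lin_linear_op)
  let ?Eig = "{z. z \<noteq> 0 \<and> (\<exists>w. w \<noteq> (\<lambda>i. 0) \<and> ?L w = (\<lambda>i. z * w i))}"
  have "{N. prime N \<and> det (mat r r (\<lambda>(i, j). A N i j)) = 0} \<subseteq> (\<Union>z\<in>?Eig. {p. prime p \<and> (\<Sum>l<p. z ^ l) = 0})"
  proof
    fix N assume "N \<in> {N. prime N \<and> det (mat r r (\<lambda>(i, j). A N i j)) = 0}"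
    then have N: "prime N" "det (mat r r (\<lambda>(i, j). A N i j)) = 0" by auto
    have N1: "N > 0" using N(1) by (rule prime_gt_0_nat)
    obtain v where v: "v \<in> carrier_vec r" "v \<noteq> 0\<^sub>v r" "mat r r (\<lambda>(i, j). A N i j) *\<^sub>v v = 0\<^sub>v r"
      using N(2) det_0_iff_vec_prod_zero[of "mat r r (\<lambda>(i, j). A N i j)" r] by auto
    define u where "u i = (if i < r then v $ i else 0)" for i
    have u: "u \<noteq> (\<lambda>i. 0)"
    proof
      assume u0: "u = (\<lambda>i. 0)"
      have "v = 0\<^sub>v r"
      proof (rule eq_vecI)
        fix i assume "i < dim_vec (0\<^sub>v r)"
        then show "v $ i = 0\<^sub>v r $ i" using fun_cong[OF u0, of i] by (simp add: u_def)
      qed (use v in simp)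
      then show False using v by simp
    qed
    define p where "p = (\<Sum>l<N. monom (1::'k) l)"
    have cp: "coeff p l = (if l < N then 1 else 0)" for l
    proof -
      have "coeff p l = (\<Sum>k<N. if k = l then 1 else 0)" unfolding p_def coeff_sum by (rule sum.cong) auto
      then show ?thesis by simp
    qed
    have dp: "degree p \<le> N" by (rule degree_le) (simp add: cp)
    have "p \<noteq> 0" using cp[of 0] N1 by auto
    have act: "poly_act ?L p u i = (\<Sum>l<N. (?L ^^ l) u i)" for i
      unfolding poly_act_bound[OF dp] cp by (rule sum.mono_neutral_cong_right) auto
    have "poly_act ?L p u i = 0" for i
    proof (cases "i < r")
      case True
      have "(mat r r (\<lambda>(i, j). A N i j) *\<^sub>v v) $ i = (\<Sum>j<r. A N i j * u j)"
        using True v(1) by (simp add: scalar_prod_def atLeast0LessThan u_def)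
      then show ?thesis unfolding act A[OF True, symmetric] using v(3) True by simp
    next
      case False
      then have "(?L ^^ l) u i = 0" for l by (cases l) (simp_all add: u_def lin_def)
      then show ?thesis unfolding act by simp
    qed
    then have "poly_act ?L p u = (\<lambda>i. 0)" by (rule ext)
    from eigenvalue_of_annihilating_poly[OF ac \<open>p \<noteq> 0\<close> u this]
    obtain z w where zw: "poly p z = 0" "w \<noteq> (\<lambda>i. 0)" "?L w = (\<lambda>i. z * w i)" by blast
    have pz: "(\<Sum>l<N. z ^ l) = 0" using zw(1) by (simp add: p_def poly_sum poly_monom)
    have "z \<noteq> 0"
    proof
      assume "z = 0"
      then have "(\<Sum>l<N. z ^ l) = (\<Sum>l<N. if l = 0 then 1 else 0)" by (intro sum.cong) auto
      then show False using pz N1 by simp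
    qed
    then show "N \<in> (\<Union>z\<in>?Eig. {p. prime p \<and> (\<Sum>l<p. z ^ l) = 0})" using zw pz N(1) by blast
  qed
  then show ?thesis
    by (rule finite_subset) (rule finite_UN_I[OF finite_nonzero_eigenvalues finite_primes_geometric_zero])
qed

end

section \<open>Finitely many periodic lines are impossible\<close>

lemma alg_closed_root:
  fixes a :: "'k::field"
  assumes "alg_closed_field TYPE('k)" "m \<ge> 1"
  shows "\<exists>c. c ^ m = a"
proof -
  let ?p = "monom 1 m + [:- a:]"
  have "degree ?p = m" using assms(2) by (subst degree_add_eq_left) (auto simp: degree_monom_eq)
  then have "degree ?p \<ge> 1" using assms(2) by simp
  then obtain c where "poly ?p c = 0" using assms(1) unfolding alg_closed_field_def by blast
  then show ?thesis by (intro exI[of _ c]) (simp add: poly_monom)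
qed

text \<open>With these cofactors \<open>F^N - id\<close> becomes a polynomial matrix applied to the
  vector \<open>x\<close>, which is how it is studied at the origin.\<close>

lemma hom_fun_Suc_split:
  fixes h :: "('v \<Rightarrow> 'k::comm_ring_1) \<Rightarrow> 'k"
  assumes "finite V" "hom_fun V t h" "t = Suc m"
  shows "\<exists>B. (\<forall>j. hom_fun V m (B j)) \<and> (\<forall>x. h x = (\<Sum>j\<in>V. B j x * x j))"
  using assms(2,3)
proof (induction rule: hom_fun.induct)
  case (hom_fun_zero m') show ?case by (rule exI[of _ "\<lambda>j x. 0"]) (simp add: hom_fun.hom_fun_zero)
next
  case (hom_fun_const c) then show ?case by simp
next
  case (hom_fun_add m' p q)
  obtain B where B: "(\<forall>j. hom_fun V m (B j)) \<and> (\<forall>x. p x = (\<Sum>j\<in>V. B j x * x j))" using hom_fun_add by blast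
  obtain C where C: "(\<forall>j. hom_fun V m (C j)) \<and> (\<forall>x. q x = (\<Sum>j\<in>V. C j x * x j))" using hom_fun_add by blast
  have "\<forall>j. hom_fun V m (\<lambda>x. B j x + C j x)" using B C by (auto intro: hom_fun.hom_fun_add)
  moreover have "\<forall>x. p x + q x = (\<Sum>j\<in>V. (B j x + C j x) * x j)"
    using B C by (simp add: distrib_right sum.distrib)
  ultimately show ?case by (intro exI[of _ "\<lambda>j x. B j x + C j x"]) simp
next
  case (hom_fun_var_mult v m' p)
  let ?B = "\<lambda>j x. if j = v then p x else 0"
  have "hom_fun V m (?B j)" for j using hom_fun_var_mult by (cases "j = v") (auto intro: hom_fun_zero)
  moreover have "x v * p x = (\<Sum>j\<in>V. ?B j x * x j)" for x
  proof -
    have "(\<Sum>j\<in>V. ?B j x * x j) = (\<Sum>j\<in>V. if j = v then p x * x j else 0)" by (rule sum.cong) auto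
    then show ?thesis using assms(1) hom_fun_var_mult(1) by (simp add: mult.commute)
  qed
  ultimately show ?case by (intro exI[of _ ?B]) simp
qed

text \<open>Multiplication of the vector \<open>A h\<close> by the adjugate of \<open>A\<close>.
  Where the determinant is nonzero, the \<open>h i\<close> thus belong to the ideal locally.\<close>

lemma poly_fun_ideal_cramer:
  fixes A :: "nat \<Rightarrow> nat \<Rightarrow> ('v \<Rightarrow> 'k::comm_ring_1) \<Rightarrow> 'k"
  assumes I: "poly_fun_ideal V I" and A: "\<And>i j. i < N \<Longrightarrow> j < N \<Longrightarrow> A i j \<in> poly_fun V"
    and mem: "\<And>i. i < N \<Longrightarrow> (\<lambda>x. \<Sum>j<N. A i j x * h j x) \<in> I" and i: "i < N"
  shows "(\<lambda>x. det (mat N N (\<lambda>(i, j). A i j x)) * h i x) \<in> I"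
proof -
  obtain C where C: "\<And>i j. i < N \<Longrightarrow> j < N \<Longrightarrow> C i j \<in> poly_fun V"
    and eq: "\<And>x w i. i < N \<Longrightarrow> det (mat N N (\<lambda>(i, j). A i j x)) * w i = (\<Sum>j<N. C i j x * (\<Sum>l<N. A j l x * w l))"
    using poly_fun_cramer[of N A V] A by blast
  have "(\<lambda>x. \<Sum>j<N. C i j x * (\<Sum>l<N. A j l x * h l x)) \<in> I"
    by (rule poly_fun_ideal_sum[OF I], rule poly_fun_idealD(4)[OF I mem C[OF i]]) simp_all
  moreover have "(\<lambda>x. det (mat N N (\<lambda>(i, j). A i j x)) * h i x) = (\<lambda>x. \<Sum>j<N. C i j x * (\<Sum>l<N. A j l x * h l x))"
    by (rule ext) (rule eq[OF i, of _ "\<lambda>l. h l x" for x])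
  ultimately show ?thesis by (simp only:)
qed

context proj_endo
begin

text \<open>
  A power \<open>G\<close> of a product of linear forms vanishing on the lines through \<open>S\<close> lies in the ideal of the
  \<open>F\<^sub>j - x\<^sub>j\<close>. At a zero \<open>c * s\<close> of \<open>F\<^sup>N - id\<close>, Cramer's rule for the matrix \<open>A N\<close> carries this over to the ideal
  \<open>I\<close> of the components of \<open>F\<^sup>N - id\<close>, up to a factor that is nonzero there. These factors form an ideal
  \<open>Q\<close> without zeros, so \<open>G\<close> lies in \<open>I\<close>.
\<close>

lemma fixed_points_not_finite:
  assumes S: "finite S" and Sfix: "\<And>s. s \<in> S \<Longrightarrow> fm s = s" and Snz: "\<And>s. s \<in> S \<Longrightarrow> \<exists>i<r. s i \<noteq> 0"
    and cov: "\<And>N x. N \<ge> 1 \<Longrightarrow> (fm ^^ N) x = x \<Longrightarrow> \<exists>i<r. x i \<noteq> 0 \<Longrightarrow> \<exists>c. \<exists>s\<in>S. x = (\<lambda>i. c * s i)"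
  shows False
proof -
  have V0: "0 \<in> V" using r by simp
  have "\<forall>s. \<exists>l. s \<in> S \<longrightarrow> hom_fun V 1 l \<and> l s = 0 \<and> (\<exists>x. l x \<noteq> 0)"
  proof
    fix s
    show "\<exists>l. s \<in> S \<longrightarrow> hom_fun V 1 l \<and> l s = 0 \<and> (\<exists>x. l x \<noteq> 0)"
    proof (cases "s \<in> S")
      case True
      then obtain i where i: "i < r" "s i \<noteq> 0" using Snz by blast
      obtain j where j: "j < r" "j \<noteq> i" using r by (metis One_nat_def Suc_1 less_le_trans lessI zero_less_Suc n_not_Suc_n)
      have "hom_fun V 1 (\<lambda>x. s i * x j - s j * x i)"
        using hom_fun_diff[OF hom_fun_cmult[OF hom_fun_var] hom_fun_cmult[OF hom_fun_var], of j V i "s i" "s j"] i j by simp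
      moreover have "s i * (if j = j then 1 else 0) - s j * (if i = j then 1 else 0) \<noteq> 0" using i j by simp
      ultimately show ?thesis
        by (intro exI[of _ "\<lambda>x. s i * x j - s j * x i"] impI conjI exI[of _ "\<lambda>k. if k = j then 1 else 0"]) simp_all
    qed simp
  qed
  from choice[OF this] obtain ell where ell: "\<forall>s. s \<in> S \<longrightarrow> hom_fun V 1 (ell s) \<and> ell s s = 0 \<and> (\<exists>x. ell s x \<noteq> 0)" ..
  have ell_scale: "ell s (\<lambda>i. c * s i) = 0" if "s \<in> S" for s c
    using hom_fun_scale[of V 1 "ell s" c s] ell that by simp
  \<comment> \<open>The linear forms take care of the lines through \<open>S\<close>; the factor
    \<open>x 0\<close> is for the origin, which is also a zero of \<open>F^N - id\<close>.\<close>
  define G0 where "G0 x = x 0 * (\<Prod>s\<in>S. ell s x)" for x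
  have G0HF: "hom_fun V (1 + card S) G0"
  proof -
    have "hom_fun V (\<Sum>s\<in>S. 1) (\<lambda>x. \<Prod>s\<in>S. ell s x)" by (rule hom_fun_prod) (use ell in blast)
    from hom_fun_mult[OF hom_fun_var[OF V0] this] show ?thesis unfolding G0_def by simp
  qed
  have G0nz: "\<exists>x. G0 x \<noteq> 0"
  proof -
    have "\<exists>x. \<forall>s\<in>S. ell s x \<noteq> 0" by (rule poly_fun_prod_nonzero[OF S, of _ V]) (use ell hom_fun_poly_fun in blast)+
    then obtain b where b: "\<forall>s\<in>S. ell s b \<noteq> 0" ..
    have 1: "(\<lambda>x. x 0) \<in> poly_fun V" by (rule poly_fun_var[OF V0])
    have 2: "(\<lambda>x. \<Prod>s\<in>S. ell s x) \<in> poly_fun V" by (rule poly_fun_prod) (use ell hom_fun_poly_fun in blast)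
    have "\<exists>x. (x 0 :: 'k) \<noteq> 0 \<and> (\<Prod>s\<in>S. ell s x) \<noteq> 0"
      by (rule poly_fun_domain[of "\<lambda>x. x 0" V _ "\<lambda>i. 1" b, OF 1 2]) (use b S in \<open>auto simp: prod_zero_iff\<close>)
    then show ?thesis unfolding G0_def by auto
  qed
  \<comment> \<open>A nonzero common zero of the 2 by 2 minors of \<open>x\<close> and
    \<open>F x\<close> is mapped to a multiple of itself; rescaled, it becomes a fixed vector, to
    which \<open>cov\<close> applies.\<close>
  have van: "G0 x = 0" if z: "\<And>p. p \<in> V \<times> V \<Longrightarrow> x (fst p) * F (snd p) x - x (snd p) * F (fst p) x = 0" for x
  proof (cases "\<exists>i<r. x i \<noteq> 0")
    case False then show ?thesis using r by (simp add: G0_def)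
  next
    case True
    then obtain i0 where i0: "i0 < r" "x i0 \<noteq> 0" by blast
    define la where "la = F i0 x / x i0"
    have Fx: "F j x = la * x j" if "j < r" for j
      using z[of "(i0, j)"] i0 that by (simp add: la_def field_simps)
    have la0: "la \<noteq> 0"
    proof
      assume "la = 0"
      then have "F j x = 0" if "j \<in> V" for j using Fx that by simp
      then have "x i0 = 0" using nz[of x i0] i0 by simp
      then show False using i0 by simp
    qed
    have "D - 1 \<ge> 1" using D by simp
    \<comment> \<open>By homogeneity \<open>F (c * x) = c^D * la * x\<close>, and for this
      \<open>c\<close> the right side is \<open>c * x\<close>.\<close>
    from alg_closed_root[OF ac this] obtain c where c: "c ^ (D - 1) = 1 / la" ..
    have c0: "c \<noteq> 0" using c la0 \<open>D - 1 \<ge> 1\<close> by (cases "D - 1") auto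
    define y where "y i = (if i < r then c * x i else 0)" for i
    have "fm y = y"
    proof
      fix i
      show "fm y i = y i"
      proof (cases "i < r")
        case True
        have "fm y i = F i (\<lambda>v. c * x v)" unfolding fm_in[OF True]
          by (rule poly_fun_cong[OF hom_fun_poly_fun[OF F]]) (use True in \<open>auto simp: y_def\<close>)
        also have "\<dots> = c ^ D * (la * x i)" using hom_fun_scale[OF F, of i c x] True Fx[OF True] by simp
        also have "c ^ D = c * c ^ (D - 1)" using D by (simp flip: power_Suc)
        finally have "fm y i = c * c ^ (D - 1) * (la * x i)" .
        moreover have "y i = c * x i" using True by (simp add: y_def)
        ultimately show ?thesis using c la0 by simp
      qed (simp add: fm_def y_def)
    qed
    then have "\<exists>c. \<exists>s\<in>S. y = (\<lambda>i. c * s i)" using i0 c0 by (intro cov[of 1 y]) (auto simp: y_def)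
    then obtain c' s where s: "s \<in> S" "y = (\<lambda>i. c' * s i)" by blast
    have "G0 x = G0 (\<lambda>i. (1 / c) * y i)"
      by (rule poly_fun_cong[OF hom_fun_poly_fun[OF G0HF]]) (use c0 in \<open>auto simp: y_def\<close>)
    also have "\<dots> = (1 / c) ^ (1 + card S) * G0 y" by (rule hom_fun_scale[OF G0HF])
    also have "G0 y = 0" unfolding G0_def using ell_scale[OF s(1), of c'] s S by (auto simp: prod_zero_iff)
    finally show ?thesis by simp
  qed
  have "\<exists>T g. (\<forall>p\<in>V \<times> V. g p \<in> poly_fun V) \<and> (\<forall>x. G0 x ^ T = (\<Sum>p\<in>V \<times> V. g p x * (x (fst p) * F (snd p) x - x (snd p) * F (fst p) x)))"
    by (rule strong_nullstellensatz[OF ac finV _ _ hom_fun_poly_fun[OF G0HF] van])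
      (auto intro!: poly_fun_diff poly_fun_mult poly_fun_var hom_fun_poly_fun[OF F])
  then obtain T g where g: "\<forall>p\<in>V \<times> V. g p \<in> poly_fun V"
    and GT: "\<forall>x. G0 x ^ T = (\<Sum>p\<in>V \<times> V. g p x * (x (fst p) * F (snd p) x - x (snd p) * F (fst p) x))" by blast
  \<comment> \<open>The exponent \<open>T + 1\<close> guarantees that \<open>G0\<close>, and in
    particular \<open>x 0\<close>, divides \<open>G\<close>.\<close>
  define G where "G x = G0 x ^ (T + 1)" for x
  define e where "e = (T + 1) * (1 + card S)"
  have GHF: "hom_fun V e G" unfolding G_def e_def by (rule hom_fun_power[OF G0HF])
  have GPF: "G \<in> poly_fun V" by (rule hom_fun_poly_fun[OF GHF])
  have GJ: "\<exists>t. (\<forall>j<r. t j \<in> poly_fun V) \<and> (\<forall>x. G x = (\<Sum>j<r. t j x * (F j x - x j)))"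
  proof -
    have FPF: "(\<lambda>x. F j x - x j) \<in> poly_fun V" if "j \<in> V" for j by (intro poly_fun_diff poly_fun_var hom_fun_poly_fun[OF F] that)
    define I where "I = {p. \<exists>g. (\<forall>i\<in>V. g i \<in> poly_fun V) \<and> p = (\<lambda>x. \<Sum>i\<in>V. g i x * (F i x - x i))}"
    have I: "poly_fun_ideal V I" unfolding I_def by (rule poly_fun_ideal_generated[OF FPF])
    have gen: "(\<lambda>x. F j x - x j) \<in> I" if "j \<in> V" for j
      unfolding I_def by (rule poly_fun_ideal_generator[OF finV that, of "\<lambda>j x. F j x - x j"])
    have "(\<lambda>x. \<Sum>p\<in>V \<times> V. G0 x * g p x * (x (fst p) * (F (snd p) x - x (snd p)) - x (snd p) * (F (fst p) x - x (fst p)))) \<in> I"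
    proof (rule poly_fun_ideal_sum[OF I], rule poly_fun_idealD(4)[OF I], rule poly_fun_ideal_diff[OF I])
      fix p assume p: "p \<in> V \<times> V"
      then have p': "fst p \<in> V" "snd p \<in> V" by auto
      show "(\<lambda>x. x (fst p) * (F (snd p) x - x (snd p))) \<in> I" by (rule poly_fun_idealD(4)[OF I gen[OF p'(2)] poly_fun_var[OF p'(1)]])
      show "(\<lambda>x. x (snd p) * (F (fst p) x - x (fst p))) \<in> I" by (rule poly_fun_idealD(4)[OF I gen[OF p'(1)] poly_fun_var[OF p'(2)]])
      show "(\<lambda>x. G0 x * g p x) \<in> poly_fun V" by (rule poly_fun_mult[OF hom_fun_poly_fun[OF G0HF]]) (use g p in blast)
    qed
    \<comment> \<open>Here \<open>x i * F j - x j * F i = x i * (F j - x j) - x j * (F i - x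
      i)\<close>, because the products of coordinates cancel.\<close>
    moreover have "G = (\<lambda>x. \<Sum>p\<in>V \<times> V. G0 x * g p x * (x (fst p) * (F (snd p) x - x (snd p)) - x (snd p) * (F (fst p) x - x (fst p))))"
    proof
      fix x
      have "G x = G0 x * (\<Sum>p\<in>V \<times> V. g p x * (x (fst p) * F (snd p) x - x (snd p) * F (fst p) x))"
        unfolding G_def using GT by simp
      also have "\<dots> = (\<Sum>p\<in>V \<times> V. G0 x * g p x * (x (fst p) * (F (snd p) x - x (snd p)) - x (snd p) * (F (fst p) x - x (fst p))))"
        unfolding sum_distrib_left by (rule sum.cong[OF refl]) (simp add: algebra_simps)
      finally show "G x = \<dots>" .
    qed
    ultimately have "G \<in> I" by (simp only:)
    then obtain t where t: "\<forall>i\<in>V. t i \<in> poly_fun V" "G = (\<lambda>x. \<Sum>i\<in>V. t i x * (F i x - x i))" unfolding I_def by blast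
    then show ?thesis by (intro exI[of _ t]) simp
  qed
  obtain t where t: "\<forall>j<r. t j \<in> poly_fun V" "\<forall>x. G x = (\<Sum>j<r. t j x * (F j x - x j))" using GJ by blast
  obtain dF A where A: "\<forall>N. (\<forall>i<r. \<forall>j<r. A N i j \<in> poly_fun V) \<and>
    (\<forall>x. \<forall>i<r. (fm ^^ N) x i - x i = (\<Sum>j<r. A N i j x * (F j x - x j))) \<and>
    (\<forall>s. fm s = s \<longrightarrow> (\<forall>v. \<forall>i<r. (\<Sum>j<r. A N i j s * v j) = (\<Sum>l<N. (lin dF s ^^ l) v i)))"
    using telescope by blast
  define Bad where "Bad = (\<Union>s\<in>S. {N. prime N \<and> det (mat r r (\<lambda>(i, j). A N i j s)) = 0})"
  have "finite Bad" unfolding Bad_def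
    by (rule finite_UN_I[OF S], rule finite_singular_primes[of _ dF]) (use A Sfix in blast)
  then have "finite (Bad \<union> {..e})" by simp
  \<comment> \<open>\<open>G\<close> and its degree \<open>e\<close> were fixed before
    \<open>N\<close>. A good prime above \<open>e\<close> therefore satisfies
    \<open>e < D ^ N\<close>.\<close>
  then have "infinite ({N::nat. prime N} - (Bad \<union> {..e}))" using primes_infinite by (rule Diff_infinite_finite)
  then have "{N::nat. prime N} - (Bad \<union> {..e}) \<noteq> {}" by (metis finite.emptyI)
  then obtain N where "N \<in> {N::nat. prime N} - (Bad \<union> {..e})" by blast
  then have N: "prime N" "N \<notin> Bad" "e < N" by auto
  have N1: "N \<ge> 1" using N(3) by simp
  have eD: "e < D ^ N"
  proof -
    have "N < 2 ^ N" by simp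
    also have "(2::nat) ^ N \<le> D ^ N" by (rule power_mono[OF D]) simp
    finally show ?thesis using N(3) by simp
  qed
  have det: "det (mat r r (\<lambda>(i, j). A N i j s)) \<noteq> 0" if "s \<in> S" for s using N that unfolding Bad_def by blast
  interpret it: form_system V "D ^ N" "\<lambda>i x. (fm ^^ N) x i" by (rule iter_form_system[OF N1])
  define I where "I = {p. \<exists>g. (\<forall>i\<in>V. g i \<in> poly_fun V) \<and> p = (\<lambda>x. \<Sum>i\<in>V. g i x * it.Phi x i)}"
  have I: "poly_fun_ideal V I" unfolding I_def by (rule poly_fun_ideal_generated) (rule it.Phi_poly_fun)
  have genI: "(\<lambda>x. it.Phi x j) \<in> I" if "j \<in> V" for j
    unfolding I_def by (rule poly_fun_ideal_generator[OF finV that, of "\<lambda>j x. it.Phi x j"])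
  \<comment> \<open>The ideal quotient of \<open>I\<close> by \<open>G\<close>: \<open>G\<close>
    lies in \<open>I\<close> as soon as 1 lies in \<open>Q\<close>, and by the Nullstellensatz this
    can be tested point by point.\<close>
  define Q where "Q = {p \<in> poly_fun V. (\<lambda>x. p x * G x) \<in> I}"
  have Q: "poly_fun_ideal V Q" unfolding poly_fun_ideal_def
  proof (intro conjI ballI)
    show "Q \<subseteq> poly_fun V" unfolding Q_def by blast
    show "(\<lambda>x. 0) \<in> Q" unfolding Q_def using poly_fun_idealD(2)[OF I] by (simp add: poly_fun_const)
  next
    fix p q assume "p \<in> Q" "q \<in> Q"
    then show "(\<lambda>x. p x + q x) \<in> Q" unfolding Q_def
      using poly_fun_idealD(3)[OF I, of "\<lambda>x. p x * G x" "\<lambda>x. q x * G x"] by (simp add: poly_fun_add distrib_right)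
  next
    fix p and q :: "(nat \<Rightarrow> 'k) \<Rightarrow> 'k" assume "p \<in> Q" "q \<in> poly_fun V"
    then show "(\<lambda>x. q x * p x) \<in> Q" unfolding Q_def
      using poly_fun_idealD(4)[OF I, of "\<lambda>x. p x * G x" q] by (simp add: poly_fun_mult mult.assoc)
  qed
  have noz: "\<exists>p\<in>Q. p x \<noteq> 0" for x
  proof (rule ccontr)
    assume "\<not> ?thesis"
    then have Qx: "p x = 0" if "p \<in> Q" for p using that by blast
    define y where "y i = (if i < r then x i else 0)" for i
    have xy: "p x = p y" if "p \<in> poly_fun V" for p by (rule poly_fun_cong[OF that]) (simp add: y_def)
    \<comment> \<open>\<open>Q\<close> contains the generators of \<open>I\<close>, so only zeros of
      \<open>F^N - id\<close> have to be examined.\<close>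
    have Phi0: "it.Phi x j = 0" if "j \<in> V" for j
    proof -
      have "(\<lambda>x. G x * it.Phi x j) \<in> I" by (rule poly_fun_idealD(4)[OF I genI[OF that] GPF])
      then have "(\<lambda>x. it.Phi x j) \<in> Q" unfolding Q_def using it.Phi_poly_fun[OF that] by (simp add: mult.commute)
      then show ?thesis by (rule Qx)
    qed
    have fy: "(fm ^^ N) y = y"
    proof
      fix i show "(fm ^^ N) y i = y i"
      proof (cases "i < r")
        case True
        have "(fm ^^ N) y i = (fm ^^ N) x i" by (rule fm_iter_cong[OF _ True]) (simp add: y_def)
        then show ?thesis using Phi0[of i] True by (simp add: it.Phi_def y_def)
      next
        case False then show ?thesis using fm_iter_outside[of y i N] by (simp add: y_def)
      qed
    qed
    show False
    proof (cases "\<exists>i<r. y i \<noteq> 0")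
      \<comment> \<open>The origin. As \<open>D ^ N \<ge> 2\<close>, the cofactors \<open>B\<close>
        vanish there, so \<open>F^N - id = C x\<close> with \<open>C = -1\<close> at 0. Cramer's
        rule puts \<open>det C * x 0\<close> into \<open>I\<close>, and \<open>x 0\<close> divides
        \<open>G\<close>.\<close>
      case False
      then have y0: "y = (\<lambda>i. 0)" by (auto simp: y_def fun_eq_iff)
      have DN: "D ^ N = Suc (D ^ N - 1)" using eD by simp
      have "\<forall>i. \<exists>B. i < r \<longrightarrow> (\<forall>j. hom_fun V (D ^ N - 1) (B j)) \<and> (\<forall>x. (fm ^^ N) x i = (\<Sum>j\<in>V. B j x * x j))"
      proof
        fix i show "\<exists>B. i < r \<longrightarrow> (\<forall>j. hom_fun V (D ^ N - 1) (B j)) \<and> (\<forall>x. (fm ^^ N) x i = (\<Sum>j\<in>V. B j x * x j))"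
          using hom_fun_Suc_split[OF finV fm_iter_hom_fun[of i N] DN] by (cases "i < r") simp_all
      qed
      from choice[OF this] obtain B where B: "\<forall>i. i < r \<longrightarrow> (\<forall>j. hom_fun V (D ^ N - 1) (B i j)) \<and> (\<forall>x. (fm ^^ N) x i = (\<Sum>j\<in>V. B i j x * x j))" ..
      define C where "C i j x = B i j x - (if i = j then 1 else 0)" for i j x
      have C: "C i j \<in> poly_fun V" if "i < r" for i j unfolding C_def by (rule poly_fun_diff[OF hom_fun_poly_fun poly_fun_const]) (use B that in blast)
      have CI: "(\<lambda>x. \<Sum>j<r. C i j x * x j) \<in> I" if i: "i < r" for i
      proof -
        have "(\<Sum>j<r. C i j x * x j) = it.Phi x i" for x
        proof -
          have "(\<Sum>j<r. (if i = j then 1 else 0) * x j) = (\<Sum>j<r. if i = j then x j else 0)" by (rule sum.cong) auto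
          then show ?thesis using B i by (simp add: C_def it.Phi_def left_diff_distrib sum_subtractf)
        qed
        then show ?thesis using genI[of i] i by simp
      qed
      define d where "d x = det (mat r r (\<lambda>(i, j). C i j x))" for x
      have dx0: "(\<lambda>x. d x * x 0) \<in> I" unfolding d_def
        by (rule poly_fun_ideal_cramer[where h="\<lambda>j x. x j", OF I _ CI]) (use C V0 in auto)
      have "(\<lambda>x. (G0 x ^ T * (\<Prod>s\<in>S. ell s x)) * (d x * x 0)) \<in> I"
        by (rule poly_fun_idealD(4)[OF I dx0], rule poly_fun_mult, rule poly_fun_power[OF hom_fun_poly_fun[OF G0HF]], rule poly_fun_prod)
          (use ell hom_fun_poly_fun in blast)
      moreover have "(\<lambda>x. (G0 x ^ T * (\<Prod>s\<in>S. ell s x)) * (d x * x 0)) = (\<lambda>x. d x * G x)"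
        by (rule ext) (simp add: G_def G0_def)
      ultimately have "(\<lambda>x. d x * G x) \<in> I" by (simp only:)
      moreover have dPF: "d \<in> poly_fun V" unfolding d_def by (rule poly_fun_det) (use C in blast)
      ultimately have "d x = 0" by (intro Qx) (simp add: Q_def)
      moreover have "d y = det (mat r r (\<lambda>(i, j). - (if i = j then 1 else 0 :: 'k)))"
      proof -
        have "B i j y = 0" if "i < r" for i j
        proof -
          have "hom_fun V (D ^ N - 1) (B i j)" using B that by blast
          from hom_fun_scale[OF this, of 0 y] y0 eD DN show ?thesis
            using iter_form_system[OF N1] unfolding form_system_def by (simp add: power_0_left)
        qed
        then have "mat r r (\<lambda>(i, j). C i j y) = mat r r (\<lambda>(i, j). - (if i = j then 1 else 0 :: 'k))"
          by (intro eq_matI) (auto simp: C_def)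
        then show ?thesis by (simp only: d_def)
      qed
      moreover have "mat r r (\<lambda>(i, j). - (if i = j then 1 else 0 :: 'k)) = (- 1) \<cdot>\<^sub>m 1\<^sub>m r" by (rule eq_matI) auto
      ultimately show False using xy[OF dPF] by (simp add: det_smult)
    next
      case True
      from cov[OF N1 fy True] obtain c s where s: "s \<in> S" "y = (\<lambda>i. c * s i)" by blast
      have c0: "c \<noteq> 0" using True s(2) by auto
      obtain i0 where i0: "i0 < r" "s i0 \<noteq> 0" using Snz[OF s(1)] by blast
      have fs: "(fm ^^ l) s = s" for l by (induction l) (simp_all add: Sfix[OF s(1)])
      \<comment> \<open>\<open>y\<close> is fixed by \<open>F^N\<close> without having to lie in
        \<open>S\<close>; comparison with the fixed vector \<open>s\<close> on its line gives this
        relation.\<close>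
      have cD: "c ^ (D ^ N) = c"
      proof -
        have "c * s i0 = c ^ (D ^ N) * s i0" using fm_iter_scale[OF i0(1), of N c s] fy s(2) fs by (metis (no_types))
        then show ?thesis using i0(2) by simp
      qed
      define d where "d x = det (mat r r (\<lambda>(i, j). A N i j x))" for x
      have dPF: "d \<in> poly_fun V" unfolding d_def by (rule poly_fun_det) (use A in blast)
      have AI: "(\<lambda>x. \<Sum>j<r. A N i j x * (F j x - x j)) \<in> I" if i: "i < r" for i
      proof -
        have "(\<lambda>x. \<Sum>j<r. A N i j x * (F j x - x j)) = (\<lambda>x. it.Phi x i)"
          unfolding it.Phi_def using A i by (intro ext) simp
        then show ?thesis using genI[of i] i by (simp only: lessThan_iff)
      qed
      have dF: "(\<lambda>x. d x * (F j x - x j)) \<in> I" if "j < r" for j unfolding d_def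
        by (rule poly_fun_ideal_cramer[OF I _ AI that]) (use A in blast)
      have "(\<lambda>x. \<Sum>j<r. t j x * (d x * (F j x - x j))) \<in> I"
        by (rule poly_fun_ideal_sum[OF I], rule poly_fun_idealD(4)[OF I dF]) (use t in auto)
      moreover have "(\<lambda>x. \<Sum>j<r. t j x * (d x * (F j x - x j))) = (\<lambda>x. d x * G x)"
        by (rule ext) (simp add: t(2) sum_distrib_left mult.left_commute)
      ultimately have "(\<lambda>x. d x * G x) \<in> I" by (simp only:)
      then obtain h where h: "\<forall>i\<in>V. h i \<in> poly_fun V" "(\<lambda>x. d x * G x) = (\<lambda>x. \<Sum>i\<in>V. h i x * it.Phi x i)"
        unfolding I_def by blast
      \<comment> \<open>Scaling by \<open>1 / c\<close> moves \<open>y\<close> to \<open>s\<close>.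
        It multiplies the components of \<open>F^N - id\<close> by \<open>1 / c\<close>, by
        \<open>cD\<close>, and \<open>G\<close> by a constant, so the relation for \<open>d\<close>
        turns into one for \<open>d'\<close>, whose value at \<open>y\<close> is that of
        \<open>d\<close> at \<open>s\<close>.\<close>
      define d' where "d' x = d (\<lambda>i. (1 / c) * x i)" for x
      have scPF: "(\<lambda>x. p (\<lambda>i. (1 / c) * x i)) \<in> poly_fun V" if "p \<in> poly_fun V" for p
        by (rule poly_fun_compose[OF that]) (intro poly_fun_cmult poly_fun_var)
      have "(\<lambda>x. d' x * G x) = (\<lambda>x. \<Sum>i\<in>V. (c ^ e * (1 / c) * h i (\<lambda>i. (1 / c) * x i)) * it.Phi x i)"
      proof
        fix x :: "nat \<Rightarrow> 'k"
        let ?x = "\<lambda>i. (1 / c) * x i"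
        have P: "it.Phi ?x i = (1 / c) * it.Phi x i" if "i \<in> V" for i
        proof -
          have "(1 / c) ^ (D ^ N) = 1 / c" using cD by (simp add: power_divide)
          then show ?thesis using fm_iter_scale[of i N "1 / c" x] that by (simp add: it.Phi_def right_diff_distrib diff_divide_distrib)
        qed
        have "d ?x * G ?x = (\<Sum>i\<in>V. h i ?x * it.Phi ?x i)" using h(2) by (rule fun_cong)
        moreover have Gx: "G ?x = (1 / c) ^ e * G x" by (rule hom_fun_scale[OF GHF])
        ultimately have calculation: "d ?x * ((1 / c) ^ e * G x) = (\<Sum>i\<in>V. h i ?x * it.Phi ?x i)" by (simp only:)
        then have "c ^ e * (d' x * ((1 / c) ^ e * G x)) = c ^ e * (\<Sum>i\<in>V. h i ?x * ((1 / c) * it.Phi x i))"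
        proof -
          have "(\<Sum>i\<in>V. h i ?x * it.Phi ?x i) = (\<Sum>i\<in>V. h i ?x * ((1 / c) * it.Phi x i))"
            by (rule sum.cong[OF refl]) (simp only: P)
          then show ?thesis using calculation unfolding d'_def by (simp only:)
        qed
        moreover have "c ^ e * (d' x * ((1 / c) ^ e * G x)) = d' x * G x" using c0 by (simp add: power_divide)
        ultimately show "d' x * G x = (\<Sum>i\<in>V. (c ^ e * (1 / c) * h i ?x) * it.Phi x i)"
          by (simp add: sum_distrib_left mult_ac)
      qed
      moreover have "\<forall>i\<in>V. (\<lambda>x. c ^ e * (1 / c) * h i (\<lambda>i. (1 / c) * x i)) \<in> poly_fun V"
        using h(1) by (intro ballI poly_fun_cmult scPF) blast
      ultimately have "(\<lambda>x. d' x * G x) \<in> I" unfolding I_def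
        by (intro CollectI exI[of _ "\<lambda>i x. c ^ e * (1 / c) * h i (\<lambda>i. (1 / c) * x i)"] conjI)
      moreover have d'poly_fun: "d' \<in> poly_fun V" unfolding d'_def by (rule scPF[OF dPF])
      ultimately have "d' x = 0" by (intro Qx) (simp add: Q_def)
      then have "d (\<lambda>i. (1 / c) * y i) = 0" using xy[OF d'poly_fun] by (simp add: d'_def)
      then have "d s = 0" using c0 by (simp add: s(2))
      then show False using det[OF s(1)] by (simp add: d_def)
    qed
  qed
  have "(\<lambda>x. 1) \<in> Q"
  proof (rule ccontr)
    assume "(\<lambda>x. 1) \<notin> Q"
    from nullstellensatz_zero[OF ac finV Q this] obtain x where "\<forall>p\<in>Q. p x = 0" ..
    with noz[of x] show False by blast
  qed
  then have "G \<in> I" unfolding Q_def by simp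
  then obtain h where h: "\<forall>i\<in>V. h i \<in> poly_fun V" "G = (\<lambda>x. \<Sum>i\<in>V. h i x * it.Phi x i)" unfolding I_def by blast
  have Gz: "G x = 0" for x
    by (rule it.low_degree_not_in_ideal[OF hom_fun_deg_le_fun[OF GHF] eD, of h]) (use h in auto)
  obtain z where "G0 z \<noteq> 0" using G0nz ..
  moreover have "G0 z ^ (T + 1) = 0" using Gz[of z] unfolding G_def .
  ultimately show False by simp
qed

end

context proj_endo
begin

lemma fm_iter_multiple:
  assumes x: "\<And>i. i \<ge> r \<Longrightarrow> x i = 0" and per: "(fm ^^ N) x = (\<lambda>i. c * x i)"
  shows "\<exists>c. (fm ^^ (N * k)) x = (\<lambda>i. c * x i)"
proof (induction k)
  case 0 show ?case by (rule exI[of _ 1]) simp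
next
  case (Suc k)
  then obtain b where b: "(fm ^^ (N * k)) x = (\<lambda>i. b * x i)" ..
  have "(fm ^^ (N * Suc k)) x i = b ^ (D ^ N) * c * x i" for i
  proof (cases "i < r")
    case True
    have "(fm ^^ (N * Suc k)) x i = (fm ^^ N) ((fm ^^ (N * k)) x) i" by (simp add: funpow_add)
    also have "\<dots> = b ^ (D ^ N) * (fm ^^ N) x i" unfolding b by (rule fm_iter_scale[OF True])
    finally show ?thesis using fun_cong[OF per, of i] by simp
  next
    case False then show ?thesis using fm_iter_outside[of x i "N * Suc k"] x by simp
  qed
  then show ?case by (intro exI[of _ "b ^ (D ^ N) * c"] ext)
qed

text \<open>Otherwise a common multiple \<open>L\<close> of the periods makes \<open>fm ^^ L\<close>
  fix every periodic line, and after rescaling a vector on each. All fixed vectors of its iterates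
  then lie on finitely many lines, which \<open>fixed_points_not_finite\<close> excludes.\<close>

lemma infinitely_many_periodic_lines:
  assumes S: "finite S"
  shows "\<exists>x. (\<forall>i\<ge>r. x i = 0) \<and> (\<exists>i<r. x i \<noteq> 0) \<and> (\<exists>N\<ge>1. \<exists>c. (fm ^^ N) x = (\<lambda>i. c * x i)) \<and>
    \<not> (\<exists>s\<in>S. \<exists>c. x = (\<lambda>i. c * s i))"
proof (rule ccontr)
  assume no: "\<not> ?thesis"
  define per where "per x \<longleftrightarrow> (\<forall>i\<ge>r. x i = 0) \<and> (\<exists>i<r. x i \<noteq> 0) \<and> (\<exists>N\<ge>1. \<exists>c. (fm ^^ N) x = (\<lambda>i. c * x i))" for x
  have cov: "\<exists>s\<in>S. \<exists>c. x = (\<lambda>i. c * s i)" if "per x" for x using no that unfolding per_def by blast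
  \<comment> \<open>\<open>S\<close> is arbitrary; only its periodic members have a period to
    contribute.\<close>
  define S' where "S' = {s \<in> S. per s}"
  have S': "finite S'" using S by (simp add: S'_def)
  have "\<forall>s. \<exists>N. s \<in> S' \<longrightarrow> N \<ge> 1 \<and> (\<exists>c. (fm ^^ N) s = (\<lambda>i. c * s i))" unfolding S'_def per_def by blast
  from choice[OF this] obtain M where M: "\<forall>s. s \<in> S' \<longrightarrow> M s \<ge> 1 \<and> (\<exists>c. (fm ^^ M s) s = (\<lambda>i. c * s i))" ..
  define L where "L = prod M S'"
  have "L \<noteq> 0" unfolding L_def using S' M by (auto simp: prod_zero_iff)
  then have L: "L \<ge> 1" by simp
  have supp: "s i = 0" if "s \<in> S'" "i \<ge> r" for s i using that unfolding S'_def per_def by blast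
  have "\<forall>s. \<exists>b. s \<in> S' \<longrightarrow> b \<noteq> 0 \<and> (fm ^^ L) (\<lambda>i. b * s i) = (\<lambda>i. b * s i)"
  proof
    fix s show "\<exists>b. s \<in> S' \<longrightarrow> b \<noteq> 0 \<and> (fm ^^ L) (\<lambda>i. b * s i) = (\<lambda>i. b * s i)"
    proof (cases "s \<in> S'")
      case True
      obtain c0 where c0: "(fm ^^ M s) s = (\<lambda>i. c0 * s i)" using M True by blast
      have "L = M s * prod M (S' - {s})" unfolding L_def using S' True by (simp add: prod.remove)
      then obtain la where la: "(fm ^^ L) s = (\<lambda>i. la * s i)"
        using fm_iter_multiple[of s "M s" c0 "prod M (S' - {s})", OF supp[OF True] c0] by auto
      have la0: "la \<noteq> 0"
      proof
        assume "la = 0"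
        then have "(fm ^^ L) s i = 0" for i using la by simp
        then have "s i = 0" if "i < r" for i using fm_iter_nz[of L s i] that by simp
        then show False using True unfolding S'_def per_def by blast
      qed
      have "D ^ 1 \<le> D ^ L" by (rule power_increasing) (use L D in auto)
      then have DL: "D ^ L - 1 \<ge> 1" "D ^ L = Suc (D ^ L - 1)" using D by auto
      \<comment> \<open>Then \<open>b^(D^L) * la = b\<close>, so \<open>b * s\<close> is a fixed
        vector on the line of \<open>s\<close>.\<close>
      from alg_closed_root[OF ac DL(1)] obtain b where b: "b ^ (D ^ L - 1) = 1 / la" ..
      have b0: "b \<noteq> 0" using b la0 DL(1) by (cases "D ^ L - 1") auto
      have "b ^ (D ^ L) = b / la" using b DL(2) by (metis power_Suc times_divide_eq_right mult_1_right)
      then have "(fm ^^ L) (\<lambda>i. b * s i) i = b * s i" for i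
        using fm_iter_scale[of i L b s] fun_cong[OF la, of i] la0 fm_iter_outside[of "\<lambda>i. b * s i" i L] supp[OF True]
        by (cases "i < r") simp_all
      then show ?thesis using b0 by blast
    qed simp
  qed
  from choice[OF this] obtain b where b: "\<forall>s. s \<in> S' \<longrightarrow> b s \<noteq> 0 \<and> (fm ^^ L) (\<lambda>i. b s * s i) = (\<lambda>i. b s * s i)" ..
  interpret fs: form_system V "D ^ L" "\<lambda>i x. (fm ^^ L) x i" by (rule iter_form_system[OF L])
  interpret it: proj_endo r "D ^ L" "\<lambda>i x. (fm ^^ L) x i" by unfold_locales (rule r)
  have itfm: "it.fm = fm ^^ L"
  proof (intro ext)
    fix x i
    obtain L' where "L = Suc L'" using L by (cases L) auto
    then have "(fm ^^ L) x i = fm ((fm ^^ L') x) i" by simp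
    then show "it.fm x i = (fm ^^ L) x i"
      by (cases "i < r") (simp_all only: it.fm_in it.fm_out fm_out simp_thms)
  qed
  show False
  proof (rule it.fixed_points_not_finite[of "(\<lambda>s i. b s * s i) ` S'"])
    show "finite ((\<lambda>s i. b s * s i) ` S')" using S' by simp
  next
    fix z assume "z \<in> (\<lambda>s i. b s * s i) ` S'"
    then show "it.fm z = z" unfolding itfm using b by auto
  next
    fix z assume "z \<in> (\<lambda>s i. b s * s i) ` S'"
    then obtain s where s: "s \<in> S'" "z = (\<lambda>i. b s * s i)" by blast
    then obtain i where "i < r" "s i \<noteq> 0" unfolding S'_def per_def by blast
    then show "\<exists>i<r. z i \<noteq> 0" using s b by auto
  next
    fix N x assume N: "1 \<le> N" and fxp: "(it.fm ^^ N) x = x" and xn: "\<exists>i<r. x i \<noteq> 0"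
    have fx: "(fm ^^ (L * N)) x = x" using fxp unfolding itfm by (simp add: funpow_mult)
    have LN: "L * N \<ge> 1" using L N by simp
    then obtain K where K: "L * N = Suc K" by (cases "L * N") auto
    have xs: "x i = 0" if "i \<ge> r" for i
      using fun_cong[OF fx, of i] that unfolding K by (simp add: fm_out)
    have "(fm ^^ (L * N)) x = (\<lambda>i. 1 * x i)" using fx by simp
    then have px: "per x" unfolding per_def using xs xn LN by blast
    then obtain s c where s: "s \<in> S" "x = (\<lambda>i. c * s i)" using cov by blast
    have c0: "c \<noteq> 0" using xn s by auto
    \<comment> \<open>\<open>s\<close> inherits periodicity from \<open>x = c * s\<close>, possibly
      with another multiplier.\<close>
    have ps: "per s" unfolding per_def
    proof (intro conjI)
      show "\<forall>i\<ge>r. s i = 0" using xs s(2) c0 by auto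
      show "\<exists>i<r. s i \<noteq> 0" using xn s(2) by auto
      have "(fm ^^ (L * N)) s = (\<lambda>i. (c / c ^ (D ^ (L * N))) * s i)"
      proof
        fix i show "(fm ^^ (L * N)) s i = (c / c ^ (D ^ (L * N))) * s i"
        proof (cases "i < r")
          case True
          have "c * s i = c ^ (D ^ (L * N)) * (fm ^^ (L * N)) s i"
            using fm_iter_scale[OF True, of "L * N" c s] fun_cong[OF fx, of i] s(2) by simp
          then show ?thesis using c0 by (simp add: field_simps)
        next
          case False
          have "s j = 0" if "j \<ge> r" for j using xs[OF that] s(2) c0 by simp
          then show ?thesis using False fm_iter_outside[of s i "L * N"] by simp
        qed
      qed
      then show "\<exists>N\<ge>1. \<exists>c. (fm ^^ N) s = (\<lambda>i. c * s i)" using LN by blast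
    qed
    then have sS': "s \<in> S'" using s(1) by (simp add: S'_def)
    have "x = (\<lambda>i. (c / b s) * (b s * s i))" using s(2) b sS' by auto
    then show "\<exists>c. \<exists>s\<in>(\<lambda>s i. b s * s i) ` S'. x = (\<lambda>i. c * s i)"
      using sS' by (intro exI[of _ "c / b s"] bexI[of _ "\<lambda>i. b s * s i"]) auto
  qed
qed

end

lemma hom_fun_mon_eval:
  assumes "Poly_Mapping.keys \<alpha> \<subseteq> V" shows "hom_fun V (mon_deg \<alpha>) (mon_eval \<alpha>)"
proof -
  have "hom_fun V (\<Sum>v\<in>Poly_Mapping.keys \<alpha>. Poly_Mapping.lookup \<alpha> v * 1) (\<lambda>x. \<Prod>v\<in>Poly_Mapping.keys \<alpha>. x v ^ Poly_Mapping.lookup \<alpha> v)"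
    by (rule hom_fun_prod, rule hom_fun_power, rule hom_fun_var) (use assms in blast)
  then show ?thesis by (simp add: mon_deg_def mon_eval_def[abs_def])
qed

lemma hom_fun_mp_eval:
  assumes "homog_in V m p" shows "hom_fun V m (mp_eval p)"
proof -
  have "hom_fun V m (\<lambda>x. \<Sum>\<alpha>\<in>Poly_Mapping.keys p. Poly_Mapping.lookup p \<alpha> * mon_eval \<alpha> x)"
  proof (rule hom_fun_sum, rule hom_fun_cmult)
    fix \<alpha> assume "\<alpha> \<in> Poly_Mapping.keys p"
    then have "Poly_Mapping.keys \<alpha> \<subseteq> V" "mon_deg \<alpha> = m" using assms unfolding homog_in_def by auto
    then show "hom_fun V m (mon_eval \<alpha>)" using hom_fun_mon_eval[of \<alpha> V] by simp
  qed
  then show ?thesis by (simp add: mp_eval_def[abs_def])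
qed

section \<open>Forms and their coefficients\<close>

text \<open>Gaussian elimination by one equation at a time: a pivot \<open>i0\<close> removes its
  unknown from the other equations and is solved for at the end.\<close>

lemma linear_system_nontrivial:
  fixes a :: "'i \<Rightarrow> 'j \<Rightarrow> 'k::field"
  assumes "finite J" "finite I" "card J < card I"
  shows "\<exists>c. (\<exists>i\<in>I. c i \<noteq> 0) \<and> (\<forall>j\<in>J. (\<Sum>i\<in>I. c i * a i j) = 0)"
  using assms
proof (induction J arbitrary: I a rule: finite_induct)
  case empty
  then obtain i where "i \<in> I" by fastforce
  then show ?case by (intro exI[of _ "\<lambda>i. 1"]) auto
next
  case (insert j J)
  show ?case
  proof (cases "\<forall>i\<in>I. a i j = 0")
    case True
    have "card J < card I" using insert by simp
    from insert.IH[OF insert.prems(1) this, of a] obtain c where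
      c: "(\<exists>i\<in>I. c i \<noteq> 0) \<and> (\<forall>j\<in>J. (\<Sum>i\<in>I. c i * a i j) = 0)" ..
    then show ?thesis using True by (intro exI[of _ c]) simp
  next
    case False
    then obtain i0 where i0: "i0 \<in> I" "a i0 j \<noteq> 0" by blast
    define I' where "I' = I - {i0}"
    have "finite I'" "card J < card I'" using insert i0 by (auto simp: I'_def)
    from insert.IH[OF this, of "\<lambda>i k. a i k - a i j / a i0 j * a i0 k"] obtain c where
      c: "(\<exists>i\<in>I'. c i \<noteq> 0) \<and> (\<forall>k\<in>J. (\<Sum>i\<in>I'. c i * (a i k - a i j / a i0 j * a i0 k)) = 0)" ..
    define d where "d = c(i0 := - (\<Sum>i\<in>I'. c i * a i j) / a i0 j)"
    have split: "(\<Sum>i\<in>I. d i * a i k) = d i0 * a i0 k + (\<Sum>i\<in>I'. c i * a i k)" for k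
    proof -
      have "(\<Sum>i\<in>I'. d i * a i k) = (\<Sum>i\<in>I'. c i * a i k)" by (rule sum.cong) (auto simp: d_def I'_def)
      then show ?thesis unfolding I'_def using i0 insert.prems(1) by (simp add: sum.remove)
    qed
    have "\<exists>i\<in>I. d i \<noteq> 0" using c by (auto simp: d_def I'_def)
    moreover have "(\<Sum>i\<in>I. d i * a i j) = 0" unfolding split using i0 by (simp add: d_def)
    moreover have "(\<Sum>i\<in>I. d i * a i k) = 0" if "k \<in> J" for k
    proof -
      have "(\<Sum>i\<in>I'. c i * (a i k - a i j / a i0 j * a i0 k)) = 0" using c that by blast
      then have "(\<Sum>i\<in>I'. c i * a i k) = (\<Sum>i\<in>I'. c i * a i j * (a i0 k / a i0 j))"
        by (simp add: right_diff_distrib sum_subtractf mult_ac)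
      also have "\<dots> = (\<Sum>i\<in>I'. c i * a i j) * (a i0 k / a i0 j)" by (rule sum_distrib_right[symmetric])
      finally show ?thesis unfolding split by (simp add: d_def)
    qed
    ultimately show ?thesis by (intro exI[of _ d]) auto
  qed
qed

text \<open>Induction on the variables: as a polynomial in the value of \<open>y\<close>, the sum
  has coefficients that collect the monomials with equal exponent of \<open>y\<close>.\<close>

lemma monomials_independent:
  fixes c :: "'e \<Rightarrow> 'k::field_char_0" and E :: "'e \<Rightarrow> 'v \<Rightarrow> nat"
  assumes "finite V" "finite A" "\<And>a b. a \<in> A \<Longrightarrow> b \<in> A \<Longrightarrow> (\<And>v. v \<in> V \<Longrightarrow> E a v = E b v) \<Longrightarrow> a = b"
    and "\<And>x. (\<Sum>a\<in>A. c a * (\<Prod>v\<in>V. x v ^ E a v)) = 0"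
  shows "\<forall>a\<in>A. c a = 0"
  using assms
proof (induction V arbitrary: A rule: finite_induct)
  case empty
  show ?case
  proof
    fix a assume a: "a \<in> A"
    then have "A = {a}" using empty.prems(2) by blast
    then show "c a = 0" using empty.prems(3) by simp
  qed
next
  case (insert y V)
  show ?case
  proof
    fix a0 assume a0: "a0 \<in> A"
    define B where "B = {a \<in> A. E a y = E a0 y}"
    have "\<forall>a\<in>B. c a = 0"
    proof (rule insert.IH)
      show "finite B" using insert.prems(1) by (simp add: B_def)
      show "a = b" if "a \<in> B" "b \<in> B" "\<And>v. v \<in> V \<Longrightarrow> E a v = E b v" for a b
      proof (rule insert.prems(2))
        show "a \<in> A" "b \<in> A" using that by (auto simp: B_def)
        show "E a v = E b v" if "v \<in> insert y V" for v
          using that \<open>a \<in> B\<close> \<open>b \<in> B\<close> \<open>\<And>v. v \<in> V \<Longrightarrow> E a v = E b v\<close> by (cases "v = y") (auto simp: B_def)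
      qed
      show "(\<Sum>a\<in>B. c a * (\<Prod>v\<in>V. x v ^ E a v)) = 0" for x
      proof -
        let ?m = "\<lambda>a. c a * (\<Prod>v\<in>V. x v ^ E a v)"
        define R where "R = (\<Sum>a\<in>A. monom (?m a) (E a y))"
        have "poly R t = 0" for t
        proof -
          have "(\<Prod>v\<in>insert y V. (x(y := t)) v ^ E a v) = t ^ E a y * (\<Prod>v\<in>V. x v ^ E a v)" for a
          proof -
            have "(\<Prod>v\<in>V. (x(y := t)) v ^ E a v) = (\<Prod>v\<in>V. x v ^ E a v)"
              by (rule prod.cong) (use insert.hyps in auto)
            then show ?thesis using insert.hyps by simp
          qed
          then show ?thesis using insert.prems(3)[of "x(y := t)"] by (simp add: R_def poly_sum poly_monom mult_ac)
        qed
        then have "R = 0" by (rule poly_eq_0_if_everywhere_0)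
        then have "0 = coeff R (E a0 y)" by simp
        also have "\<dots> = (\<Sum>a\<in>A. if E a y = E a0 y then ?m a else 0)"
          unfolding R_def coeff_sum by (rule sum.cong) auto
        also have "\<dots> = (\<Sum>a\<in>B. ?m a)" unfolding B_def by (rule sum.inter_filter[symmetric, OF insert.prems(1)])
        finally show ?thesis by simp
      qed
    qed
    then show "c a0 = 0" using a0 by (simp add: B_def)
  qed
qed

lemma card_exps: assumes "finite V" shows "card (exps V T) = (T + 1) ^ card V"
proof -
  have "bij_betw (\<lambda>e. restrict e V) (exps V T) (PiE V (\<lambda>_. {..T}))"
    by (rule bij_betw_byWitness[where f' = "\<lambda>g v. if v \<in> V then g v else 0"])
      (auto simp: exps_def fun_eq_iff PiE_def extensional_def)
  then have "card (exps V T) = card (PiE V (\<lambda>_. {..T}))" by (rule bij_betw_same_card)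
  then show ?thesis using assms by (simp add: card_PiE)
qed

text \<open>With fewer parameters than coordinates the image is not dense. There are
  \<open>(T + 1)^card Y\<close> monomials in the \<open>psi y\<close> with exponents up to
  \<open>T\<close>, but they lie in the span of \<open>(M + 1)^card X\<close> monomials with
  \<open>M\<close> linear in \<open>T\<close>. For large \<open>T\<close> there is a linear
  relation, and this is \<open>H\<close>.\<close>

lemma polynomial_image_in_hypersurface:
  fixes psi :: "'y \<Rightarrow> ('x \<Rightarrow> 'k::field_char_0) \<Rightarrow> 'k"
  assumes X: "finite X" and Y: "finite Y" and card: "card X < card Y"
    and psi: "\<And>y. y \<in> Y \<Longrightarrow> psi y \<in> poly_fun X"
  shows "\<exists>H\<in>poly_fun Y. (\<exists>z. H z \<noteq> 0) \<and> (\<forall>x. H (\<lambda>y. psi y x) = 0)"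
proof -
  have "\<forall>y. \<exists>N. y \<in> Y \<longrightarrow> deg_le_fun X N (psi y)" using poly_fun_deg_le_fun psi by blast
  from choice[OF this] obtain N where N: "\<forall>y. y \<in> Y \<longrightarrow> deg_le_fun X (N y) (psi y)" ..
  define K where "K = sum N Y"
  define p where "p = card X"
  \<comment> \<open>Large enough for \<open>(M + 1)^p \<le> ((K + 1) * (T + 1))^p = T * (T + 1)^p <
    (T + 1)^(p + 1)\<close>.\<close>
  define T where "T = (K + 1) ^ p"
  define M where "M = K * T"
  define mon where "mon e x = (\<Prod>y\<in>Y. psi y x ^ e y)" for e :: "'y \<Rightarrow> nat" and x
  have "\<forall>e. \<exists>c. e \<in> exps Y T \<longrightarrow> mon e = (\<lambda>x. \<Sum>f\<in>exps X M. c f * (\<Prod>v\<in>X. x v ^ f v))"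
  proof
    fix e
    show "\<exists>c. e \<in> exps Y T \<longrightarrow> mon e = (\<lambda>x. \<Sum>f\<in>exps X M. c f * (\<Prod>v\<in>X. x v ^ f v))"
    proof (cases "e \<in> exps Y T")
      case True
      have DFp: "deg_le_fun X (\<Sum>y\<in>S. e y * N y) (\<lambda>x. \<Prod>y\<in>S. psi y x ^ e y)" if "finite S" "S \<subseteq> Y" for S
        using that
      proof (induction S rule: finite_induct)
        case empty show ?case using hom_fun_deg_le_fun[OF hom_fun_const[of X 1]] by simp
      next
        case (insert y S)
        have "deg_le_fun X (e y * N y) (\<lambda>x. psi y x ^ e y)" by (rule deg_le_fun_power) (use N insert in simp)
        from deg_le_fun_mult[OF this insert.IH] insert show ?case by simp
      qed
      have "(\<Sum>y\<in>Y. e y * N y) \<le> (\<Sum>y\<in>Y. T * N y)" by (rule sum_mono) (use True in \<open>auto simp: exps_def\<close>)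
      then have "(\<Sum>y\<in>Y. e y * N y) \<le> M" by (simp add: M_def K_def sum_distrib_left mult.commute)
      from deg_le_fun_span[OF X DFp[OF Y order.refl] this] show ?thesis unfolding mon_def by blast
    qed simp
  qed
  from choice[OF this] obtain a where a: "\<forall>e. e \<in> exps Y T \<longrightarrow> mon e = (\<lambda>x. \<Sum>f\<in>exps X M. a e f * (\<Prod>v\<in>X. x v ^ f v))" ..
  have "card (exps X M) < card (exps Y T)"
  proof -
    have "M + 1 \<le> (K + 1) * (T + 1)" by (simp add: M_def)
    then have "(M + 1) ^ p \<le> ((K + 1) * (T + 1)) ^ p" by (rule power_mono) simp
    also have "\<dots> = T * (T + 1) ^ p" by (simp only: power_mult_distrib T_def)
    also have "\<dots> < (T + 1) * (T + 1) ^ p" by simp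
    also have "\<dots> = (T + 1) ^ Suc p" by simp
    also have "\<dots> \<le> (T + 1) ^ card Y" by (rule power_increasing) (use card p_def in auto)
    finally show ?thesis by (simp add: card_exps[OF X] card_exps[OF Y] p_def)
  qed
  from linear_system_nontrivial[OF finite_exps[OF X] finite_exps[OF Y] this, of a] obtain c where
    c: "(\<exists>e\<in>exps Y T. c e \<noteq> 0) \<and> (\<forall>f\<in>exps X M. (\<Sum>e\<in>exps Y T. c e * a e f) = 0)" ..
  define H where "H z = (\<Sum>e\<in>exps Y T. c e * (\<Prod>y\<in>Y. z y ^ e y))" for z :: "'y \<Rightarrow> 'k"
  have "H \<in> poly_fun Y" unfolding H_def by (intro poly_fun_sum poly_fun_cmult poly_fun_prod poly_fun_power poly_fun_var)
  moreover have "\<exists>z. H z \<noteq> 0"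
  proof (rule ccontr)
    assume "\<not> ?thesis"
    then have H0: "(\<Sum>e\<in>exps Y T. c e * (\<Prod>y\<in>Y. z y ^ e y)) = 0" for z unfolding H_def by blast
    have "\<forall>e\<in>exps Y T. c e = 0"
    proof (rule monomials_independent[where E="\<lambda>e. e", OF Y finite_exps[OF Y] _ H0])
      fix e f assume ef: "e \<in> exps Y T" "f \<in> exps Y T" "\<And>y. y \<in> Y \<Longrightarrow> e y = f y"
      show "e = f"
      proof
        fix y show "e y = f y" using ef by (cases "y \<in> Y") (auto simp: exps_def)
      qed
    qed
    then show False using c by blast
  qed
  moreover have "H (\<lambda>y. psi y x) = 0" for x
  proof -
    have "H (\<lambda>y. psi y x) = (\<Sum>e\<in>exps Y T. c e * (\<Sum>f\<in>exps X M. a e f * (\<Prod>v\<in>X. x v ^ f v)))"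
      unfolding H_def
    proof (rule sum.cong[OF refl])
      fix e assume "e \<in> exps Y T"
      then have "mon e = (\<lambda>x. \<Sum>f\<in>exps X M. a e f * (\<Prod>v\<in>X. x v ^ f v))" using a by blast
      then show "c e * (\<Prod>y\<in>Y. psi y x ^ e y) = c e * (\<Sum>f\<in>exps X M. a e f * (\<Prod>v\<in>X. x v ^ f v))"
        unfolding mon_def by (auto dest: fun_cong[of _ _ x])
    qed
    also have "\<dots> = (\<Sum>f\<in>exps X M. (\<Sum>e\<in>exps Y T. c e * a e f) * (\<Prod>v\<in>X. x v ^ f v))"
      by (simp only: sum_distrib_left sum_distrib_right mult.assoc) (rule sum.swap)
    also have "\<dots> = 0" using c by simp
    finally show ?thesis .
  qed
  ultimately show ?thesis by blast
qed

text \<open>The coordinates are moved into \<open>T\<close> one after the other; each time a nonzero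
  univariate polynomial has a non-root in \<open>T\<close>.\<close>

lemma poly_fun_nonzero_on_grid:
  fixes p :: "('v \<Rightarrow> 'k::field_char_0) \<Rightarrow> 'k"
  assumes "finite X" "p \<in> poly_fun X" "p a \<noteq> 0" "infinite T"
  shows "\<exists>t. (\<forall>v\<in>X. t v \<in> T) \<and> p t \<noteq> 0"
proof -
  have "\<exists>t. (\<forall>v\<in>S. t v \<in> T) \<and> p t \<noteq> 0" if "finite S" for S
    using that
  proof (induction S rule: finite_induct)
    case empty show ?case using assms(3) by (intro exI[of _ a]) simp
  next
    case (insert y S)
    then obtain t where t: "\<forall>v\<in>S. t v \<in> T" "p t \<noteq> 0" by (elim exE conjE)
    from poly_fun_fiber[OF assms(2), of t y] obtain P where P: "\<forall>s. p (t(y := s)) = poly P s" ..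
    have "P \<noteq> 0" using P[rule_format, of "t y"] t(2) by auto
    then obtain s where s: "s \<in> T" "poly P s \<noteq> 0" using poly_zero_if_zero_on_infinite[OF assms(4), of P] by blast
    have "\<forall>v\<in>insert y S. (t(y := s)) v \<in> T" using s t(1) by simp
    moreover have "p (t(y := s)) \<noteq> 0" using s(2) P by simp
    ultimately show ?case by (intro exI[of _ "t(y := s)"] conjI)
  qed
  from this[OF assms(1)] show ?thesis .
qed

lemma mon_eval_prod:
  assumes "finite V" "Poly_Mapping.keys \<alpha> \<subseteq> V"
  shows "mon_eval \<alpha> x = (\<Prod>v\<in>V. x v ^ Poly_Mapping.lookup \<alpha> v)"
  unfolding mon_eval_def by (rule prod.mono_neutral_left) (use assms in \<open>auto simp: in_keys_iff\<close>)

text \<open>The bridge from formal polynomials to polynomial functions: distinct monomials are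
  linearly independent as functions.\<close>

lemma mp_eval_nonzero:
  fixes p :: "('v, 'k::field_char_0) mpoly"
  assumes "p \<noteq> 0"
  shows "\<exists>x. mp_eval p x \<noteq> 0"
proof (rule ccontr)
  assume "\<not> ?thesis"
  then have z: "mp_eval p x = 0" for x by blast
  define V where "V = (\<Union>\<alpha>\<in>Poly_Mapping.keys p. Poly_Mapping.keys \<alpha>)"
  have V: "finite V" unfolding V_def by simp
  have "\<forall>\<alpha>\<in>Poly_Mapping.keys p. Poly_Mapping.lookup p \<alpha> = 0"
  proof (rule monomials_independent[where E=Poly_Mapping.lookup, OF V])
    fix a b assume a: "a \<in> Poly_Mapping.keys p" "b \<in> Poly_Mapping.keys p"
      "\<And>v. v \<in> V \<Longrightarrow> Poly_Mapping.lookup a v = Poly_Mapping.lookup b v"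
    show "a = b"
    proof (rule poly_mapping_eqI)
      fix v show "Poly_Mapping.lookup a v = Poly_Mapping.lookup b v"
        using a by (cases "v \<in> V") (auto simp: V_def in_keys_iff)
    qed
  next
    fix x
    have "(\<Sum>a\<in>Poly_Mapping.keys p. Poly_Mapping.lookup p a * (\<Prod>v\<in>V. x v ^ Poly_Mapping.lookup a v)) = mp_eval p x"
      unfolding mp_eval_def by (rule sum.cong[OF refl]) (subst mon_eval_prod[OF V], auto simp: V_def)
    then show "(\<Sum>a\<in>Poly_Mapping.keys p. Poly_Mapping.lookup p a * (\<Prod>v\<in>V. x v ^ Poly_Mapping.lookup a v)) = 0" using z by simp
  qed simp
  then have "p = 0" by (intro poly_mapping_eqI) (auto simp: in_keys_iff)
  then show False using assms by simp
qed

lemma mon_deg_sum: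
  assumes "finite V" "Poly_Mapping.keys \<alpha> \<subseteq> V"
  shows "mon_deg \<alpha> = (\<Sum>v\<in>V. Poly_Mapping.lookup \<alpha> v)"
  unfolding mon_deg_def by (rule sum.mono_neutral_left) (use assms in \<open>auto simp: in_keys_iff\<close>)

lemma finite_mons: "finite (mons n m)"
proof (rule inj_on_finite[where f = Poly_Mapping.lookup and B = "exps {..n} m"])
  show "inj_on Poly_Mapping.lookup (mons n m)" by (auto intro!: inj_onI poly_mapping_eqI)
  show "Poly_Mapping.lookup ` mons n m \<subseteq> exps {..n} m"
  proof (rule image_subsetI)
    fix \<alpha> :: "nat \<Rightarrow>\<^sub>0 nat" assume "\<alpha> \<in> mons n m"
    then have k: "Poly_Mapping.keys \<alpha> \<subseteq> {..n}" "mon_deg \<alpha> = m" by (auto simp: mons_def)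
    have "Poly_Mapping.lookup \<alpha> v \<le> m" if "v \<in> {..n}" for v
      using member_le_sum[OF that, of "Poly_Mapping.lookup \<alpha>"] mon_deg_sum[OF _ k(1)] k(2) by simp
    moreover have "Poly_Mapping.lookup \<alpha> v = 0" if "v \<notin> {..n}" for v using k(1) that by (auto simp: in_keys_iff)
    ultimately show "Poly_Mapping.lookup \<alpha> \<in> exps {..n} m" by (simp add: exps_def)
  qed
  show "finite (exps {..n} m)" by (rule finite_exps) simp
qed

text \<open>Forms are parametrized by arbitrary functions, of which only the values on
  \<open>mons n m\<close> matter. The forms thus make up an affine space with
  \<open>poly_fun (mons n m)\<close> as its coordinate ring.\<close>

definition coeff_form :: "nat \<Rightarrow> nat \<Rightarrow> ((nat \<Rightarrow>\<^sub>0 nat) \<Rightarrow> 'k::comm_ring_1) \<Rightarrow> (nat, 'k) mpoly" where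
  "coeff_form n m v = (\<Sum>\<alpha>\<in>mons n m. Poly_Mapping.single \<alpha> (v \<alpha>))"

definition form_eval :: "nat \<Rightarrow> nat \<Rightarrow> ((nat \<Rightarrow>\<^sub>0 nat) \<Rightarrow> 'k::comm_ring_1) \<Rightarrow> (nat \<Rightarrow> 'k) \<Rightarrow> 'k" where
  "form_eval n m v x = (\<Sum>\<alpha>\<in>mons n m. v \<alpha> * mon_eval \<alpha> x)"

lemma lookup_coeff_form: "Poly_Mapping.lookup (coeff_form n m v) \<alpha> = (if \<alpha> \<in> mons n m then v \<alpha> else 0)"
proof -
  have "Poly_Mapping.lookup (coeff_form n m v) \<alpha> = (\<Sum>\<beta>\<in>mons n m. if \<beta> = \<alpha> then v \<beta> else 0)"
    unfolding coeff_form_def lookup_sum by (rule sum.cong) (auto simp: lookup_single when_def)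
  then show ?thesis using finite_mons by simp
qed

lemma keys_coeff_form: "Poly_Mapping.keys (coeff_form n m v) \<subseteq> mons n m"
  by (auto simp: in_keys_iff lookup_coeff_form split: if_splits)

lemma form_coeff_form: "form n m (coeff_form n m v)"
  using keys_coeff_form[of n m v] by (auto simp: form_def homog_in_def mons_def)

lemma mp_eval_coeff_form: "mp_eval (coeff_form n m v) x = form_eval n m v x"
proof -
  have "mp_eval (coeff_form n m v) x = (\<Sum>\<alpha>\<in>mons n m. Poly_Mapping.lookup (coeff_form n m v) \<alpha> * mon_eval \<alpha> x)"
    unfolding mp_eval_def
    by (rule sum.mono_neutral_left[OF finite_mons keys_coeff_form]) (simp add: in_keys_iff)
  then show ?thesis by (simp add: form_eval_def lookup_coeff_form)
qed

lemma hom_fun_form_eval: "hom_fun {..n} m (form_eval n m v)"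
  using hom_fun_mp_eval[of "{..n}" m "coeff_form n m v"] form_coeff_form[of n m v]
  by (simp add: form_def mp_eval_coeff_form[abs_def])

lemma poly_fun_form_eval_coeffs: "(\<lambda>v. form_eval n m v x) \<in> poly_fun (mons n m)"
  unfolding form_eval_def by (intro poly_fun_sum poly_fun_mult poly_fun_var poly_fun_const)

lemma form_eval_add_mult: "form_eval n m (\<lambda>\<alpha>. v \<alpha> + t * w \<alpha>) x = form_eval n m v x + t * form_eval n m w x"
  by (simp add: form_eval_def distrib_right sum.distrib sum_distrib_left mult.assoc)

lemma hom_fun_is_form_eval:
  fixes h :: "(nat \<Rightarrow> 'k::comm_ring_1) \<Rightarrow> 'k"
  assumes "hom_fun {..n} m h"
  shows "\<exists>v. h = form_eval n m v"
proof -
  have "monomial_sum {..n} m h" by (rule hom_fun_monomial_sum[OF _ assms]) simp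
  then show ?thesis
  proof (induction rule: monomial_sum.induct)
    case monomial_sum_zero show ?case by (rule exI[of _ "\<lambda>_. 0"]) (simp add: form_eval_def[abs_def])
  next
    case (monomial_sum_add p e c)
    then obtain v where v: "p = form_eval n m v" by blast
    define e' where "e' u = (if u \<le> n then e u else 0)" for u
    have fe: "finite {u. e' u \<noteq> 0}" by (rule finite_subset[of _ "{..n}"]) (auto simp: e'_def)
    define \<alpha> where "\<alpha> = Abs_poly_mapping e'"
    have la: "Poly_Mapping.lookup \<alpha> = e'" unfolding \<alpha>_def using fe by (simp add: Abs_poly_mapping_inverse)
    have ka: "Poly_Mapping.keys \<alpha> \<subseteq> {..n}" by (auto simp: in_keys_iff la e'_def split: if_splits)
    have "mon_deg \<alpha> = m" using mon_deg_sum[OF _ ka] monomial_sum_add(2) by (simp add: la e'_def)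
    then have am: "\<alpha> \<in> mons n m" using ka by (simp add: mons_def)
    have me: "mon_eval \<alpha> x = (\<Prod>u\<in>{..n}. x u ^ e u)" for x :: "nat \<Rightarrow> 'k"
      unfolding mon_eval_prod[OF finite_atMost ka] la by (rule prod.cong) (auto simp: e'_def)
    have "c * (\<Prod>u\<in>{..n}. x u ^ e u) + p x = form_eval n m (\<lambda>\<beta>. v \<beta> + (if \<beta> = \<alpha> then c else 0)) x" for x
    proof -
      have "(\<Sum>\<beta>\<in>mons n m. (if \<beta> = \<alpha> then c else 0) * mon_eval \<beta> x) = (\<Sum>\<beta>\<in>mons n m. if \<beta> = \<alpha> then c * mon_eval \<beta> x else 0)"
        by (rule sum.cong) auto
      also have "\<dots> = c * (\<Prod>u\<in>{..n}. x u ^ e u)" using finite_mons am me by simp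
      finally show ?thesis unfolding v form_eval_def by (simp add: distrib_right sum.distrib)
    qed
    then show ?case by (intro exI[of _ "\<lambda>\<beta>. v \<beta> + (if \<beta> = \<alpha> then c else 0)"] ext)
  qed
qed

section \<open>Hypersurfaces through periodic points\<close>

lemma endomorphism_proj_endo:
  fixes f :: "nat \<Rightarrow> (nat, 'k::field_char_0) mpoly"
  assumes ac: "alg_closed_field TYPE('k)" and "n \<ge> 1" "d \<ge> 2" and f: "endomorphism n d f"
  shows "proj_endo (Suc n) d (\<lambda>i. mp_eval (f i))"
proof
  show "hom_fun {..<Suc n} d (mp_eval (f i))" if "i \<in> {..<Suc n}" for i
    using f that hom_fun_mp_eval[of "{..n}" d "f i"] unfolding endomorphism_def form_def lessThan_Suc_atMost by auto
next
  fix x :: "nat \<Rightarrow> 'k" and i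
  assume z: "\<And>i. i \<in> {..<Suc n} \<Longrightarrow> mp_eval (f i) x = 0" and i: "i \<in> {..<Suc n}"
  define y where "y j = (if j \<le> n then x j else 0)" for j
  show "x i = 0"
  proof (rule ccontr)
    assume "x i \<noteq> 0"
    then have "y \<in> Pts n" using i unfolding Pts_def y_def by auto
    then obtain j where j: "j \<le> n" "mp_eval (f j) y \<noteq> 0" using f unfolding endomorphism_def by blast
    have "mp_eval (f j) \<in> poly_fun {..n}" using f j(1) hom_fun_poly_fun[OF hom_fun_mp_eval] unfolding endomorphism_def form_def by blast
    then have "mp_eval (f j) y = mp_eval (f j) x" by (rule poly_fun_cong) (simp add: y_def)
    then show False using z[of j] j by simp
  qed
qed (use assms in auto)

lemma proj_endo_fm_endo_map:
  assumes "proj_endo (Suc n) d (\<lambda>i. mp_eval (f i))"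
  shows "proj_endo.fm (Suc n) (\<lambda>i. mp_eval (f i)) = endo_map n f"
  by (intro ext) (simp add: proj_endo.fm_def[OF assms] endo_map_def)

text \<open>Periodicity is meant in projective space, hence the multiplier \<open>c\<close>; for the
  lift of an endomorphism it cannot be 0.\<close>

definition periodic_pts :: "nat \<Rightarrow> ((nat \<Rightarrow> 'k) \<Rightarrow> nat \<Rightarrow> 'k) \<Rightarrow> (nat \<Rightarrow> 'k::comm_ring_1) set" where
  "periodic_pts n F = {x \<in> Pts n. \<exists>N\<ge>1. \<exists>c. (F ^^ N) x = (\<lambda>i. c * x i)}"

lemma periodic_pts_exist:
  fixes f :: "nat \<Rightarrow> (nat, 'k::field_char_0) mpoly"
  assumes "alg_closed_field TYPE('k)" "n \<ge> 1" "d \<ge> 2" "endomorphism n d f" and S: "finite S"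
  shows "\<exists>x\<in>periodic_pts n (endo_map n f). \<not> (\<exists>s\<in>S. \<exists>c. x = (\<lambda>i. c * s i))"
proof -
  have pe: "proj_endo (Suc n) d (\<lambda>i. mp_eval (f i))" by (rule endomorphism_proj_endo[OF assms(1-4)])
  from proj_endo.infinitely_many_periodic_lines[OF pe S, unfolded proj_endo_fm_endo_map[OF pe]] obtain x where
    "(\<forall>i\<ge>Suc n. x i = 0) \<and> (\<exists>i<Suc n. x i \<noteq> 0) \<and> (\<exists>N\<ge>1. \<exists>c. (endo_map n f ^^ N) x = (\<lambda>i. c * x i)) \<and>
    \<not> (\<exists>s\<in>S. \<exists>c. x = (\<lambda>i. c * s i))" ..
  then have x: "\<forall>i\<ge>Suc n. x i = 0" "\<exists>i<Suc n. x i \<noteq> 0" "\<exists>N\<ge>1. \<exists>c. (endo_map n f ^^ N) x = (\<lambda>i. c * x i)"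
    "\<not> (\<exists>s\<in>S. \<exists>c. x = (\<lambda>i. c * s i))" by blast+
  have "x \<in> Pts n" using x(1,2) unfolding Pts_def by (auto simp: less_Suc_eq_le Suc_le_eq)
  then have "x \<in> periodic_pts n (endo_map n f)" using x(3) unfolding periodic_pts_def by blast
  then show ?thesis using x(4) by blast
qed

lemma Pts_scale: "x \<in> Pts n \<Longrightarrow> c \<noteq> 0 \<Longrightarrow> (\<lambda>i. c * x i) \<in> Pts n" for c :: "'k::field"
  unfolding Pts_def by auto

lemma zclosed_scale:
  fixes c :: "'k::field"
  assumes "zclosed n Z" "x \<in> Z" "c \<noteq> 0"
  shows "(\<lambda>i. c * x i) \<in> Z"
proof -
  obtain S where S: "\<forall>G\<in>S. \<exists>e. homog_in {..n} e G" "Z = {x \<in> Pts n. \<forall>G\<in>S. mp_eval G x = 0}"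
    using assms(1) unfolding zclosed_def by blast
  have "mp_eval G (\<lambda>i. c * x i) = 0" if G: "G \<in> S" for G
  proof -
    obtain e where "homog_in {..n} e G" using S(1) G by blast
    then have "mp_eval G (\<lambda>i. c * x i) = c ^ e * mp_eval G x" by (intro hom_fun_scale[OF hom_fun_mp_eval])
    then show ?thesis using S(2) assms(2) G by simp
  qed
  then show ?thesis using S(2) assms(2,3) Pts_scale by blast
qed

lemma periodic_pts_scale:
  fixes f :: "nat \<Rightarrow> (nat, 'k::field_char_0) mpoly"
  assumes pe: "proj_endo (Suc n) d (\<lambda>i. mp_eval (f i))"
    and x: "x \<in> periodic_pts n (endo_map n f)" and c: "c \<noteq> 0"
  shows "(\<lambda>i. c * x i) \<in> periodic_pts n (endo_map n f)"
proof -
  interpret proj_endo "Suc n" d "\<lambda>i. mp_eval (f i)" by (rule pe)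
  note fm = proj_endo_fm_endo_map[OF pe]
  obtain N b where N: "N \<ge> 1" "(fm ^^ N) x = (\<lambda>i. b * x i)" and xP: "x \<in> Pts n" using x unfolding periodic_pts_def fm by blast
  have x0: "x i = 0" if "i \<ge> Suc n" for i using xP that unfolding Pts_def by simp
  have "(fm ^^ N) (\<lambda>i. c * x i) i = (c ^ (d ^ N) * b / c) * (c * x i)" for i
  proof (cases "i < Suc n")
    case True then show ?thesis using fm_iter_scale[OF True, of N c x] fun_cong[OF N(2), of i] c by simp
  next
    case False
    then show ?thesis using fm_iter_outside[of "\<lambda>i. c * x i" i N] x0 by simp
  qed
  then have "(fm ^^ N) (\<lambda>i. c * x i) = (\<lambda>i. (c ^ (d ^ N) * b / c) * (c * x i))" by (rule ext)
  then show ?thesis using N(1) Pts_scale[OF xP c] unfolding periodic_pts_def fm by blast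
qed

text \<open>A periodic point of \<open>Z\<close> with period \<open>N\<close> lies in the image of
  \<open>Z\<close> under each iterate whose order is a multiple of \<open>N\<close>. The indices
  \<open>0, N, 2N, ...\<close> therefore work for all \<open>r\<close> alike.\<close>

lemma dyn_improperI:
  fixes f :: "nat \<Rightarrow> (nat, 'k::field_char_0) mpoly"
  assumes pe: "proj_endo (Suc n) d (\<lambda>i. mp_eval (f i))"
    and comp: "\<And>Z. irr_component n H Z \<Longrightarrow> Z \<inter> periodic_pts n (endo_map n f) \<noteq> {}"
  shows "dyn_improper n (endo_map n f) H"
  unfolding dyn_improper_def improper_def
proof (intro allI impI)
  interpret proj_endo "Suc n" d "\<lambda>i. mp_eval (f i)" by (rule pe)
  note fm = proj_endo_fm_endo_map[OF pe]
  fix r :: nat and Z assume r: "r > 0" and Z: "irr_component n H Z"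
  obtain x where x: "x \<in> Z" "x \<in> Pts n" and "\<exists>N\<ge>1. \<exists>c. (fm ^^ N) x = (\<lambda>i. c * x i)"
    using comp[OF Z] unfolding periodic_pts_def fm by blast
  then obtain N b where N: "N \<ge> 1" "(fm ^^ N) x = (\<lambda>i. b * x i)" by blast
  have x0: "x i = 0" if "i \<ge> Suc n" for i using x(2) that unfolding Pts_def by simp
  obtain i0 where i0: "i0 < Suc n" "x i0 \<noteq> 0" using x(2) unfolding Pts_def by (auto simp: less_Suc_eq_le)
  have Zc: "zclosed n Z" using Z unfolding irr_component_def zirred_def by blast
  define idx where "idx j = j * N" for j
  have sm: "strict_mono_on {..n} idx" using N(1) by (intro strict_mono_onI) (simp add: idx_def)
  have "x \<in> ((fm ^^ r) ^^ idx j) ` Z" for j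
  proof -
    let ?M = "N * (r * j)"
    have eq: "((fm ^^ r) ^^ idx j) = fm ^^ ?M" unfolding funpow_mult idx_def by (simp add: mult_ac)
    obtain c where c: "(fm ^^ ?M) x = (\<lambda>i. c * x i)" using fm_iter_multiple[OF x0 N(2)] by blast
    have c0: "c \<noteq> 0"
    proof
      assume "c = 0"
      then have "(fm ^^ ?M) x i = 0" for i using c by simp
      then have "x i0 = 0" by (intro fm_iter_nz[of ?M x i0] i0)
      then show False using i0 by simp
    qed
    have "d ^ ?M \<ge> 1" using D by simp
    \<comment> \<open>The images consist of vectors, so a preimage of \<open>x\<close> itself is
      needed and not only of its line: \<open>b * x\<close> lies in the cone \<open>Z\<close> and is
      mapped to \<open>b^(d^M) * c * x = x\<close>, where \<open>M\<close> is
      \<open>?M\<close>.\<close>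
    from alg_closed_root[OF ac this] obtain b where b: "b ^ (d ^ ?M) = 1 / c" ..
    have b0: "b \<noteq> 0" using b c0 D by (auto simp: power_0_left)
    have "(fm ^^ ?M) (\<lambda>i. b * x i) i = x i" for i
    proof (cases "i < Suc n")
      case True then show ?thesis using fm_iter_scale[OF True, of ?M b x] fun_cong[OF c, of i] b c0 by simp
    next
      case False then show ?thesis using fm_iter_outside[of "\<lambda>i. b * x i" i ?M] x0 by simp
    qed
    then have "(fm ^^ ?M) (\<lambda>i. b * x i) = x" by (rule ext)
    moreover have "(\<lambda>i. b * x i) \<in> Z" by (rule zclosed_scale[OF Zc x(1) b0])
    ultimately show ?thesis unfolding eq by (intro image_eqI[where x="\<lambda>i. b * x i"]) simp_all
  qed
  then have "(\<Inter>j\<in>{..n}. ((endo_map n f ^^ r) ^^ idx j) ` Z) \<noteq> {}" unfolding fm by blast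
  with sm show "\<exists>idx. strict_mono_on {..n} idx \<and> (\<Inter>j\<in>{..n}. ((endo_map n f ^^ r) ^^ idx j) ` Z) \<noteq> {}" by blast
qed

lemma many_independent_points:
  assumes P: "\<And>S. finite S \<Longrightarrow> \<exists>x\<in>P. \<not> (\<exists>s\<in>S. \<exists>c. x = (\<lambda>i. c * s i))" and sub: "P \<subseteq> Pts n"
  shows "\<exists>X. finite X \<and> card X = k \<and> X \<subseteq> P \<and> (\<forall>x\<in>X. \<forall>y\<in>X. x \<noteq> y \<longrightarrow> \<not> (\<exists>c::'k::field. x = (\<lambda>i. c * y i)))"
proof (induction k)
  case 0 show ?case by (rule exI[of _ "{}"]) simp
next
  case (Suc k)
  then obtain X where X: "finite X" "card X = k" "X \<subseteq> P" "\<forall>x\<in>X. \<forall>y\<in>X. x \<noteq> y \<longrightarrow> \<not> (\<exists>c. x = (\<lambda>i. c * y i))" by blast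
  obtain x where x: "x \<in> P" "\<not> (\<exists>s\<in>X. \<exists>c. x = (\<lambda>i. c * s i))" using P[OF X(1)] by blast
  have "x \<notin> X"
  proof
    assume "x \<in> X"
    moreover have "x = (\<lambda>i. 1 * x i)" by simp
    ultimately show False using x(2) by blast
  qed
  moreover have "\<not> (\<exists>c. y = (\<lambda>i. c * x i))" if y: "y \<in> X" for y
  proof
    assume "\<exists>c. y = (\<lambda>i. c * x i)"
    then obtain c where c: "y = (\<lambda>i. c * x i)" ..
    have "y \<in> Pts n" using X(3) sub y by blast
    then have "c \<noteq> 0" using c unfolding Pts_def by auto
    then have "x = (\<lambda>i. (1 / c) * y i)" using c by auto
    then show False using x(2) y by blast
  qed
  ultimately show ?case using X x by (intro exI[of _ "insert x X"]) auto
qed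

text \<open>Since \<open>x\<close> and \<open>y\<close> are not proportional, some 2 by 2 minor
  gives a linear form that vanishes at \<open>y\<close> and not at \<open>x\<close>; its
  \<open>m\<close>-th power has the right degree.\<close>

lemma separating_form:
  fixes x y :: "nat \<Rightarrow> 'k::field"
  assumes "x \<in> Pts n" "y \<in> Pts n" "\<not> (\<exists>c. x = (\<lambda>i. c * y i))" "m \<ge> 1"
  shows "\<exists>v. form_eval n m v y = 0 \<and> form_eval n m v x \<noteq> 0"
proof -
  have "\<exists>i\<le>n. \<exists>j\<le>n. x i * y j \<noteq> x j * y i"
  proof (rule ccontr)
    assume no: "\<not> ?thesis"
    obtain i where i: "i \<le> n" "y i \<noteq> 0" using assms(2) unfolding Pts_def by blast
    have "x j = (x i / y i) * y j" for j
    proof (cases "j \<le> n")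
      case True
      then have "x i * y j = x j * y i" using no i(1) by blast
      then show ?thesis using i(2) by (simp add: field_simps)
    next
      case False then show ?thesis using assms(1,2) unfolding Pts_def by simp
    qed
    then show False using assms(3) by blast
  qed
  then obtain i j where ij: "i \<le> n" "j \<le> n" "x i * y j \<noteq> x j * y i" by blast
  have "hom_fun {..n} 1 (\<lambda>z. y j * z i - y i * z j)"
    by (intro hom_fun_diff hom_fun_cmult hom_fun_var) (use ij in auto)
  from hom_fun_power[OF this, of m] have "hom_fun {..n} m (\<lambda>z. (y j * z i - y i * z j) ^ m)" by simp
  from hom_fun_is_form_eval[OF this] obtain v where v: "(\<lambda>z. (y j * z i - y i * z j) ^ m) = form_eval n m v" ..
  have "form_eval n m v y = 0" "form_eval n m v x \<noteq> 0"
    using ij(3) assms(4) unfolding v[symmetric] by (auto simp: mult.commute)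
  then show ?thesis by blast
qed

lemma nonvanishing_form:
  fixes x :: "nat \<Rightarrow> 'k::field"
  assumes "x \<in> Pts n"
  shows "\<exists>v. form_eval n m v x \<noteq> 0"
proof -
  obtain i where i: "i \<le> n" "x i \<noteq> 0" using assms unfolding Pts_def by blast
  have "hom_fun {..n} m (\<lambda>z::nat \<Rightarrow> 'k. z i ^ m)" using hom_fun_power[OF hom_fun_var[of i "{..n}"], of m] i by simp
  from hom_fun_is_form_eval[OF this] obtain v where v: "(\<lambda>z::nat \<Rightarrow> 'k. z i ^ m) = form_eval n m v" ..
  have "form_eval n m v x \<noteq> 0" unfolding v[symmetric] using i by simp
  then show ?thesis by (rule exI[of "\<lambda>v. form_eval n m v x \<noteq> 0"])
qed

text \<open>
  A general line in the space of forms meets the hyperplanes of forms vanishing at \<open>x\<close>, for different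
  points \<open>x\<close> of \<open>P\<close>, in different points.
\<close>

lemma generic_form_through_point:
  fixes H :: "((nat \<Rightarrow>\<^sub>0 nat) \<Rightarrow> 'k::field_char_0) \<Rightarrow> 'k"
  assumes P: "\<And>S. finite S \<Longrightarrow> \<exists>x\<in>P. \<not> (\<exists>s\<in>S. \<exists>c. x = (\<lambda>i. c * s i))" and sub: "P \<subseteq> Pts n"
    and H: "H \<in> poly_fun (mons n m)" "H v0 \<noteq> 0" and m: "m \<ge> 1"
  shows "\<exists>v. \<exists>x\<in>P. H v \<noteq> 0 \<and> form_eval n m v x = 0"
proof -
  obtain E where E: "\<And>a b. \<exists>Q. degree Q \<le> E \<and> (\<forall>t. H (\<lambda>v. a v + t * b v) = poly Q t)"
    using poly_fun_line_degree[OF H(1)] by blast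
  have "\<exists>X. finite X \<and> card X = Suc E \<and> X \<subseteq> P \<and> (\<forall>x\<in>X. \<forall>y\<in>X. x \<noteq> y \<longrightarrow> \<not> (\<exists>c. x = (\<lambda>i. c * y i)))"
    by (rule many_independent_points[OF _ sub]) (rule P)
  then obtain X where X: "finite X" "card X = Suc E" "X \<subseteq> P"
    and Xi: "\<forall>x\<in>X. \<forall>y\<in>X. x \<noteq> y \<longrightarrow> \<not> (\<exists>c. x = (\<lambda>i. c * y i))" by blast
  have XP: "x \<in> Pts n" if "x \<in> X" for x using that X(3) sub by blast
  have "\<exists>a. \<forall>q\<in>insert None (Some ` X). (case q of None \<Rightarrow> H | Some x \<Rightarrow> \<lambda>v. form_eval n m v x) a \<noteq> 0"
  proof (rule poly_fun_prod_nonzero[of _ _ "mons n m"])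
    show "finite (insert None (Some ` X))" using X(1) by simp
    show "(case q of None \<Rightarrow> H | Some x \<Rightarrow> \<lambda>v. form_eval n m v x) \<in> poly_fun (mons n m)" for q
      using H(1) poly_fun_form_eval_coeffs by (cases q) simp_all
    show "\<exists>a. (case q of None \<Rightarrow> H | Some x \<Rightarrow> \<lambda>v. form_eval n m v x) a \<noteq> 0" if "q \<in> insert None (Some ` X)" for q
    proof (cases q)
      case None
      then show ?thesis using H(2) by (intro exI[of _ v0]) simp
    next
      case (Some x)
      then have "x \<in> X" using that by auto
      from nonvanishing_form[OF XP[OF this], of m] show ?thesis unfolding Some by simp
    qed
  qed
  then obtain a where a: "H a \<noteq> 0" "\<And>x. x \<in> X \<Longrightarrow> form_eval n m a x \<noteq> 0" by auto
  define ev where "ev v x = form_eval n m v x" for v :: "(nat \<Rightarrow>\<^sub>0 nat) \<Rightarrow> 'k" and x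
  \<comment> \<open>The diagonal entries ask that \<open>w\<close> vanish at no point of
    \<open>X\<close>; the others ask that different points yield different parameters on the line
    \<open>a + t * w\<close>.\<close>
  define C where "C p w = (if fst p = snd p then ev w (fst p) else ev a (fst p) * ev w (snd p) - ev a (snd p) * ev w (fst p))" for p w
  have "\<exists>w. \<forall>p\<in>X \<times> X. C p w \<noteq> 0"
  proof (rule poly_fun_prod_nonzero[of _ _ "mons n m"])
    show "finite (X \<times> X)" using X(1) by simp
    fix p assume p: "p \<in> X \<times> X"
    show "C p \<in> poly_fun (mons n m)"
    proof (cases "fst p = snd p")
      case True then show ?thesis using poly_fun_form_eval_coeffs[of n m "fst p"] by (simp add: C_def[abs_def] ev_def)
    next
      case False
      then show ?thesis
        using poly_fun_diff[OF poly_fun_cmult[OF poly_fun_form_eval_coeffs[of n m "snd p"], of "ev a (fst p)"] poly_fun_cmult[OF poly_fun_form_eval_coeffs[of n m "fst p"], of "ev a (snd p)"]]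
        by (simp add: C_def[abs_def] ev_def)
    qed
    show "\<exists>w. C p w \<noteq> 0"
    proof (cases "fst p = snd p")
      case True
      have "fst p \<in> X" using p by auto
      from nonvanishing_form[OF XP[OF this], of m] show ?thesis using True by (simp add: C_def ev_def)
    next
      case False
      have "\<not> (\<exists>c. snd p = (\<lambda>i. c * fst p i))" using Xi p False by auto
      then obtain w where w: "ev w (fst p) = 0" "ev w (snd p) \<noteq> 0"
        using separating_form[of "snd p" n "fst p" m] XP p m unfolding ev_def by auto
      have "ev a (fst p) \<noteq> 0" using a(2)[of "fst p"] p unfolding ev_def by auto
      then show ?thesis using w False by (intro exI[of _ w]) (simp add: C_def)
    qed
  qed
  then obtain w where w: "\<And>x y. x \<in> X \<Longrightarrow> y \<in> X \<Longrightarrow> C (x, y) w \<noteq> 0" by auto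
  have wx: "ev w x \<noteq> 0" if "x \<in> X" for x using w[OF that that] by (simp add: C_def)
  obtain Q where Q: "degree Q \<le> E" "\<And>t. H (\<lambda>v. a v + t * w v) = poly Q t" using E by blast
  have Q0: "Q \<noteq> 0" using Q(2)[of 0] a(1) by auto
  \<comment> \<open>The parameter at which the line meets the hyperplane of forms vanishing at
    \<open>x\<close>. There are \<open>E + 1\<close> such parameters, but \<open>H\<close> has at
    most \<open>E\<close> zeros on the line.\<close>
  define t where "t x = - ev a x / ev w x" for x
  have "inj_on t X"
  proof (rule inj_onI, rule ccontr)
    fix x y assume xy: "x \<in> X" "y \<in> X" "t x = t y" "x \<noteq> y"
    then have "ev a x * ev w y = ev a y * ev w x" using wx by (simp add: t_def field_simps)
    then show False using w[OF xy(1,2)] xy(4) by (simp add: C_def)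
  qed
  then have card: "card (t ` X) = Suc E" using X(2) by (simp add: card_image)
  have "\<not> t ` X \<subseteq> {s. poly Q s = 0}"
  proof
    assume "t ` X \<subseteq> {s. poly Q s = 0}"
    then have "card (t ` X) \<le> card {s. poly Q s = 0}" by (rule card_mono[OF poly_roots_finite[OF Q0]])
    also have "\<dots> \<le> degree Q" by (rule card_poly_roots_bound[OF Q0])
    finally show False using card Q(1) by simp
  qed
  then obtain x where x: "x \<in> X" "poly Q (t x) \<noteq> 0" by blast
  have "H (\<lambda>v. a v + t x * w v) \<noteq> 0" using Q(2) x(2) by simp
  moreover have "form_eval n m (\<lambda>v. a v + t x * w v) x = 0"
    unfolding form_eval_add_mult using wx[OF x(1)] by (simp add: t_def ev_def)
  ultimately show ?thesis using x(1) X(3) by blast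
qed

section \<open>Irreducibility of generic hypersurfaces\<close>

text \<open>As a type that is an instance of \<open>idom\<close>, polynomial functions can serve as
  coefficients of library polynomials, so degree and pseudo-division in one distinguished variable
  become available.\<close>

typedef (overloaded) 'k::field_char_0 pfun = "poly_fun UNIV :: ((nat \<Rightarrow> 'k) \<Rightarrow> 'k) set"
  morphisms pf_eval Abs_pfun
  by (rule exI[of _ "\<lambda>x. 0"]) (rule poly_fun_const)

setup_lifting type_definition_pfun

instantiation pfun :: (field_char_0) idom
begin

lift_definition zero_pfun :: "'a pfun" is "\<lambda>x. 0" by (rule poly_fun_const)
lift_definition one_pfun :: "'a pfun" is "\<lambda>x. 1" by (rule poly_fun_const)
lift_definition plus_pfun :: "'a pfun \<Rightarrow> 'a pfun \<Rightarrow> 'a pfun" is "\<lambda>p q x. p x + q x" by (rule poly_fun_add)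
lift_definition minus_pfun :: "'a pfun \<Rightarrow> 'a pfun \<Rightarrow> 'a pfun" is "\<lambda>p q x. p x - q x" by (rule poly_fun_diff)
lift_definition uminus_pfun :: "'a pfun \<Rightarrow> 'a pfun" is "\<lambda>p x. - p x" by (rule poly_fun_uminus)
lift_definition times_pfun :: "'a pfun \<Rightarrow> 'a pfun \<Rightarrow> 'a pfun" is "\<lambda>p q x. p x * q x" by (rule poly_fun_mult)

instance
proof
  fix a b c :: "'a pfun"
  show "a * b * c = a * (b * c)" by transfer (simp add: mult.assoc)
  show "a * b = b * a" by transfer (simp add: mult.commute)
  show "1 * a = a" by transfer simp
  show "a + b + c = a + (b + c)" by transfer (simp add: add.assoc)
  show "a + b = b + a" by transfer (simp add: add.commute)
  show "0 + a = a" by transfer simp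
  show "- a + a = 0" by transfer simp
  show "a - b = a + - b" by transfer simp
  show "(a + b) * c = a * c + b * c" by transfer (simp add: distrib_right)
  show "a * (b + c) = a * b + a * c" by transfer (simp add: distrib_left)
  show "0 * a = 0" by transfer simp
  show "a * 0 = 0" by transfer simp
  show "(0 :: 'a pfun) \<noteq> 1" by transfer (auto dest: fun_cong)
  show "a * b \<noteq> 0" if ab: "a \<noteq> 0" "b \<noteq> 0"
  proof -
    have nz: "\<exists>x. pf_eval p x \<noteq> 0" if "p \<noteq> 0" for p :: "'a pfun"
    proof (rule ccontr)
      assume "\<not> ?thesis"
      then have "pf_eval p = pf_eval 0" unfolding zero_pfun.rep_eq by auto
      then show False using that by (simp add: pf_eval_inject)
    qed
    obtain x where x: "pf_eval a x \<noteq> 0" using nz[OF ab(1)] ..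
    obtain y where y: "pf_eval b y \<noteq> 0" using nz[OF ab(2)] ..
    obtain z where "pf_eval a z \<noteq> 0 \<and> pf_eval b z \<noteq> 0"
      using poly_fun_domain[of "pf_eval a" UNIV "pf_eval b" x y, OF pf_eval pf_eval x y] ..
    then have "pf_eval (a * b) z \<noteq> pf_eval 0 z" by (simp add: times_pfun.rep_eq zero_pfun.rep_eq)
    then show ?thesis by auto
  qed
qed

end

lemma pf_eval_simps [simp]:
  "pf_eval 0 x = 0" "pf_eval 1 x = 1" "pf_eval (p + q) x = pf_eval p x + pf_eval q x"
  "pf_eval (p - q) x = pf_eval p x - pf_eval q x" "pf_eval (- p) x = - pf_eval p x"
  "pf_eval (p * q) x = pf_eval p x * pf_eval q x"
  by (simp_all add: zero_pfun.rep_eq one_pfun.rep_eq plus_pfun.rep_eq minus_pfun.rep_eq uminus_pfun.rep_eq times_pfun.rep_eq)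

lemma pf_eval_sum [simp]: "pf_eval (\<Sum>i\<in>I. p i) x = (\<Sum>i\<in>I. pf_eval (p i) x)"
  by (induction I rule: infinite_finite_induct) simp_all

lemma pf_eval_power [simp]: "pf_eval (p ^ k) x = pf_eval p x ^ k"
  by (induction k) simp_all

lemma pfun_nonzero: "p \<noteq> 0 \<Longrightarrow> \<exists>x. pf_eval p x \<noteq> 0"
  by (metis ext pf_eval_inject pf_eval_simps(1))

lift_definition pconst :: "'k::field_char_0 \<Rightarrow> 'k pfun" is "\<lambda>c x. c" by (rule poly_fun_const)

lemma pf_eval_pconst [simp]: "pf_eval (pconst c) x = c"
  by (simp add: pconst.rep_eq)

definition eval_coeffs :: "'k::field_char_0 pfun poly \<Rightarrow> (nat \<Rightarrow> 'k) \<Rightarrow> 'k poly" where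
  "eval_coeffs P x = map_poly (\<lambda>c. pf_eval c x) P"

lemma coeff_eval_coeffs [simp]: "coeff (eval_coeffs P x) i = pf_eval (coeff P i) x"
  by (simp add: eval_coeffs_def coeff_map_poly)

lemma eval_coeffs_simps [simp]:
  "eval_coeffs (P + Q) x = eval_coeffs P x + eval_coeffs Q x"
  "eval_coeffs (P * Q) x = eval_coeffs P x * eval_coeffs Q x"
  "eval_coeffs (Polynomial.smult c P) x = Polynomial.smult (pf_eval c x) (eval_coeffs P x)"
  "eval_coeffs [:c:] x = [:pf_eval c x:]"
  by (rule poly_eqI; simp add: coeff_mult coeff_pCons split: nat.split)+

text \<open>Pseudo-division replaces the Euclidean algorithm over the fraction field.\<close>

lemma irreducible_divides_or_coprime:
  fixes P G :: "'r::idom poly"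
  assumes deg: "degree P \<ge> 1"
    and irr: "\<And>c A B. c \<noteq> 0 \<Longrightarrow> Polynomial.smult c P = A * B \<Longrightarrow> degree A = 0 \<or> degree B = 0"
  shows "(\<exists>k Q. Polynomial.smult (lead_coeff P ^ k) G = P * Q) \<or> (\<exists>r U W. r \<noteq> 0 \<and> [:r:] = U * P + W * G)"
proof -
  define I where "I = {A. \<exists>U W. A = U * P + W * G}"
  have PI: "P \<in> I" unfolding I_def by (intro CollectI exI[of _ 1] exI[of _ 0]) simp
  have GI: "G \<in> I" unfolding I_def by (intro CollectI exI[of _ 0] exI[of _ 1]) simp
  have Idiff: "Polynomial.smult c A - B * C \<in> I" if AB: "A \<in> I" "B \<in> I" for c A B C
  proof -
    obtain U W where "A = U * P + W * G" using AB(1) unfolding I_def by blast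
    moreover obtain U' W' where "B = U' * P + W' * G" using AB(2) unfolding I_def by blast
    ultimately have "Polynomial.smult c A - B * C = (Polynomial.smult c U - U' * C) * P + (Polynomial.smult c W - W' * C) * G"
      by (simp add: algebra_simps smult_add_right)
    then show ?thesis unfolding I_def by blast
  qed
  have P0: "P \<noteq> 0" using deg by auto
  define d where "d = (LEAST d. \<exists>A\<in>I. A \<noteq> 0 \<and> degree A = d)"
  have "\<exists>A\<in>I. A \<noteq> 0 \<and> degree A = d" unfolding d_def by (rule LeastI_ex) (use PI P0 in blast)
  then obtain A where A: "A \<in> I" "A \<noteq> 0" "degree A = d" by blast
  have min: "d \<le> degree B" if "B \<in> I" "B \<noteq> 0" for B unfolding d_def by (rule Least_le) (use that in blast)
  \<comment> \<open>A member of least degree divides every member up to a nonzero scalar, since the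
    pseudo-remainder lies in \<open>I\<close> and has smaller degree.\<close>
  have dv: "\<exists>c q. c \<noteq> 0 \<and> Polynomial.smult c B = A * q" if "B \<in> I" for B
  proof -
    obtain q r where qr: "pseudo_divmod B A = (q, r)" by fastforce
    let ?c = "coeff A (degree A) ^ (Suc (degree B) - degree A)"
    have *: "Polynomial.smult ?c B = A * q + r" "r = 0 \<or> degree r < degree A" using pseudo_divmod[OF A(2) qr] by auto
    then have "r = Polynomial.smult ?c B - A * q" by simp
    then have "r \<in> I" using Idiff[OF that A(1)] by simp
    then have "r = 0" using *(2) min A(3) by fastforce
    then show ?thesis using *(1) A(2) by (intro exI[of _ ?c] exI[of _ q]) simp
  qed
  obtain c q where cq: "c \<noteq> 0" "Polynomial.smult c P = A * q" using dv[OF PI] by blast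
  show ?thesis
  proof (cases "degree A = 0")
    case True
    then obtain r where r: "A = [:r:]" by (rule degree_eq_zeroE)
    then have "r \<noteq> 0" using A(2) by simp
    moreover obtain U W where "A = U * P + W * G" using A(1) unfolding I_def by blast
    ultimately show ?thesis using r by (intro disjI2 exI[of _ r] exI[of _ U] exI[of _ W]) simp
  next
    \<comment> \<open>\<open>A\<close> is not constant and divides \<open>P\<close> up to a scalar,
      so by irreducibility the cofactor \<open>q\<close> is constant. Then \<open>P\<close> also has
      least degree in \<open>I\<close>, which makes the pseudo-remainder of \<open>G\<close> modulo
      \<open>P\<close> vanish.\<close>
    case False
    then have "degree q = 0" using irr[OF cq] by simp
    then obtain q0 where q0: "q = [:q0:]" by (rule degree_eq_zeroE)
    have "q0 \<noteq> 0" using cq q0 P0 by auto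
    have "Polynomial.smult c P = Polynomial.smult q0 A" using cq(2) q0 by simp
    then have "degree (Polynomial.smult c P) = degree (Polynomial.smult q0 A)" by (rule arg_cong)
    then have dPA: "degree P = degree A" using cq(1) \<open>q0 \<noteq> 0\<close> by simp
    obtain s r where sr: "pseudo_divmod G P = (s, r)" by fastforce
    let ?l = "lead_coeff P ^ (Suc (degree G) - degree P)"
    have *: "Polynomial.smult ?l G = P * s + r" "r = 0 \<or> degree r < degree P" using pseudo_divmod[OF P0 sr] by auto
    have "r = 0"
    proof (rule ccontr)
      assume r0: "r \<noteq> 0"
      have "r = Polynomial.smult ?l G - P * s" using *(1) by simp
      then have "r \<in> I" using Idiff[OF GI PI] by simp
      then show False using min[OF _ r0] *(2) r0 dPA A(3) by simp
    qed
    then show ?thesis using *(1) by auto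
  qed
qed

section \<open>Forms as polynomials in the last variable\<close>

lemma poly_fun_expand_last:
  assumes "p \<in> poly_fun (insert y V)"
  shows "\<exists>N. deg_less_in y V N p"
  using assms
proof (induction rule: poly_fun.induct)
  case (poly_fun_const c)
  have "deg_less_in y V 1 (\<lambda>x. c * x y ^ 0)" by (rule deg_less_in_single[OF poly_fun.poly_fun_const]) simp
  then show ?case by (intro exI[of _ 1]) simp
next
  case (poly_fun_add p q)
  then obtain N M where "deg_less_in y V N p" "deg_less_in y V M q" by blast
  then have "deg_less_in y V (max N M) p" "deg_less_in y V (max N M) q" using deg_less_in_mono[of y V N p "max N M"] deg_less_in_mono[of y V M q "max N M"] by simp_all
  from deg_less_in_add[OF this] have *: "deg_less_in y V (max N M) (\<lambda>x. p x + q x)" .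
  show ?case by (rule exI, rule *)
next
  case (poly_fun_var_mult v p)
  then obtain N where N: "deg_less_in y V N p" by blast
  show ?case
  proof (cases "v = y")
    case True show ?thesis unfolding True by (rule exI, rule deg_less_in_mult_y[OF N])
  next
    case False
    then have "(\<lambda>x. x v) \<in> poly_fun V" using poly_fun_var_mult(1) by (intro poly_fun_var) simp
    from deg_less_in_mult[OF N this] have *: "deg_less_in y V N (\<lambda>x. x v * p x)" .
    show ?thesis by (rule exI, rule *)
  qed
qed

lemma deg_less_in_as_poly:
  fixes p :: "(nat \<Rightarrow> 'k::field_char_0) \<Rightarrow> 'k"
  assumes "deg_less_in y V N p" "y \<notin> V"
  shows "\<exists>P :: 'k pfun poly. (\<forall>i\<ge>N. coeff P i = 0) \<and> (\<forall>x t. poly (eval_coeffs P x) t = p (x(y := t)))"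
proof -
  obtain c where c: "\<And>i. c i \<in> poly_fun V" "p = (\<lambda>x. \<Sum>i<N. c i x * x y ^ i)" using assms(1) unfolding deg_less_in_def by blast
  have cU: "c i \<in> poly_fun UNIV" for i by (rule poly_fun_mono[OF c(1)]) simp
  define P where "P = (\<Sum>i<N. monom (Abs_pfun (c i)) i)"
  have coP: "coeff P i = (if i < N then Abs_pfun (c i) else 0)" for i
  proof -
    have "coeff P i = (\<Sum>j<N. if j = i then Abs_pfun (c i) else 0)" unfolding P_def coeff_sum by (rule sum.cong) auto
    then show ?thesis by simp
  qed
  have "poly (eval_coeffs P x) t = p (x(y := t))" for x t
  proof -
    have eq: "eval_coeffs P x = (\<Sum>i<N. monom (c i x) i)"
    proof (rule poly_eqI)
      fix i
      have "coeff (\<Sum>j<N. monom (c j x) j) i = (\<Sum>j<N. if j = i then c i x else 0)" unfolding coeff_sum by (rule sum.cong) auto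
      then show "coeff (eval_coeffs P x) i = coeff (\<Sum>i<N. monom (c i x) i) i"
        by (simp add: coP Abs_pfun_inverse[OF cU])
    qed
    have "c i (x(y := t)) = c i x" for i by (rule poly_fun_cong[OF c(1)]) (use assms(2) in auto)
    then show ?thesis unfolding c(2) eq by (simp add: poly_sum poly_monom)
  qed
  then show ?thesis using coP by (intro exI[of _ P]) simp
qed

text \<open>The coefficient of \<open>x n ^ m\<close> in a form of degree \<open>m\<close> is its
  value at the last unit vector. As this is a nonzero constant, no specialization of the other
  variables lowers the degree.\<close>

lemma form_as_poly:
  fixes h :: "(nat \<Rightarrow> 'k::field_char_0) \<Rightarrow> 'k"
  assumes "hom_fun {..n} m h" "h (\<lambda>i. if i = n then 1 else 0) \<noteq> 0"
  shows "\<exists>P :: 'k pfun poly. degree P = m \<and> lead_coeff P = pconst (h (\<lambda>i. if i = n then 1 else 0)) \<and>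
    (\<forall>x t. poly (eval_coeffs P x) t = h (x(n := t)))"
proof -
  let ?k = "h (\<lambda>i. if i = n then 1 else 0)"
  have ins: "{..n} = insert n {..<n}" by auto
  have fe: "(\<lambda>v. if v = n then x n else x v + 0 * x n) = x" for x :: "nat \<Rightarrow> 'k" by auto
  have "deg_less_in n {..<n} m (\<lambda>x. h x - ?k * x n ^ m)"
    using hom_fun_shear_monic[of n "{..<n}" m h "\<lambda>_. 0", OF assms(1)[unfolded ins]] by (simp only: fe)
  then obtain P :: "'k pfun poly" where P: "\<forall>i\<ge>m. coeff P i = 0"
    "\<forall>x t. poly (eval_coeffs P x) t = h (x(n := t)) - ?k * t ^ m"
    using deg_less_in_as_poly[of n "{..<n}" m "\<lambda>x. h x - ?k * x n ^ m"] by auto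
  define Q where "Q = P + monom (pconst ?k) m"
  have k0: "pconst ?k \<noteq> 0" using assms(2) by (metis pf_eval_pconst pf_eval_simps(1))
  have cm: "coeff Q m = pconst ?k" using P(1) by (simp add: Q_def)
  have "degree Q \<le> m" by (rule degree_le) (use P(1) in \<open>simp add: Q_def\<close>)
  moreover have "m \<le> degree Q" by (rule le_degree) (use cm k0 in simp)
  ultimately have dQ: "degree Q = m" by simp
  have "eval_coeffs (monom (pconst ?k) m) x = monom ?k m" for x by (rule poly_eqI) simp
  then have "poly (eval_coeffs Q x) t = h (x(n := t))" for x t using P(2) by (simp add: Q_def poly_monom)
  then show ?thesis using dQ cm by (intro exI[of _ Q]) simp
qed

text \<open>A form \<open>G\<close> that is nonzero somewhere on the hypersurface is coprime to
  \<open>P\<close> over the fraction field of the coefficients, giving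
  \<open>r = U * P + W * Q\<close> with \<open>r \<noteq> 0\<close>. For two such forms, a point of
  the hypersurface above some \<open>x\<close> with \<open>r\<close> and \<open>r'\<close> nonzero
  is a zero of neither, so two closed sets cannot cover the hypersurface unless one of them
  does.\<close>

lemma hyp_zirred:
  fixes v :: "(nat \<Rightarrow>\<^sub>0 nat) \<Rightarrow> 'k::field_char_0" and P :: "'k pfun poly"
  assumes ac: "alg_closed_field TYPE('k)" and n: "n \<ge> 1" and m: "m \<ge> 1"
    and degP: "degree P = m" and lcP: "lead_coeff P = pconst k" "k \<noteq> 0"
    and P: "\<And>x t. poly (eval_coeffs P x) t = form_eval n m v (x(n := t))"
    and irr: "\<And>c A B. c \<noteq> 0 \<Longrightarrow> Polynomial.smult c P = A * B \<Longrightarrow> degree A = 0 \<or> degree B = 0"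
    and ne: "hyp n (coeff_form n m v) \<noteq> {}"
  shows "zirred n (hyp n (coeff_form n m v))"
proof -
  let ?H = "hyp n (coeff_form n m v)"
  have closed: "zclosed n ?H" unfolding zclosed_def hyp_def
    by (rule exI[of _ "{coeff_form n m v}"]) (use form_coeff_form[of n m v] in \<open>auto simp: form_def\<close>)
  have coprime: "\<exists>r U W Q. r \<noteq> 0 \<and> [:r:] = U * P + W * Q \<and> (\<forall>x t. poly (eval_coeffs Q x) t = mp_eval G (x(n := t)))"
    if G: "homog_in {..n} e G" and z: "z \<in> ?H" "mp_eval G z \<noteq> 0" for G e z
  proof -
    have ins: "{..n} = insert n {..<n}" by auto
    have "mp_eval G \<in> poly_fun (insert n {..<n})" using hom_fun_poly_fun[OF hom_fun_mp_eval[OF G]] unfolding ins .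
    from poly_fun_expand_last[OF this] obtain N where N: "deg_less_in n {..<n} N (mp_eval G)" ..
    from deg_less_in_as_poly[OF N] obtain Q :: "'k pfun poly" where Q: "\<forall>x t. poly (eval_coeffs Q x) t = mp_eval G (x(n := t))" by auto
    \<comment> \<open>If \<open>P\<close> divided \<open>Q\<close> up to a power of the constant
      \<open>k\<close>, then \<open>G\<close> would vanish at the point \<open>z\<close> of the
      hypersurface.\<close>
    have "\<not> (\<exists>k' S. Polynomial.smult (lead_coeff P ^ k') Q = P * S)"
    proof
      assume "\<exists>k' S. Polynomial.smult (lead_coeff P ^ k') Q = P * S"
      then obtain k' S where "Polynomial.smult (lead_coeff P ^ k') Q = P * S" by blast
      then have "eval_coeffs (Polynomial.smult (lead_coeff P ^ k') Q) z = eval_coeffs (P * S) z" by simp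
      then have "poly (eval_coeffs (Polynomial.smult (lead_coeff P ^ k') Q) z) (z n) = poly (eval_coeffs (P * S) z) (z n)" by simp
      then have "k ^ k' * mp_eval G z = form_eval n m v z * poly (eval_coeffs S z) (z n)"
        using Q P by (simp add: lcP(1))
      moreover have "form_eval n m v z = 0" using z(1) by (simp add: hyp_def mp_eval_coeff_form)
      ultimately show False using z(2) lcP(2) by simp
    qed
    then have "\<exists>r U W. r \<noteq> 0 \<and> [:r:] = U * P + W * Q"
      using irreducible_divides_or_coprime[of P Q] degP m irr by blast
    then show ?thesis using Q by blast
  qed
  have "?H \<subseteq> A \<or> ?H \<subseteq> B" if A: "zclosed n A" and B: "zclosed n B" and sub: "?H \<subseteq> A \<union> B" for A B
  proof (rule ccontr)
    assume no: "\<not> (?H \<subseteq> A \<or> ?H \<subseteq> B)"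
    obtain S where S: "\<forall>G\<in>S. \<exists>e. homog_in {..n} e G" "A = {x \<in> Pts n. \<forall>G\<in>S. mp_eval G x = 0}"
      using A unfolding zclosed_def by blast
    obtain T where T: "\<forall>G\<in>T. \<exists>e. homog_in {..n} e G" "B = {x \<in> Pts n. \<forall>G\<in>T. mp_eval G x = 0}"
      using B unfolding zclosed_def by blast
    have HP: "?H \<subseteq> Pts n" by (auto simp: hyp_def)
    obtain G z where G: "G \<in> S" "z \<in> ?H" "mp_eval G z \<noteq> 0" using no S(2) HP by blast
    obtain G' z' where G': "G' \<in> T" "z' \<in> ?H" "mp_eval G' z' \<noteq> 0" using no T(2) HP by blast
    obtain e e' where e: "homog_in {..n} e G" "homog_in {..n} e' G'" using S(1) T(1) G(1) G'(1) by blast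
    obtain r U W Q where r: "r \<noteq> 0" "[:r:] = U * P + W * Q" "\<forall>x t. poly (eval_coeffs Q x) t = mp_eval G (x(n := t))"
      using coprime[OF e(1) G(2,3)] by blast
    obtain r' U' W' Q' where r': "r' \<noteq> 0" "[:r':] = U' * P + W' * Q'" "\<forall>x t. poly (eval_coeffs Q' x) t = mp_eval G' (x(n := t))"
      using coprime[OF e(2) G'(2,3)] by blast
    \<comment> \<open>The factor \<open>x 0\<close> keeps the point \<open>w\<close> away from the
      origin; since \<open>n \<ge> 1\<close>, replacing the coordinate \<open>n\<close> by a root
      does not affect it.\<close>
    define X0 :: "'k pfun" where "X0 = Abs_pfun (\<lambda>x. x 0)"
    have X0: "pf_eval X0 x = x 0" for x unfolding X0_def by (subst Abs_pfun_inverse) (auto intro: poly_fun_var)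
    have "X0 \<noteq> 0" using X0[of "\<lambda>_. 1"] by auto
    then have "r * r' * X0 \<noteq> 0" using r(1) r'(1) by simp
    then obtain x where x: "pf_eval (r * r' * X0) x \<noteq> 0" using pfun_nonzero by blast
    then have x0: "x 0 \<noteq> 0" and rx: "pf_eval r x \<noteq> 0" "pf_eval r' x \<noteq> 0" by (auto simp: X0)
    have "coeff (eval_coeffs P x) m = k" using lcP degP by simp
    then have "degree (eval_coeffs P x) \<ge> 1" using m lcP(2) by (metis le_degree order.trans)
    then obtain t where t: "poly (eval_coeffs P x) t = 0" using ac unfolding alg_closed_field_def by blast
    define w where "w i = (if i \<le> n then (x(n := t)) i else 0)" for i
    have wx: "p w = p (x(n := t))" if "p \<in> poly_fun {..n}" for p by (rule poly_fun_cong[OF that]) (simp add: w_def)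
    have "w 0 \<noteq> 0" using x0 n by (simp add: w_def)
    then have "\<exists>i\<le>n. w i \<noteq> 0" by blast
    moreover have "\<forall>i>n. w i = 0" by (simp add: w_def)
    ultimately have wP: "w \<in> Pts n" unfolding Pts_def by simp
    have "form_eval n m v w = 0" using t P wx[OF hom_fun_poly_fun[OF hom_fun_form_eval]] by simp
    then have "w \<in> ?H" using wP by (simp add: hyp_def mp_eval_coeff_form)
    then have "w \<in> A \<or> w \<in> B" using sub by blast
    then show False
    proof
      assume "w \<in> A"
      then have "mp_eval G w = 0" using S(2) G(1) by blast
      then have "poly (eval_coeffs Q x) t = 0" using r(3) wx[OF hom_fun_poly_fun[OF hom_fun_mp_eval[OF e(1)]]] by simp
      moreover have "pf_eval r x = poly (eval_coeffs [:r:] x) t" by simp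
      ultimately show False using rx(1) t unfolding r(2) by simp
    next
      assume "w \<in> B"
      then have "mp_eval G' w = 0" using T(2) G'(1) by blast
      then have "poly (eval_coeffs Q' x) t = 0" using r'(3) wx[OF hom_fun_poly_fun[OF hom_fun_mp_eval[OF e(2)]]] by simp
      moreover have "pf_eval r' x = poly (eval_coeffs [:r':] x) t" by simp
      ultimately show False using rx(2) t unfolding r'(2) by simp
    qed
  qed
  then show ?thesis unfolding zirred_def using closed ne by blast
qed

section \<open>Bivariate polynomials: Gauss' lemma and total degree\<close>

lemma bipoly_eqI:
  fixes P Q :: "'k::field_char_0 poly poly"
  assumes "\<And>s t. poly (poly P [:t:]) s = poly (poly Q [:t:]) s"
  shows "P = Q"
proof -
  have "poly (P - Q) [:t:] = 0" for t
    by (rule poly_eq_0_if_everywhere_0) (simp add: assms)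
  moreover have "infinite (range (\<lambda>t::'k. [:t:]))" 
    using finite_imageD[of "\<lambda>t::'k. [:t:]" UNIV] by (auto simp: inj_def)
  ultimately have "P - Q = 0" by (intro poly_zero_if_zero_on_infinite[of "range (\<lambda>t. [:t:])"]) auto
  then show ?thesis by simp
qed

lemma smult_left_cancel:
  fixes l :: "'a::idom"
  assumes "l \<noteq> 0" "Polynomial.smult l P = Polynomial.smult l Q"
  shows "P = Q"
proof -
  have "Polynomial.smult l (P - Q) = 0" using assms(2) by (simp add: Polynomial.smult_diff_right)
  then show ?thesis using assms(1) by simp
qed

text \<open>Gauss' lemma for \<open>k[s][y]\<close>: the roots of \<open>c\<close> are cancelled one after the other.\<close>

lemma factorization_cancel_constant:
  fixes Q A B :: "'k::field_char_0 poly poly"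
  assumes ac: "alg_closed_field TYPE('k)" and "c \<noteq> 0" "Polynomial.smult c Q = A * B"
  shows "\<exists>A' B'. Q = A' * B' \<and> degree A' = degree A \<and> degree B' = degree B"
  using assms(2,3)
proof (induction "degree c" arbitrary: c A B)
  case 0
  then obtain c0 where c0: "c = [:c0:]" by (metis degree_eq_zeroE)
  then have nz: "c0 \<noteq> 0" using 0 by simp
  have "Polynomial.smult [:1 / c0:] (Polynomial.smult c Q) = Q" using nz by (simp add: c0 flip: one_pCons)
  then have "Q = Polynomial.smult [:1 / c0:] A * B" using 0 by simp
  then show ?case using nz by (intro exI[of _ "Polynomial.smult [:1 / c0:] A"] exI[of _ B]) simp
next
  case (Suc d)
  then have "degree c \<ge> 1" by simp
  then obtain s where "poly c s = 0" using ac unfolding alg_closed_field_def by blast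
  then obtain c1 where c1: "c = [:- s, 1:] * c1" by (auto simp: poly_eq_0_iff_dvd elim: dvdE)
  let ?l = "[:- s, 1:]"
  have c10: "c1 \<noteq> 0" using c1 Suc.prems(1) by auto
  then have "degree c = Suc (degree c1)" unfolding c1 by (subst degree_mult_eq) auto
  then have d1: "d = degree c1" using Suc.hyps(2) by simp
  \<comment> \<open>Reduction of the coefficients modulo the linear factor. The reductions lie in an
    integral domain, so \<open>A\<close> or \<open>B\<close> reduces to 0, that is, contains this
    factor.\<close>
  define h where "h A = map_poly (\<lambda>p. poly p s) A" for A :: "'k poly poly"
  have ch: "coeff (h A) i = poly (coeff A i) s" for A i by (simp add: h_def coeff_map_poly)
  have "h A * h B = h (A * B)" by (rule poly_eqI) (simp add: coeff_mult ch poly_sum)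
  also have "\<dots> = 0" unfolding Suc.prems(2)[symmetric] by (rule poly_eqI) (simp add: ch c1)
  finally have "h A = 0 \<or> h B = 0" by simp
  then have "[:?l:] dvd A \<or> [:?l:] dvd B"
  proof
    assume "h A = 0"
    then have "poly (coeff A i) s = 0" for i using ch[of A i] by simp
    then show ?thesis unfolding const_poly_dvd_iff by (auto simp: poly_eq_0_iff_dvd)
  next
    assume "h B = 0"
    then have "poly (coeff B i) s = 0" for i using ch[of B i] by simp
    then show ?thesis unfolding const_poly_dvd_iff by (auto simp: poly_eq_0_iff_dvd)
  qed
  then show ?case
  proof
    assume "[:?l:] dvd A"
    then obtain A1 where A1: "A = Polynomial.smult ?l A1" by (auto elim!: dvdE)
    have "Polynomial.smult ?l (Polynomial.smult c1 Q) = Polynomial.smult ?l (A1 * B)"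
      using Suc.prems(2) unfolding c1 A1 by (simp only: smult_smult mult_smult_left)
    then have "Polynomial.smult c1 Q = A1 * B" by (rule smult_left_cancel[rotated]) simp
    from Suc.hyps(1)[OF d1 c10 this] show ?thesis unfolding A1 by simp
  next
    assume "[:?l:] dvd B"
    then obtain B1 where B1: "B = Polynomial.smult ?l B1" by (auto elim!: dvdE)
    have "Polynomial.smult ?l (Polynomial.smult c1 Q) = Polynomial.smult ?l (A * B1)"
      using Suc.prems(2) unfolding c1 B1 by (simp only: smult_smult mult_smult_right)
    then have "Polynomial.smult c1 Q = A * B1" by (rule smult_left_cancel[rotated]) simp
    from Suc.hyps(1)[OF d1 c10 this] show ?thesis unfolding B1 by simp
  qed
qed

text \<open>The homogeneous part of total degree \<open>e\<close>, with the inner variable set to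
  1.\<close>

definition top_form :: "nat \<Rightarrow> 'k::comm_ring_1 poly poly \<Rightarrow> 'k poly" where
  "top_form e A = (\<Sum>j\<le>e. monom (coeff (coeff A j) (e - j)) j)"

lemma coeff_top_form: "coeff (top_form e A) j = (if j \<le> e then coeff (coeff A j) (e - j) else 0)"
proof -
  have "coeff (top_form e A) j = (\<Sum>k\<le>e. if k = j then coeff (coeff A j) (e - j) else 0)"
    unfolding top_form_def coeff_sum by (rule sum.cong) auto
  then show ?thesis by simp
qed

text \<open>Substituting \<open>y * s\<close> for the outer variable sorts monomials by total
  degree: \<open>s^i * (y * s)^j\<close> contributes to \<open>s^(i + j)\<close>.\<close>

lemma coeff_diagonal:
  fixes A :: "'k::idom poly poly"
  shows "coeff (poly A [:0, y:]) e = poly (top_form e A) y"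
proof -
  have pw: "[:0, y:] ^ j = monom (y ^ j) j" for j
  proof -
    have "[:0, y:] = monom y 1" by (simp add: monom_altdef)
    then show ?thesis by (simp add: monom_power)
  qed
  let ?M = "max e (degree A)"
  have "poly A [:0, y:] = (\<Sum>j\<le>degree A. coeff A j * monom (y ^ j) j)" unfolding poly_altdef pw ..
  also have "\<dots> = (\<Sum>j\<le>?M. coeff A j * monom (y ^ j) j)"
    by (rule sum.mono_neutral_left) (auto simp: coeff_eq_0)
  finally have "coeff (poly A [:0, y:]) e = (\<Sum>j\<le>?M. coeff (monom (y ^ j) j * coeff A j) e)"
    by (simp add: coeff_sum mult.commute)
  also have "\<dots> = (\<Sum>j\<le>?M. if j \<le> e then coeff (coeff A j) (e - j) * y ^ j else 0)"
    by (rule sum.cong[OF refl]) (subst coeff_monom_mult, simp add: mult.commute)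
  also have "\<dots> = (\<Sum>j\<le>e. coeff (coeff A j) (e - j) * y ^ j)"
    by (rule sum.mono_neutral_cong_right) auto
  also have "\<dots> = poly (top_form e A) y" by (simp add: top_form_def poly_sum poly_monom)
  finally show ?thesis .
qed

text \<open>Total degree is additive. For a slope \<open>y\<close> at which the relevant homogeneous
  parts of \<open>A\<close> and \<open>B\<close> do not vanish, the degrees of the two restrictions
  add up to at most \<open>a + b\<close>, and \<open>B\<close> already accounts for
  \<open>b\<close>.\<close>

lemma total_degree_factor:
  fixes A B :: "'k::field_char_0 poly poly"
  assumes Q: "\<And>i j. a + b < i + j \<Longrightarrow> coeff (coeff (A * B) j) i = 0"
    and B: "coeff (coeff B b) 0 \<noteq> 0" and ij: "a < i + j"
  shows "coeff (coeff A j) i = 0"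
proof (rule ccontr)
  assume nz: "coeff (coeff A j) i \<noteq> 0"
  have "coeff (top_form (i + j) A) j \<noteq> 0" using nz by (simp add: coeff_top_form)
  then have tA: "top_form (i + j) A \<noteq> 0" by auto
  have "coeff (top_form b B) b \<noteq> 0" using B by (simp add: coeff_top_form)
  then have tB: "top_form b B \<noteq> 0" by auto
  have "top_form (i + j) A * top_form b B \<noteq> 0" using tA tB by simp
  then obtain y where "poly (top_form (i + j) A * top_form b B) y \<noteq> 0"
    using poly_eq_0_if_everywhere_0 by blast
  then have y: "coeff (poly A [:0, y:]) (i + j) \<noteq> 0" "coeff (poly B [:0, y:]) b \<noteq> 0"
    unfolding coeff_diagonal by auto
  then have nz: "poly A [:0, y:] \<noteq> 0" "poly B [:0, y:] \<noteq> 0" by auto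
  have "i + j + b \<le> degree (poly A [:0, y:]) + degree (poly B [:0, y:])"
    by (rule add_mono; rule le_degree) (use y in auto)
  also have "\<dots> = degree (poly (A * B) [:0, y:])" using nz by (simp add: degree_mult_eq)
  also have "\<dots> \<le> a + b"
  proof (rule degree_le, intro allI impI)
    fix e assume "a + b < e"
    then have "top_form e (A * B) = 0" by (intro poly_eqI) (simp add: coeff_top_form Q)
    then show "coeff (poly (A * B) [:0, y:]) e = 0" unfolding coeff_diagonal by simp
  qed
  finally show False using ij by simp
qed

section \<open>Dimension count for reducible bivariate polynomials\<close>

definition tri :: "nat \<Rightarrow> (nat \<times> nat) set" where
  "tri m = {(i, j). i + j \<le> m}"

lemma finite_tri: "finite (tri m)"
  by (rule finite_subset[of _ "{..m} \<times> {..m}"]) (auto simp: tri_def)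

text \<open>
  Dimension count: the injection \<open>f\<close> below compares the coefficients of two factors, the first one normalized,
  with those of their product, and it misses the monomial \<open>(m, 0)\<close>.
\<close>

lemma reducible_locus_fixed_degrees:
  assumes "a \<ge> 1" "b \<ge> 1" "a + b = m"
  shows "\<exists>H :: (nat \<times> nat \<Rightarrow> 'k::field_char_0) \<Rightarrow> 'k. H \<in> poly_fun (tri m) \<and> (\<exists>z. H z \<noteq> 0) \<and>
    (\<forall>A B. (\<forall>i j. a < i + j \<longrightarrow> coeff (coeff A j) i = 0) \<longrightarrow> (\<forall>i j. b < i + j \<longrightarrow> coeff (coeff B j) i = 0) \<longrightarrow>
      coeff (coeff A a) 0 = 1 \<longrightarrow> H (\<lambda>(i, j). coeff (coeff (A * B) j) i) = 0)"
proof -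
  \<comment> \<open>The free parameters: all coefficients of the second factor, and those of the
    first one except the coefficient of the pure power \<open>a\<close> of the outer variable, which
    is 1.\<close>
  define X where "X = Inl ` (tri a - {(0, a)}) \<union> Inr ` tri b"
  define cA where "cA p x = (if p = (0, a) then 1 else if p \<in> tri a then x (Inl p) else (0 :: 'k))" for p and x :: "nat \<times> nat + nat \<times> nat \<Rightarrow> 'k"
  define cB where "cB p x = (if p \<in> tri b then x (Inr p) else (0 :: 'k))" for p and x :: "nat \<times> nat + nat \<times> nat \<Rightarrow> 'k"
  define psi where "psi = (\<lambda>(i, j) x. \<Sum>j'\<le>j. \<Sum>i'\<le>i. cA (i', j') x * cB (i - i', j - j') x)"
  have cA: "cA p \<in> poly_fun X" for p
    unfolding cA_def by (cases "p = (0, a)"; cases "p \<in> tri a") (auto intro!: poly_fun_const poly_fun_var simp: X_def)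
  have cB: "cB p \<in> poly_fun X" for p
    unfolding cB_def by (cases "p \<in> tri b") (auto intro!: poly_fun_const poly_fun_var simp: X_def)
  have psi: "psi p \<in> poly_fun X" for p
    unfolding psi_def by (cases p) (auto intro!: poly_fun_sum poly_fun_mult cA cB)
  have card: "card X < card (tri m)"
  proof -
    \<comment> \<open>Parameters of the first factor stay in place and have \<open>j < a\<close>;
      those of the second are shifted to \<open>j \<ge> a\<close>. Because \<open>a\<close> and
      \<open>b\<close> are positive, nothing is sent to \<open>(m, 0)\<close>.\<close>
    define f where "f = case_sum (\<lambda>p. p) (\<lambda>(i :: nat, j). (i, j + a))"
    have "inj_on f X"
      by (rule inj_onI) (auto simp: X_def f_def tri_def split: sum.splits)
    moreover have "f ` X \<subseteq> tri m - {(m, 0)}" using assms by (auto simp: X_def f_def tri_def)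
    ultimately have "card X \<le> card (tri m - {(m, 0)})" using card_inj_on_le finite_tri by blast
    also have "\<dots> < card (tri m)" by (rule psubset_card_mono[OF finite_tri]) (auto simp: tri_def)
    finally show ?thesis .
  qed
  have "finite X" by (auto simp: X_def finite_tri)
  from polynomial_image_in_hypersurface[OF this finite_tri card, of psi] psi obtain H where
    H: "H \<in> poly_fun (tri m)" "\<exists>z. H z \<noteq> 0" "\<forall>x. H (\<lambda>p. psi p x) = 0" by blast
  have "H (\<lambda>(i, j). coeff (coeff (A * B) j) i) = 0"
    if A: "\<forall>i j. a < i + j \<longrightarrow> coeff (coeff A j) i = 0" and B: "\<forall>i j. b < i + j \<longrightarrow> coeff (coeff B j) i = 0"
      and lA: "coeff (coeff A a) 0 = 1" for A B
  proof -
    define x where "x = case_sum (\<lambda>(i, j). coeff (coeff A j) i) (\<lambda>(i, j). coeff (coeff B j) i)"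
    have xA: "cA (i, j) x = coeff (coeff A j) i" for i j
      using A lA by (auto simp: cA_def x_def tri_def)
    have xB: "cB (i, j) x = coeff (coeff B j) i" for i j
      using B by (auto simp: cB_def x_def tri_def)
    have "(\<lambda>(i, j). coeff (coeff (A * B) j) i) = (\<lambda>p. psi p x)"
      by (rule ext) (simp add: psi_def xA xB coeff_mult coeff_sum split: prod.split)
    then show ?thesis using H(3) by simp
  qed
  then show ?thesis using H(1,2) by blast
qed

text \<open>One polynomial for all splittings of the degree, namely the product over
  \<open>a\<close>; for \<open>m = 1\<close> the product is empty and there is nothing to
  avoid.\<close>

lemma reducible_locus:
  "\<exists>H :: (nat \<times> nat \<Rightarrow> 'k::field_char_0) \<Rightarrow> 'k. H \<in> poly_fun (tri m) \<and> (\<exists>z. H z \<noteq> 0) \<and>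
    (\<forall>a b A B. a \<ge> 1 \<longrightarrow> b \<ge> 1 \<longrightarrow> a + b = m \<longrightarrow>
      (\<forall>i j. a < i + j \<longrightarrow> coeff (coeff A j) i = 0) \<longrightarrow> (\<forall>i j. b < i + j \<longrightarrow> coeff (coeff B j) i = 0) \<longrightarrow>
      coeff (coeff A a) 0 = 1 \<longrightarrow> H (\<lambda>(i, j). coeff (coeff (A * B) j) i) = 0)"
proof -
  define ok where "ok a H \<longleftrightarrow> H \<in> poly_fun (tri m) \<and> (\<exists>z. H z \<noteq> 0) \<and>
    (\<forall>A B. (\<forall>i j. a < i + j \<longrightarrow> coeff (coeff A j) i = 0) \<longrightarrow> (\<forall>i j. m - a < i + j \<longrightarrow> coeff (coeff B j) i = 0) \<longrightarrow>
      coeff (coeff A a) 0 = 1 \<longrightarrow> H (\<lambda>(i, j). coeff (coeff (A * B) j) i) = 0)" for a and H :: "(nat \<times> nat \<Rightarrow> 'k) \<Rightarrow> 'k"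
  have "\<forall>a. \<exists>H. a \<in> {1..<m} \<longrightarrow> ok a H"
  proof
    fix a show "\<exists>H. a \<in> {1..<m} \<longrightarrow> ok a H"
    proof (cases "a \<in> {1..<m}")
      case True
      then show ?thesis using reducible_locus_fixed_degrees[of a "m - a" m] unfolding ok_def by auto
    next
      case False
      then show ?thesis by blast
    qed
  qed
  from choice[OF this] obtain H where H: "\<forall>a. a \<in> {1..<m} \<longrightarrow> ok a (H a)" ..
  define K where "K z = (\<Prod>a\<in>{1..<m}. H a z)" for z
  have "K \<in> poly_fun (tri m)" unfolding K_def by (rule poly_fun_prod) (use H in \<open>simp add: ok_def\<close>)
  moreover have "\<exists>z. \<forall>a\<in>{1..<m}. H a z \<noteq> 0"
    by (rule poly_fun_prod_nonzero[of _ _ "tri m"]) (use H in \<open>simp_all add: ok_def\<close>)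
  then have "\<exists>z. K z \<noteq> 0" unfolding K_def by (auto simp: prod_zero_iff)
  moreover have "K (\<lambda>(i, j). coeff (coeff (A * B) j) i) = 0"
    if "a \<ge> 1" "b \<ge> 1" "a + b = m" "\<forall>i j. a < i + j \<longrightarrow> coeff (coeff A j) i = 0"
      "\<forall>i j. b < i + j \<longrightarrow> coeff (coeff B j) i = 0" "coeff (coeff A a) 0 = 1" for a b A B
  proof -
    have a: "a \<in> {1..<m}" "m - a = b" using that by auto
    then have "H a (\<lambda>(i, j). coeff (coeff (A * B) j) i) = 0" using H that(4-6) unfolding ok_def by blast
    then show ?thesis unfolding K_def using a(1) by (auto simp: prod_zero_iff)
  qed
  ultimately show ?thesis by blast
qed

text \<open>Restriction to a plane: the inner variable \<open>s\<close> moves the coordinate 1 away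
  from \<open>u\<close>, and the outer variable is the coordinate \<open>n\<close>. The coefficients
  depend polynomially on \<open>u\<close>, so a condition on the section can be imposed for general
  \<open>u\<close>.\<close>

lemma plane_section:
  fixes h :: "(nat \<Rightarrow> 'k::comm_ring_1) \<Rightarrow> 'k"
  assumes "hom_fun V m h" "(1::nat) \<noteq> n"
  shows "\<exists>Q. (\<forall>u s t. poly (poly (Q u) [:t:]) s = h (\<lambda>i. if i = n then t else u i + (if i = 1 then s else 0))) \<and>
    (\<forall>i j. (\<lambda>u. coeff (coeff (Q u) j) i) \<in> poly_fun V) \<and> (\<forall>u i j. m < i + j \<longrightarrow> coeff (coeff (Q u) j) i = 0)"
  using assms(1)
proof (induction rule: hom_fun.induct)
  case (hom_fun_zero m) show ?case by (rule exI[of _ "\<lambda>u. 0"]) (simp add: poly_fun_const)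
next
  case (hom_fun_const c)
  show ?case
  proof (rule exI[of _ "\<lambda>u. [:[:c:]:]"], intro conjI allI impI)
    fix i j show "(\<lambda>u. coeff (coeff [:[:c:]:] j) i) \<in> poly_fun V" by (rule poly_fun_const)
  next
    fix u :: "nat \<Rightarrow> 'k" and i j :: nat assume "0 < i + j"
    then show "coeff (coeff [:[:c:]:] j) i = 0" by (cases i; cases j) auto
  qed simp
next
  case (hom_fun_add m p q)
  obtain P where P: "\<forall>u s t. poly (poly (P u) [:t:]) s = p (\<lambda>i. if i = n then t else u i + (if i = 1 then s else 0))"
    "\<forall>i j. (\<lambda>u. coeff (coeff (P u) j) i) \<in> poly_fun V" "\<forall>u i j. m < i + j \<longrightarrow> coeff (coeff (P u) j) i = 0" using hom_fun_add(3) by blast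
  obtain Q where Q: "\<forall>u s t. poly (poly (Q u) [:t:]) s = q (\<lambda>i. if i = n then t else u i + (if i = 1 then s else 0))"
    "\<forall>i j. (\<lambda>u. coeff (coeff (Q u) j) i) \<in> poly_fun V" "\<forall>u i j. m < i + j \<longrightarrow> coeff (coeff (Q u) j) i = 0" using hom_fun_add(4) by blast
  show ?case by (rule exI[of _ "\<lambda>u. P u + Q u"]) (use P Q in \<open>simp add: poly_fun_add\<close>)
next
  case (hom_fun_var_mult v m p)
  obtain P where P: "\<forall>u s t. poly (poly (P u) [:t:]) s = p (\<lambda>i. if i = n then t else u i + (if i = 1 then s else 0))"
    "\<forall>i j. (\<lambda>u. coeff (coeff (P u) j) i) \<in> poly_fun V" "\<forall>u i j. m < i + j \<longrightarrow> coeff (coeff (P u) j) i = 0" using hom_fun_var_mult(3) by blast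
  show ?case
  proof (cases "v = n")
    case True
    show ?thesis
    proof (rule exI[of _ "\<lambda>u. pCons 0 (P u)"], intro conjI allI impI)
      fix u s t show "poly (poly (pCons 0 (P u)) [:t:]) s = (if v = n then t else u v + (if v = 1 then s else 0)) * p (\<lambda>i. if i = n then t else u i + (if i = 1 then s else 0))"
        using P(1) True by simp
    next
      fix i j show "(\<lambda>u. coeff (coeff (pCons 0 (P u)) j) i) \<in> poly_fun V" using P(2) by (cases j) (auto intro: poly_fun_const)
    next
      fix u :: "nat \<Rightarrow> 'k" and i j :: nat assume "Suc m < i + j"
      then show "coeff (coeff (pCons 0 (P u)) j) i = 0" using P(3) by (cases j) auto
    qed
  next
    case False
    define e where "e = (if v = 1 then 1 else 0 :: 'k)"
    have co: "coeff (coeff (Polynomial.smult [:u v, e:] (P u)) j) i = u v * coeff (coeff (P u) j) i + e * (case i of 0 \<Rightarrow> 0 | Suc i' \<Rightarrow> coeff (coeff (P u) j) i')" for u i j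
      by (cases i) simp_all
    show ?thesis
    proof (rule exI[of _ "\<lambda>u. Polynomial.smult [:u v, e:] (P u)"], intro conjI allI impI)
      fix u s t show "poly (poly (Polynomial.smult [:u v, e:] (P u)) [:t:]) s = (if v = n then t else u v + (if v = 1 then s else 0)) * p (\<lambda>i. if i = n then t else u i + (if i = 1 then s else 0))"
        using P(1) False by (simp add: e_def distrib_right)
    next
      fix i j
      have 1: "(\<lambda>u. u v * coeff (coeff (P u) j) i) \<in> poly_fun V" by (rule poly_fun_var_mult[OF hom_fun_var_mult(1)]) (use P(2) in blast)
      have 2: "(\<lambda>u. e * (case i of 0 \<Rightarrow> 0 | Suc i' \<Rightarrow> coeff (coeff (P u) j) i')) \<in> poly_fun V"
        using P(2) by (cases i) (auto intro: poly_fun_const poly_fun_cmult)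
      show "(\<lambda>u. coeff (coeff (Polynomial.smult [:u v, e:] (P u)) j) i) \<in> poly_fun V" unfolding co by (rule poly_fun_add[OF 1 2])
    next
      fix u :: "nat \<Rightarrow> 'k" and i j :: nat assume "Suc m < i + j"
      then show "coeff (coeff (Polynomial.smult [:u v, e:] (P u)) j) i = 0" unfolding co using P(3) by (cases i) auto
    qed
  qed
qed

text \<open>The same restriction for factors whose coefficients are arbitrary polynomial functions:
  these become univariate along the line in direction of coordinate 1. The degree in the polynomial
  variable may drop.\<close>

lemma specialize_to_line:
  fixes A :: "'k::field_char_0 pfun poly"
  shows "\<exists>A1 :: 'k poly poly. degree A1 \<le> degree A \<and> (\<forall>j s. poly (coeff A1 j) s = pf_eval (coeff A j) (\<lambda>i. u i + (if i = 1 then s else 0))) \<and>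
    (\<forall>s t. poly (poly A1 [:t:]) s = poly (eval_coeffs A (\<lambda>i. u i + (if i = 1 then s else 0))) t)"
proof -
  have "\<forall>p :: 'k pfun. \<exists>q. \<forall>s. poly q s = pf_eval p (\<lambda>i. u i + (if i = 1 then s else 0))"
  proof
    fix p :: "'k pfun"
    have eq: "(\<lambda>i. u i + (if i = 1 then s else 0)) = (\<lambda>i. poly [:u i, if i = 1 then 1 else 0:] s)" for s by auto
    show "\<exists>q. \<forall>s. poly q s = pf_eval p (\<lambda>i. u i + (if i = 1 then s else 0))"
      unfolding eq using poly_fun_curve[OF pf_eval[of p], of "\<lambda>i. [:u i, if i = 1 then 1 else 0:]"] by metis
  qed
  from choice[OF this] obtain \<rho> :: "'k pfun \<Rightarrow> 'k poly" where
    \<rho>: "\<forall>p s. poly (\<rho> p) s = pf_eval p (\<lambda>i. u i + (if i = 1 then s else 0))" ..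
  have \<rho>0: "\<rho> 0 = 0" by (rule poly_eq_0_if_everywhere_0) (simp add: \<rho>)
  define A1 where "A1 = map_poly \<rho> A"
  have co: "coeff A1 j = \<rho> (coeff A j)" for j unfolding A1_def by (rule coeff_map_poly) (rule \<rho>0)
  have dA: "degree A1 \<le> degree A" unfolding A1_def by (rule degree_map_poly_le)
  have "poly (poly A1 [:t:]) s = poly (eval_coeffs A (\<lambda>i. u i + (if i = 1 then s else 0))) t" for s t
  proof -
    let ?x = "\<lambda>i. u i + (if i = 1 then s else 0)"
    have "poly (poly A1 [:t:]) s = (\<Sum>j\<le>degree A. poly (coeff A1 j) s * t ^ j)"
    proof -
      have "poly A1 [:t:] = (\<Sum>j\<le>degree A. coeff A1 j * [:t:] ^ j)"
        unfolding poly_altdef by (rule sum.mono_neutral_left) (use dA in \<open>auto simp: coeff_eq_0\<close>)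
      then show ?thesis by (simp add: poly_sum poly_power)
    qed
    also have "\<dots> = (\<Sum>j\<le>degree A. coeff (eval_coeffs A ?x) j * t ^ j)" by (simp add: co \<rho>)
    also have "\<dots> = poly (eval_coeffs A ?x) t"
      unfolding poly_altdef by (rule sum.mono_neutral_right) (auto simp: coeff_eq_0 eval_coeffs_def degree_map_poly_le intro: order.trans[OF _ degree_map_poly_le])
    finally show ?thesis .
  qed
  then show ?thesis using dA co \<rho> by (intro exI[of _ A1]) simp
qed

text \<open>
  A factorization over the fraction field of the coefficient ring restricts to a factorization on a general
  plane section, where the dimension count applies.
\<close>

lemma generic_form_irreducible:
  assumes ac: "alg_closed_field TYPE('k::field_char_0)" and n: "n \<ge> 2" and m: "m \<ge> 1"
  shows "\<exists>K \<in> poly_fun (mons n m). (\<exists>v. K v \<noteq> 0) \<and> (\<forall>(v :: (nat \<Rightarrow>\<^sub>0 nat) \<Rightarrow> 'k) (P :: 'k pfun poly) k. K v \<noteq> 0 \<longrightarrow> k \<noteq> 0 \<longrightarrow>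
    degree P = m \<longrightarrow> lead_coeff P = pconst k \<longrightarrow> (\<forall>x t. poly (eval_coeffs P x) t = form_eval n m v (x(n := t))) \<longrightarrow>
    (\<forall>c A B. c \<noteq> 0 \<longrightarrow> Polynomial.smult c P = A * B \<longrightarrow> degree A = 0 \<or> degree B = 0))"
proof -
  obtain D :: "(nat \<times> nat \<Rightarrow> 'k) \<Rightarrow> 'k" where D: "D \<in> poly_fun (tri m)" "\<exists>z. D z \<noteq> 0"
    and red: "\<forall>a b A B. a \<ge> 1 \<longrightarrow> b \<ge> 1 \<longrightarrow> a + b = m \<longrightarrow>
      (\<forall>i j. a < i + j \<longrightarrow> coeff (coeff A j) i = 0) \<longrightarrow> (\<forall>i j. b < i + j \<longrightarrow> coeff (coeff B j) i = 0) \<longrightarrow>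
      coeff (coeff A a) 0 = 1 \<longrightarrow> D (\<lambda>(i, j). coeff (coeff (A * B) j) i) = 0"
    using reducible_locus[of m] by blast
  have n1: "(1::nat) \<noteq> n" using n by simp
  have "\<forall>\<alpha>. \<exists>Q. \<alpha> \<in> mons n m \<longrightarrow> (\<forall>u s t. poly (poly (Q u) [:t:]) s = mon_eval \<alpha> (\<lambda>i. if i = n then t else u i + (if i = 1 then s else 0 :: 'k))) \<and>
    (\<forall>i j. (\<lambda>u. coeff (coeff (Q u) j) i) \<in> poly_fun {..n}) \<and> (\<forall>u i j. m < i + j \<longrightarrow> coeff (coeff (Q u) j) i = 0)"
  proof
    fix \<alpha> :: "nat \<Rightarrow>\<^sub>0 nat"
    show "\<exists>Q. \<alpha> \<in> mons n m \<longrightarrow> (\<forall>u s t. poly (poly (Q u) [:t:]) s = mon_eval \<alpha> (\<lambda>i. if i = n then t else u i + (if i = 1 then s else 0 :: 'k))) \<and>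
      (\<forall>i j. (\<lambda>u. coeff (coeff (Q u) j) i) \<in> poly_fun {..n}) \<and> (\<forall>u i j. m < i + j \<longrightarrow> coeff (coeff (Q u) j) i = 0)"
    proof (cases "\<alpha> \<in> mons n m")
      case True
      then have "hom_fun {..n} m (mon_eval \<alpha> :: (nat \<Rightarrow> 'k) \<Rightarrow> 'k)" using hom_fun_mon_eval[of \<alpha> "{..n}"] by (simp add: mons_def)
      from plane_section[OF this n1] True show ?thesis by simp
    qed simp
  qed
  from choice[OF this] obtain QQ where QQ: "\<forall>\<alpha>. \<alpha> \<in> mons n m \<longrightarrow> (\<forall>u s t. poly (poly (QQ \<alpha> u) [:t:]) s = mon_eval \<alpha> (\<lambda>i. if i = n then t else u i + (if i = 1 then s else 0 :: 'k))) \<and>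
    (\<forall>i j. (\<lambda>u. coeff (coeff (QQ \<alpha> u) j) i) \<in> poly_fun {..n}) \<and> (\<forall>u i j. m < i + j \<longrightarrow> coeff (coeff (QQ \<alpha> u) j) i = 0)" ..
  define Qv where "Qv v u = (\<Sum>\<alpha>\<in>mons n m. Polynomial.smult [:v \<alpha>:] (QQ \<alpha> u))" for v u
  have coQ: "coeff (coeff (Qv v u) j) i = (\<Sum>\<alpha>\<in>mons n m. v \<alpha> * coeff (coeff (QQ \<alpha> u) j) i)" for v u i j
    by (simp add: Qv_def coeff_sum)
  have evQ: "poly (poly (Qv v u) [:t:]) s = form_eval n m v (\<lambda>i. if i = n then t else u i + (if i = 1 then s else 0))" for v u s t
    unfolding Qv_def form_eval_def poly_sum by (rule sum.cong[OF refl]) (use QQ in simp)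
  have Qu: "(\<lambda>u. coeff (coeff (Qv v u) j) i) \<in> poly_fun {..n}" for v i j
    unfolding coQ by (rule poly_fun_sum, rule poly_fun_cmult) (use QQ in blast)
  have Qvv: "(\<lambda>v. coeff (coeff (Qv v u) j) i) \<in> poly_fun (mons n m)" for u i j
    unfolding coQ by (rule poly_fun_sum, rule poly_fun_mult, erule poly_fun_var, rule poly_fun_const)
  have Qdeg: "coeff (coeff (Qv v u) j) i = 0" if "m < i + j" for v u i j
    unfolding coQ by (rule sum.neutral) (use QQ that in simp)
  \<comment> \<open>At this base point the plane section is the dehomogenization with
    \<open>x 0 = 1\<close>, so all polynomials of total degree at most \<open>m\<close> occur as
    sections.\<close>
  define e0 where "e0 i = (if i = 0 then 1 else 0 :: 'k)" for i :: nat
  define K where "K v = D (\<lambda>(i, j). coeff (coeff (Qv v e0) j) i)" for v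
  have "(\<lambda>v. D (\<lambda>p. (case p of (i, j) \<Rightarrow> \<lambda>v. coeff (coeff (Qv v e0) j) i) v)) \<in> poly_fun (mons n m)"
    by (rule poly_fun_compose[OF D(1)]) (auto intro: Qvv)
  then have KPF: "K \<in> poly_fun (mons n m)" unfolding K_def by (simp add: case_prod_unfold)
  have Knz: "\<exists>v. K v \<noteq> 0"
  proof -
    obtain z where z: "D z \<noteq> 0" using D(2) ..
    \<comment> \<open>Homogenization by \<open>x 0\<close> of the bivariate polynomial with
      coefficients \<open>z\<close>; the coordinates 0, 1 and \<open>n\<close> are distinct because
      \<open>n \<ge> 2\<close>.\<close>
    define h where "h x = (\<Sum>p\<in>tri m. z p * (x 0 ^ (m - (fst p + snd p)) * (x 1 ^ fst p * x n ^ snd p)))" for x :: "nat \<Rightarrow> 'k"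
    have "hom_fun {..n} m h" unfolding h_def
    proof (rule hom_fun_sum, rule hom_fun_cmult)
      fix p assume p: "p \<in> tri m"
      have "hom_fun {..n} ((m - (fst p + snd p)) * 1 + (fst p * 1 + snd p * 1)) (\<lambda>x. x 0 ^ (m - (fst p + snd p)) * (x 1 ^ fst p * x n ^ snd p) :: 'k)"
        by (intro hom_fun_mult hom_fun_power hom_fun_var) (use n in auto)
      then show "hom_fun {..n} m (\<lambda>x. x 0 ^ (m - (fst p + snd p)) * (x 1 ^ fst p * x n ^ snd p) :: 'k)"
        using p by (auto simp: tri_def)
    qed
    from hom_fun_is_form_eval[OF this] obtain v where v: "h = form_eval n m v" ..
    define R where "R = (\<Sum>p\<in>tri m. monom (monom (z p) (fst p)) (snd p))"
    have "Qv v e0 = R"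
    proof (rule bipoly_eqI)
      fix s t
      have "poly (poly (Qv v e0) [:t:]) s = h (\<lambda>i. if i = n then t else e0 i + (if i = 1 then s else 0))"
        unfolding v evQ ..
      also have "\<dots> = (\<Sum>p\<in>tri m. z p * (s ^ fst p * t ^ snd p))" using n by (simp add: h_def e0_def)
      also have "\<dots> = poly (poly R [:t:]) s" by (simp add: R_def poly_sum poly_monom poly_power mult_ac)
      finally show "poly (poly (Qv v e0) [:t:]) s = poly (poly R [:t:]) s" .
    qed
    moreover have "coeff (coeff R j) i = z (i, j)" if ij: "(i, j) \<in> tri m" for i j
    proof -
      have "coeff (coeff R j) i = (\<Sum>p\<in>tri m. if p = (i, j) then z p else 0)"
        unfolding R_def coeff_sum by (rule sum.cong) (auto split: if_splits)
      then show ?thesis using ij finite_tri by simp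
    qed
    ultimately have "K v = D z" unfolding K_def by (intro poly_fun_cong[OF D(1)]) auto
    then show ?thesis using z by (intro exI[of _ v]) simp
  qed
  have "degree A = 0 \<or> degree B = 0"
    if Kv: "K v \<noteq> 0" and k: "k \<noteq> 0" and dP: "degree P = m" and lP: "lead_coeff P = pconst k"
      and P: "\<forall>x t. poly (eval_coeffs P x) t = form_eval n m v (x(n := t))"
      and c: "c \<noteq> 0" and fac: "Polynomial.smult c P = A * B"
    for v k c A B and P :: "'k pfun poly"
  proof (rule ccontr)
    assume "\<not> ?thesis"
    then have ab: "degree A \<ge> 1" "degree B \<ge> 1" by auto
    then have "A \<noteq> 0" "B \<noteq> 0" by auto
    then have "degree A + degree B = degree (Polynomial.smult c P)" unfolding fac by (simp add: degree_mult_eq)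
    then have abm: "degree A + degree B = m" using c dP by simp
    \<comment> \<open>The denominator \<open>c\<close> may vanish at \<open>e0\<close>. Nonvanishing
      of the condition at \<open>e0\<close> carries over to general \<open>u\<close>, hence to some
      \<open>u\<close> with \<open>c\<close> nonzero.\<close>
    define Du where "Du u = D (\<lambda>(i, j). coeff (coeff (Qv v u) j) i)" for u
    have "(\<lambda>u. D (\<lambda>p. (case p of (i, j) \<Rightarrow> \<lambda>u. coeff (coeff (Qv v u) j) i) u)) \<in> poly_fun UNIV"
      by (rule poly_fun_compose[OF D(1)]) (auto intro: poly_fun_mono[OF Qu])
    then have DuPF: "Du \<in> poly_fun UNIV" unfolding Du_def by (simp add: case_prod_unfold)
    have De0: "Du e0 \<noteq> 0" using Kv by (simp add: Du_def K_def)
    obtain x0 where x0: "pf_eval c x0 \<noteq> 0" using pfun_nonzero[OF c] ..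
    obtain u where u: "pf_eval c u \<noteq> 0 \<and> Du u \<noteq> 0"
      using poly_fun_domain[of "pf_eval c" UNIV Du x0 e0, OF pf_eval DuPF x0 De0] ..
    let ?x = "\<lambda>s i. u i + (if i = 1 then s else 0 :: 'k)"
    obtain A1 where A1: "degree A1 \<le> degree A" "\<forall>s t. poly (poly A1 [:t:]) s = poly (eval_coeffs A (?x s)) t"
      using specialize_to_line[of A u] by blast
    obtain B1 where B1: "degree B1 \<le> degree B" "\<forall>s t. poly (poly B1 [:t:]) s = poly (eval_coeffs B (?x s)) t"
      using specialize_to_line[of B u] by blast
    obtain P1 where P1: "degree P1 \<le> degree P" "\<forall>j s. poly (coeff P1 j) s = pf_eval (coeff P j) (?x s)"
      "\<forall>s t. poly (poly P1 [:t:]) s = poly (eval_coeffs P (?x s)) t"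
      using specialize_to_line[of P u] by blast
    obtain C1 where C1: "\<forall>j s. poly (coeff C1 j) s = pf_eval (coeff [:c:] j) (?x s)"
      using specialize_to_line[of "[:c:]" u] by blast
    define c1 where "c1 = coeff C1 0"
    have c1: "poly c1 s = pf_eval c (?x s)" for s using C1 by (simp add: c1_def)
    have "(\<lambda>i. u i + (if i = 1 then 0 else 0)) = u" by auto
    then have "poly c1 0 = pf_eval c u" unfolding c1 by simp
    then have c10: "c1 \<noteq> 0" using u by auto
    have P1Q: "P1 = Qv v u"
    proof (rule bipoly_eqI)
      fix s t
      have "(?x s)(n := t) = (\<lambda>i. if i = n then t else u i + (if i = 1 then s else 0))" by auto
      then show "poly (poly P1 [:t:]) s = poly (poly (Qv v u) [:t:]) s" using P1(3) P evQ by simp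
    qed
    have fac1: "Polynomial.smult c1 (Qv v u) = A1 * B1"
    proof (rule bipoly_eqI)
      fix s t
      have "eval_coeffs (Polynomial.smult c P) (?x s) = eval_coeffs (A * B) (?x s)" using fac by simp
      then have "poly (eval_coeffs (Polynomial.smult c P) (?x s)) t = poly (eval_coeffs (A * B) (?x s)) t" by simp
      then show "poly (poly (Polynomial.smult c1 (Qv v u)) [:t:]) s = poly (poly (A1 * B1) [:t:]) s"
        using A1(2) B1(2) P1(3) c1 unfolding P1Q[symmetric] by simp
    qed
    have cm: "coeff (Qv v u) m = [:k:]"
    proof -
      have "coeff P1 m - [:k:] = 0"
        by (rule poly_eq_0_if_everywhere_0) (use P1(2) lP dP in simp)
      then show ?thesis unfolding P1Q by simp
    qed
    have "m \<le> degree (Qv v u)" by (rule le_degree) (use cm k in simp)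
    then have dQ: "degree (Qv v u) = m" using P1(1) dP unfolding P1Q by simp
    obtain A2 B2 where Q2: "Qv v u = A2 * B2" "degree A2 = degree A1" "degree B2 = degree B1"
      using factorization_cancel_constant[OF ac c10 fac1] by blast
    have "A2 * B2 \<noteq> 0" using cm k Q2(1) by (metis coeff_0 pCons_eq_0_iff)
    then have "A2 \<noteq> 0" "B2 \<noteq> 0" by auto
    then have d2: "degree A2 + degree B2 = m" using dQ unfolding Q2(1) by (simp add: degree_mult_eq)
    \<comment> \<open>Specialization can only lower the two degrees, but their sum is still
      \<open>m\<close>, so neither of them drops.\<close>
    then have dA2: "degree A2 = degree A" and dB2: "degree B2 = degree B"
      using Q2(2,3) A1(1) B1(1) abm by auto
    \<comment> \<open>The leading coefficients multiply to the constant \<open>k\<close>, so they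
      are constants themselves and the first factor can be normalized.\<close>
    have lc: "lead_coeff A2 * lead_coeff B2 = [:k:]" using cm dQ Q2(1) by (metis lead_coeff_mult)
    then have nz: "lead_coeff A2 \<noteq> 0" "lead_coeff B2 \<noteq> 0" using k by auto
    then have "degree (lead_coeff A2) + degree (lead_coeff B2) = degree [:k:]" unfolding lc[symmetric] by (simp add: degree_mult_eq)
    then have "degree (lead_coeff A2) = 0" "degree (lead_coeff B2) = 0" by auto
    then obtain p q where p: "lead_coeff A2 = [:p:]" and q: "lead_coeff B2 = [:q:]" by (auto elim!: degree_eq_zeroE)
    have p0: "p \<noteq> 0" and q0: "q \<noteq> 0" using nz p q by auto
    define A3 where "A3 = Polynomial.smult [:1 / p:] A2"
    define B3 where "B3 = Polynomial.smult [:p:] B2"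
    have Q3: "Qv v u = A3 * B3" using p0 by (simp add: Q2(1) A3_def B3_def flip: one_pCons)
    have a3: "coeff (coeff A3 (degree A)) 0 = 1" using p p0 dA2 by (simp add: A3_def)
    have b3: "coeff (coeff B3 (degree B)) 0 \<noteq> 0" using q q0 p0 dB2 by (simp add: B3_def)
    \<comment> \<open>From degree in the outer variable to total degree: \<open>B3\<close> contains
      the pure power of the outer variable with exponent \<open>degree B\<close>, which leaves at
      most \<open>degree A\<close> for the total degree of \<open>A3\<close>.\<close>
    have tA: "coeff (coeff A3 j) i = 0" if "degree A < i + j" for i j
      by (rule total_degree_factor[of "degree A" "degree B" A3 B3, OF _ b3 that])
        (use Qdeg[of _ _ v u] abm in \<open>simp flip: Q3\<close>)
    have tB: "coeff (coeff B3 j) i = 0" if "degree B < i + j" for i j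
      by (rule total_degree_factor[of "degree B" "degree A" B3 A3, OF _ _ that])
        (use Qdeg[of _ _ v u] abm a3 in \<open>simp_all add: mult.commute[of B3] add.commute flip: Q3\<close>)
    have "D (\<lambda>(i, j). coeff (coeff (A3 * B3) j) i) = 0"
      using red[rule_format, of "degree A" "degree B" A3 B3] ab abm tA tB a3 by blast
    then show False using u unfolding Du_def Q3 by simp
  qed
  then show ?thesis using KPF Knz by (intro bexI[of _ K] conjI allI impI)
qed

lemma form_eval_inject:
  fixes v w :: "(nat \<Rightarrow>\<^sub>0 nat) \<Rightarrow> 'k::field_char_0"
  assumes "\<And>x. form_eval n m v x = form_eval n m w x" "\<alpha> \<in> mons n m"
  shows "v \<alpha> = w \<alpha>"
proof -
  have "\<forall>\<alpha>\<in>mons n m. v \<alpha> - w \<alpha> = 0"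
  proof (rule monomials_independent[where E = Poly_Mapping.lookup and V = "{..n}"])
    fix a b assume ab: "a \<in> mons n m" "b \<in> mons n m" "\<And>i. i \<in> {..n} \<Longrightarrow> Poly_Mapping.lookup a i = Poly_Mapping.lookup b i"
    show "a = b"
    proof (rule poly_mapping_eqI)
      fix i show "Poly_Mapping.lookup a i = Poly_Mapping.lookup b i"
      proof (cases "i \<in> {..n}")
        case False
        then have "i \<notin> Poly_Mapping.keys a" "i \<notin> Poly_Mapping.keys b" using ab(1,2) by (auto simp: mons_def)
        then show ?thesis by (simp add: in_keys_iff)
      qed (rule ab(3))
    qed
  next
    fix x :: "nat \<Rightarrow> 'k"
    have "(\<Sum>\<alpha>\<in>mons n m. (v \<alpha> - w \<alpha>) * (\<Prod>i\<in>{..n}. x i ^ Poly_Mapping.lookup \<alpha> i)) = (\<Sum>\<alpha>\<in>mons n m. (v \<alpha> - w \<alpha>) * mon_eval \<alpha> x)"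
    proof (rule sum.cong[OF refl])
      fix \<alpha> :: "nat \<Rightarrow>\<^sub>0 nat" assume "\<alpha> \<in> mons n m"
      then show "(v \<alpha> - w \<alpha>) * (\<Prod>i\<in>{..n}. x i ^ Poly_Mapping.lookup \<alpha> i) = (v \<alpha> - w \<alpha>) * mon_eval \<alpha> x"
        using mon_eval_prod[of "{..n}" \<alpha> x] by (simp add: mons_def)
    qed
    also have "\<dots> = 0" using assms(1)[of x] by (simp add: form_eval_def left_diff_distrib sum_subtractf)
    finally show "(\<Sum>\<alpha>\<in>mons n m. (v \<alpha> - w \<alpha>) * (\<Prod>i\<in>{..n}. x i ^ Poly_Mapping.lookup \<alpha> i)) = 0" .
  qed (simp_all add: finite_mons)
  then show ?thesis using assms(2) by simp
qed

section \<open>Roots and coefficients\<close>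

lemma alg_closed_splits:
  fixes p :: "'k::field poly"
  assumes ac: "alg_closed_field TYPE('k)" and "p \<noteq> 0"
  shows "\<exists>r. p = Polynomial.smult (lead_coeff p) (\<Prod>i<degree p. [:- r i, 1:])"
  using assms(2)
proof (induction "degree p" arbitrary: p)
  case 0
  then obtain c where "p = [:c:]" by (metis degree_eq_zeroE)
  then show ?case by simp
next
  case (Suc d)
  then have "degree p \<ge> 1" by simp
  then obtain s where "poly p s = 0" using ac unfolding alg_closed_field_def by blast
  then obtain q where q: "p = [:- s, 1:] * q" by (auto simp: poly_eq_0_iff_dvd elim: dvdE)
  have q0: "q \<noteq> 0" using q Suc.prems by auto
  then have dp: "degree p = Suc (degree q)" unfolding q by (subst degree_mult_eq) auto
  then have "d = degree q" using Suc.hyps(2) by simp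
  from Suc.hyps(1)[OF this q0] obtain r where r: "q = Polynomial.smult (lead_coeff q) (\<Prod>i<degree q. [:- r i, 1:])" ..
  have lc: "lead_coeff p = lead_coeff q" unfolding q lead_coeff_mult by simp
  have "(\<Prod>i<Suc (degree q). [:- (r(degree q := s)) i, 1:]) = [:- s, 1:] * (\<Prod>i<degree q. [:- r i, 1:])"
  proof -
    have "(\<Prod>i<degree q. [:- (r(degree q := s)) i, 1:]) = (\<Prod>i<degree q. [:- r i, 1:])" by (rule prod.cong) auto
    then show ?thesis by (simp add: mult.commute)
  qed
  then have "Polynomial.smult (lead_coeff p) (\<Prod>i<degree p. [:- (r(degree q := s)) i, 1:]) =
     [:- s, 1:] * Polynomial.smult (lead_coeff q) (\<Prod>i<degree q. [:- r i, 1:])"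
    unfolding lc unfolding dp by (simp only: mult_smult_right)
  also have "\<dots> = p" using r q by simp
  finally show ?case by (intro exI[of _ "r(degree q := s)"]) simp
qed

text \<open>A polynomial condition on coefficients thereby becomes a polynomial condition on tuples
  of roots.\<close>

lemma poly_fun_coeff_prod_linear:
  "(\<lambda>t :: nat \<Rightarrow> 'k::comm_ring_1. coeff (\<Prod>i<m. [:- t i, 1:]) j) \<in> poly_fun {..<m}"
proof (induction m arbitrary: j)
  case 0 show ?case by (simp add: poly_fun_const)
next
  case (Suc m)
  have IH: "(\<lambda>t :: nat \<Rightarrow> 'k. coeff (\<Prod>i<m. [:- t i, 1:]) j) \<in> poly_fun {..<Suc m}" for j by (rule poly_fun_mono[OF Suc]) auto
  have "coeff (\<Prod>i<Suc m. [:- t i, 1:]) j = - t m * coeff (\<Prod>i<m. [:- t i, 1:]) j + (case j of 0 \<Rightarrow> 0 | Suc j' \<Rightarrow> coeff (\<Prod>i<m. [:- t i, 1:]) j')" for t :: "nat \<Rightarrow> 'k"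
    by (cases j) (simp_all add: mult.commute[of _ "[:- t m, 1:]"])
  moreover have "(\<lambda>t :: nat \<Rightarrow> 'k. case j of 0 \<Rightarrow> 0 | Suc j' \<Rightarrow> coeff (\<Prod>i<m. [:- t i, 1:]) j') \<in> poly_fun {..<Suc m}"
    using IH by (cases j) (auto intro: poly_fun_const)
  ultimately show ?case by (simp only:) (intro poly_fun_add poly_fun_mult poly_fun_uminus poly_fun_var IH; simp)
qed

lemma coeff_prod_linear_top: "coeff (\<Prod>i<m. [:- t i, 1:]) m = (1 :: 'k::idom)"
proof -
  have "degree (\<Prod>i<m. [:- t i, 1:]) = m"
  proof (induction m)
    case (Suc m)
    have "(\<Prod>i<m. [:- t i, 1:]) \<noteq> 0" by (simp add: prod_zero_iff)
    then show ?case unfolding prod.lessThan_Suc by (subst degree_mult_eq) (simp_all add: Suc)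
  qed simp
  moreover have "lead_coeff (\<Prod>i<m. [:- t i, 1:]) = 1"
  proof (induction m)
    case (Suc m) then show ?case unfolding prod.lessThan_Suc lead_coeff_mult by simp
  qed simp
  ultimately show ?thesis by simp
qed

section \<open>Density\<close>

text \<open>Pulled back to tuples of roots, \<open>H\<close> is a nonzero polynomial, so it is
  nonzero at some tuple from the infinite set of parameters of points in \<open>P\<close>.
  Nonvanishing at \<open>(0, 1)\<close> means that the form has \<open>m\<close> roots in the affine
  parameter and none at infinity.\<close>

lemma binary_form_with_zeros_in:
  fixes H :: "((nat \<Rightarrow>\<^sub>0 nat) \<Rightarrow> 'k::field_char_0) \<Rightarrow> 'k"
  assumes ac: "alg_closed_field TYPE('k)"
    and P: "\<And>S. finite S \<Longrightarrow> \<exists>x\<in>P. \<not> (\<exists>s\<in>S. \<exists>c. x = (\<lambda>i. c * s i))" and sub: "P \<subseteq> Pts 1"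
    and scale: "\<And>x c. x \<in> P \<Longrightarrow> c \<noteq> 0 \<Longrightarrow> (\<lambda>i. c * x i) \<in> P"
    and H: "H \<in> poly_fun (mons 1 m)" "H v0 \<noteq> 0" and k0: "form_eval 1 m v0 (\<lambda>i. if i = 1 then 1 else 0) \<noteq> 0"
  shows "\<exists>v. H v \<noteq> 0 \<and> form_eval 1 m v (\<lambda>i. if i = 1 then 1 else 0) \<noteq> 0 \<and>
    (\<forall>x\<in>Pts 1. form_eval 1 m v x = 0 \<longrightarrow> x \<in> P)"
proof -
  define k where "k = form_eval 1 m v0 (\<lambda>i. if i = 1 then 1 else 0)"
  define pt where "pt t = (\<lambda>i::nat. if i = 0 then 1 else if i = 1 then t else 0 :: 'k)" for t
  define T where "T = {t. pt t \<in> P}"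
  \<comment> \<open>Only the line with \<open>x 0 = 0\<close> is missed by the chart
    \<open>pt\<close>, so a finite \<open>T\<close> would leave finitely many lines for
    \<open>P\<close>.\<close>
  have infT: "infinite T"
  proof
    assume "finite T"
    then have "finite (insert (\<lambda>i. if i = 1 then 1 else 0) (pt ` T))" by simp
    from P[OF this] obtain x where x: "x \<in> P"
      "\<not> (\<exists>s\<in>insert (\<lambda>i. if i = 1 then 1 else 0) (pt ` T). \<exists>c. x = (\<lambda>i. c * s i))" by blast
    have xo: "x i = 0" if "i > 1" for i using x(1) sub that unfolding Pts_def by auto
    show False
    proof (cases "x 0 = 0")
      case True
      have "x = (\<lambda>i. x 1 * (if i = 1 then 1 else 0))"
      proof
        fix i show "x i = x 1 * (if i = 1 then 1 else 0)" using True xo[of i] by (cases "i = 0"; cases "i = 1") auto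
      qed
      then have "\<exists>c. x = (\<lambda>i. c * (if i = 1 then 1 else 0))" by (intro exI[of _ "x 1"])
      then show False using x(2) by simp
    next
      case False
      have eq: "x = (\<lambda>i. x 0 * pt (x 1 / x 0) i)"
      proof
        fix i show "x i = x 0 * pt (x 1 / x 0) i" using False xo[of i] by (cases "i = 0"; cases "i = 1") (auto simp: pt_def)
      qed
      have "(\<lambda>i. (1 / x 0) * x i) \<in> P" by (rule scale[OF x(1)]) (use False in simp)
      moreover have "(\<lambda>i. (1 / x 0) * x i) = pt (x 1 / x 0)" using False by (subst eq) auto
      ultimately have "x 1 / x 0 \<in> T" by (simp add: T_def)
      moreover have "\<exists>c. x = (\<lambda>i. c * pt (x 1 / x 0) i)" using eq by (intro exI[of _ "x 0"])
      ultimately show False using x(2) by blast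
    qed
  qed
  have "\<forall>j. \<exists>w. j \<le> m \<longrightarrow> (\<lambda>x :: nat \<Rightarrow> 'k. x 0 ^ (m - j) * x 1 ^ j) = form_eval 1 m w"
  proof
    fix j show "\<exists>w. j \<le> m \<longrightarrow> (\<lambda>x :: nat \<Rightarrow> 'k. x 0 ^ (m - j) * x 1 ^ j) = form_eval 1 m w"
    proof (cases "j \<le> m")
      case True
      have "hom_fun {..1} ((m - j) * 1 + j * 1) (\<lambda>x :: nat \<Rightarrow> 'k. x 0 ^ (m - j) * x 1 ^ j)" by (intro hom_fun_mult hom_fun_power hom_fun_var) auto
      then have "hom_fun {..1} m (\<lambda>x :: nat \<Rightarrow> 'k. x 0 ^ (m - j) * x 1 ^ j)" using True by simp
      from hom_fun_is_form_eval[OF this] show ?thesis by blast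
    qed simp
  qed
  from choice[OF this] obtain w where w: "\<forall>j. j \<le> m \<longrightarrow> (\<lambda>x :: nat \<Rightarrow> 'k. x 0 ^ (m - j) * x 1 ^ j) = form_eval 1 m (w j)" ..
  have we: "form_eval 1 m (w j) x = x 0 ^ (m - j) * x 1 ^ j" if "j \<le> m" for j x
    using fun_cong[OF w[rule_format, OF that], of x] by (rule sym)
  \<comment> \<open>Coefficient vector of the homogenization of \<open>q\<close> to degree
    \<open>m\<close>.\<close>
  define V where "V q \<alpha> = (\<Sum>j\<le>m. coeff q j * w j \<alpha>)" for q \<alpha>
  have ev: "form_eval 1 m (V q) x = (\<Sum>j\<le>m. coeff q j * (x 0 ^ (m - j) * x 1 ^ j))" for q x
  proof -
    have "form_eval 1 m (V q) x = (\<Sum>j\<le>m. coeff q j * form_eval 1 m (w j) x)"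
      unfolding form_eval_def V_def sum_distrib_right sum_distrib_left
      by (subst sum.swap) (simp only: mult.assoc)
    also have "\<dots> = (\<Sum>j\<le>m. coeff q j * (x 0 ^ (m - j) * x 1 ^ j))"
      by (rule sum.cong[OF refl]) (simp only: we atMost_iff)
    finally show ?thesis .
  qed
  have ev_nz: "form_eval 1 m (V q) x = x 0 ^ m * poly q (x 1 / x 0)" if "x 0 \<noteq> 0" "degree q \<le> m" for q x
  proof -
    have "poly q (x 1 / x 0) = (\<Sum>j\<le>m. coeff q j * (x 1 / x 0) ^ j)"
      unfolding poly_altdef by (rule sum.mono_neutral_left) (use that in \<open>auto simp: coeff_eq_0\<close>)
    then have "x 0 ^ m * poly q (x 1 / x 0) = (\<Sum>j\<le>m. coeff q j * (x 0 ^ m * (x 1 / x 0) ^ j))"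
      by (simp add: sum_distrib_left mult.left_commute)
    also have "\<dots> = form_eval 1 m (V q) x" unfolding ev
    proof (rule sum.cong[OF refl])
      fix j assume "j \<in> {..m}"
      then have "x 0 ^ m = x 0 ^ (m - j) * x 0 ^ j" by (simp flip: power_add)
      then show "coeff q j * (x 0 ^ m * (x 1 / x 0) ^ j) = coeff q j * (x 0 ^ (m - j) * x 1 ^ j)"
        using that(1) by (simp add: power_divide)
    qed
    finally show ?thesis by simp
  qed
  have ev_0: "form_eval 1 m (V q) x = coeff q m * x 1 ^ m" if "x 0 = 0" for q x
  proof -
    have "form_eval 1 m (V q) x = (\<Sum>j\<le>m. if j = m then coeff q m * x 1 ^ m else 0)"
      unfolding ev by (rule sum.cong) (use that in \<open>auto simp: power_0_left\<close>)
    then show ?thesis by simp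
  qed
  obtain Q :: "'k pfun poly" where Q: "degree Q = m" "lead_coeff Q = pconst k"
    "\<forall>x t. poly (eval_coeffs Q x) t = form_eval 1 m v0 (x(1 := t))"
    using form_as_poly[OF hom_fun_form_eval k0] unfolding k_def by blast
  define p where "p = eval_coeffs Q (pt 0)"
  have dp: "degree p \<le> m" unfolding p_def eval_coeffs_def using degree_map_poly_le[of _ Q] Q(1) by simp
  have cp: "coeff p m = k" using Q(1,2) by (simp add: p_def)
  have kn: "k \<noteq> 0" using k0 by (simp add: k_def)
  then have "m \<le> degree p" by (intro le_degree) (simp add: cp)
  then have dpm: "degree p = m" using dp by simp
  have pt_upd: "(pt 0)(1 := t) = pt t" for t by (auto simp: pt_def)
  have pe: "poly p t = form_eval 1 m v0 (pt t)" for t using Q(3) by (simp only: p_def pt_upd)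
  \<comment> \<open>\<open>v0\<close> is recovered from its dehomogenization \<open>p\<close>: both
    forms agree where \<open>x 0 \<noteq> 0\<close>, hence everywhere, and forms determine their
    coefficients.\<close>
  have v0V: "v0 \<alpha> = V p \<alpha>" if "\<alpha> \<in> mons 1 m" for \<alpha>
  proof (rule form_eval_inject[OF _ that])
    fix x
    have "form_eval 1 m v0 x - form_eval 1 m (V p) x = 0"
    proof (rule poly_fun_domain_eq[of "\<lambda>x. x (0::nat)" "{..1}" "\<lambda>x. form_eval 1 m v0 x - form_eval 1 m (V p) x" "\<lambda>_. 1"])
      show "(\<lambda>x. x (0::nat)) \<in> poly_fun {..1}" by (rule poly_fun_var) simp
      show "(\<lambda>x. form_eval 1 m v0 x - form_eval 1 m (V p) x) \<in> poly_fun {..1}" by (intro poly_fun_diff hom_fun_poly_fun[OF hom_fun_form_eval])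
      show "x 0 * (form_eval 1 m v0 x - form_eval 1 m (V p) x) = 0" for x
      proof (cases "x 0 = 0")
        case False
        have "form_eval 1 m v0 x = form_eval 1 m v0 (\<lambda>i. x 0 * pt (x 1 / x 0) i)"
          by (rule poly_fun_cong[OF hom_fun_poly_fun[OF hom_fun_form_eval]]) (use False in \<open>auto simp: pt_def le_Suc_eq\<close>)
        also have "\<dots> = x 0 ^ m * form_eval 1 m v0 (pt (x 1 / x 0))" by (rule hom_fun_scale[OF hom_fun_form_eval])
        finally show ?thesis using ev_nz[of x p, OF False dp] by (simp add: pe)
      qed simp
    qed simp
    then show "form_eval 1 m v0 x = form_eval 1 m (V p) x" by simp
  qed
  have "p \<noteq> 0" using cp kn by auto
  from alg_closed_splits[OF ac this] obtain r where r: "p = Polynomial.smult k (\<Prod>i<m. [:- r i, 1:])" unfolding dpm cp ..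
  \<comment> \<open>The leading coefficient \<open>k\<close> stays fixed and the roots vary. The
    roots \<open>r\<close> of \<open>p\<close> show that \<open>H\<close> is not identically 0 in
    \<open>t\<close>.\<close>
  define q where "q t = Polynomial.smult k (\<Prod>i<m. [:- t i, 1:])" for t :: "nat \<Rightarrow> 'k"
  have "(\<lambda>t. H (\<lambda>\<alpha>. V (q t) \<alpha>)) \<in> poly_fun {..<m}"
    by (rule poly_fun_compose[OF H(1)]) (auto simp: V_def q_def intro!: poly_fun_sum poly_fun_mult poly_fun_const poly_fun_coeff_prod_linear)
  moreover have "H (\<lambda>\<alpha>. V (q r) \<alpha>) \<noteq> 0"
  proof -
    have "H (\<lambda>\<alpha>. V (q r) \<alpha>) = H v0" by (rule poly_fun_cong[OF H(1)]) (simp add: q_def r[symmetric] v0V)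
    then show ?thesis using H(2) by simp
  qed
  ultimately have "\<exists>t. (\<forall>i\<in>{..<m}. t i \<in> T) \<and> H (\<lambda>\<alpha>. V (q t) \<alpha>) \<noteq> 0"
    using poly_fun_nonzero_on_grid[of "{..<m}" "\<lambda>t. H (\<lambda>\<alpha>. V (q t) \<alpha>)" r T] infT by simp
  then obtain t where t: "\<forall>i\<in>{..<m}. t i \<in> T" "H (V (q t)) \<noteq> 0" by auto
  have cq: "coeff (q t) m = k" by (simp add: q_def coeff_prod_linear_top)
  have dq: "degree (q t) \<le> m"
  proof -
    have "degree (\<Prod>i<m. [:- t i, 1:]) \<le> (\<Sum>i<m. degree [:- t i, 1:])" 
      using degree_prod_sum_le[of "{..<m}" "\<lambda>i. [:- t i, 1:]"] by (simp add: comp_def)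
    also have "\<dots> \<le> m" by simp
    finally show ?thesis unfolding q_def by (rule order.trans[OF degree_smult_le])
  qed
  have "x \<in> P" if x: "x \<in> Pts 1" and z: "form_eval 1 m (V (q t)) x = 0" for x
  proof -
    have xo: "x i = 0" if "i > 1" for i using x that unfolding Pts_def by auto
    have x0: "x 0 \<noteq> 0"
    proof
      assume x0: "x 0 = 0"
      then have "x 1 ^ m = 0" using z ev_0[of x "q t", OF x0] cq kn by simp
      then have "x 1 = 0" by simp
      then have "x i = 0" for i using x0 xo[of i] by (cases "i = 0"; cases "i = 1") auto
      then show False using x unfolding Pts_def by simp
    qed
    then have "poly (q t) (x 1 / x 0) = 0" using z ev_nz[of x "q t", OF x0 dq] by simp
    then have "(\<Prod>i<m. x 1 / x 0 - t i) = 0" using kn by (simp add: q_def poly_prod)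
    then obtain i where i: "i < m" "x 1 / x 0 = t i" by (auto simp: prod_zero_iff)
    then have "pt (x 1 / x 0) \<in> P" using t(1) by (simp add: T_def)
    then have "(\<lambda>i. x 0 * pt (x 1 / x 0) i) \<in> P" by (rule scale) (rule x0)
    moreover have "(\<lambda>i. x 0 * pt (x 1 / x 0) i) = x"
    proof
      fix i show "x 0 * pt (x 1 / x 0) i = x i" using x0 xo[of i] by (cases "i = 0"; cases "i = 1") (auto simp: pt_def)
    qed
    ultimately show ?thesis by simp
  qed
  moreover have "form_eval 1 m (V (q t)) (\<lambda>i. if i = 1 then 1 else 0) \<noteq> 0" using cq kn by (subst ev_0) simp_all
  ultimately show ?thesis using t(2) by blast
qed

text \<open>\<open>H\<close> is the polynomial whose nonvanishing density demands. For
  \<open>n = 1\<close> the form is chosen with all zeros periodic, and components are nonempty; for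
  \<open>n \<ge> 2\<close> the hypersurface is its own only component.\<close>

lemma form_with_periodic_components:
  fixes f :: "nat \<Rightarrow> (nat, 'k::field_char_0) mpoly" and H :: "((nat \<Rightarrow>\<^sub>0 nat) \<Rightarrow> 'k) \<Rightarrow> 'k"
  assumes ac: "alg_closed_field TYPE('k)" and n: "n \<ge> 1" and m: "m \<ge> 1" and d: "d \<ge> 2" and f: "endomorphism n d f"
    and H: "H \<in> poly_fun (mons n m)" "H v1 \<noteq> 0"
  shows "\<exists>v. H v \<noteq> 0 \<and> coeff_form n m v \<noteq> 0 \<and>
    (\<forall>Z. irr_component n (hyp n (coeff_form n m v)) Z \<longrightarrow> Z \<inter> periodic_pts n (endo_map n f) \<noteq> {})"
proof -
  let ?P = "periodic_pts n (endo_map n f)" and ?e = "\<lambda>i. if i = n then 1 else 0 :: 'k"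
  have pe: "proj_endo (Suc n) d (\<lambda>i. mp_eval (f i))" by (rule endomorphism_proj_endo[OF ac n d f])
  have P: "\<exists>x\<in>?P. \<not> (\<exists>s\<in>S. \<exists>c. x = (\<lambda>i. c * s i))" if "finite S" for S
    by (rule periodic_pts_exist[OF ac n d f that])
  have sub: "?P \<subseteq> Pts n" by (auto simp: periodic_pts_def)
  have nz: "coeff_form n m v \<noteq> 0" if "form_eval n m v ?e \<noteq> 0" for v
  proof
    assume "coeff_form n m v = 0"
    then have "form_eval n m v ?e = 0" unfolding mp_eval_coeff_form[symmetric] by (simp add: mp_eval_def)
    then show False using that by simp
  qed
  have ePts: "?e \<in> Pts n" by (auto simp: Pts_def)
  obtain v2 where v2: "form_eval n m v2 ?e \<noteq> 0" using nonvanishing_form[OF ePts, of m] by (elim exE)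
  have Kn: "(\<lambda>v. form_eval n m v ?e) \<in> poly_fun (mons n m)" by (rule poly_fun_form_eval_coeffs)
  \<comment> \<open>Nonvanishing at the last unit vector makes the form nonzero and gives it full
    degree in the last variable, as both cases require.\<close>
  have "\<exists>v. H v \<noteq> 0 \<and> form_eval n m v ?e \<noteq> 0"
    by (rule poly_fun_domain[of H "mons n m" "\<lambda>v. form_eval n m v ?e" v1 v2, OF H(1) Kn H(2) v2])
  then obtain v3 where v3: "H v3 \<noteq> 0" "form_eval n m v3 ?e \<noteq> 0" by (elim exE conjE)
  show ?thesis
  proof (cases "n = 1")
    case True
    have "\<exists>v. H v \<noteq> 0 \<and> form_eval 1 m v (\<lambda>i. if i = 1 then 1 else 0) \<noteq> 0 \<and>
      (\<forall>x\<in>Pts 1. form_eval 1 m v x = 0 \<longrightarrow> x \<in> ?P)"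
    proof (rule binary_form_with_zeros_in[OF ac P])
      show "?P \<subseteq> Pts 1" using sub True by simp
      show "(\<lambda>i. c * x i) \<in> ?P" if "x \<in> ?P" "c \<noteq> 0" for x c by (rule periodic_pts_scale[OF pe that])
      show "H \<in> poly_fun (mons 1 m)" "H v3 \<noteq> 0" using H(1) v3(1) True by simp_all
      show "form_eval 1 m v3 (\<lambda>i. if i = 1 then 1 else 0) \<noteq> 0" using v3(2) unfolding True .
    qed
    then obtain v where v: "H v \<noteq> 0" "form_eval 1 m v (\<lambda>i. if i = 1 then 1 else 0) \<noteq> 0"
      "\<forall>x\<in>Pts 1. form_eval 1 m v x = 0 \<longrightarrow> x \<in> ?P" by blast
    have "Z \<inter> ?P \<noteq> {}" if Z: "irr_component n (hyp n (coeff_form n m v)) Z" for Z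
    proof -
      have "Z \<noteq> {}" "Z \<subseteq> hyp n (coeff_form n m v)" using Z unfolding irr_component_def zirred_def by auto
      moreover have "hyp n (coeff_form n m v) \<subseteq> ?P"
        using v(3) True by (auto simp: hyp_def mp_eval_coeff_form)
      ultimately show ?thesis by blast
    qed
    then show ?thesis using v(1,2) nz[of v] True by blast
  next
    case False
    then have n2: "n \<ge> 2" using n by simp
    obtain K where K: "K \<in> poly_fun (mons n m)" "\<exists>v. K v \<noteq> 0" and irr: "\<forall>(v :: (nat \<Rightarrow>\<^sub>0 nat) \<Rightarrow> 'k) (Q :: 'k pfun poly) k. K v \<noteq> 0 \<longrightarrow> k \<noteq> 0 \<longrightarrow>
      degree Q = m \<longrightarrow> lead_coeff Q = pconst k \<longrightarrow> (\<forall>x t. poly (eval_coeffs Q x) t = form_eval n m v (x(n := t))) \<longrightarrow>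
      (\<forall>c A B. c \<noteq> 0 \<longrightarrow> Polynomial.smult c Q = A * B \<longrightarrow> degree A = 0 \<or> degree B = 0)"
      using generic_form_irreducible[OF ac n2 m] by blast
    obtain v4 where v4: "K v4 \<noteq> 0" using K(2) ..
    have H2: "(\<lambda>v. H v * form_eval n m v ?e) \<in> poly_fun (mons n m)" by (rule poly_fun_mult[OF H(1) Kn])
    have "H v3 * form_eval n m v3 ?e \<noteq> 0" using v3 by simp
    from poly_fun_domain[of "\<lambda>v. H v * form_eval n m v ?e" "mons n m" K v3 v4, OF H2 K(1) this v4]
    obtain v5 where v5: "H v5 * form_eval n m v5 ?e \<noteq> 0 \<and> K v5 \<noteq> 0" ..
    have H3: "(\<lambda>v. H v * form_eval n m v ?e * K v) \<in> poly_fun (mons n m)" by (rule poly_fun_mult[OF H2 K(1)])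
    \<comment> \<open>All open conditions are multiplied into one polynomial, so that the form
      through a periodic point satisfies them simultaneously.\<close>
    have "\<exists>v. \<exists>x\<in>?P. H v * form_eval n m v ?e * K v \<noteq> 0 \<and> form_eval n m v x = 0"
      by (rule generic_form_through_point[where H="\<lambda>v. H v * form_eval n m v ?e * K v" and ?v0.0=v5, OF P sub H3 _ m])
        (use v5 in auto)
    then obtain v x where vx: "x \<in> ?P" "H v * form_eval n m v ?e * K v \<noteq> 0" "form_eval n m v x = 0" by blast
    then have v: "H v \<noteq> 0" "form_eval n m v ?e \<noteq> 0" "K v \<noteq> 0" by auto
    have xh: "x \<in> hyp n (coeff_form n m v)" using vx(1,3) sub by (auto simp: hyp_def mp_eval_coeff_form)
    obtain Q :: "'k pfun poly" where Q: "degree Q = m" "lead_coeff Q = pconst (form_eval n m v ?e)"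
      "\<forall>x t. poly (eval_coeffs Q x) t = form_eval n m v (x(n := t))"
      using form_as_poly[OF hom_fun_form_eval v(2)] by blast
    have zi: "zirred n (hyp n (coeff_form n m v))"
    proof (rule hyp_zirred[OF ac n m Q(1,2) v(2)])
      show "poly (eval_coeffs Q x) t = form_eval n m v (x(n := t))" for x t using Q(3) by blast
      show "degree A = 0 \<or> degree B = 0" if "c \<noteq> 0" "Polynomial.smult c Q = A * B" for c A B
        by (rule irr[rule_format, OF v(3,2) Q(1,2) Q(3)[rule_format] that])
      show "hyp n (coeff_form n m v) \<noteq> {}" using xh by blast
    qed
    have "Z \<inter> ?P \<noteq> {}" if Z: "irr_component n (hyp n (coeff_form n m v)) Z" for Z
    proof -
      have "hyp n (coeff_form n m v) = Z" using Z zi unfolding irr_component_def by blast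
      then show ?thesis using xh vx(1) by blast
    qed
    then show ?thesis using v(1) nz[OF v(2)] by blast
  qed
qed

theorem theorem1:
  fixes f :: "nat \<Rightarrow> (nat, 'k::field_char_0) mpoly"
    and n m d :: nat
  assumes "alg_closed_field TYPE('k)"
    and "n \<ge> 1" and "m \<ge> 1" and "d \<ge> 2"
    and "endomorphism n d f"
  shows "zdense_forms n m
           {\<Phi>. form n m \<Phi> \<and> \<Phi> \<noteq> 0 \<and> dyn_improper n (endo_map n f) (hyp n \<Phi>)}"
  unfolding zdense_forms_def
proof (intro allI impI)
  fix G :: "(nat \<Rightarrow>\<^sub>0 nat, 'k) mpoly" and e
  assume G: "homog_in (mons n m) e G" "G \<noteq> 0"
  have GPF: "mp_eval G \<in> poly_fun (mons n m)" by (rule hom_fun_poly_fun[OF hom_fun_mp_eval[OF G(1)]])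
  obtain v1 where v1: "mp_eval G v1 \<noteq> 0" using mp_eval_nonzero[OF G(2)] ..
  from form_with_periodic_components[OF assms GPF v1] obtain v where
    v: "mp_eval G v \<noteq> 0" "coeff_form n m v \<noteq> 0"
    "\<forall>Z. irr_component n (hyp n (coeff_form n m v)) Z \<longrightarrow> Z \<inter> periodic_pts n (endo_map n f) \<noteq> {}" by blast
  have "dyn_improper n (endo_map n f) (hyp n (coeff_form n m v))"
    by (rule dyn_improperI[OF endomorphism_proj_endo[OF assms(1,2,4,5)]]) (use v(3) in blast)
  \<comment> \<open>\<open>coeff_form\<close> forgets the values of \<open>v\<close> outside
    \<open>mons n m\<close>, but \<open>G\<close> involves no other variables than those.\<close>
  moreover have "mp_eval G (Poly_Mapping.lookup (coeff_form n m v)) = mp_eval G v"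
    by (rule poly_fun_cong[OF GPF]) (simp add: lookup_coeff_form)
  ultimately show "\<exists>\<Phi>\<in>{\<Phi>. form n m \<Phi> \<and> \<Phi> \<noteq> 0 \<and> dyn_improper n (endo_map n f) (hyp n \<Phi>)}.
      mp_eval G (Poly_Mapping.lookup \<Phi>) \<noteq> 0"
    using v(1,2) form_coeff_form[of n m v] by (intro bexI[of _ "coeff_form n m v"]) simp_all
qed

end
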